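(* Let $\Gamma\cong\mathbb{Z}_2$, let $\tau=\tau_0e_0+\tau_1e_1\in\mathbb{C}\Gamma$ be regular, and let $G_\Gamma=\mathrm{Aut}_{\mathbb{C}}(O_\tau(\Gamma))$. For each $\epsilon\in\{0,1\}$ and each $(m,n)\in L_\epsilon$, the group $G_\Gamma$ acts transitively on the quiver variety $\mathfrak{M}^\tau_\Gamma(m,n;\epsilon)$.
   Context: Algebras. $\Gamma=\{1,g\}\cong\mathbb{Z}_2$ acts on the free algebra $\mathbb{C}\langle x,y\rangle$ by $g\cdot x=-x$, $g\cdot y=-y$, and $R=\mathbb{C}\langle x,y\rangle*\Gamma$ is the crossed product. Put $e_0=(1+g)/2$, $e_1=(1-g)/2$, $e=e_0$. For $\tau=\tau_0e_0+\tau_1e_1$ put $\mathcal{S}_\tau=R/(xy-yx-\tau)$ and $O_\tau=e\mathcal{S}_\tau e$. $\tau$ is regular if it lies on no root hyperplane of the affine root system $\tilde A_1$, i.e. $\tau_0+\tau_1\ne0$ and $n\tau_0+(n+1)\tau_1\neq 0$ for all $n\in\mathbb{Z}$. Quiver varieties. $L_0=\{(n-k,n): k\ge0,\ n\ge k^2+k\}\cup\{(n,n-k):k\ge0,\ n\ge k^2\}$ and $L_1=\{(n-k,n):k\ge0,\ n\ge k^2\}\cup\{(n,n-k):k\ge0,\ n\ge k^2+k\}$ (subsets of $(\mathbb{Z}_{\ge0})^2$). For $(n_0,n_1)\in L_\epsilon$ let $V_0=\mathbb{C}^{n_0}$, $V_1=\mathbb{C}^{n_1}$. $\mathfrak{M}^\tau_\Gamma(n_0,n_1;\epsilon)$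 is the quotient by $GL(V_0)\times GL(V_1)$ (acting by change of basis) of the variety of tuples $(X_0,X_1;Y_0,Y_1;v_\epsilon,w_\epsilon)$ with $X_0,Y_1\in\mathrm{Hom}(V_1,V_0)$, $X_1,Y_0\in\mathrm{Hom}(V_0,V_1)$, $v_\epsilon\in\mathrm{Hom}(\mathbb{C},V_\epsilon)$, $w_\epsilon\in\mathrm{Hom}(V_\epsilon,\mathbb{C})$ satisfying $X_0Y_0-Y_1X_1+\tau_0\mathrm{Id}_{V_0}=\delta_{\epsilon,0}v_\epsilon w_\epsilon$ and $X_1Y_1-Y_0X_0+\tau_1\mathrm{Id}_{V_1}=\delta_{\epsilon,1}v_\epsilon w_\epsilon$. Equivalently, points are classes of quadruples $(X,Y,v,w)$ with $X=\begin{pmatrix}0&X_0\\ X_1&0\end{pmatrix}$, $Y=\begin{pmatrix}0&Y_1\\ Y_0&0\end{pmatrix}$, $v$ (column) and $w$ (row) being $v_\epsilon,w_\epsilon$ extended by zero, and $XY-YX+\mathrm{Diag}[\tau_0\mathrm{Id}_{n_0},\tau_1\mathrm{Id}_{n_1}]=vw$. Action. By a theorem of Bavula and Jordan, $G_\Gamma=\mathrm{Aut}_{\mathbb{C}}(O_\tau)$ is generated by the restrictions to $O_\tau=e\mathcal{S}_\tau e$ of the following automorphisms of $\mathcal{S}_\tau$ (all fixing $g$): $\theta_\lambda:x\mapsto\lambda^{-1}x,\ y\mapsto\lambda y$ ($\lambda\in\mathbb{C}^*$); $\psi_{k,\lambda}:x\mapsto x-k\lambda(\tau_0+\tau_1)y^{2k-1},\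 y\mapsto y$; $\phi_{k,\lambda}:x\mapsto x,\ y\mapsto y+k\lambda(\tau_0+\tau_1)x^{2k-1}$ ($k\ge1$, $\lambda\in\mathbb{C}$). The action of $G_\Gamma$ on $\mathfrak{M}^\tau_\Gamma(n_0,n_1;\epsilon)$ is determined on these generators by $\sigma.(X,Y,v,w)=(\sigma^{-1}(X),\sigma^{-1}(Y),v,w)$, where $\sigma^{-1}(X),\sigma^{-1}(Y)$ are obtained by substituting $X,Y$ for $x,y$ in the noncommutative polynomials $\sigma^{-1}(x),\sigma^{-1}(y)$. *)

theory Defs
  imports
    "HOL-Library.Poly_Mapping"
    "HOL-Algebra.QuotRing"
    "HOL-Algebra.Group_Action"
    "Jordan_Normal_Form.Matrix"
begin

section \<open>The free algebra on two generators\<close>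

datatype letter = LetterX | LetterY

datatype xy_word = Word (letters: "letter list")

instantiation xy_word :: monoid_add
begin

definition zero_xy_word :: xy_word where
  "0 = Word []"

definition plus_xy_word :: "xy_word \<Rightarrow> xy_word \<Rightarrow> xy_word" where
  "u + v = Word (letters u @ letters v)"

instance
  by standard (simp_all add: zero_xy_word_def plus_xy_word_def)

end

text \<open>Finitely supported functions on words, with the convolution product of
  \<^theory>\<open>HOL-Library.Poly_Mapping\<close>; the neutral word \<open>0\<close> is the empty word.\<close>

type_synonym free_alg = "xy_word \<Rightarrow>\<^sub>0 complex"

abbreviation free_const :: "complex \<Rightarrow> free_alg" where
  "free_const c \<equiv> Poly_Mapping.single 0 c"

definition free_x :: free_alg where
  "free_x = Poly_Mapping.single (Word [LetterX]) 1"

definition free_y :: free_alg where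
  "free_y = Poly_Mapping.single (Word [LetterY]) 1"

fun letter_value :: "'a \<Rightarrow> 'a \<Rightarrow> letter \<Rightarrow> 'a" where
  "letter_value p q LetterX = p"
| "letter_value p q LetterY = q"

text \<open>The algebra endomorphism with \<open>x \<mapsto> p\<close>, \<open>y \<mapsto> q\<close>.\<close>

definition free_hom :: "free_alg \<Rightarrow> free_alg \<Rightarrow> free_alg \<Rightarrow> free_alg" where
  "free_hom p q f =
     (\<Sum>u \<in> Poly_Mapping.keys f. free_const (Poly_Mapping.lookup f u) *
        prod_list (map (letter_value p q) (letters u)))"

text \<open>Substitution of \<open>N \<times> N\<close> matrices for \<open>x\<close> and \<open>y\<close>; the sum is taken
  entrywise because \<^typ>\<open>complex mat\<close> is not an additive monoid.\<close>

definition mat_word :: "nat \<Rightarrow> complex mat \<Rightarrow> complex mat \<Rightarrow> xy_word \<Rightarrow> complex mat" where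
  "mat_word N X Y u = foldr (\<lambda>l M. letter_value X Y l * M) (letters u) (1\<^sub>m N)"

definition mat_eval :: "nat \<Rightarrow> complex mat \<Rightarrow> complex mat \<Rightarrow> free_alg \<Rightarrow> complex mat" where
  "mat_eval N X Y f = mat N N (\<lambda>(i, j).
     \<Sum>u \<in> Poly_Mapping.keys f. Poly_Mapping.lookup f u * mat_word N X Y u $$ (i, j))"

lemma free_const_commute: "free_const c * f = f * free_const c"
proof (induct f rule: update_induct)
  case const
  show ?case by simp
next
  case (update f a b)
  have "Poly_Mapping.update a b f = Poly_Mapping.single a b + f"
    using update by (intro poly_mapping_eqI)
      (auto simp: lookup_update lookup_add lookup_single in_keys_iff when_def)
  thus ?case using update by (simp add: algebra_simps mult_single)
qed

lemma free_hom_superset: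
  assumes "finite A" "Poly_Mapping.keys f \<subseteq> A"
  shows "free_hom p q f =
     (\<Sum>u \<in> A. free_const (Poly_Mapping.lookup f u) *
        prod_list (map (letter_value p q) (letters u)))"
  unfolding free_hom_def
  by (rule sum.mono_neutral_left) (use assms in \<open>auto simp: in_keys_iff\<close>)

lemma free_hom_add: "free_hom p q (f + h) = free_hom p q f + free_hom p q h"
proof -
  let ?A = "Poly_Mapping.keys f \<union> Poly_Mapping.keys h"
  have "Poly_Mapping.keys (f + h) \<subseteq> ?A"
    by (rule Poly_Mapping.keys_add)
  thus ?thesis
    by (simp add: free_hom_superset[of ?A] lookup_add single_add distrib_right sum.distrib)
qed

lemma free_hom_zero [simp]: "free_hom p q 0 = 0"
  by (simp add: free_hom_def)

lemma free_hom_single: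
  "free_hom p q (Poly_Mapping.single u c) =
     free_const c * prod_list (map (letter_value p q) (letters u))"
  by (simp add: free_hom_superset[of "{u}"])

lemma free_hom_one [simp]: "free_hom p q 1 = 1"
  by (simp flip: single_one add: free_hom_single zero_xy_word_def) (simp flip: zero_xy_word_def)

lemma free_hom_mult: "free_hom p q (f * h) = free_hom p q f * free_hom p q h"
proof (induct f rule: update_induct)
  case const
  show ?case by simp
next
  case (update f a b)
  have upd: "Poly_Mapping.update a b f = Poly_Mapping.single a b + f"
    using update by (intro poly_mapping_eqI)
      (auto simp: lookup_update lookup_add lookup_single in_keys_iff when_def)
  have "free_hom p q (Poly_Mapping.single a b * h) =
      free_hom p q (Poly_Mapping.single a b) * free_hom p q h"
  proof (induct h rule: update_induct)
    case const
    show ?case by simp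
  next
    case (update h a' b')
    have "Poly_Mapping.update a' b' h = Poly_Mapping.single a' b' + h"
      using update by (intro poly_mapping_eqI)
        (auto simp: lookup_update lookup_add lookup_single in_keys_iff when_def)
    moreover have "free_const (b * b') * (s * t) = (free_const b * s) * (free_const b' * t)" for s t
    proof -
      have "free_const (b * b') = free_const b * free_const b'"
        by (simp add: mult_single)
      moreover have "free_const b * free_const b' * (s * t) =
          free_const b * (free_const b' * s) * t"
        by (simp only: mult.assoc)
      ultimately show ?thesis
        by (simp only: free_const_commute[of b' s] mult.assoc)
    qed
    ultimately show ?case using update
      by (simp add: distrib_left free_hom_add mult_single free_hom_single plus_xy_word_def)
  qed
  thus ?case using update
    by (simp add: upd distrib_right free_hom_add)
qed


section \<open>The crossed product\<close>

definition gamma :: "free_alg \<Rightarrow> free_alg" where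
  "gamma = free_hom (- free_x) (- free_y)"

lemma prod_list_neg_words:
  "prod_list (map (letter_value (- free_x) (- free_y)) ls) =
     Poly_Mapping.single (Word ls) ((-1) ^ length ls)"
proof (induct ls)
  case Nil
  show ?case by (simp flip: zero_xy_word_def)
next
  case (Cons l ls)
  thus ?case
    by (cases l) (simp_all add: free_x_def free_y_def mult_single plus_xy_word_def
        flip: single_uminus)
qed

lemma gamma_single:
  "gamma (Poly_Mapping.single u c) =
     Poly_Mapping.single u (c * (-1) ^ length (letters u))"
  by (simp add: gamma_def free_hom_single prod_list_neg_words mult_single)

lemma gamma_involution: "gamma (gamma f) = f"
proof (induct f rule: update_induct)
  case const
  show ?case by (simp add: gamma_def)
next
  case (update f a b)
  have "Poly_Mapping.update a b f = Poly_Mapping.single a b + f"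
    using update by (intro poly_mapping_eqI)
      (auto simp: lookup_update lookup_add lookup_single in_keys_iff when_def)
  moreover have "gamma (gamma (Poly_Mapping.single a b)) = Poly_Mapping.single a b"
    by (simp add: gamma_single mult.assoc flip: power_mult_distrib)
  ultimately show ?case using update
    by (simp add: gamma_def free_hom_add)
qed

text \<open>\<open>Crossed a b\<close> stands for \<open>a + b g\<close>, with \<open>g f = gamma f g\<close> and \<open>g\<^sup>2 = 1\<close>.\<close>

datatype crossed = Crossed (coeff_1: free_alg) (coeff_g: free_alg)

instantiation crossed :: ring_1
begin

definition zero_crossed :: crossed where
  "0 = Crossed 0 0"

definition one_crossed :: crossed where
  "1 = Crossed 1 0"

definition plus_crossed :: "crossed \<Rightarrow> crossed \<Rightarrow> crossed" where
  "r + s = Crossed (coeff_1 r + coeff_1 s) (coeff_g r + coeff_g s)"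

definition uminus_crossed :: "crossed \<Rightarrow> crossed" where
  "- r = Crossed (- coeff_1 r) (- coeff_g r)"

definition minus_crossed :: "crossed \<Rightarrow> crossed \<Rightarrow> crossed" where
  "r - s = Crossed (coeff_1 r - coeff_1 s) (coeff_g r - coeff_g s)"

definition times_crossed :: "crossed \<Rightarrow> crossed \<Rightarrow> crossed" where
  "r * s = Crossed
     (coeff_1 r * coeff_1 s + coeff_g r * gamma (coeff_g s))
     (coeff_1 r * coeff_g s + coeff_g r * gamma (coeff_1 s))"

instance
proof
  fix a b c :: crossed
  have add: "gamma (f + h) = gamma f + gamma h" and mul: "gamma (f * h) = gamma f * gamma h"
    and one: "gamma 1 = 1" and zero: "gamma 0 = 0" for f h
    by (simp_all add: gamma_def free_hom_add free_hom_mult)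
  note defs = zero_crossed_def one_crossed_def plus_crossed_def uminus_crossed_def
    minus_crossed_def times_crossed_def
  show "a * b * c = a * (b * c)"
    by (simp add: defs add mul gamma_involution algebra_simps)
  show "(a + b) * c = a * c + b * c" "a * (b + c) = a * b + a * c"
    by (simp_all add: defs add algebra_simps)
  show "1 * a = a" "a * 1 = a"
    by (simp_all add: defs one zero)
  show "a + b + c = a + (b + c)" "a + b = b + a" "0 + a = a" "- a + a = 0" "a - b = a + - b"
    "(0::crossed) \<noteq> 1"
    by (simp_all add: defs algebra_simps)
qed

end

definition of_free :: "free_alg \<Rightarrow> crossed" where
  "of_free f = Crossed f 0"

definition of_scalar :: "complex \<Rightarrow> crossed" where
  "of_scalar c = of_free (free_const c)"

definition group_g :: crossed where
  "group_g = Crossed 0 1"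

definition idem_0 :: crossed where
  "idem_0 = of_scalar (1/2) * (1 + group_g)"

definition idem_1 :: crossed where
  "idem_1 = of_scalar (1/2) * (1 - group_g)"

definition tau_elem :: "complex \<Rightarrow> complex \<Rightarrow> crossed" where
  "tau_elem \<tau>0 \<tau>1 = of_scalar \<tau>0 * idem_0 + of_scalar \<tau>1 * idem_1"

definition R_alg :: "crossed ring" where
  "R_alg = \<lparr>carrier = UNIV, monoid.mult = (*), one = 1, zero = 0, add = (+)\<rparr>"

lemma ring_R_alg: "ring R_alg"
  by (rule ringI)
    (auto simp: R_alg_def algebra_simps intro!: abelian_groupI monoidI exI[of _ "- _"])


section \<open>The algebras \<open>S\<^sub>\<tau>\<close> and \<open>O\<^sub>\<tau>\<close>\<close>

definition tau_regular :: "complex \<Rightarrow> complex \<Rightarrow> bool" where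
  "tau_regular \<tau>0 \<tau>1 \<longleftrightarrow>
     \<tau>0 + \<tau>1 \<noteq> 0 \<and> (\<forall>n::int. of_int n * \<tau>0 + of_int (n + 1) * \<tau>1 \<noteq> 0)"

definition S_ideal :: "complex \<Rightarrow> complex \<Rightarrow> crossed set" where
  "S_ideal \<tau>0 \<tau>1 = genideal R_alg
     {of_free free_x * of_free free_y - of_free free_y * of_free free_x - tau_elem \<tau>0 \<tau>1}"

definition S_alg :: "complex \<Rightarrow> complex \<Rightarrow> crossed set ring" where
  "S_alg \<tau>0 \<tau>1 = R_alg Quot (S_ideal \<tau>0 \<tau>1)"

definition S_class :: "complex \<Rightarrow> complex \<Rightarrow> crossed \<Rightarrow> crossed set" where
  "S_class \<tau>0 \<tau>1 r = S_ideal \<tau>0 \<tau>1 +>\<^bsub>R_alg\<^esub> r"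

definition S_scale :: "complex \<Rightarrow> complex \<Rightarrow> complex \<Rightarrow> crossed set \<Rightarrow> crossed set" where
  "S_scale \<tau>0 \<tau>1 c s = S_class \<tau>0 \<tau>1 (of_scalar c) \<otimes>\<^bsub>S_alg \<tau>0 \<tau>1\<^esub> s"

definition O_alg :: "complex \<Rightarrow> complex \<Rightarrow> crossed set ring" where
  "O_alg \<tau>0 \<tau>1 = (let S = S_alg \<tau>0 \<tau>1; e = S_class \<tau>0 \<tau>1 idem_0 in
     S\<lparr>carrier := (\<lambda>s. e \<otimes>\<^bsub>S\<^esub> s \<otimes>\<^bsub>S\<^esub> e) ` carrier S, one := e\<rparr>)"

definition G_Gamma :: "complex \<Rightarrow> complex \<Rightarrow> (crossed set \<Rightarrow> crossed set) monoid" where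
  "G_Gamma \<tau>0 \<tau>1 = (let A = O_alg \<tau>0 \<tau>1 in
     BijGroup (carrier A)\<lparr>carrier := {\<sigma> \<in> Bij (carrier A) \<inter> Ring.ring_hom A A.
       \<forall>c. \<forall>s \<in> carrier A. \<sigma> (S_scale \<tau>0 \<tau>1 c s) = S_scale \<tau>0 \<tau>1 c (\<sigma> s)}\<rparr>)"


section \<open>The generating automorphisms\<close>

datatype generator = Theta complex | Psi nat complex | Phi nat complex

definition generators :: "generator set" where
  "generators = {Theta l | l. l \<noteq> 0} \<union> {Psi k l | k l. k \<ge> 1} \<union> {Phi k l | k l. k \<ge> 1}"

fun image_x :: "complex \<Rightarrow> complex \<Rightarrow> generator \<Rightarrow> free_alg" where
  "image_x \<tau>0 \<tau>1 (Theta l) = free_const (inverse l) * free_x"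
| "image_x \<tau>0 \<tau>1 (Psi k l) =
     free_x - free_const (of_nat k * l * (\<tau>0 + \<tau>1)) * free_y ^ (2 * k - 1)"
| "image_x \<tau>0 \<tau>1 (Phi k l) = free_x"

fun image_y :: "complex \<Rightarrow> complex \<Rightarrow> generator \<Rightarrow> free_alg" where
  "image_y \<tau>0 \<tau>1 (Theta l) = free_const l * free_y"
| "image_y \<tau>0 \<tau>1 (Psi k l) = free_y"
| "image_y \<tau>0 \<tau>1 (Phi k l) =
     free_y + free_const (of_nat k * l * (\<tau>0 + \<tau>1)) * free_x ^ (2 * k - 1)"

definition gen_free :: "complex \<Rightarrow> complex \<Rightarrow> generator \<Rightarrow> free_alg \<Rightarrow> free_alg" where
  "gen_free \<tau>0 \<tau>1 s = free_hom (image_x \<tau>0 \<tau>1 s) (image_y \<tau>0 \<tau>1 s)"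

definition gen_R :: "complex \<Rightarrow> complex \<Rightarrow> generator \<Rightarrow> crossed \<Rightarrow> crossed" where
  "gen_R \<tau>0 \<tau>1 s r =
     Crossed (gen_free \<tau>0 \<tau>1 s (coeff_1 r)) (gen_free \<tau>0 \<tau>1 s (coeff_g r))"

text \<open>The induced map on cosets: \<open>gen_R\<close> preserves the ideal, so the image below is a singleton.\<close>

definition gen_S :: "complex \<Rightarrow> complex \<Rightarrow> generator \<Rightarrow> crossed set \<Rightarrow> crossed set" where
  "gen_S \<tau>0 \<tau>1 s A = the_elem ((\<lambda>r. S_class \<tau>0 \<tau>1 (gen_R \<tau>0 \<tau>1 s r)) ` A)"

definition gen_O :: "complex \<Rightarrow> complex \<Rightarrow> generator \<Rightarrow> crossed set \<Rightarrow> crossed set" where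
  "gen_O \<tau>0 \<tau>1 s = restrict (gen_S \<tau>0 \<tau>1 s) (carrier (O_alg \<tau>0 \<tau>1))"


section \<open>The quiver varieties\<close>

definition L_set :: "nat \<Rightarrow> (nat \<times> nat) set" where
  "L_set \<epsilon> = (if \<epsilon> = 0
     then {(n - k, n) | n k. n \<ge> k\<^sup>2 + k} \<union> {(n, n - k) | n k. n \<ge> k\<^sup>2}
     else {(n - k, n) | n k. n \<ge> k\<^sup>2} \<union> {(n, n - k) | n k. n \<ge> k\<^sup>2 + k})"

type_synonym quadruple = "complex mat \<times> complex mat \<times> complex mat \<times> complex mat"

text \<open>\<open>v\<^sub>\<epsilon>\<close> is a column and \<open>w\<^sub>\<epsilon>\<close> a row, of length \<open>n\<^sub>\<epsilon>\<close>, both extended by zero to length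
  \<open>n\<^sub>0 + n\<^sub>1\<close>. All dimensions may vanish.\<close>

definition block_quadruple ::
  "nat \<Rightarrow> nat \<Rightarrow> nat \<Rightarrow> complex mat \<Rightarrow> complex mat \<Rightarrow> complex mat \<Rightarrow> complex mat \<Rightarrow>
   complex mat \<Rightarrow> complex mat \<Rightarrow> quadruple" where
  "block_quadruple n0 n1 \<epsilon> X0 X1 Y0 Y1 v w =
    (four_block_mat (0\<^sub>m n0 n0) X0 X1 (0\<^sub>m n1 n1),
     four_block_mat (0\<^sub>m n0 n0) Y1 Y0 (0\<^sub>m n1 n1),
     (if \<epsilon> = 0 then v @\<^sub>r 0\<^sub>m n1 1 else 0\<^sub>m n0 1 @\<^sub>r v),
     (if \<epsilon> = 0 then four_block_mat w (0\<^sub>m 1 n1) (0\<^sub>m 0 n0) (0\<^sub>m 0 n1)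
      else four_block_mat (0\<^sub>m 1 n0) w (0\<^sub>m 0 n0) (0\<^sub>m 0 n1)))"

definition quiver_reps ::
  "complex \<Rightarrow> complex \<Rightarrow> nat \<Rightarrow> nat \<Rightarrow> nat \<Rightarrow> quadruple set" where
  "quiver_reps \<tau>0 \<tau>1 n0 n1 \<epsilon> =
    {block_quadruple n0 n1 \<epsilon> X0 X1 Y0 Y1 v w | X0 X1 Y0 Y1 v w.
      X0 \<in> carrier_mat n0 n1 \<and> Y1 \<in> carrier_mat n0 n1 \<and>
      X1 \<in> carrier_mat n1 n0 \<and> Y0 \<in> carrier_mat n1 n0 \<and>
      v \<in> carrier_mat (if \<epsilon> = 0 then n0 else n1) 1 \<and>
      w \<in> carrier_mat 1 (if \<epsilon> = 0 then n0 else n1) \<and>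
      X0 * Y0 - Y1 * X1 + \<tau>0 \<cdot>\<^sub>m 1\<^sub>m n0 = (if \<epsilon> = 0 then v * w else 0\<^sub>m n0 n0) \<and>
      X1 * Y1 - Y0 * X0 + \<tau>1 \<cdot>\<^sub>m 1\<^sub>m n1 = (if \<epsilon> = 0 then 0\<^sub>m n1 n1 else v * w)}"

definition GL_pairs :: "nat \<Rightarrow> (complex mat \<times> complex mat) set" where
  "GL_pairs n = {(a, b). a \<in> carrier_mat n n \<and> b \<in> carrier_mat n n \<and>
     inverts_mat a b \<and> inverts_mat b a}"

text \<open>The orbit under \<open>GL(n\<^sub>0) \<times> GL(n\<^sub>1)\<close>; the pairs \<open>(a\<^sub>i, b\<^sub>i)\<close> are matrices with their inverses.\<close>

definition GL_orbit :: "nat \<Rightarrow> nat \<Rightarrow> quadruple \<Rightarrow> quadruple set" where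
  "GL_orbit n0 n1 p = (case p of (X, Y, v, w) \<Rightarrow>
    {(P * X * Q, P * Y * Q, P * v, w * Q) | P Q. \<exists>(a0, b0) \<in> GL_pairs n0. \<exists>(a1, b1) \<in> GL_pairs n1.
       P = four_block_mat a0 (0\<^sub>m n0 n1) (0\<^sub>m n1 n0) a1 \<and>
       Q = four_block_mat b0 (0\<^sub>m n0 n1) (0\<^sub>m n1 n0) b1})"

definition quiver_variety ::
  "complex \<Rightarrow> complex \<Rightarrow> nat \<Rightarrow> nat \<Rightarrow> nat \<Rightarrow> quadruple set set" where
  "quiver_variety \<tau>0 \<tau>1 n0 n1 \<epsilon> = GL_orbit n0 n1 ` quiver_reps \<tau>0 \<tau>1 n0 n1 \<epsilon>"


section \<open>The action\<close>

text \<open>The relation \<open>xy - yx = \<tau>\<close> does not hold for the matrices, so \<open>\<sigma>\<^sup>-\<^sup>1(x)\<close> and \<open>\<sigma>\<^sup>-\<^sup>1(y)\<close> have to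
  be taken in the free algebra. The symbol \<open>inv\<close> is used by HOL-Algebra, hence \<^const>\<open>inv_into\<close>.\<close>

definition gen_on_quadruple ::
  "complex \<Rightarrow> complex \<Rightarrow> nat \<Rightarrow> generator \<Rightarrow> quadruple \<Rightarrow> quadruple" where
  "gen_on_quadruple \<tau>0 \<tau>1 N s p = (case p of (X, Y, v, w) \<Rightarrow>
    (mat_eval N X Y (inv_into UNIV (gen_free \<tau>0 \<tau>1 s) free_x),
     mat_eval N X Y (inv_into UNIV (gen_free \<tau>0 \<tau>1 s) free_y), v, w))"

text \<open>By a theorem of Bavula and Jordan the maps \<open>gen_O \<tau>0 \<tau>1 s\<close> generate \<open>G_Gamma \<tau>0 \<tau>1\<close>,
  so the following conditions determine \<open>\<alpha>\<close>; that theorem is not assumed here.\<close>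

definition is_G_Gamma_action ::
  "complex \<Rightarrow> complex \<Rightarrow> nat \<Rightarrow> nat \<Rightarrow> nat \<Rightarrow>
   ((crossed set \<Rightarrow> crossed set) \<Rightarrow> quadruple set \<Rightarrow> quadruple set) \<Rightarrow> bool" where
  "is_G_Gamma_action \<tau>0 \<tau>1 n0 n1 \<epsilon> \<alpha> \<longleftrightarrow>
     group_action (G_Gamma \<tau>0 \<tau>1) (quiver_variety \<tau>0 \<tau>1 n0 n1 \<epsilon>) \<alpha> \<and>
     (\<forall>s \<in> generators. \<forall>p \<in> quiver_reps \<tau>0 \<tau>1 n0 n1 \<epsilon>.
        \<alpha> (gen_O \<tau>0 \<tau>1 s) (GL_orbit n0 n1 p) =
          GL_orbit n0 n1 (gen_on_quadruple \<tau>0 \<tau>1 (n0 + n1) s p))"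

end

theory Submission
  imports
    Defs
    "HOL-Library.Function_Algebras"
    "HOL-Computational_Algebra.Fundamental_Theorem_Algebra"
begin

text \<open>A point of the quiver variety is encoded by the functional \<open>W \<mapsto> w W(X, Y) v\<close> on words in two letters.
  Regularity excludes graded finite-dimensional solutions of \<open>XY - YX + \<tau> = 0\<close>, so every point is cyclic and
  cocyclic and its functional determines it. The group acts through \<open>X \<mapsto> X + c Y\<^sup>2\<^sup>k\<^sup>+\<^sup>1\<close> and \<open>Y \<mapsto> Y + c X\<^sup>2\<^sup>k\<^sup>+\<^sup>1\<close>,
  which are linear maps on functionals.

  Let \<open>n\<^sub>0 = n\<^sub>1\<close>, and choose a point of the orbit for which the span of the \<open>X\<^sup>i v\<close> has maximal dimension. Moving \<open>X\<close>
  infinitesimally by odd powers of \<open>Y + a X\<close> cannot increase it; the resulting first-order conditions force the span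
  to be the whole space. Then \<open>Y\<close> is determined up to an odd polynomial in \<open>X\<close> by the numbers \<open>w X\<^sup>i v\<close>, and these can
  be realised in an explicit family that forms a single orbit.

  For other dimensions, the reflections at the two vertices are maps on functionals that commute with the action, and
  alternating them leads to \<open>n\<^sub>0 = n\<^sub>1\<close> with another regular \<open>\<tau>\<close>.\<close>

section \<open>Linear algebra on spaces of functions\<close>

text \<open>What the overview only names is why maximality forces the span S of the X^i v to be
  everything. A functional psi that kills S, together with a relation g(X) v = 0, defines an
  infinitesimal change (A, om) of (Y, w) that preserves XY - YX + \<tau> = v w to first order. The
  derivative of the functional along it is symmetric in the letters at lowest order, so it vanishes
  once its sums over symmetrised words do. These sums are the coefficients in a of powers of Y + a
  X, which is why moves along (Y + a X)^(2k+1) are taken for every a. A functional determines its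
  point, also infinitesimally, so the change is trivial; this confines to S every u of one parity
  for which Y u lies in S + Y S. Comparing dimensions turns that into Y v in S, and the comparison
  uses that both vertex spaces have the same dimension: hence the reduction to n0 = n1. In this
  reduction no kernel or cokernel of a reflection functor is built. The reflected functional is
  given by a formula on words, and its new dimension is read off from the trace of the
  relation.\<close>

definition scl :: "complex \<Rightarrow> ('i \<Rightarrow> complex) \<Rightarrow> 'i \<Rightarrow> complex"  (infixr \<open>*f\<close> 75)
  where "c *f u = (\<lambda>i. c * u i)"

lemma scl_apply: "(c *f u) i = c * u i"
  by (simp add: scl_def)

text \<open>Vectors stay opaque and identities are proved between vectors;
  \<open>fun_pointwise\<close> unfolds them coordinatewise on request. Words, matrix indices and
  positions in a sequence all serve as index types.\<close>

declare plus_fun_apply [simp del] zero_fun_apply [simp del] minus_apply [simp del]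
  uminus_apply [simp del]

lemmas fun_pointwise = plus_fun_apply zero_fun_apply minus_apply uminus_apply scl_apply fun_eq_iff

interpretation fv: vector_space scl
  by standard (auto simp: fun_pointwise algebra_simps)

definition clin :: "(('i \<Rightarrow> complex) \<Rightarrow> 'j \<Rightarrow> complex) \<Rightarrow> bool" where
  "clin A \<longleftrightarrow> (\<forall>u v. A (u + v) = A u + A v) \<and> (\<forall>c u. A (c *f u) = c *f A u)"

definition clf :: "(('i \<Rightarrow> complex) \<Rightarrow> complex) \<Rightarrow> bool" where
  "clf w \<longleftrightarrow> (\<forall>u v. w (u + v) = w u + w v) \<and> (\<forall>c u. w (c *f u) = c * w u)"

lemma sum_fun_apply: "(\<Sum>s\<in>S. f s) i = (\<Sum>s\<in>S. f s i)"
  for f :: "'a \<Rightarrow> 'b \<Rightarrow> 'c::comm_monoid_add"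
  by (induction S rule: infinite_finite_induct) (auto simp: fun_pointwise)

lemma clinD:
  assumes "clin A"
  shows "A (u + v) = A u + A v" "A (c *f u) = c *f A u" "A 0 = 0" "A (- u) = - A u"
    "A (u - v) = A u - A v" "A (\<Sum>s\<in>S. f s) = (\<Sum>s\<in>S. A (f s))"
proof -
  show ha: "A (u + v) = A u + A v" and sc: "A (c *f u) = c *f A u" for u v c
    using assms by (auto simp: clin_def)
  have z: "0 *f x = 0" and mi: "(-1) *f x = - x" for x :: "'x \<Rightarrow> complex" by (auto simp: fun_pointwise)
  show hz: "A 0 = 0" using sc[of 0 0] by (simp only: z)
  show neg: "A (- u) = - A u" for u using sc[of "-1" u] by (simp only: mi)
  show "A (u - v) = A u - A v" using ha[of u "-v"] by (simp add: neg)
  show "A (\<Sum>s\<in>S. f s) = (\<Sum>s\<in>S. A (f s))"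
    by (induction S rule: infinite_finite_induct) (simp_all only: sum.infinite sum.empty sum.insert hz ha not_False_eq_True)
qed

lemma clfD:
  assumes "clf w"
  shows "w (u + v) = w u + w v" "w (c *f u) = c * w u" "w 0 = 0" "w (- u) = - w u"
    "w (u - v) = w u - w v" "w (\<Sum>s\<in>S. f s) = (\<Sum>s\<in>S. w (f s))"
proof -
  show ha: "w (u + v) = w u + w v" and sc: "w (c *f u) = c * w u" for u v c
    using assms by (auto simp: clf_def)
  have z: "0 *f x = 0" and mi: "(-1) *f x = - x" for x :: "'x \<Rightarrow> complex" by (auto simp: fun_pointwise)
  show hz: "w 0 = 0" using sc[of 0 0] by (simp only: z mult_zero_left)
  show neg: "w (- u) = - w u" for u using sc[of "-1" u] by (simp add: mi)
  show "w (u - v) = w u - w v" using ha[of u "-v"] by (simp add: neg)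
  show "w (\<Sum>s\<in>S. f s) = (\<Sum>s\<in>S. w (f s))"
    by (induction S rule: infinite_finite_induct) (simp_all only: sum.infinite sum.empty sum.insert hz ha not_False_eq_True)
qed

lemma clin_id: "clin (\<lambda>u. u)" by (simp add: clin_def)
lemma clin_zero: "clin (\<lambda>u. 0)" by (simp add: clin_def fun_pointwise)
lemma clin_comp: "clin A \<Longrightarrow> clin B \<Longrightarrow> clin (\<lambda>u. A (B u))" by (simp add: clin_def)
lemma clin_plus: "clin A \<Longrightarrow> clin B \<Longrightarrow> clin (\<lambda>u. A u + B u)"
  by (simp add: clin_def fun_pointwise algebra_simps)
lemma clin_minus: "clin A \<Longrightarrow> clin B \<Longrightarrow> clin (\<lambda>u. A u - B u)"
  by (simp add: clin_def fun_pointwise algebra_simps)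
lemma clin_scl: "clin A \<Longrightarrow> clin (\<lambda>u. c *f A u)"
  by (simp add: clin_def fun_pointwise algebra_simps)
lemma clin_pow: "clin A \<Longrightarrow> clin (A ^^ k)" for A :: "('i \<Rightarrow> complex) \<Rightarrow> 'i \<Rightarrow> complex"
  by (induction k) (simp_all add: clin_def)
lemma clin_sum: "(\<And>s. s \<in> S \<Longrightarrow> clin (A s)) \<Longrightarrow> clin (\<lambda>u. \<Sum>s\<in>S. A s u)"
  by (induction S rule: infinite_finite_induct) (simp_all add: clin_zero clin_plus)
lemma clin_rank1: "clf w \<Longrightarrow> clin (\<lambda>u. w u *f a)"
  by (simp add: clf_def clin_def fun_pointwise algebra_simps)
lemma clf_comp: "clf w \<Longrightarrow> clin A \<Longrightarrow> clf (\<lambda>u. w (A u))" by (simp add: clf_def clin_def)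
lemma clf_eval: "clf (\<lambda>u. u i)" by (simp add: clf_def fun_pointwise)
lemma clf_zero: "clf (\<lambda>u. 0)" by (simp add: clf_def)
lemma clf_plus: "clf A \<Longrightarrow> clf B \<Longrightarrow> clf (\<lambda>u. A u + B u)"
  by (simp add: clf_def algebra_simps)
lemma clf_scl: "clf A \<Longrightarrow> clf (\<lambda>u. c * A u)"
  by (simp add: clf_def algebra_simps)
lemma clf_sum: "(\<And>s. s \<in> S \<Longrightarrow> clf (A s)) \<Longrightarrow> clf (\<lambda>u. \<Sum>s\<in>S. A s u)"
  by (induction S rule: infinite_finite_induct) (simp_all add: clf_zero clf_plus)

lemma subspace_kernel: assumes "clf w" shows "fv.subspace {u. w u = 0}"
  using clfD[OF assms] by (auto simp: fv.subspace_def)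

lemma subspace_vimage: assumes "clin A" "fv.subspace W" shows "fv.subspace {u. A u \<in> W}"
  using clinD[OF assms(1)] assms(2) by (auto simp: fv.subspace_def)

lemma subspace_equalizer: assumes "clin A" "clin B" shows "fv.subspace {u. A u = B u}"
  using clinD[OF assms(1)] clinD[OF assms(2)] by (auto simp: fv.subspace_def)

lemma subspace_image: "clin A \<Longrightarrow> fv.subspace W \<Longrightarrow> fv.subspace (A ` W)"
  unfolding fv.subspace_def
proof (intro conjI ballI allI)
  assume A: "clin A" and W: "0 \<in> W \<and> (\<forall>x\<in>W. \<forall>y\<in>W. x + y \<in> W) \<and> (\<forall>c. \<forall>x\<in>W. c *f x \<in> W)"
  show "0 \<in> A ` W" using W clinD(3)[OF A] by force
  show "x + y \<in> A ` W" if "x \<in> A ` W" "y \<in> A ` W" for x y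
    using that W by (auto simp flip: clinD(1)[OF A])
  show "c *f x \<in> A ` W" if "x \<in> A ` W" for x c
    using that W by (auto simp flip: clinD(2)[OF A])
qed

lemma clin_span_mem:
  assumes "clin A" "fv.subspace W" "\<And>s. s \<in> S \<Longrightarrow> A s \<in> W" "u \<in> fv.span S"
  shows "A u \<in> W"
  using fv.span_induct[OF assms(4), of "\<lambda>u. A u \<in> W"] subspace_vimage[OF assms(1,2)] assms(3)
  by auto

lemma clin_eq_on_span:
  assumes "clin A" "clin B" "\<And>s. s \<in> S \<Longrightarrow> A s = B s" "u \<in> fv.span S"
  shows "A u = B u"
  using fv.span_induct[OF assms(4), of "\<lambda>u. A u = B u"] subspace_equalizer[OF assms(1,2)] assms(3)
  by auto

lemma clf_zero_on_span:
  assumes "clf w" "\<And>s. s \<in> S \<Longrightarrow> w s = 0" "u \<in> fv.span S"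
  shows "w u = 0"
  using fv.span_induct[OF assms(3), of "\<lambda>u. w u = 0"] subspace_kernel[OF assms(1)] assms(2)
  by auto

lemma span_image_clin:
  assumes "clin A" shows "fv.span (A ` S) = A ` fv.span S"
proof
  show "fv.span (A ` S) \<subseteq> A ` fv.span S"
    by (rule fv.span_minimal) (auto intro: fv.span_base subspace_image assms fv.subspace_span)
  show "A ` fv.span S \<subseteq> fv.span (A ` S)"
    using clin_span_mem[OF assms fv.subspace_span, of S "A ` S"] by (auto intro: fv.span_base)
qed

lemma clf_extend:
  assumes "fv.independent B"
  shows "\<exists>g. clf g \<and> (\<forall>b\<in>B. g b = f b)"
proof -
  interpret p: vector_space_pair scl "(*) :: complex \<Rightarrow> complex \<Rightarrow> complex"
    by standard (auto simp: algebra_simps)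
  obtain g where "Vector_Spaces.linear scl (*) g" "\<forall>x\<in>B. g x = f x"
    using p.linear_independent_extend[OF assms, of f] by auto
  thus ?thesis
    unfolding clf_def using p.linear_add p.linear_scale by blast
qed

text \<open>A basis of the span stays independent when x is added to it, so the value 1 at x and the
  values 0 on the basis extend to a functional.\<close>

lemma separating_functional:
  assumes "x \<notin> fv.span S"
  shows "\<exists>g. clf g \<and> (\<forall>s\<in>fv.span S. g s = 0) \<and> g x = 1"
proof -
  obtain B where B: "B \<subseteq> S" "fv.independent B" "S \<subseteq> fv.span B"
    using fv.maximal_independent_subset by blast
  have sp: "fv.span B = fv.span S"
    using B by (metis fv.span_eq fv.span_superset order_trans)
  have "fv.independent (insert x B)"
    using assms B sp by (simp add: fv.independent_insert)
  then obtain g where g: "clf g" "\<forall>b\<in>insert x B. g b = (if b = x then 1 else 0)"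
    using clf_extend[of _ "\<lambda>b. if b = x then 1 else 0"] by blast
  have "x \<notin> B" using assms sp fv.span_base by blast
  hence "g b = 0" if "b \<in> B" for b using g that by auto
  hence "\<forall>s\<in>fv.span S. g s = 0" using clf_zero_on_span[OF g(1), of B] sp by auto
  thus ?thesis using g by auto
qed

text \<open>A relation rather than a number: it also asserts that S is a subspace of finite
  dimension, for which a dimension function would need a default value.\<close>

definition has_dim :: "('i \<Rightarrow> complex) set \<Rightarrow> nat \<Rightarrow> bool" where
  "has_dim S n \<longleftrightarrow> (\<exists>B. finite B \<and> card B = n \<and> fv.independent B \<and> fv.span B = S)"

lemma has_dim_subspace: "has_dim S n \<Longrightarrow> fv.subspace S"
  by (auto simp: has_dim_def)

lemma has_dim_le:
  assumes "has_dim S n" "has_dim T m" "S \<subseteq> T"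
  shows "n \<le> m"
proof -
  obtain B C where B: "finite B" "card B = n" "fv.independent B" "fv.span B = S"
    and C: "finite C" "card C = m" "fv.span C = T" using assms by (auto simp: has_dim_def)
  have "B \<subseteq> fv.span C" using B C assms fv.span_superset by blast
  thus ?thesis using fv.independent_span_bound[OF C(1) B(3)] B C by auto
qed

lemma has_dim_unique: "has_dim S n \<Longrightarrow> has_dim S m \<Longrightarrow> n = m"
  by (meson antisym has_dim_le order_refl)

lemma has_dim_extend:
  assumes "has_dim T m" "fv.subspace T" "fv.independent B" "B \<subseteq> T"
  obtains C where "B \<subseteq> C" "finite C" "card C = m" "fv.independent C" "fv.span C = T"
proof -
  obtain C where C: "B \<subseteq> C" "C \<subseteq> T" "fv.independent C" "T \<subseteq> fv.span C"
    using fv.maximal_independent_subset_extend[OF assms(4,3)] by blast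
  have sp: "fv.span C = T" using C assms(2) by (simp add: antisym fv.span_minimal)
  obtain D where D: "finite D" "card D = m" "fv.span D = T" using assms(1) by (auto simp: has_dim_def)
  have "finite C" using fv.independent_span_bound[OF D(1) C(3)] D C by auto
  moreover from this have "has_dim T (card C)" using C sp by (auto simp: has_dim_def)
  hence "card C = m" using has_dim_unique assms(1) by blast
  ultimately show thesis using that C sp by blast
qed

lemma has_dim_eq:
  assumes "has_dim S n" "has_dim T n" "S \<subseteq> T"
  shows "S = T"
proof -
  obtain B where B: "finite B" "card B = n" "fv.independent B" "fv.span B = S"
    using assms(1) unfolding has_dim_def by blast
  have "B \<subseteq> T" by (rule subset_trans[OF fv.span_superset assms(3)[folded B(4)]])
  from has_dim_extend[OF assms(2) has_dim_subspace[OF assms(2)] B(3) this]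
  obtain C where C: "B \<subseteq> C" "finite C" "card C = n" "fv.span C = T" .
  have "B = C" by (rule card_subset_eq[OF C(2,1)]) (simp only: B(2) C(3))
  thus ?thesis by (simp only: B(4)[symmetric] C(4)[symmetric])
qed

lemma has_dim_finite_span:
  assumes "finite T" "S \<subseteq> fv.span T" "fv.subspace S"
  obtains n where "has_dim S n" "n \<le> card T"
proof -
  obtain B where B: "B \<subseteq> S" "fv.independent B" "S \<subseteq> fv.span B"
    by (rule fv.maximal_independent_subset)
  have eq: "fv.span B = S"
    by (rule subset_antisym[OF fv.span_minimal[OF B(1) assms(3)] B(3)])
  have fin: "finite B \<and> card B \<le> card T"
    by (rule fv.independent_span_bound[OF assms(1) B(2) subset_trans[OF B(1) assms(2)]])
  have "has_dim S (card B)"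
    unfolding has_dim_def by (intro exI[of _ B] conjI refl eq B(2)) (use fin in blast)
  thus thesis using that fin by blast
qed

text \<open>C extends B to a basis, and the kernel of A modulo span D lies in span B. If A c
  depended on D and the other images, the difference of c and a preimage would lie in span B, so c
  would depend on the rest of the basis.\<close>

lemma independent_image_mod:
  assumes A: "clin A" and C: "finite C" "B \<inter> C = {}" "fv.independent (B \<union> C)"
    and D: "finite D" "fv.independent D"
    and inj: "\<And>u. u \<in> fv.span (B \<union> C) \<Longrightarrow> A u \<in> fv.span D \<Longrightarrow> u \<in> fv.span B"
  shows "fv.independent (A ` C \<union> D) \<and> card (A ` C \<union> D) = card C + card D"
  using C inj
proof (induction C rule: finite_induct)
  case empty
  thus ?case using D by simp
next
  case (insert c C)
  have "A c \<notin> fv.span (A ` C \<union> D)"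
  proof
    assume "A c \<in> fv.span (A ` C \<union> D)"
    then obtain a d where ad: "A c = a + d" "a \<in> fv.span (A ` C)" "d \<in> fv.span D"
      by (auto simp: fv.span_Un)
    then obtain e where e: "e \<in> fv.span C" "a = A e" using span_image_clin[OF A] by blast
    have "A (c - e) \<in> fv.span D" using ad e by (simp add: clinD[OF A])
    moreover have "c - e \<in> fv.span (B \<union> insert c C)"
      by (rule fv.span_diff) (use e fv.span_mono[of C "B \<union> insert c C"] in \<open>auto intro: fv.span_base\<close>)
    ultimately have "c - e \<in> fv.span B" using insert.prems(3) by blast
    hence "(c - e) + e \<in> fv.span (B \<union> C)"
      using e fv.span_mono[of B "B \<union> C"] fv.span_mono[of C "B \<union> C"] by (intro fv.span_add) auto
    hence "c \<in> fv.span (B \<union> C)" by simp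
    moreover have "c \<notin> B \<union> C" using insert.prems(1) insert.hyps by blast
    moreover have "fv.independent (insert c (B \<union> C))" using insert.prems(2) by simp
    ultimately show False unfolding fv.independent_insert by simp
  qed
  moreover have "fv.independent (A ` C \<union> D) \<and> card (A ` C \<union> D) = card C + card D"
  proof (rule insert.IH)
    show "B \<inter> C = {}" using insert.prems(1) by blast
    show "fv.independent (B \<union> C)" using insert.prems(2) by (rule fv.independent_mono) auto
    fix u assume u: "u \<in> fv.span (B \<union> C)" "A u \<in> fv.span D"
    moreover have "fv.span (B \<union> C) \<subseteq> fv.span (B \<union> insert c C)" by (rule fv.span_mono) auto
    ultimately show "u \<in> fv.span B" using insert.prems(3) by blast
  qed
  moreover from calculation have nc: "A c \<notin> A ` C \<union> D" using fv.span_base by metis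
  moreover have fin: "finite (A ` C \<union> D)" using insert.hyps D(1) by simp
  ultimately have "fv.independent (insert (A c) (A ` C \<union> D))"
    "card (insert (A c) (A ` C \<union> D)) = Suc (card C + card D)"
    by (simp_all only: fv.independent_insert card_insert_disjoint if_False not_False_eq_True simp_thms)
  thus ?case using insert.hyps by simp
qed

text \<open>The kernel of the map from P to Q / R induced by A lies in S, so its rank is at least p
  - s, and it is at most q - r.\<close>

lemma dim_quotient_le:
  assumes A: "clin A" and dims: "has_dim P p" "has_dim S s" "has_dim Q q" "has_dim R r"
    and sub: "S \<subseteq> P" "R \<subseteq> Q" and maps: "\<And>u. u \<in> P \<Longrightarrow> A u \<in> Q"
    and inj: "\<And>u. u \<in> P \<Longrightarrow> A u \<in> R \<Longrightarrow> u \<in> S"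
  shows "p + r \<le> q + s"
proof -
  obtain B where B: "finite B" "card B = s" "fv.independent B" "fv.span B = S"
    using dims by (auto simp: has_dim_def)
  obtain E where E: "B \<subseteq> E" "finite E" "card E = p" "fv.independent E" "fv.span E = P"
    using has_dim_extend[OF dims(1) has_dim_subspace[OF dims(1)] B(3)] B sub fv.span_superset by blast
  obtain D where D: "finite D" "card D = r" "fv.independent D" "fv.span D = R"
    using dims by (auto simp: has_dim_def)
  have BC: "B \<union> (E - B) = E" using E by auto
  have "fv.independent (A ` (E - B) \<union> D) \<and> card (A ` (E - B) \<union> D) = card (E - B) + card D"
    by (rule independent_image_mod[OF A, where B = B]) (use B E D inj BC in \<open>simp_all add: Diff_disjoint\<close>)
  moreover have "A ` (E - B) \<union> D \<subseteq> Q"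
  proof -
    have "E \<subseteq> P" using fv.span_superset[of E] E(5) by simp
    moreover have "D \<subseteq> Q" using fv.span_superset[of D] D(4) sub(2) by simp
    ultimately show ?thesis using maps by auto
  qed
  moreover obtain F where F: "finite F" "card F = q" "fv.span F = Q"
    using dims by (auto simp: has_dim_def)
  ultimately have "card (E - B) + card D \<le> q"
    using fv.independent_span_bound[OF F(1), of "A ` (E - B) \<union> D"] by auto
  moreover have "card (E - B) = p - s" using B E card_Diff_subset by metis
  moreover have "s \<le> p" using B E card_mono by metis
  ultimately show ?thesis using D by auto
qed

lemma has_dim_inj_image:
  fixes A :: "('a \<Rightarrow> complex) \<Rightarrow> 'b \<Rightarrow> complex"
  assumes A: "clin A" and S: "has_dim S n" and inj: "\<And>u. u \<in> S \<Longrightarrow> A u = 0 \<Longrightarrow> u = 0"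
  shows "has_dim (A ` S) n"
proof -
  obtain B where B: "finite B" "card B = n" "fv.independent B" "fv.span B = S"
    using S by (auto simp: has_dim_def)
  have "fv.independent (A ` B \<union> {}) \<and> card (A ` B \<union> {}) = card B + card ({} :: ('b \<Rightarrow> complex) set)"
  proof (rule independent_image_mod[OF A, where B = "{}"])
    fix u assume "u \<in> fv.span ({} \<union> B)" "A u \<in> fv.span {}"
    thus "u \<in> fv.span {}" using inj B by simp
  qed (use B in \<open>simp_all add: fv.independent_empty\<close>)
  thus ?thesis using B span_image_clin[OF A, of B] unfolding has_dim_def by auto
qed

section \<open>Functionals on words\<close>

type_synonym wfun = "letter list \<Rightarrow> complex"

text \<open>If \<open>f W = w (W v)\<close>, then \<open>SX f\<close> and \<open>SY f\<close> are the functionals with \<open>v\<close> replaced by \<open>X v\<close> and \<open>Y v\<close>.\<close>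

definition SL :: "letter \<Rightarrow> wfun \<Rightarrow> wfun" where
  "SL l f = (\<lambda>W. f (W @ [l]))"

abbreviation "SX \<equiv> SL LetterX"
abbreviation "SY \<equiv> SL LetterY"

definition ev :: "wfun \<Rightarrow> complex" where "ev f = f []"

fun opw :: "('a \<Rightarrow> 'a) \<Rightarrow> ('a \<Rightarrow> 'a) \<Rightarrow> letter list \<Rightarrow> 'a \<Rightarrow> 'a" where
  "opw A B [] u = u"
| "opw A B (LetterX # W) u = A (opw A B W u)"
| "opw A B (LetterY # W) u = B (opw A B W u)"

definition fnl :: "('a \<Rightarrow> 'a) \<Rightarrow> ('a \<Rightarrow> 'a) \<Rightarrow> ('a \<Rightarrow> complex) \<Rightarrow> 'a \<Rightarrow> wfun" where
  "fnl A B w v = (\<lambda>W. w (opw A B W v))"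

lemma opw_Cons: "opw A B (l # W) u = (case l of LetterX \<Rightarrow> A | LetterY \<Rightarrow> B) (opw A B W u)"
  by (cases l) auto

lemma opw_append: "opw A B (V @ W) u = opw A B V (opw A B W u)"
  by (induction V) (auto simp: opw_Cons)

lemma clin_SL [simp]: "clin (SL l)"
  by (auto simp: clin_def SL_def fun_pointwise)

lemma clin_SL_comp: "clin A \<Longrightarrow> clin (\<lambda>u. SL l (A u))"
  by (rule clin_comp[OF clin_SL])

lemma clf_ev [simp]: "clf ev"
  by (auto simp: clf_def ev_def fun_pointwise)

lemma opw_SL: "opw SX SY W f = (\<lambda>V. f (V @ W))"
proof (induction W)
  case (Cons l W)
  thus ?case by (cases l) (auto simp: SL_def)
qed simp

text \<open>Every functional f realises itself: the operators are \<open>SX\<close> and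
  \<open>SY\<close>, the vector is f and the covector is \<open>ev\<close>.\<close>

lemma fnl_SL [simp]: "fnl SX SY ev f = f"
  by (simp add: fnl_def opw_SL ev_def)

lemma clin_opw: "clin A \<Longrightarrow> clin B \<Longrightarrow> clin (opw A B W)"
proof (induction W)
  case Nil
  have "opw A B [] = (\<lambda>u. u)" by (auto simp: fun_eq_iff)
  thus ?case by (simp add: clin_id)
next
  case (Cons l W)
  have "opw A B (l # W) = (\<lambda>u. (case l of LetterX \<Rightarrow> A | LetterY \<Rightarrow> B) (opw A B W u))"
    by (simp add: opw_Cons fun_eq_iff)
  thus ?case using Cons by (cases l) (simp_all add: clin_comp)
qed

lemma clin_fnl:
  assumes "clin A" "clin B" "clf w" shows "clin (fnl A B w)"
  unfolding clin_def fnl_def clinD(1,2)[OF clin_opw[OF assms(1,2)]] clfD(1,2)[OF assms(3)]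
  by (auto simp: fun_pointwise)

lemma SL_fnl: "SL l (fnl A B w v) = fnl A B w (opw A B [l] v)"
  by (auto simp: SL_def fnl_def opw_append)

text \<open>So \<open>fnl A B w\<close> carries A, B and w to \<open>SX\<close>, \<open>SY\<close>
  and \<open>ev\<close>. Every representation with a covector maps to the functions on words in this
  way, and a kernel vector is one that all words followed by w annihilate.\<close>

lemma SX_fnl: "SX (fnl A B w v) = fnl A B w (A v)"
  and SY_fnl: "SY (fnl A B w v) = fnl A B w (B v)"
  by (simp_all add: SL_fnl)

lemma ev_fnl [simp]: "ev (fnl A B w v) = w v"
  by (simp add: ev_def fnl_def)

lemma opw_intertwine:
  assumes "\<And>u. J (A u) = A' (J u)" "\<And>u. J (B u) = B' (J u)"
  shows "J (opw A B W u) = opw A' B' W (J u)"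
  by (induction W) (auto simp: opw_Cons assms split: letter.split)

lemma fnl_intertwine:
  assumes "\<And>u. J (A u) = A' (J u)" "\<And>u. J (B u) = B' (J u)" "\<And>u. w' (J u) = w u"
  shows "fnl A' B' w' (J v) = fnl A B w v"
proof -
  have "opw A' B' W (J v) = J (opw A B W v)" for W
    by (rule opw_intertwine[symmetric]) (rule assms)+
  thus ?thesis by (simp add: fnl_def assms(3))
qed

lemma funpow_intertwine:
  fixes A :: "'a \<Rightarrow> 'a" and A' :: "'b \<Rightarrow> 'b"
  assumes "\<And>u. J (A u) = A' (J u)" shows "J ((A ^^ k) u) = (A' ^^ k) (J u)"
  by (induction k) (auto simp: assms)

section \<open>The moves on functionals and the equivalence that they generate\<close>

definition moveX :: "complex \<Rightarrow> nat \<Rightarrow> wfun \<Rightarrow> wfun" where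
  "moveX c k = fnl (\<lambda>u. SX u + c *f (SY ^^ (2 * k + 1)) u) SY ev"

definition moveY :: "complex \<Rightarrow> nat \<Rightarrow> wfun \<Rightarrow> wfun" where
  "moveY c k = fnl SX (\<lambda>u. SY u + c *f (SX ^^ (2 * k + 1)) u) ev"

text \<open>The map \<open>fnl A B w\<close> intertwines the modified operators on both sides, so
  the move can be computed in any realisation of the functional and not only in the tautological
  one.\<close>

lemma moveX_fnl:
  assumes "clin A" "clin B" "clf w"
  shows "moveX c k (fnl A B w v) = fnl (\<lambda>u. A u + c *f (B ^^ (2 * k + 1)) u) B w v"
  unfolding moveX_def
proof (rule fnl_intertwine)
  note J = clin_fnl[OF assms]
  show "fnl A B w (A u + c *f (B ^^ (2 * k + 1)) u) =
      SX (fnl A B w u) + c *f (SY ^^ (2 * k + 1)) (fnl A B w u)" for u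
    using funpow_intertwine[of "fnl A B w" B SY "2 * k + 1" u]
    by (simp add: clinD[OF J] SX_fnl SY_fnl)
qed (simp_all add: SY_fnl)

lemma moveY_fnl:
  assumes "clin A" "clin B" "clf w"
  shows "moveY c k (fnl A B w v) = fnl A (\<lambda>u. B u + c *f (A ^^ (2 * k + 1)) u) w v"
  unfolding moveY_def
proof (rule fnl_intertwine)
  note J = clin_fnl[OF assms]
  show "fnl A B w (B u + c *f (A ^^ (2 * k + 1)) u) =
      SY (fnl A B w u) + c *f (SX ^^ (2 * k + 1)) (fnl A B w u)" for u
    using funpow_intertwine[of "fnl A B w" A SX "2 * k + 1" u]
    by (simp add: clinD[OF J] SX_fnl SY_fnl)
qed (simp_all add: SX_fnl)

lemma clin_step: "clin A \<Longrightarrow> clin B \<Longrightarrow> clin (\<lambda>u. A u + c *f (B ^^ k) u)"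
  for A B :: "('i \<Rightarrow> complex) \<Rightarrow> 'i \<Rightarrow> complex"
  by (intro clin_plus clin_scl clin_pow)

lemma clin_moveX [simp]: "clin (moveX c k)"
  unfolding moveX_def by (intro clin_fnl clin_step clin_SL clf_ev)

lemma clin_moveY [simp]: "clin (moveY c k)"
  unfolding moveY_def by (intro clin_fnl clin_step clin_SL clf_ev)

lemma scl_cancel [simp]: "(u + c *f v) + (- c) *f v = u" "(u + (- c) *f v) + c *f v = u"
  by (auto simp: fun_pointwise)

lemma moveX_inverse: "moveX (- c) k (moveX c k f) = f"
proof -
  have "moveX (- c) k (moveX c k f) = fnl SX SY ev f"
    unfolding moveX_def[of c] by (subst moveX_fnl) (simp_all del: funpow.simps add: clin_step)
  thus ?thesis by simp
qed

lemma moveY_inverse: "moveY (- c) k (moveY c k f) = f"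
proof -
  have "moveY (- c) k (moveY c k f) = fnl SX SY ev f"
    unfolding moveY_def[of c] by (subst moveY_fnl) (simp_all del: funpow.simps add: clin_step)
  thus ?thesis by simp
qed

text \<open>One move is appended at a time, so that a chain can later be followed one group element
  after the other. Symmetry comes from the inverse moves with -c.\<close>

inductive mequiv :: "wfun \<Rightarrow> wfun \<Rightarrow> bool" for f where
  base: "mequiv f f"
| stepX: "mequiv f g \<Longrightarrow> mequiv f (moveX c k g)"
| stepY: "mequiv f g \<Longrightarrow> mequiv f (moveY c k g)"

lemma mequiv_trans: "mequiv g h \<Longrightarrow> mequiv f g \<Longrightarrow> mequiv f h"
  by (induction rule: mequiv.induct) (auto intro: mequiv.intros)

lemma mequiv_sym: "mequiv f g \<Longrightarrow> mequiv g f"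
proof (induction rule: mequiv.induct)
  case (stepX g c k)
  have "mequiv (moveX c k g) (moveX (-c) k (moveX c k g))" by (intro mequiv.intros)
  thus ?case unfolding moveX_inverse by (rule mequiv_trans[OF stepX.IH])
next
  case (stepY g c k)
  have "mequiv (moveY c k g) (moveY (-c) k (moveY c k g))" by (intro mequiv.intros)
  thus ?case unfolding moveY_inverse by (rule mequiv_trans[OF stepY.IH])
qed (rule mequiv.base)

text \<open>\<open>VP True f\<close> and \<open>VP False f\<close> are the realisations of \<open>V\<^sub>\<epsilon>\<close> and of the other vertex space in
  the space of functions on words.\<close>

definition VP :: "bool \<Rightarrow> wfun \<Rightarrow> wfun set" where
  "VP p f = fv.span {opw SX SY W f | W. even (length W) = p}"

definition parf :: "bool \<Rightarrow> wfun \<Rightarrow> bool" where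
  "parf p u \<longleftrightarrow> (\<forall>W. even (length W) \<noteq> p \<longrightarrow> u W = 0)"

definition tsel :: "complex \<Rightarrow> complex \<Rightarrow> bool \<Rightarrow> complex" where
  "tsel t0 t1 p = (if p then t0 else t1)"

text \<open>The relation \<open>XY - YX + \<tau> = v w\<close> for the functional of \<open>(X, Y, v, w)\<close>. Here \<open>True\<close> is the parity of the framed
  vertex \<open>\<epsilon>\<close> and \<open>t0\<close> the component of \<open>\<tau>\<close> at it, so that \<open>\<epsilon> = 1\<close> exchanges the roles of \<open>\<tau>\<^sub>0\<close> and \<open>\<tau>\<^sub>1\<close>.\<close>

definition cmf :: "complex \<Rightarrow> complex \<Rightarrow> wfun \<Rightarrow> bool" where
  "cmf t0 t1 f \<longleftrightarrow> parf True f \<and> (\<forall>V W. f (V @ [LetterX, LetterY] @ W) - f (V @ [LetterY, LetterX] @ W)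
     + tsel t0 t1 (even (length W)) * f (V @ W) = f V * f W)"

definition cmdim :: "complex \<Rightarrow> complex \<Rightarrow> nat \<Rightarrow> nat \<Rightarrow> wfun \<Rightarrow> bool" where
  "cmdim t0 t1 n0 n1 f \<longleftrightarrow> cmf t0 t1 f \<and> has_dim (VP True f) n0 \<and> has_dim (VP False f) n1"

lemma subspace_VP [simp]: "fv.subspace (VP p f)"
  by (simp add: VP_def)

lemma VP_base: "even (length W) = p \<Longrightarrow> opw SX SY W f \<in> VP p f"
  unfolding VP_def by (rule fv.span_base) auto

lemma VP_self [simp]: "f \<in> VP True f"
  using VP_base[of "[]" True f] by simp

lemma VP_SL:
  assumes "u \<in> VP p f" shows "SL l u \<in> VP (\<not> p) f"
proof (rule clin_span_mem[where A = "SL l" and u = u, OF clin_SL subspace_VP])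
  show "u \<in> fv.span {opw SX SY W f | W. even (length W) = p}" using assms by (simp add: VP_def)
  fix s assume "s \<in> {opw SX SY W f | W. even (length W) = p}"
  then obtain W where W: "s = opw SX SY W f" "even (length W) = p" by blast
  have "SL l s = opw SX SY (l # W) f" using W by (cases l) simp_all
  moreover have "opw SX SY (l # W) f \<in> VP (\<not> p) f" by (rule VP_base) (use W(2) in auto)
  ultimately show "SL l s \<in> VP (\<not> p) f" by simp
qed

lemma VP_pow: "u \<in> VP p f \<Longrightarrow> (SL l ^^ k) u \<in> VP (p = even k) f"
proof (induction k)
  case (Suc k)
  have "SL l ((SL l ^^ k) u) \<in> VP (\<not> (p = even k)) f"
    by (rule VP_SL[OF Suc.IH[OF Suc.prems]])
  moreover have "(\<not> (p = even k)) = (p = even (Suc k))" by auto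
  ultimately show ?case by simp
qed simp

lemma VP_odd_pow: "u \<in> VP p f \<Longrightarrow> (SL l ^^ (2 * k + 1)) u \<in> VP (\<not> p) f"
  using VP_pow[of u p f "2 * k + 1" l] by simp

text \<open>The vertex spaces form the least graded family that contains f and is stable under both
  shifts. The map A makes the same induction available for images of vertex spaces under
  moves.\<close>

lemma VP_minimal:
  assumes "clin A" "\<And>p. fv.subspace (E p)" "A f \<in> E True"
    "\<And>l p u. A u \<in> E p \<Longrightarrow> A (SL l u) \<in> E (\<not> p)" "u \<in> VP p f"
  shows "A u \<in> E p"
proof (rule clin_span_mem[OF assms(1,2)])
  show "u \<in> fv.span {opw SX SY W f | W. even (length W) = p}" using assms by (simp add: VP_def)
  fix s assume "s \<in> {opw SX SY W f | W. even (length W) = p}"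
  then obtain W where W: "s = opw SX SY W f" "even (length W) = p" by blast
  have "A (opw SX SY W f) \<in> E (even (length W))"
  proof (induction W)
    case Nil thus ?case using assms by simp
  next
    case (Cons l W) thus ?case using assms(4)[OF Cons] by (cases l) auto
  qed
  thus "A s \<in> E p" using W by simp
qed

lemma subspace_parf: "fv.subspace {u. parf p u}"
  by (auto simp: fv.subspace_def parf_def fun_pointwise)

lemma parf_SL: "parf p u \<Longrightarrow> parf (\<not> p) (SL l u)"
  by (auto simp: parf_def SL_def)

lemma parf_VP: "parf True f \<Longrightarrow> u \<in> VP p f \<Longrightarrow> parf p u"
  using VP_minimal[of "\<lambda>u. u" "\<lambda>p. {u. parf p u}" f u p, OF clin_id] subspace_parf parf_SL by simp

lemma ev_odd: "parf False u \<Longrightarrow> ev u = 0"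
  by (simp add: parf_def ev_def)

lemma cmf_rel:
  assumes "cmf t0 t1 f" "u \<in> VP p f"
  shows "SX (SY u) - SY (SX u) + tsel t0 t1 p *f u = ev u *f f"
proof (rule clin_eq_on_span[where A = "\<lambda>u. SX (SY u) - SY (SX u) + tsel t0 t1 p *f u" and B = "\<lambda>u. ev u *f f" and u = u])
  show "u \<in> fv.span {opw SX SY W f | W. even (length W) = p}" using assms by (simp add: VP_def)
  show "clin (\<lambda>u. SX (SY u) - SY (SX u) + tsel t0 t1 p *f u)" "clin (\<lambda>u. ev u *f f)"
    by (intro clin_plus clin_minus clin_scl clin_SL_comp clin_id, intro clin_rank1 clf_ev)
  fix s assume "s \<in> {opw SX SY W f | W. even (length W) = p}"
  then obtain W where W: "s = (\<lambda>V. f (V @ W))" "even (length W) = p" by (auto simp: opw_SL)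
  show "SX (SY s) - SY (SX s) + tsel t0 t1 p *f s = ev s *f f"
  proof
    fix V
    have "f (V @ [LetterX, LetterY] @ W) - f (V @ [LetterY, LetterX] @ W) + tsel t0 t1 p * f (V @ W) = f V * f W"
      using assms(1) W unfolding cmf_def by auto
    thus "(SX (SY s) - SY (SX s) + tsel t0 t1 p *f s) V = (ev s *f f) V"
      using W by (simp add: SL_def ev_def mult.commute fun_pointwise)
  qed
qed

lemma opw_parity:
  assumes "v \<in> E True" "\<And>p u. u \<in> E p \<Longrightarrow> A u \<in> E (\<not> p)" "\<And>p u. u \<in> E p \<Longrightarrow> B u \<in> E (\<not> p)"
  shows "opw A B W v \<in> E (even (length W))"
proof (induction W)
  case (Cons l W)
  thus ?case using assms(2,3)[OF Cons] by (cases l) auto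
qed (simp add: assms)

text \<open>This is the converse of \<open>cmf_rel\<close>: applying w and a word V to the operator
  relation at the vector W v gives the relation on words. The family E only has to contain v and to
  be exchanged by A and B.\<close>

lemma cmf_fnl:
  fixes A :: "('i \<Rightarrow> complex) \<Rightarrow> 'i \<Rightarrow> complex"
  assumes lin: "clin A" "clin B" "clf w"
    and E: "v \<in> E True" "\<And>p u. u \<in> E p \<Longrightarrow> A u \<in> E (\<not> p)" "\<And>p u. u \<in> E p \<Longrightarrow> B u \<in> E (\<not> p)"
    and w0: "\<And>u. u \<in> E False \<Longrightarrow> w u = 0"
    and rel: "\<And>p u. u \<in> E p \<Longrightarrow> A (B u) - B (A u) + tsel t0 t1 p *f u = w u *f v"
  shows "cmf t0 t1 (fnl A B w v)"
  unfolding cmf_def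
proof (intro conjI allI)
  note par = opw_parity[of v E A B, OF E]
  have "w (opw A B W v) = 0" if "even (length W) \<noteq> True" for W
    using w0[of "opw A B W v"] par[of W] that by simp
  thus "parf True (fnl A B w v)" unfolding parf_def fnl_def by blast
  fix V W
  define u where "u = opw A B W v"
  have u: "u \<in> E (even (length W))" unfolding u_def by (rule par)
  have "w (opw A B V (A (B u) - B (A u) + tsel t0 t1 (even (length W)) *f u)) = w (opw A B V (w u *f v))"
    using rel[OF u] by simp
  thus "fnl A B w v (V @ [LetterX, LetterY] @ W) - fnl A B w v (V @ [LetterY, LetterX] @ W)
     + tsel t0 t1 (even (length W)) * fnl A B w v (V @ W) = fnl A B w v V * fnl A B w v W"
    by (simp add: fnl_def opw_append clinD[OF clin_opw[OF lin(1,2)]] clfD[OF lin(3)] flip: u_def)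
qed

text \<open>Y^(2k+1) commutes with Y and changes the parity as X does, so the commutator of X and Y
  and the grading are both preserved.\<close>

lemma cmf_moveX:
  assumes "cmf t0 t1 f" shows "cmf t0 t1 (moveX c k f)"
  unfolding moveX_def
proof (rule cmf_fnl[where E = "\<lambda>p. VP p f"])
  show "clin (\<lambda>u. SX u + c *f (SY ^^ (2 * k + 1)) u)" by (intro clin_step clin_SL)
  fix p u assume u: "u \<in> VP p f"
  show "SX u + c *f (SY ^^ (2 * k + 1)) u \<in> VP (\<not> p) f"
    by (intro fv.subspace_add fv.subspace_scale VP_odd_pow VP_SL subspace_VP u)
  show "SY u \<in> VP (\<not> p) f" by (intro VP_SL u)
  have "SY (SX u + c *f (SY ^^ (2 * k + 1)) u) = SY (SX u) + c *f (SY ^^ (2 * k + 1)) (SY u)"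
    by (simp add: clinD[OF clin_SL] funpow_swap1)
  thus "SX (SY u) + c *f (SY ^^ (2 * k + 1)) (SY u) - SY (SX u + c *f (SY ^^ (2 * k + 1)) u)
     + tsel t0 t1 p *f u = ev u *f f"
    using cmf_rel[OF assms u] by simp
next
  fix u assume "u \<in> VP False f"
  thus "ev u = 0" using assms parf_VP ev_odd unfolding cmf_def by blast
qed auto

lemma cmf_moveY:
  assumes "cmf t0 t1 f" shows "cmf t0 t1 (moveY c k f)"
  unfolding moveY_def
proof (rule cmf_fnl[where E = "\<lambda>p. VP p f"])
  show "clin (\<lambda>u. SY u + c *f (SX ^^ (2 * k + 1)) u)" by (intro clin_step clin_SL)
  fix p u assume u: "u \<in> VP p f"
  show "SY u + c *f (SX ^^ (2 * k + 1)) u \<in> VP (\<not> p) f"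
    by (intro fv.subspace_add fv.subspace_scale VP_odd_pow VP_SL subspace_VP u)
  show "SX u \<in> VP (\<not> p) f" by (intro VP_SL u)
  have "SX (SY u + c *f (SX ^^ (2 * k + 1)) u) = SX (SY u) + c *f (SX ^^ (2 * k + 1)) (SX u)"
    by (simp add: clinD[OF clin_SL] funpow_swap1)
  thus "SX (SY u + c *f (SX ^^ (2 * k + 1)) u) - (SY (SX u) + c *f (SX ^^ (2 * k + 1)) (SX u))
     + tsel t0 t1 p *f u = ev u *f f"
    using cmf_rel[OF assms u] by simp
next
  fix u assume "u \<in> VP False f"
  thus "ev u = 0" using assms parf_VP ev_odd unfolding cmf_def by blast
qed auto

text \<open>On moved functionals \<open>SX\<close> stands for X + c Y^(2k+1). Solving for the old X
  produces the sign of -c.\<close>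

lemma moveX_SY: "moveX c k (SY u) = SY (moveX c k u)"
  and moveX_SX: "moveX c k (SX u) = SX (moveX c k u) + (- c) *f (SY ^^ (2 * k + 1)) (moveX c k u)"
proof -
  show a: "moveX c k (SY u) = SY (moveX c k u)" for u unfolding moveX_def by (simp add: SY_fnl)
  have "SX (moveX c k u) = moveX c k (SX u + c *f (SY ^^ (2 * k + 1)) u)"
    unfolding moveX_def by (simp add: SX_fnl)
  also have "\<dots> = moveX c k (SX u) + c *f (SY ^^ (2 * k + 1)) (moveX c k u)"
    using funpow_intertwine[of "moveX c k" SY SY, OF a] by (simp only: clinD[OF clin_moveX])
  finally show "moveX c k (SX u) = SX (moveX c k u) + (- c) *f (SY ^^ (2 * k + 1)) (moveX c k u)"
    by (simp only: scl_cancel)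
qed

lemma moveY_SX: "moveY c k (SX u) = SX (moveY c k u)"
  and moveY_SY: "moveY c k (SY u) = SY (moveY c k u) + (- c) *f (SX ^^ (2 * k + 1)) (moveY c k u)"
proof -
  show a: "moveY c k (SX u) = SX (moveY c k u)" for u unfolding moveY_def by (simp add: SX_fnl)
  have "SY (moveY c k u) = moveY c k (SY u + c *f (SX ^^ (2 * k + 1)) u)"
    unfolding moveY_def by (simp add: SY_fnl)
  also have "\<dots> = moveY c k (SY u) + c *f (SX ^^ (2 * k + 1)) (moveY c k u)"
    using funpow_intertwine[of "moveY c k" SX SX, OF a] by (simp only: clinD[OF clin_moveY])
  finally show "moveY c k (SY u) = SY (moveY c k u) + (- c) *f (SX ^^ (2 * k + 1)) (moveY c k u)"
    by (simp only: scl_cancel)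
qed

lemma VP_moveX_subset: "moveX c k ` VP p f \<subseteq> VP p (moveX c k f)"
proof
  fix x assume "x \<in> moveX c k ` VP p f"
  then obtain u where u: "x = moveX c k u" "u \<in> VP p f" by auto
  have "moveX c k (SL l u) \<in> VP (\<not> p) (moveX c k f)" if "moveX c k u \<in> VP p (moveX c k f)" for l p u
  proof (cases l)
    case LetterX
    show ?thesis unfolding LetterX moveX_SX
      by (intro fv.subspace_add fv.subspace_scale subspace_VP VP_odd_pow VP_SL that)
  next
    case LetterY
    show ?thesis unfolding LetterY moveX_SY
      by (intro fv.subspace_add fv.subspace_scale subspace_VP VP_odd_pow VP_SL that)
  qed
  thus "x \<in> VP p (moveX c k f)"
    using VP_minimal[of "moveX c k" "\<lambda>p. VP p (moveX c k f)" f u p] u by auto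
qed

lemma VP_moveY_subset: "moveY c k ` VP p f \<subseteq> VP p (moveY c k f)"
proof
  fix x assume "x \<in> moveY c k ` VP p f"
  then obtain u where u: "x = moveY c k u" "u \<in> VP p f" by auto
  have "moveY c k (SL l u) \<in> VP (\<not> p) (moveY c k f)" if "moveY c k u \<in> VP p (moveY c k f)" for l p u
  proof (cases l)
    case LetterX
    show ?thesis unfolding LetterX moveY_SX
      by (intro fv.subspace_add fv.subspace_scale subspace_VP VP_odd_pow VP_SL that)
  next
    case LetterY
    show ?thesis unfolding LetterY moveY_SY
      by (intro fv.subspace_add fv.subspace_scale subspace_VP VP_odd_pow VP_SL that)
  qed
  thus "x \<in> VP p (moveY c k f)"
    using VP_minimal[of "moveY c k" "\<lambda>p. VP p (moveY c k f)" f u p] u by auto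
qed

lemma VP_moveX: "VP p (moveX c k f) = moveX c k ` VP p f"
proof
  show "VP p (moveX c k f) \<subseteq> moveX c k ` VP p f"
  proof
    fix x assume "x \<in> VP p (moveX c k f)"
    hence "moveX (-c) k x \<in> VP p f"
      using VP_moveX_subset[of "-c" k p "moveX c k f"] by (auto simp: moveX_inverse)
    moreover have "x = moveX c k (moveX (-c) k x)" using moveX_inverse[of "-c" k x] by simp
    ultimately show "x \<in> moveX c k ` VP p f" by blast
  qed
qed (rule VP_moveX_subset)

lemma VP_moveY: "VP p (moveY c k f) = moveY c k ` VP p f"
proof
  show "VP p (moveY c k f) \<subseteq> moveY c k ` VP p f"
  proof
    fix x assume "x \<in> VP p (moveY c k f)"
    hence "moveY (-c) k x \<in> VP p f"
      using VP_moveY_subset[of "-c" k p "moveY c k f"] by (auto simp: moveY_inverse)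
    moreover have "x = moveY c k (moveY (-c) k x)" using moveY_inverse[of "-c" k x] by simp
    ultimately show "x \<in> moveY c k ` VP p f" by blast
  qed
qed (rule VP_moveY_subset)

lemma moveX_eq_0: "moveX c k u = 0 \<Longrightarrow> u = 0"
  using moveX_inverse[of c k u] by (simp add: clinD(3)[OF clin_moveX])

lemma moveY_eq_0: "moveY c k u = 0 \<Longrightarrow> u = 0"
  using moveY_inverse[of c k u] by (simp add: clinD(3)[OF clin_moveY])

lemma cmdim_mequiv:
  assumes "mequiv f g" "cmdim t0 t1 n0 n1 f"
  shows "cmdim t0 t1 n0 n1 g"
  using assms
proof (induction rule: mequiv.induct)
  case (stepX g c k)
  hence *: "cmf t0 t1 g" "has_dim (VP True g) n0" "has_dim (VP False g) n1" by (auto simp: cmdim_def)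
  show ?case unfolding cmdim_def VP_moveX
    by (intro conjI cmf_moveX has_dim_inj_image clin_moveX *) (erule moveX_eq_0)+
next
  case (stepY g c k)
  hence *: "cmf t0 t1 g" "has_dim (VP True g) n0" "has_dim (VP False g) n1" by (auto simp: cmdim_def)
  show ?case unfolding cmdim_def VP_moveY
    by (intro conjI cmf_moveY has_dim_inj_image clin_moveY *) (erule moveY_eq_0)+
qed

section \<open>Points with a maximal span of powers of X\<close>

text \<open>Independence of a family and not of its set of values: a repeated vector counts as a
  dependence, as is needed for the powers X^i f.\<close>

definition cindep :: "nat \<Rightarrow> (nat \<Rightarrow> 'i \<Rightarrow> complex) \<Rightarrow> bool" where
  "cindep d u \<longleftrightarrow> (\<forall>c. (\<Sum>i<d. c i *f u i) = 0 \<longrightarrow> (\<forall>i<d. c i = 0))"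

lemma span_image_sum: "x \<in> fv.span (u ` {..<d}) \<longleftrightarrow> (\<exists>c. x = (\<Sum>i<d. c i *f u i))"
  for u :: "nat \<Rightarrow> 'i \<Rightarrow> complex"
proof (induction d arbitrary: x)
  case 0
  show ?case by simp
next
  case (Suc d)
  have "u ` {..<Suc d} = insert (u d) (u ` {..<d})" by (auto simp: lessThan_Suc)
  hence "x \<in> fv.span (u ` {..<Suc d}) \<longleftrightarrow> (\<exists>k c. x - k *f u d = (\<Sum>i<d. c i *f u i))"
    by (simp only: fv.span_breakdown_eq Suc.IH)
  also have "\<dots> \<longleftrightarrow> (\<exists>c. x = (\<Sum>i<Suc d. c i *f u i))"
  proof
    assume "\<exists>k c. x - k *f u d = (\<Sum>i<d. c i *f u i)"
    then obtain k c where kc: "x - k *f u d = (\<Sum>i<d. c i *f u i)" by blast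
    have "(\<Sum>i<d. (c(d := k)) i *f u i) = (\<Sum>i<d. c i *f u i)" by (rule sum.cong) auto
    hence "x = (\<Sum>i<Suc d. (c(d := k)) i *f u i)" using kc by (simp add: diff_eq_eq)
    thus "\<exists>c. x = (\<Sum>i<Suc d. c i *f u i)" by blast
  next
    assume "\<exists>c. x = (\<Sum>i<Suc d. c i *f u i)"
    then obtain c where "x = (\<Sum>i<Suc d. c i *f u i)" by blast
    hence "x - c d *f u d = (\<Sum>i<d. c i *f u i)" by simp
    thus "\<exists>k c. x - k *f u d = (\<Sum>i<d. c i *f u i)" by blast
  qed
  finally show ?case .
qed

lemma cindep_Suc_iff: "cindep (Suc d) u \<longleftrightarrow> cindep d u \<and> u d \<notin> fv.span (u ` {..<d})"
proof
  assume L: "cindep (Suc d) u"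
  show "cindep d u \<and> u d \<notin> fv.span (u ` {..<d})"
  proof
    show "cindep d u" unfolding cindep_def
    proof (intro allI impI)
      fix c i assume c: "(\<Sum>i<d. c i *f u i) = 0" and i: "i < d"
      have "(\<Sum>i<d. (c(d := 0)) i *f u i) = (\<Sum>i<d. c i *f u i)" by (rule sum.cong) auto
      hence "(\<Sum>i<Suc d. (c(d := 0)) i *f u i) = 0" using c by simp
      hence "(c(d := 0)) i = 0" using L i unfolding cindep_def by (metis less_Suc_eq)
      thus "c i = 0" using i by simp
    qed
    show "u d \<notin> fv.span (u ` {..<d})"
    proof
      assume "u d \<in> fv.span (u ` {..<d})"
      then obtain c where c: "u d = (\<Sum>i<d. c i *f u i)" by (auto simp: span_image_sum)
      have "(\<Sum>i<d. (c(d := -1)) i *f u i) = (\<Sum>i<d. c i *f u i)" by (rule sum.cong) auto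
      hence "(\<Sum>i<Suc d. (c(d := -1)) i *f u i) = 0" using c by simp
      hence "(c(d := -1)) d = 0" using L unfolding cindep_def by (metis lessI)
      thus False by simp
    qed
  qed
next
  assume R: "cindep d u \<and> u d \<notin> fv.span (u ` {..<d})"
  show "cindep (Suc d) u" unfolding cindep_def
  proof (intro allI impI)
    fix c i assume c: "(\<Sum>i<Suc d. c i *f u i) = 0" and i: "i < Suc d"
    have eq: "c d *f u d = - (\<Sum>i<d. c i *f u i)" using c by (simp add: eq_neg_iff_add_eq_0 add.commute)
    have cd: "c d = 0"
    proof (rule ccontr)
      assume nz: "c d \<noteq> 0"
      have "- (\<Sum>i<d. c i *f u i) \<in> fv.span (u ` {..<d})"
        by (intro fv.span_neg) (auto simp: span_image_sum)
      hence "inverse (c d) *f (c d *f u d) \<in> fv.span (u ` {..<d})"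
        unfolding eq by (rule fv.span_scale)
      thus False using R nz by simp
    qed
    hence "(\<Sum>i<d. c i *f u i) = 0" using c by simp
    thus "c i = 0" using R i cd unfolding cindep_def by (metis less_Suc_eq)
  qed
qed

lemma cindep_independent: "cindep d u \<Longrightarrow> inj_on u {..<d} \<and> fv.independent (u ` {..<d})"
proof (induction d)
  case 0 thus ?case by (simp add: fv.independent_empty)
next
  case (Suc d)
  hence IH: "inj_on u {..<d}" "fv.independent (u ` {..<d})" and n: "u d \<notin> fv.span (u ` {..<d})"
    by (auto simp: cindep_Suc_iff)
  have e: "{..<Suc d} = insert d {..<d}" by auto
  have "u d \<notin> u ` {..<d}" using n fv.span_base[of "u d" "u ` {..<d}"] by metis
  thus ?case unfolding e image_insert inj_on_insert using IH n fv.independent_insertI[OF n IH(2)] by simp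
qed

lemma cindep_has_dim: "cindep d u \<Longrightarrow> has_dim (fv.span (u ` {..<d})) d"
  unfolding has_dim_def using cindep_independent[of d u] card_image[of u "{..<d}"]
  by (intro exI[of _ "u ` {..<d}"]) auto

lemma cindep_cong: "(\<And>i. i < d \<Longrightarrow> u i = v i) \<Longrightarrow> cindep d u = cindep d v"
proof -
  assume "\<And>i. i < d \<Longrightarrow> u i = v i"
  hence "(\<Sum>i<d. c i *f u i) = (\<Sum>i<d. c i *f v i)" for c by (intro sum.cong) auto
  thus ?thesis by (simp add: cindep_def)
qed

lemma cindep_image:
  assumes "cindep d u" "clin A" "\<And>x. A x = 0 \<Longrightarrow> x = 0"
  shows "cindep d (\<lambda>i. A (u i))"
  unfolding cindep_def
proof (intro allI impI)
  fix c i assume c: "(\<Sum>i<d. c i *f A (u i)) = 0" and i: "i < d"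
  have "A (\<Sum>i<d. c i *f u i) = 0" using c by (simp add: clinD[OF assms(2)])
  thus "c i = 0" using assms(1,3) i unfolding cindep_def by blast
qed

lemma cindep_dual:
  assumes "cindep d u"
  obtains l where "\<And>j. clf (l j)" "\<And>i j. i < d \<Longrightarrow> l j (u i) = (if i = j then 1 else 0)"
proof -
  have inj: "inj_on u {..<d}" and ind: "fv.independent (u ` {..<d})"
    using cindep_independent[OF assms] by auto
  have "\<exists>g. clf g \<and> (\<forall>b\<in>u ` {..<d}. g b = (if the_inv_into {..<d} u b = j then 1 else 0))" for j
    by (rule clf_extend[OF ind])
  then obtain l where l: "\<And>j. clf (l j)"
    "\<And>j. \<forall>b\<in>u ` {..<d}. l j b = (if the_inv_into {..<d} u b = j then 1 else 0)" by metis
  show thesis by (rule that[of l]) (use l the_inv_into_f_f[OF inj] in auto)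
qed

text \<open>Linear independence is an open condition. Functionals dual to the family at s = 0 turn
  the family at s into a matrix that is polynomial in s and equal to the identity at s = 0; for
  small s it is too close to the identity to have a kernel.\<close>

lemma cindep_open:
  fixes q :: "nat \<Rightarrow> nat \<Rightarrow> 'i \<Rightarrow> complex"
  assumes "cindep d (\<lambda>i. q i 0)" "L > 0"
  shows "\<exists>s\<noteq>0. cindep d (\<lambda>i. \<Sum>l<L. s ^ l *f q i l)"
proof -
  obtain l where l: "\<And>j. clf (l j)" "\<And>i j. i < d \<Longrightarrow> l j (q i 0) = (if i = j then 1 else 0)"
    using cindep_dual[OF assms(1)] by blast
  define P where "P i j s = (\<Sum>k<L. s ^ k * l j (q i k))" for i j and s :: complex
  have P: "l j (\<Sum>k<L. s ^ k *f q i k) = P i j s" for i j s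
    by (simp add: P_def clfD[OF l(1)])
  have P0: "P i j 0 = (if i = j then 1 else 0)" if "i < d" for i j
  proof -
    have "P i j 0 = (\<Sum>k<L. if k = 0 then l j (q i 0) else 0)"
      unfolding P_def by (rule sum.cong) (auto simp: power_0_left)
    also have "\<dots> = l j (q i 0)" using assms(2) by simp
    finally show ?thesis using l(2)[OF that] by simp
  qed
  \<comment> \<open>For a kernel vector c with largest entry c j this bound gives |c j| \<le> d e |c
    j|, and d e < 1.\<close>
  define e where "e = 1 / (real d + 1)"
  have e: "e > 0" by (simp add: e_def)
  have "eventually (\<lambda>s. \<forall>i\<in>{..<d}. \<forall>j\<in>{..<d}. norm (P i j s - P i j 0) < e) (at 0)"
  proof (intro eventually_ball_finite ballI)
    fix i j
    have "isCont (P i j) 0" unfolding P_def by (intro continuous_intros)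
    thus "eventually (\<lambda>s. norm (P i j s - P i j 0) < e) (at 0)"
      using e unfolding isCont_def tendsto_iff dist_norm by blast
  qed auto
  moreover have "eventually (\<lambda>s::complex. s \<noteq> 0) (at 0)" by (simp add: eventually_at_filter)
  ultimately have "eventually (\<lambda>s. (\<forall>i\<in>{..<d}. \<forall>j\<in>{..<d}. norm (P i j s - P i j 0) < e) \<and> s \<noteq> 0) (at 0)"
    by (rule eventually_conj)
  hence "\<exists>s. (\<forall>i\<in>{..<d}. \<forall>j\<in>{..<d}. norm (P i j s - P i j 0) < e) \<and> s \<noteq> 0"
    by (rule eventually_happens'[OF at_neq_bot])
  then obtain s where s: "\<And>i j. i < d \<Longrightarrow> j < d \<Longrightarrow> norm (P i j s - P i j 0) < e" "s \<noteq> 0"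
    by auto
  have "cindep d (\<lambda>i. \<Sum>l<L. s ^ l *f q i l)" unfolding cindep_def
  proof (intro allI impI)
    fix c i0 assume c: "(\<Sum>i<d. c i *f (\<Sum>l<L. s ^ l *f q i l)) = 0" and i0: "i0 < d"
    have cP: "(\<Sum>i<d. c i * P i j s) = 0" for j
      using arg_cong[OF c, of "l j"] by (simp add: clfD(2,3,6)[OF l(1)] flip: P)
    have fin: "finite ((\<lambda>i. norm (c i)) ` {..<d})" "(\<lambda>i. norm (c i)) ` {..<d} \<noteq> {}" using i0 by auto
    obtain j where j: "j < d" "norm (c j) = Max ((\<lambda>i. norm (c i)) ` {..<d})"
      using Max_in[OF fin] by auto
    have mx: "norm (c i) \<le> norm (c j)" if "i < d" for i
      unfolding j(2) by (rule Max_ge[OF fin(1)]) (use that in auto)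
    have "c j = (\<Sum>i<d. c i * P i j 0)"
    proof -
      have "(\<Sum>i<d. c i * P i j 0) = (\<Sum>i<d. if i = j then c j else 0)"
        by (rule sum.cong) (auto simp: P0)
      thus ?thesis using j by simp
    qed
    also have "\<dots> = - (\<Sum>i<d. c i * (P i j s - P i j 0))"
      by (simp add: algebra_simps sum_subtractf cP)
    finally have "norm (c j) = norm (\<Sum>i<d. c i * (P i j s - P i j 0))"
      by (simp only: norm_minus_cancel)
    also have "\<dots> \<le> (\<Sum>i<d. norm (c i * (P i j s - P i j 0)))" by (rule norm_sum)
    also have "\<dots> \<le> (\<Sum>i<d. norm (c j) * e)"
    proof (rule sum_mono)
      fix i assume "i \<in> {..<d}"
      hence "norm (c i) * norm (P i j s - P i j 0) \<le> norm (c j) * e"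
        by (intro mult_mono mx less_imp_le[OF s(1)] j(1) norm_ge_zero) auto
      thus "norm (c i * (P i j s - P i j 0)) \<le> norm (c j) * e" by (simp add: norm_mult)
    qed
    also have "\<dots> = norm (c j) * (real d * e)" by simp
    finally have "norm (c j) * (1 - real d * e) \<le> 0" by (simp add: algebra_simps)
    moreover have "1 - real d * e > 0" by (simp add: e_def field_simps)
    ultimately have "norm (c j) \<le> 0" by (simp add: mult_le_0_iff)
    thus "c i0 = 0" using mx[OF i0] by simp
  qed
  thus ?thesis using s(2) by blast
qed

text \<open>The Leibniz rule for the commutator with B on a power of A.\<close>

lemma commutator_pow:
  fixes A B :: "('i \<Rightarrow> complex) \<Rightarrow> 'i \<Rightarrow> complex"
  assumes "clin A" "clin B"
  shows "(A ^^ k) (B u) - B ((A ^^ k) u)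
    = (\<Sum>i<k. (A ^^ i) (A (B ((A ^^ (k - 1 - i)) u)) - B (A ((A ^^ (k - 1 - i)) u))))"
proof (induction k)
  case (Suc k)
  have "(\<Sum>i<Suc k. (A ^^ i) (A (B ((A ^^ (Suc k - 1 - i)) u)) - B (A ((A ^^ (Suc k - 1 - i)) u))))
    = A (B ((A ^^ k) u)) - B (A ((A ^^ k) u))
      + (\<Sum>i<k. (A ^^ Suc i) (A (B ((A ^^ (k - 1 - i)) u)) - B (A ((A ^^ (k - 1 - i)) u))))"
    by (simp add: sum.lessThan_Suc_shift del: sum.lessThan_Suc)
  also have "(\<Sum>i<k. (A ^^ Suc i) (A (B ((A ^^ (k - 1 - i)) u)) - B (A ((A ^^ (k - 1 - i)) u))))
     = A ((A ^^ k) (B u) - B ((A ^^ k) u))"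
    unfolding Suc.IH by (simp add: clinD[OF assms(1)])
  finally show ?case by (simp add: clinD[OF assms(1)])
qed simp

text \<open>Conjugation by the shear \<open>y \<mapsto> y + a x\<close> turns \<open>x \<mapsto> x + s y\<^sup>2\<^sup>k\<^sup>+\<^sup>1\<close> into a move along \<open>(y + a x)\<^sup>2\<^sup>k\<^sup>+\<^sup>1\<close>.\<close>

definition flow :: "complex \<Rightarrow> complex \<Rightarrow> nat \<Rightarrow> wfun \<Rightarrow> wfun" where
  "flow a s k u = moveY (- a) 0 (moveX s k (moveY a 0 u))"

definition zop :: "complex \<Rightarrow> wfun \<Rightarrow> wfun" where
  "zop a u = SY u + a *f SX u"

lemma clin_zop [simp]: "clin (zop a)"
  unfolding zop_def by (intro clin_plus clin_scl clin_SL)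

lemma moveX_SX': "SX (moveX c k u) = moveX c k (SX u + c *f (SY ^^ (2 * k + 1)) u)"
  unfolding moveX_def by (simp add: SX_fnl)

lemma moveY_SY': "SY (moveY c k u) = moveY c k (SY u + c *f (SX ^^ (2 * k + 1)) u)"
  unfolding moveY_def by (simp add: SY_fnl)

text \<open>The shear \<open>moveY a 0\<close> commutes with \<open>SX\<close> and carries
  \<open>zop a\<close> to \<open>SY\<close>, so the inner \<open>moveX\<close> adds a power of
  \<open>zop a\<close> once the shear is undone.\<close>

lemma flow_SX: "SX (flow a s k u) = flow a s k (SX u + s *f (zop a ^^ (2 * k + 1)) u)"
proof -
  have "moveY a 0 (zop a v) = SY (moveY a 0 v)" for v
    by (simp add: moveY_SY' zop_def)
  hence "(SY ^^ (2 * k + 1)) (moveY a 0 u) = moveY a 0 ((zop a ^^ (2 * k + 1)) u)"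
    using funpow_intertwine[of "moveY a 0" "zop a" SY "2 * k + 1" u] by simp
  thus ?thesis
    unfolding flow_def moveY_SX[symmetric] moveX_SX'
    by (simp only: moveY_SX[symmetric] clinD[OF clin_moveY])
qed

lemma clin_flow [simp]: "clin (flow a s k)"
  unfolding flow_def
  by (rule clin_comp[OF clin_moveY, of "\<lambda>u. moveX s k (moveY a 0 u)", OF clin_comp[OF clin_moveX clin_moveY]])

lemma flow_eq_0: "flow a s k u = 0 \<Longrightarrow> u = 0"
  unfolding flow_def by (meson moveX_eq_0 moveY_eq_0)

lemma mequiv_flow: "mequiv f (flow a s k f)"
  unfolding flow_def by (intro mequiv.intros)

text \<open>\<open>pert Z f i l\<close> is the coefficient of \<open>s\<^sup>l\<close> in \<open>(X + s Z)\<^sup>i f\<close>.\<close>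

fun pert :: "(wfun \<Rightarrow> wfun) \<Rightarrow> wfun \<Rightarrow> nat \<Rightarrow> nat \<Rightarrow> wfun" where
  "pert Z f 0 0 = f"
| "pert Z f 0 (Suc l) = 0"
| "pert Z f (Suc i) 0 = SX (pert Z f i 0)"
| "pert Z f (Suc i) (Suc l) = SX (pert Z f i (Suc l)) + Z (pert Z f i l)"

lemma pert_0: "pert Z f i 0 = (SX ^^ i) f"
  by (induction i) auto

lemma pert_big: "clin Z \<Longrightarrow> i < l \<Longrightarrow> pert Z f i l = 0"
proof (induction i arbitrary: l)
  case (Suc i) thus ?case by (cases l) (auto simp: clinD[OF clin_SL] clinD(3)[OF Suc.prems(1)])
qed (auto simp: gr0_conv_Suc)

lemma pert_1: "clin Z \<Longrightarrow> pert Z f i (Suc 0) = (\<Sum>a<i. (SX ^^ a) (Z ((SX ^^ (i - 1 - a)) f)))"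
proof (induction i)
  case (Suc i)
  thus ?case
    by (simp add: sum.lessThan_Suc_shift clinD[OF clin_SL] pert_0 add.commute del: sum.lessThan_Suc)
qed simp

lemma pert_sum:
  assumes Z: "clin Z" and "i < L"
  shows "((\<lambda>u. SX u + s *f Z u) ^^ i) f = (\<Sum>l<L. s ^ l *f pert Z f i l)"
  using assms(2)
proof (induction i)
  case 0
  have "(\<Sum>l<L. s ^ l *f pert Z f 0 l) = (\<Sum>l<L. if l = 0 then f else 0)"
    by (rule sum.cong) (auto simp: gr0_conv_Suc)
  thus ?case using 0 by simp
next
  case (Suc i)
  obtain M where M: "L = Suc M" "i < M" using Suc.prems by (cases L) auto
  have e: "(\<Sum>l<L. s ^ l *f pert Z f i l) = (\<Sum>l<M. s ^ l *f pert Z f i l)"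
    using M pert_big[OF Z, of i M f] by simp
  have "((\<lambda>u. SX u + s *f Z u) ^^ Suc i) f
     = SX (\<Sum>l<L. s ^ l *f pert Z f i l) + s *f Z (\<Sum>l<M. s ^ l *f pert Z f i l)"
    using Suc e by simp
  also have "SX (\<Sum>l<L. s ^ l *f pert Z f i l)
    = SX (pert Z f i 0) + (\<Sum>l<M. s ^ Suc l *f SX (pert Z f i (Suc l)))"
    unfolding M(1) by (simp add: sum.lessThan_Suc_shift clinD[OF clin_SL] del: sum.lessThan_Suc)
  also have "s *f Z (\<Sum>l<M. s ^ l *f pert Z f i l) = (\<Sum>l<M. s ^ Suc l *f Z (pert Z f i l))"
    by (simp add: clinD[OF Z] fv.scale_sum_right)
  also have "SX (pert Z f i 0) + (\<Sum>l<M. s ^ Suc l *f SX (pert Z f i (Suc l))) +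
      (\<Sum>l<M. s ^ Suc l *f Z (pert Z f i l)) = (\<Sum>l<L. s ^ l *f pert Z f (Suc i) l)"
    unfolding M(1)
    by (simp add: sum.lessThan_Suc_shift sum.distrib fv.scale_right_distrib add.assoc del: sum.lessThan_Suc)
  finally show ?case .
qed

text \<open>The inner sum is the derivative of X^k f in the direction Z = (Y + \<alpha> X)^(2j+1),
  so the claim says that the derivative of g(X) f stays in the span. Otherwise it would be
  independent of the X^i f with i < d; by \<open>cindep_open\<close> this persists for some nonzero
  s, and the corresponding flow reaches a point with a larger span.\<close>

lemma maximal_condition:
  assumes ind: "cindep d (\<lambda>i. (SX ^^ i) f)"
    and maxi: "\<And>h. mequiv f h \<Longrightarrow> \<not> cindep (Suc d) (\<lambda>i. (SX ^^ i) h)"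
    and g: "(\<Sum>k\<le>d. g k *f (SX ^^ k) f) = 0" "g d = 1"
  shows "(\<Sum>k\<le>d. g k *f (\<Sum>a<k. (SX ^^ a) ((zop \<alpha> ^^ (2 * j + 1)) ((SX ^^ (k - 1 - a)) f))))
    \<in> fv.span ((\<lambda>i. (SX ^^ i) f) ` {..<d})"
proof (rule ccontr)
  define Z where "Z = (zop \<alpha> ^^ (2 * j + 1))"
  have Z: "clin Z" unfolding Z_def by (intro clin_pow clin_zop)
  define zeta where "zeta = (\<Sum>k\<le>d. g k *f pert Z f k (Suc 0))"
  assume "\<not> ?thesis"
  hence zeta: "zeta \<notin> fv.span ((\<lambda>i. (SX ^^ i) f) ` {..<d})"
    unfolding zeta_def pert_1[OF Z] unfolding Z_def .
  \<comment> \<open>Expansions in s: the first d vectors are the powers of X + s Z on f, and the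
    last one is g(X + s Z) f divided by s, which has no pole because g(X) f = 0.\<close>
  define q where "q i l = (if i < d then pert Z f i l else \<Sum>k\<le>d. g k *f pert Z f k (Suc l))" for i l
  have "(\<lambda>i. q i 0) ` {..<d} = (\<lambda>i. (SX ^^ i) f) ` {..<d}"
    by (rule image_cong) (auto simp: q_def pert_0)
  moreover have "cindep d (\<lambda>i. q i 0)"
    using ind by (subst cindep_cong[of d _ "\<lambda>i. (SX ^^ i) f"]) (auto simp: q_def pert_0)
  ultimately have qi: "cindep (Suc d) (\<lambda>i. q i 0)"
    using zeta by (simp add: cindep_Suc_iff q_def[of d] zeta_def)
  have "0 < d + 2" by simp
  from cindep_open[where q = q, OF qi this]
  obtain s where s: "s \<noteq> 0" "cindep (Suc d) (\<lambda>i. \<Sum>l<d+2. s ^ l *f q i l)" by auto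
  define Xs where "Xs = (\<lambda>u. SX u + s *f Z u)"
  define wd where "wd = (\<Sum>l<d+2. s ^ l *f q d l)"
  have low: "(\<Sum>l<d+2. s ^ l *f q i l) = (Xs ^^ i) f" if "i < d" for i
    using pert_sum[OF Z, of i "d + 2" s f] that by (simp add: q_def Xs_def)
  have top: "(\<Sum>k\<le>d. g k *f (Xs ^^ k) f) = s *f wd"
  proof -
    have "(\<Sum>k\<le>d. g k *f (Xs ^^ k) f) = (\<Sum>k\<le>d. g k *f (\<Sum>l<Suc (d+2). s ^ l *f pert Z f k l))"
      unfolding Xs_def by (rule sum.cong[OF refl]) (simp only: pert_sum[OF Z, of _ "Suc (d+2)"] atMost_iff le_imp_less_Suc less_SucI add_2_eq_Suc')
    also have "\<dots> = (\<Sum>k\<le>d. g k *f (SX ^^ k) f)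
        + (\<Sum>k\<le>d. g k *f (\<Sum>l<d+2. s ^ Suc l *f pert Z f k (Suc l)))"
      by (simp only: sum.lessThan_Suc_shift pert_0 fv.scale_right_distrib sum.distrib power_0 fv.scale_one)
    also have "\<dots> = (\<Sum>l<d+2. \<Sum>k\<le>d. g k *f (s ^ Suc l *f pert Z f k (Suc l)))"
      unfolding g(1) fv.scale_sum_right by (simp only: add_0_left) (rule sum.swap)
    also have "\<dots> = s *f wd"
      unfolding wd_def q_def
      by (simp only: less_irrefl if_False fv.scale_sum_right fv.scale_scale mult_ac power_Suc)
    finally show ?thesis .
  qed
  have "cindep (Suc d) (\<lambda>i. (Xs ^^ i) f)" unfolding cindep_def
  proof (intro allI impI)
    fix c i assume c: "(\<Sum>i<Suc d. c i *f (Xs ^^ i) f) = 0" and i: "i < Suc d"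
    have top': "(Xs ^^ d) f = s *f wd - (\<Sum>k<d. g k *f (Xs ^^ k) f)"
      using top g(2) by (simp add: lessThan_Suc_atMost[symmetric] eq_diff_eq add.commute)
    \<comment> \<open>These are the coefficients of the same combination after the top power has
      been replaced by means of \<open>top'\<close>.\<close>
    define c' where "c' k = (if k < d then c k - c d * g k else c d * s)" for k
    have "(\<Sum>i<Suc d. c' i *f (\<Sum>l<d+2. s ^ l *f q i l))
      = (\<Sum>i<d. c' i *f (\<Sum>l<d+2. s ^ l *f q i l)) + (c d * s) *f wd"
      by (simp add: wd_def c'_def)
    also have "(\<Sum>i<d. c' i *f (\<Sum>l<d+2. s ^ l *f q i l))
       = (\<Sum>i<d. c i *f (Xs ^^ i) f) - c d *f (\<Sum>i<d. g i *f (Xs ^^ i) f)"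
    proof -
      have "(\<Sum>i<d. c' i *f (\<Sum>l<d+2. s ^ l *f q i l)) = (\<Sum>i<d. c i *f (Xs ^^ i) f - c d *f (g i *f (Xs ^^ i) f))"
        by (rule sum.cong) (simp_all only: c'_def low fv.scale_left_diff_distrib fv.scale_scale lessThan_iff if_True)
      thus ?thesis by (simp only: sum_subtractf fv.scale_sum_right)
    qed
    also have "\<dots> + (c d * s) *f wd = (\<Sum>i<d. c i *f (Xs ^^ i) f) + c d *f (Xs ^^ d) f"
      unfolding top' by (simp add: fv.scale_right_diff_distrib)
    finally have z: "(\<Sum>i<Suc d. c' i *f (\<Sum>l<d+2. s ^ l *f q i l)) = 0" using c by simp
    hence c0: "c' k = 0" if "k < Suc d" for k using s(2) that unfolding cindep_def by blast
    have "c d = 0" using c0[of d] s(1) by (simp add: c'_def)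
    thus "c i = 0" using c0[OF i] i by (cases "i = d") (auto simp: c'_def)
  qed
  hence "cindep (Suc d) (\<lambda>i. flow \<alpha> s j ((Xs ^^ i) f))"
    by (rule cindep_image[OF _ clin_flow flow_eq_0])
  moreover have "flow \<alpha> s j ((Xs ^^ i) f) = (SX ^^ i) (flow \<alpha> s j f)" for i
    by (rule funpow_intertwine[of "flow \<alpha> s j" Xs SX i f]) (simp only: flow_SX Xs_def Z_def)
  ultimately have "cindep (Suc d) (\<lambda>i. (SX ^^ i) (flow \<alpha> s j f))" by simp
  thus False by (rule notE[OF maxi[OF mequiv_flow]])
qed

text \<open>The derivatives of \<open>W(X, Y)\<close> and of \<open>(Y + a X)\<^sup>m\<close> along \<open>Y \<mapsto> Y + s A\<close>.\<close>

fun dwg :: "(wfun \<Rightarrow> wfun) \<Rightarrow> letter list \<Rightarrow> wfun \<Rightarrow> wfun" where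
  "dwg A [] u = 0"
| "dwg A (LetterX # W) u = SX (dwg A W u)"
| "dwg A (LetterY # W) u = SY (dwg A W u) + A (opw SX SY W u)"

lemma clin_opw_SL: "clin (opw SX SY W)"
  by (intro clin_opw clin_SL)

lemma clin_dwg: "clin A \<Longrightarrow> clin (dwg A W)"
proof (induction W)
  case Nil
  have "dwg A [] = (\<lambda>u. 0)" by (rule ext) simp
  thus ?case by (simp add: clin_zero)
next
  case (Cons l W)
  show ?case
  proof (cases l)
    case LetterX
    have "dwg A (l # W) = (\<lambda>u. SX (dwg A W u))" unfolding LetterX by (rule ext) simp
    thus ?thesis using clin_SL_comp[OF Cons.IH[OF Cons.prems]] by simp
  next
    case LetterY
    have "dwg A (l # W) = (\<lambda>u. SY (dwg A W u) + A (opw SX SY W u))"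
      unfolding LetterY by (rule ext) simp
    thus ?thesis
      using clin_plus[OF clin_SL_comp[OF Cons.IH[OF Cons.prems]] clin_comp[OF Cons.prems clin_opw_SL]]
      by simp
  qed
qed

lemma dwg_append: "dwg A (V @ W) u = opw SX SY V (dwg A W u) + dwg A V (opw SX SY W u)"
proof (induction V)
  case (Cons l V)
  thus ?case by (cases l) (simp_all add: clinD[OF clin_SL] opw_append)
qed simp

definition x_count :: "letter list \<Rightarrow> nat" where "x_count W = length (filter (\<lambda>l. l = LetterX) W)"

definition words :: "nat \<Rightarrow> letter list set" where "words m = {W. length W = m}"

lemma finite_words [simp]: "finite (words m)"
proof -
  have "(UNIV :: letter set) = {LetterX, LetterY}" using letter.exhaust by auto
  hence "finite (UNIV :: letter set)" by (metis finite.emptyI finite.insertI)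
  from finite_lists_length_eq[OF this, of m] show ?thesis by (simp add: words_def)
qed

lemma sum_words_Suc:
  "(\<Sum>W\<in>words (Suc m). h W) = (\<Sum>W\<in>words m. h (LetterX # W)) + (\<Sum>W\<in>words m. h (LetterY # W))"
  for h :: "letter list \<Rightarrow> 'a::comm_monoid_add"
proof -
  have e: "words (Suc m) = Cons LetterX ` words m \<union> Cons LetterY ` words m"
  proof
    show "words (Suc m) \<subseteq> Cons LetterX ` words m \<union> Cons LetterY ` words m"
    proof
      fix W assume "W \<in> words (Suc m)"
      then obtain l V where "W = l # V" "length V = m" by (auto simp: words_def length_Suc_conv)
      thus "W \<in> Cons LetterX ` words m \<union> Cons LetterY ` words m"
        by (cases l) (auto simp: words_def)
    qed
  qed (auto simp: words_def)
  show ?thesis unfolding e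
    by (subst sum.union_disjoint) (auto simp: sum.reindex)
qed

lemma sum_words_0: "(\<Sum>W\<in>words 0. h W) = h []"
  by (simp add: words_def)

lemma x_count_simps [simp]: "x_count [] = 0" "x_count (LetterX # W) = Suc (x_count W)" "x_count (LetterY # W) = x_count W"
  "x_count (V @ W) = x_count V + x_count W"
  by (simp_all add: x_count_def)

text \<open>The coefficient of a^k is the sum of all words with k letters X, so identities that hold
  for every a are identities between symmetrised words.\<close>

lemma zop_pow_words: "(zop a ^^ m) u = (\<Sum>W\<in>words m. a ^ x_count W *f opw SX SY W u)"
proof (induction m)
  case (Suc m)
  thus ?case
    by (simp add: sum_words_Suc zop_def clinD[OF clin_SL] fv.scale_sum_right add.commute)
qed (simp add: sum_words_0)

fun dz :: "complex \<Rightarrow> (wfun \<Rightarrow> wfun) \<Rightarrow> nat \<Rightarrow> wfun \<Rightarrow> wfun" where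
  "dz a A 0 u = 0"
| "dz a A (Suc m) u = zop a (dz a A m u) + A ((zop a ^^ m) u)"

lemma dz_words:
  assumes "clin A"
  shows "dz a A m u = (\<Sum>W\<in>words m. a ^ x_count W *f dwg A W u)"
proof (induction m)
  case (Suc m)
  show ?case
    by (simp add: sum_words_Suc Suc.IH zop_def clinD[OF clin_SL] clinD[OF assms] fv.scale_sum_right
        fv.scale_right_distrib sum.distrib zop_pow_words add_ac)
qed (simp add: sum_words_0)

lemma dz_sum: "dz a A m u = (\<Sum>i<m. (zop a ^^ i) (A ((zop a ^^ (m - 1 - i)) u)))"
proof (induction m)
  case (Suc m)
  show ?case
    by (simp add: sum.lessThan_Suc_shift Suc.IH clinD[OF clin_zop] add.commute del: sum.lessThan_Suc)
qed simp

text \<open>A functional on words satisfying the linearised relation is determined by its lowest-order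
  part, which is symmetric in the letters; there it is a multiple of its symmetrisation.\<close>

lemma symmetric_on_words:
  assumes "\<And>V W. length V + length W + 2 = m \<Longrightarrow> D (V @ [LetterX, LetterY] @ W) = D (V @ [LetterY, LetterX] @ W)"
    and "length W = m"
  shows "D W = (D (replicate (x_count W) LetterX @ replicate (m - x_count W) LetterY) :: complex)"
proof -
  have le: "x_count W \<le> length W" for W by (simp add: x_count_def)
  have swap: "length V + Suc a + length U = m \<Longrightarrow>
      D (V @ [LetterY] @ replicate a LetterX @ U) = D (V @ replicate a LetterX @ [LetterY] @ U)" for V a U
  proof (induction a arbitrary: V)
    case (Suc a)
    have "D (V @ [LetterY] @ replicate (Suc a) LetterX @ U) = D (V @ [LetterY, LetterX] @ replicate a LetterX @ U)"
      by simp
    also have "\<dots> = D (V @ [LetterX, LetterY] @ replicate a LetterX @ U)"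
      by (rule assms(1)[symmetric]) (use Suc.prems in simp)
    also have "\<dots> = D ((V @ [LetterX]) @ [LetterY] @ replicate a LetterX @ U)" by simp
    also have "\<dots> = D ((V @ [LetterX]) @ replicate a LetterX @ [LetterY] @ U)"
      by (rule Suc.IH) (use Suc.prems in simp)
    finally show ?case by simp
  qed simp
  have "length V + length W = m \<Longrightarrow>
     D (V @ W) = D (V @ replicate (x_count W) LetterX @ replicate (length W - x_count W) LetterY)" for V
  proof (induction W arbitrary: V)
    case (Cons l W)
    have IH: "D ((V @ [l]) @ W) = D ((V @ [l]) @ replicate (x_count W) LetterX @ replicate (length W - x_count W) LetterY)"
      by (rule Cons.IH) (use Cons.prems in simp)
    show ?case
    proof (cases l)
      case LetterX
      thus ?thesis using IH by simp
    next
      case LetterY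
      have "D (V @ [LetterY] @ replicate (x_count W) LetterX @ replicate (length W - x_count W) LetterY)
        = D (V @ replicate (x_count W) LetterX @ [LetterY] @ replicate (length W - x_count W) LetterY)"
        by (rule swap) (use Cons.prems le[of W] in simp)
      moreover have "length (l # W) - x_count (l # W) = Suc (length W - x_count W)"
        using le[of W] LetterY by simp
      ultimately show ?thesis using IH LetterY by simp
    qed
  qed simp
  from this[of "[]"] show ?thesis using assms(2) by simp
qed

lemma zero_of_symmetrised:
  assumes lr: "\<And>V W. D (V @ [LetterX, LetterY] @ W) - D (V @ [LetterY, LetterX] @ W)
      + \<tau> (length W) * D (V @ W) = D V * f W + f V * D W"
    and odd: "\<And>W. odd (length W) \<Longrightarrow> D W = 0"
    and sym: "\<And>m a. even m \<Longrightarrow> (\<Sum>W\<in>words m. a ^ x_count W * D W) = 0"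
  shows "D W = (0 :: complex)"
proof (induction "length W" arbitrary: W rule: less_induct)
  case less
  define m where "m = length W"
  show ?case
  proof (cases "even m")
    case False
    thus ?thesis using odd m_def by simp
  next
    case True
    \<comment> \<open>In the linearised relation all words other than the two longest are shorter
      than W, where D vanishes by induction.\<close>
    have swap: "D (V @ [LetterX, LetterY] @ U) = D (V @ [LetterY, LetterX] @ U)"
      if "length V + length U + 2 = m" for V U
    proof -
      have "D (V @ U) = 0" "D V = 0" "D U = 0"
        using that by (auto intro!: less simp: m_def)
      thus ?thesis using lr[of V U] by simp
    qed
    define N where "N k = replicate k LetterX @ replicate (m - k) LetterY" for k
    have DN: "D V = D (N (x_count V))" if "V \<in> words m" for V
      using symmetric_on_words[of m D V, OF swap] that by (simp add: N_def words_def)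
    have xle: "x_count V \<le> m" if "V \<in> words m" for V
      using that by (auto simp: words_def x_count_def)
    \<comment> \<open>All words with k letters X share one value of D, so the symmetrised sum is
      this count times that value. The polynomial in a vanishes identically, and the count for W is
      positive.\<close>
    define cf where "cf k = of_nat (card {V \<in> words m. x_count V = k}) * D (N k)" for k
    have "(\<Sum>k\<le>m. cf k * a ^ k) = 0" for a
    proof -
      have "(\<Sum>V\<in>words m. a ^ x_count V * D V) = (\<Sum>V\<in>words m. a ^ x_count V * D (N (x_count V)))"
        by (rule sum.cong) (auto simp flip: DN)
      also have "\<dots> = (\<Sum>k\<le>m. \<Sum>V\<in>{V \<in> words m. x_count V = k}. a ^ x_count V * D (N (x_count V)))"
        by (rule sum.group[symmetric]) (use xle in auto)
      also have "\<dots> = (\<Sum>k\<le>m. cf k * a ^ k)"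
        by (rule sum.cong) (simp_all add: cf_def)
      finally show ?thesis using sym[OF True, of a] by simp
    qed
    hence cf0: "\<forall>k\<le>m. cf k = 0" using polyfun_eq_0[of cf m] by blast
    have W: "W \<in> words m" by (simp add: words_def m_def)
    have "cf (x_count W) = 0" using cf0 xle[OF W] by blast
    moreover have "card {V \<in> words m. x_count V = x_count W} \<noteq> 0" using W by auto
    ultimately have "D (N (x_count W)) = 0" by (simp add: cf_def)
    thus ?thesis using DN[OF W] by simp
  qed
qed

section \<open>Parity components, and the variation defined by a functional that kills the powers of
  X\<close>

definition proj :: "bool \<Rightarrow> wfun \<Rightarrow> wfun" where
  "proj p u = (\<lambda>W. if even (length W) = p then u W else 0)"

lemma clin_proj [simp]: "clin (proj p)"
  by (auto simp: clin_def proj_def fun_pointwise)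

lemma proj_parf: "parf p u \<Longrightarrow> proj p u = u" "parf (\<not> p) u \<Longrightarrow> proj p u = 0"
  by (auto simp: parf_def proj_def fun_pointwise)

lemma proj_parf': "parf q u \<Longrightarrow> proj p u = (if p = q then u else 0)"
  using proj_parf[of p u] by (cases p; cases q) auto

lemma proj_add: "proj True u + proj False u = u"
  by (auto simp: proj_def fun_pointwise)

lemma proj_SL: "proj p (SL l u) = SL l (proj (\<not> p) u)"
  by (auto simp: proj_def SL_def fun_pointwise)

lemma even_rearrange: "i < k \<Longrightarrow> even (k - 1 - i) = (even k \<noteq> even i)" for i k :: nat
  by (induction k) (auto simp: less_Suc_eq Suc_diff_le)

text \<open>A functional \<open>\<psi>\<close> that kills the span of the \<open>X\<^sup>i f\<close> yields \<open>A\<close> and \<open>om\<close> with \<open>[X, A] = - om f\<close>. By the first-order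
  conditions, \<open>(X, Y + s A, f, ev - s om)\<close> has the same functional as the given point up to \<open>o(s)\<close>.\<close>

locale variation =
  fixes t0 t1 :: complex and f :: wfun and d :: nat and g :: "nat \<Rightarrow> complex" and \<psi> :: "wfun \<Rightarrow> complex"
  assumes cm: "cmf t0 t1 f"
    and g: "(\<Sum>k\<le>d. g k *f (SX ^^ k) f) = 0" "g d = 1"
    and gpar: "\<And>k. even k \<noteq> even d \<Longrightarrow> g k = 0"
    and psi: "clf \<psi>" "\<And>i. \<psi> ((SX ^^ i) f) = 0" "\<And>u. parf (odd d) u \<Longrightarrow> \<psi> u = 0"
    and stat: "\<And>\<alpha> j. (\<Sum>k\<le>d. g k * (\<Sum>i<k. \<psi> ((SX ^^ i) ((zop \<alpha> ^^ (2 * j + 1)) ((SX ^^ (k - 1 - i)) f))))) = 0"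
begin

text \<open>The divided difference (g(s) - g(t)) / (s - t), with s^i replaced by psi (X^i u) and t^j
  by X^j f.\<close>

definition A :: "wfun \<Rightarrow> wfun" where
  "A u = (\<Sum>k\<le>d. g k *f (\<Sum>i<k. \<psi> ((SX ^^ i) u) *f (SX ^^ (k - 1 - i)) f))"

definition om :: "wfun \<Rightarrow> complex" where
  "om u = (\<Sum>k\<le>d. g k * \<psi> ((SX ^^ k) u))"

lemma clinX: "clin (SX ^^ i)" by (rule clin_pow[OF clin_SL])

lemma clin_A: "clin A"
  unfolding A_def by (intro clin_sum clin_scl clin_rank1[OF clf_comp[OF psi(1) clinX]])

lemma clf_om: "clf om"
  unfolding om_def by (intro clf_sum clf_scl[OF clf_comp[OF psi(1) clinX]])

text \<open>Multiplying the divided difference by s - t leaves g(s) - g(t). One of the two terms is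
  a multiple of g(X) f = 0, the other is om.\<close>

lemma XA: "SX (A u) = A (SX u) - om u *f f"
proof -
  have inner: "SX (\<Sum>i<k. \<psi> ((SX ^^ i) u) *f (SX ^^ (k - 1 - i)) f)
     - (\<Sum>i<k. \<psi> ((SX ^^ i) (SX u)) *f (SX ^^ (k - 1 - i)) f)
     = \<psi> u *f (SX ^^ k) f - \<psi> ((SX ^^ k) u) *f f" for k
  proof -
    have "SX (\<Sum>i<k. \<psi> ((SX ^^ i) u) *f (SX ^^ (k - 1 - i)) f)
        = (\<Sum>i<k. \<psi> ((SX ^^ i) u) *f (SX ^^ (k - i)) f)"
      unfolding clinD(2,6)[OF clin_SL]
    proof (rule sum.cong[OF HOL.refl])
      fix i assume "i \<in> {..<k}"
      hence "k - i = Suc (k - 1 - i)" by auto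
      thus "\<psi> ((SX ^^ i) u) *f SX ((SX ^^ (k - 1 - i)) f) = \<psi> ((SX ^^ i) u) *f (SX ^^ (k - i)) f"
        by simp
    qed
    moreover have "(\<Sum>i<k. \<psi> ((SX ^^ i) (SX u)) *f (SX ^^ (k - 1 - i)) f)
       = (\<Sum>i<k. \<psi> ((SX ^^ Suc i) u) *f (SX ^^ (k - Suc i)) f)"
      by (simp add: funpow_swap1)
    moreover have "(\<Sum>i<k. \<psi> ((SX ^^ i) u) *f (SX ^^ (k - i)) f)
       - (\<Sum>i<k. \<psi> ((SX ^^ Suc i) u) *f (SX ^^ (k - Suc i)) f)
       = \<psi> ((SX ^^ 0) u) *f (SX ^^ (k - 0)) f - \<psi> ((SX ^^ k) u) *f (SX ^^ (k - k)) f"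
      unfolding sum_subtractf[symmetric]
      by (rule sum_lessThan_telescope'[where f = "\<lambda>i. \<psi> ((SX ^^ i) u) *f (SX ^^ (k - i)) f"])
    ultimately show ?thesis by simp
  qed
  have "(\<Sum>k\<le>d. g k *f (\<psi> u *f (SX ^^ k) f - \<psi> ((SX ^^ k) u) *f f))
     = (\<Sum>k\<le>d. g k *f (SX (\<Sum>i<k. \<psi> ((SX ^^ i) u) *f (SX ^^ (k - 1 - i)) f)
     - (\<Sum>i<k. \<psi> ((SX ^^ i) (SX u)) *f (SX ^^ (k - 1 - i)) f)))"
    by (simp only: inner)
  also have "\<dots> = SX (A u) - A (SX u)"
    by (simp only: A_def clinD(2,6)[OF clin_SL] sum_subtractf fv.scale_right_diff_distrib)
  finally have "SX (A u) - A (SX u) = (\<Sum>k\<le>d. g k *f (\<psi> u *f (SX ^^ k) f - \<psi> ((SX ^^ k) u) *f f))" ..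
  also have "\<dots> = \<psi> u *f (\<Sum>k\<le>d. g k *f (SX ^^ k) f) - om u *f f"
    by (simp add: om_def fv.scale_sum_right fv.scale_sum_left fv.scale_right_diff_distrib sum_subtractf mult.commute)
  finally show ?thesis unfolding g(1) by (simp add: diff_eq_eq)
qed

text \<open>A nonzero term has k of the parity of d, by \<open>gpar\<close>, and X^i u of that
  parity too, since psi kills the other one. Then X^(k-1-i) f has the parity opposite to u.\<close>

lemma A_VP: assumes "u \<in> VP p f" shows "A u \<in> VP (\<not> p) f"
  unfolding A_def fv.scale_sum_right
proof (intro fv.subspace_sum subspace_VP)
  have pf: "parf True f" using cm by (simp add: cmf_def)
  fix k i assume k: "k \<in> {..d}" and i: "i \<in> {..<k}"
  show "g k *f (\<psi> ((SX ^^ i) u) *f (SX ^^ (k - 1 - i)) f) \<in> VP (\<not> p) f"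
  proof (cases "even k = even d \<and> (p = even i) = even d")
    case True
    have "even (k - 1 - i) = (\<not> p)" using even_rearrange[of i k] i True by auto
    moreover have "(SX ^^ (k - 1 - i)) f \<in> VP (True = even (k - 1 - i)) f" by (rule VP_pow[OF VP_self])
    ultimately have "(SX ^^ (k - 1 - i)) f \<in> VP (\<not> p) f" by simp
    thus ?thesis by (intro fv.subspace_scale subspace_VP)
  next
    case False
    have "g k = 0 \<or> \<psi> ((SX ^^ i) u) = 0"
    proof (cases "even k = even d")
      case True
      hence "(p = even i) = odd d" using False by auto
      hence "parf (odd d) ((SX ^^ i) u)" using parf_VP[OF pf VP_pow[OF assms, of i LetterX]] by simp
      thus ?thesis using psi(3) by blast
    qed (use gpar in blast)
    thus ?thesis using fv.subspace_0[OF subspace_VP] by auto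
  qed
qed

text \<open>The derivative at s = 0 of the functional of (X, Y + s A, f, ev - s om) at the word
  W.\<close>

definition D :: "letter list \<Rightarrow> complex" where
  "D W = ev (dwg A W f) - om (opw SX SY W f)"

lemma dwg_VP: "dwg A W f \<in> VP (even (length W)) f"
proof (induction W)
  case (Cons l W)
  have "opw SX SY W f \<in> VP (even (length W)) f" by (rule VP_base) simp
  hence a: "A (opw SX SY W f) \<in> VP (\<not> even (length W)) f" by (rule A_VP)
  show ?case
  proof (cases l)
    case LetterX
    thus ?thesis using VP_SL[OF Cons, of LetterX] by simp
  next
    case LetterY
    thus ?thesis using fv.subspace_add[OF subspace_VP VP_SL[OF Cons, of LetterY] a] by simp
  qed
qed (simp add: fv.subspace_0)

lemma D_odd: assumes "odd (length W)" shows "D W = 0"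
proof -
  have pf: "parf True f" using cm by (simp add: cmf_def)
  have "dwg A W f \<in> VP False f" using dwg_VP[of W] assms by simp
  hence 1: "ev (dwg A W f) = 0" by (intro ev_odd parf_VP[OF pf])
  have 2: "g k * \<psi> ((SX ^^ k) (opw SX SY W f)) = 0" for k
  proof (cases "even k = even d")
    case True
    have "opw SX SY W f \<in> VP False f" by (rule VP_base) (use assms in simp)
    hence "parf (False = even k) ((SX ^^ k) (opw SX SY W f))" by (intro parf_VP[OF pf] VP_pow)
    hence "\<psi> ((SX ^^ k) (opw SX SY W f)) = 0" using True by (intro psi(3)) simp
    thus ?thesis by simp
  qed (simp add: gpar)
  show ?thesis by (simp only: D_def om_def 1 2 sum.neutral_const diff_self)
qed

text \<open>The derivative of the defining relation. By \<open>XA\<close> the commutator of X with A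
  is -om times f, exactly the first-order change of the rank-one term at the place where the letters
  are exchanged.\<close>

lemma D_rel: "D (V @ [LetterX, LetterY] @ W) - D (V @ [LetterY, LetterX] @ W)
   + tsel t0 t1 (even (length W)) * D (V @ W) = D V * f W + f V * D W"
proof -
  define u u' t where "u = opw SX SY W f" and "u' = dwg A W f" and "t = tsel t0 t1 (even (length W))"
  have u: "u \<in> VP (even (length W)) f" unfolding u_def by (rule VP_base) simp
  have ru: "SX (SY u) - SY (SX u) + t *f u = ev u *f f" unfolding t_def by (rule cmf_rel[OF cm u])
  have ru': "SX (SY u') - SY (SX u') + t *f u' = ev u' *f f"
    unfolding t_def u'_def by (rule cmf_rel[OF cm dwg_VP])
  have dw: "dwg A ([LetterX, LetterY] @ W) f - dwg A ([LetterY, LetterX] @ W) f + t *f u' = ev u' *f f - om u *f f"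
  proof -
    have "dwg A ([LetterX, LetterY] @ W) f - dwg A ([LetterY, LetterX] @ W) f + t *f u'
      = (SX (SY u') - SY (SX u') + t *f u') + (SX (A u) - A (SX u))"
      by (simp add: u_def u'_def clinD[OF clin_SL])
    also have "\<dots> = ev u' *f f - om u *f f" unfolding ru' by (simp add: XA)
    finally show ?thesis .
  qed
  note lo = clinD[OF clin_opw_SL, of V] and ld = clinD[OF clin_dwg[OF clin_A], of V]
    and le = clfD[OF clf_ev] and lm = clfD[OF clf_om]
  have f1: "ev (opw SX SY V f) = f V" and f2: "ev u = f W" by (simp_all add: u_def opw_SL ev_def)
  have "D (V @ [LetterX, LetterY] @ W) - D (V @ [LetterY, LetterX] @ W) + t * D (V @ W)
     = ev (opw SX SY V (dwg A ([LetterX, LetterY] @ W) f - dwg A ([LetterY, LetterX] @ W) f + t *f u'))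
       + ev (dwg A V (SX (SY u) - SY (SX u) + t *f u))
       - om (opw SX SY V (SX (SY u) - SY (SX u) + t *f u))"
    unfolding D_def dwg_append[of A V] opw_append[of SX SY V] lo ld le lm
    by (simp add: u_def u'_def algebra_simps)
  also have "\<dots> = (ev u' - om u) * f V + ev u * D V"
    unfolding dw ru lo ld le lm by (simp add: D_def f1 algebra_simps)
  finally show ?thesis by (simp add: t_def D_def f2 flip: u_def u'_def)
qed

lemma zop_VP: "u \<in> VP p f \<Longrightarrow> zop a u \<in> VP (\<not> p) f"
  unfolding zop_def by (intro fv.subspace_add fv.subspace_scale subspace_VP VP_SL)

lemma zop_pow_VP: "u \<in> VP p f \<Longrightarrow> (zop a ^^ k) u \<in> VP (p = even k) f"
proof (induction k)
  case (Suc k)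
  have "zop a ((zop a ^^ k) u) \<in> VP (\<not> (p = even k)) f" by (rule zop_VP[OF Suc.IH[OF Suc.prems]])
  moreover have "(\<not> (p = even k)) = (p = even (Suc k))" by auto
  ultimately show ?case by simp
qed simp

lemma sum_alternating: "(\<Sum>i<2 * n. tsel t0 t1 (p = even (2 * n - 1 - i))) = of_nat n * (t0 + t1)"
proof (induction n)
  case (Suc n)
  have "(\<Sum>i<2 * Suc n. tsel t0 t1 (p = even (2 * Suc n - 1 - i)))
      = tsel t0 t1 (p = even (2 * n + 1)) + (tsel t0 t1 (p = even (2 * n))
        + (\<Sum>i<2 * n. tsel t0 t1 (p = even (2 * n - 1 - i))))"
    by (simp add: sum.lessThan_Suc_shift del: sum.lessThan_Suc)
  also have "tsel t0 t1 (p = even (2 * n + 1)) + (tsel t0 t1 (p = even (2 * n)) + x) = (t0 + t1) + x" for x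
    by (cases p) (simp_all add: tsel_def)
  finally show ?case unfolding Suc.IH by (simp add: algebra_simps)
qed simp

text \<open>X has the same commutator with Y + a X as with Y. An even power meets both parities
  equally often, so the contribution of \<tau> is a scalar that does not depend on p. It leaves an
  odd power of Y + a X, on which \<open>stat\<close> can act.\<close>

lemma X_zop_commutator:
  assumes "u \<in> VP p f"
  shows "SX ((zop a ^^ (2 * n)) u) - (zop a ^^ (2 * n)) (SX u)
    = (\<Sum>i<2 * n. ev ((zop a ^^ (2 * n - 1 - i)) u) *f (zop a ^^ i) f)
      - (of_nat n * (t0 + t1)) *f (zop a ^^ (2 * n - 1)) u"
proof -
  have "(zop a ^^ (2 * n)) (SX u) - SX ((zop a ^^ (2 * n)) u)
      = (\<Sum>i<2 * n. (zop a ^^ i) (zop a (SX ((zop a ^^ (2 * n - 1 - i)) u)) - SX (zop a ((zop a ^^ (2 * n - 1 - i)) u))))"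
    by (rule commutator_pow[OF clin_zop clin_SL])
  also have "\<dots> = (\<Sum>i<2 * n. tsel t0 t1 (p = even (2 * n - 1 - i)) *f (zop a ^^ (2 * n - 1)) u
        - ev ((zop a ^^ (2 * n - 1 - i)) u) *f (zop a ^^ i) f)"
  proof (rule sum.cong[OF HOL.refl])
    fix i assume i: "i \<in> {..<2 * n}"
    define v where "v = (zop a ^^ (2 * n - 1 - i)) u"
    have v: "v \<in> VP (p = even (2 * n - 1 - i)) f" unfolding v_def by (rule zop_pow_VP[OF assms])
    have "zop a (SX v) - SX (zop a v) = - (SX (SY v) - SY (SX v))"
      by (simp add: zop_def clinD[OF clin_SL])
    also have "\<dots> = tsel t0 t1 (p = even (2 * n - 1 - i)) *f v - ev v *f f"
      using cmf_rel[OF cm v] by (simp add: algebra_simps eq_diff_eq)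
    finally have e: "zop a (SX v) - SX (zop a v) = tsel t0 t1 (p = even (2 * n - 1 - i)) *f v - ev v *f f" .
    have "(zop a ^^ i) v = (zop a ^^ (2 * n - 1)) u"
      unfolding v_def using i by (simp flip: funpow_add comp_apply[of "zop a ^^ i"])
    thus "(zop a ^^ i) (zop a (SX ((zop a ^^ (2 * n - 1 - i)) u)) - SX (zop a ((zop a ^^ (2 * n - 1 - i)) u)))
       = tsel t0 t1 (p = even (2 * n - 1 - i)) *f (zop a ^^ (2 * n - 1)) u
        - ev ((zop a ^^ (2 * n - 1 - i)) u) *f (zop a ^^ i) f"
      unfolding v_def[symmetric] e by (simp add: clinD[OF clin_pow[OF clin_zop]])
  qed
  also have "\<dots> = (of_nat n * (t0 + t1)) *f (zop a ^^ (2 * n - 1)) u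
      - (\<Sum>i<2 * n. ev ((zop a ^^ (2 * n - 1 - i)) u) *f (zop a ^^ i) f)"
    by (simp only: sum_subtractf fv.scale_sum_left[symmetric] sum_alternating)
  finally show ?thesis by (simp add: algebra_simps)
qed

text \<open>Put z = Y + a X. Since g(X) f = 0, the number om (z^m f) is psi of the commutator of
  g(X) and z^m on f. The rank-one parts of this commutator add up to the derivative of z^m along A,
  and the remaining part is a multiple of a stationary expression.\<close>

lemma D_symmetrised:
  assumes "even m" shows "(\<Sum>W\<in>words m. a ^ x_count W * D W) = 0"
proof -
  obtain n where m: "m = 2 * n" using assms by auto
  let ?z = "zop a" and ?q = "of_nat n * (t0 + t1)"
  have cz: "clin (?z ^^ k)" for k by (rule clin_pow[OF clin_zop])
  have "(\<Sum>W\<in>words m. a ^ x_count W * D W) = ev (dz a A m f) - om ((?z ^^ m) f)"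
    unfolding dz_words[OF clin_A] zop_pow_words D_def
    by (simp add: clfD[OF clf_ev] clfD[OF clf_om] right_diff_distrib sum_subtractf)
  also have "om ((?z ^^ m) f) = (\<Sum>k\<le>d. g k * \<psi> ((SX ^^ k) ((?z ^^ m) f) - (?z ^^ m) ((SX ^^ k) f)))"
  proof -
    have "(\<Sum>k\<le>d. g k * \<psi> ((?z ^^ m) ((SX ^^ k) f))) = \<psi> ((?z ^^ m) (\<Sum>k\<le>d. g k *f (SX ^^ k) f))"
      by (simp only: clinD[OF cz] clfD[OF psi(1)])
    also have "\<dots> = 0" unfolding g(1) by (simp only: clinD[OF cz] clfD[OF psi(1)])
    finally show ?thesis unfolding om_def by (simp add: clfD[OF psi(1)] right_diff_distrib sum_subtractf)
  qed
  also have "\<dots> = (\<Sum>k\<le>d. g k * (\<Sum>i<k. (\<Sum>b<m. ev ((?z ^^ (m - 1 - b)) ((SX ^^ (k - 1 - i)) f)) * \<psi> ((SX ^^ i) ((?z ^^ b) f)))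
       - ?q * \<psi> ((SX ^^ i) ((?z ^^ (m - 1)) ((SX ^^ (k - 1 - i)) f)))))"
  proof (rule sum.cong[OF HOL.refl])
    fix k
    have "(SX ^^ k) ((?z ^^ m) f) - (?z ^^ m) ((SX ^^ k) f)
      = (\<Sum>i<k. (SX ^^ i) (SX ((?z ^^ m) ((SX ^^ (k - 1 - i)) f)) - (?z ^^ m) (SX ((SX ^^ (k - 1 - i)) f))))"
      by (rule commutator_pow[OF clin_SL cz])
    also have "\<dots> = (\<Sum>i<k. (SX ^^ i) ((\<Sum>b<m. ev ((?z ^^ (m - 1 - b)) ((SX ^^ (k - 1 - i)) f)) *f (?z ^^ b) f)
      - ?q *f (?z ^^ (m - 1)) ((SX ^^ (k - 1 - i)) f)))"
    proof (rule sum.cong[OF HOL.refl])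
      fix i
      have "(SX ^^ (k - 1 - i)) f \<in> VP (True = even (k - 1 - i)) f" by (rule VP_pow[OF VP_self])
      from X_zop_commutator[OF this, where a = a and n = n]
      show "(SX ^^ i) (SX ((?z ^^ m) ((SX ^^ (k - 1 - i)) f)) - (?z ^^ m) (SX ((SX ^^ (k - 1 - i)) f)))
         = (SX ^^ i) ((\<Sum>b<m. ev ((?z ^^ (m - 1 - b)) ((SX ^^ (k - 1 - i)) f)) *f (?z ^^ b) f)
            - ?q *f (?z ^^ (m - 1)) ((SX ^^ (k - 1 - i)) f))"
        unfolding m by (rule arg_cong)
    qed
    finally show "g k * \<psi> ((SX ^^ k) ((?z ^^ m) f) - (?z ^^ m) ((SX ^^ k) f)) =
       g k * (\<Sum>i<k. (\<Sum>b<m. ev ((?z ^^ (m - 1 - b)) ((SX ^^ (k - 1 - i)) f)) * \<psi> ((SX ^^ i) ((?z ^^ b) f)))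
       - ?q * \<psi> ((SX ^^ i) ((?z ^^ (m - 1)) ((SX ^^ (k - 1 - i)) f))))"
      by (simp only: clinD[OF clinX] clfD[OF psi(1)])
  qed
  also have "\<dots> = (\<Sum>k\<le>d. g k * (\<Sum>i<k. \<Sum>b<m. ev ((?z ^^ (m - 1 - b)) ((SX ^^ (k - 1 - i)) f)) * \<psi> ((SX ^^ i) ((?z ^^ b) f))))
     - ?q * (\<Sum>k\<le>d. g k * (\<Sum>i<k. \<psi> ((SX ^^ i) ((?z ^^ (m - 1)) ((SX ^^ (k - 1 - i)) f)))))"
    by (simp add: sum_subtractf right_diff_distrib sum_distrib_left mult_ac)
  \<comment> \<open>The exponent m - 1 is odd, as \<open>stat\<close> requires. For n = 0 it is
    truncated to 0, but then the factor \<open>?q\<close> vanishes.\<close>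
  also have "?q * (\<Sum>k\<le>d. g k * (\<Sum>i<k. \<psi> ((SX ^^ i) ((?z ^^ (m - 1)) ((SX ^^ (k - 1 - i)) f))))) = 0"
  proof (cases n)
    case (Suc n')
    hence "m - 1 = 2 * n' + 1" using m by simp
    thus ?thesis using stat[where \<alpha> = a and j = n'] by simp
  qed simp
  also have "(\<Sum>k\<le>d. g k * (\<Sum>i<k. \<Sum>b<m. ev ((?z ^^ (m - 1 - b)) ((SX ^^ (k - 1 - i)) f)) * \<psi> ((SX ^^ i) ((?z ^^ b) f))))
     = ev (dz a A m f)"
  proof -
    \<comment> \<open>The Leibniz sum counts the factors to the left of A, the commutator those to
      its right; reversing the index matches them.\<close>
    have "ev (dz a A m f) = (\<Sum>b<m. ev ((?z ^^ (m - 1 - b)) (A ((?z ^^ b) f))))"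
      unfolding dz_sum clfD(6)[OF clf_ev]
      by (rule sum.reindex_bij_witness[of _ "\<lambda>b. m - 1 - b" "\<lambda>b. m - 1 - b"]) auto
    also have "\<dots> = (\<Sum>b<m. \<Sum>k\<le>d. g k * (\<Sum>i<k. ev ((?z ^^ (m - 1 - b)) ((SX ^^ (k - 1 - i)) f)) * \<psi> ((SX ^^ i) ((?z ^^ b) f))))"
      unfolding A_def by (simp only: clinD[OF cz] clfD[OF clf_ev] mult.commute[of "\<psi> _"])
    also have "\<dots> = (\<Sum>k\<le>d. \<Sum>b<m. g k * (\<Sum>i<k. ev ((?z ^^ (m - 1 - b)) ((SX ^^ (k - 1 - i)) f)) * \<psi> ((SX ^^ i) ((?z ^^ b) f))))"
      by (rule sum.swap)
    also have "\<dots> = (\<Sum>k\<le>d. g k * (\<Sum>i<k. \<Sum>b<m. ev ((?z ^^ (m - 1 - b)) ((SX ^^ (k - 1 - i)) f)) * \<psi> ((SX ^^ i) ((?z ^^ b) f))))"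
      unfolding sum_distrib_left[symmetric] by (intro sum.cong HOL.refl arg_cong2[of _ _ _ _ "(*)"] sum.swap)
    finally show ?thesis by simp
  qed
  finally show ?thesis by simp
qed

lemma D_zero: "D W = 0"
  by (rule zero_of_symmetrised[where \<tau> = "\<lambda>n. tsel t0 t1 (even n)" and f = f, OF D_rel D_odd D_symmetrised])

text \<open>\<open>tangent u u'\<close>: to first order, \<open>u + s u'\<close> is a word in \<open>X\<close>, \<open>Y + s A\<close> applied to \<open>f\<close>.\<close>

definition tangent :: "wfun \<Rightarrow> wfun \<Rightarrow> bool" where
  "tangent u u' \<longleftrightarrow> (\<forall>W. ev (opw SX SY W u') + ev (dwg A W u) - om (opw SX SY W u) = 0)"

lemma tangent_start: "tangent f 0"
  unfolding tangent_def using D_zero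
  by (simp add: D_def clinD[OF clin_opw_SL] clfD[OF clf_ev])

lemma tangent_X: assumes "tangent u u'" shows "tangent (SX u) (SX u')"
  unfolding tangent_def
proof
  fix W
  have "dwg A (W @ [LetterX]) u = dwg A W (SX u)"
    by (simp add: dwg_append clinD[OF clin_SL] clinD[OF clin_opw_SL])
  thus "ev (opw SX SY W (SX u')) + ev (dwg A W (SX u)) - om (opw SX SY W (SX u)) = 0"
    using assms[unfolded tangent_def, rule_format, of "W @ [LetterX]"] by (simp add: opw_append)
qed

lemma tangent_Y: assumes "tangent u u'" shows "tangent (SY u) (SY u' + A u)"
  unfolding tangent_def
proof
  fix W
  have "dwg A (W @ [LetterY]) u = opw SX SY W (A u) + dwg A W (SY u)"
    by (simp add: dwg_append clinD[OF clin_SL])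
  thus "ev (opw SX SY W (SY u' + A u)) + ev (dwg A W (SY u)) - om (opw SX SY W (SY u)) = 0"
    using assms[unfolded tangent_def, rule_format, of "W @ [LetterY]"]
    by (simp add: opw_append clinD[OF clin_opw_SL] clfD[OF clf_ev] add_ac)
qed

lemma tangent_add: "tangent u u' \<Longrightarrow> tangent v v' \<Longrightarrow> tangent (u + v) (u' + v')"
  unfolding tangent_def clinD[OF clin_opw_SL] clinD[OF clin_dwg[OF clin_A]] clfD[OF clf_ev] clfD[OF clf_om]
  by (simp add: algebra_simps)

lemma tangent_scl: "tangent u u' \<Longrightarrow> tangent (c *f u) (c *f u')"
  unfolding tangent_def clinD[OF clin_opw_SL] clinD[OF clin_dwg[OF clin_A]] clfD[OF clf_ev] clfD[OF clf_om]
  by (simp flip: distrib_left right_diff_distrib)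

text \<open>Infinitesimal rigidity: a functional is known from the values of \<open>ev\<close> on
  all its shifts, so the correction u' is determined by u.\<close>

lemma tangent_unique: assumes "tangent u u'" "tangent u u''" shows "u' = u''"
proof -
  have "(-1) *f u'' + u' = 0"
  proof
    fix W
    have "ev (opw SX SY W u') = ev (opw SX SY W u'')" using assms unfolding tangent_def
      by (metis add_right_cancel diff_add_cancel)
    thus "((-1) *f u'' + u') W = 0 W" by (simp add: opw_SL ev_def fun_pointwise)
  qed
  thus ?thesis by simp
qed

end

section \<open>The filtration of the vertex spaces by the degree in Y\<close>

abbreviation Xp :: "wfun \<Rightarrow> nat \<Rightarrow> wfun" where "Xp f i \<equiv> (SX ^^ i) f"

text \<open>The span of all Y^j X^i f with j \<le> k.\<close>

fun Uc :: "wfun \<Rightarrow> nat \<Rightarrow> wfun set" where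
  "Uc f 0 = fv.span (range (Xp f))"
| "Uc f (Suc k) = {a + SY b | a b. a \<in> Uc f k \<and> b \<in> Uc f k}"

lemma subspace_Uc: "fv.subspace (Uc f k)"
proof (induction k)
  case (Suc k)
  have "fv.subspace {x + y |x y. x \<in> Uc f k \<and> y \<in> SY ` Uc f k}"
    by (rule fv.subspace_sums[OF Suc subspace_image[OF clin_SL Suc]])
  moreover have "{x + y |x y. x \<in> Uc f k \<and> y \<in> SY ` Uc f k} = Uc f (Suc k)" by auto
  ultimately show ?case by simp
qed simp

lemma Uc_Suc: "u \<in> Uc f k \<Longrightarrow> u \<in> Uc f (Suc k)"
proof -
  assume "u \<in> Uc f k"
  moreover have "u = u + SY 0" by (simp add: clinD(3)[OF clin_SL])
  ultimately show ?thesis using fv.subspace_0[OF subspace_Uc, of f k] unfolding Uc.simps by blast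
qed

lemma Uc_mono: "k \<le> l \<Longrightarrow> u \<in> Uc f k \<Longrightarrow> u \<in> Uc f l"
  by (induction l) (auto simp: le_Suc_eq simp del: Uc.simps intro: Uc_Suc)

lemma Uc_Y: "u \<in> Uc f k \<Longrightarrow> SY u \<in> Uc f (Suc k)"
proof -
  assume "u \<in> Uc f k"
  moreover have "SY u = 0 + SY u" by simp
  ultimately show ?thesis using fv.subspace_0[OF subspace_Uc, of f k] unfolding Uc.simps by blast
qed

lemma Xp_mem: "Xp f i \<in> Uc f 0"
  unfolding Uc.simps by (rule fv.span_base) blast

lemma Uc_start: "f \<in> Uc f 0"
  using Xp_mem[where f = f and i = 0] by simp

lemma proj_Xp: "parf True f \<Longrightarrow> proj p (Xp f i) = (if p = even i then Xp f i else 0)"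
proof (rule proj_parf')
  assume "parf True f"
  from parf_VP[OF this VP_pow[OF VP_self, where k = i and l = LetterX]]
  show "parf (even i) (Xp f i)" by simp
qed

context
  fixes t0 t1 f assumes cm: "cmf t0 t1 f"
begin

lemma pf: "parf True f" using cm by (simp add: cmf_def)

text \<open>The direct sum of the two vertex spaces, described by the parity components of its
  elements.\<close>

definition VV where "VV = {u. \<forall>p. proj p u \<in> VP p f}"

lemma subspace_VV: "fv.subspace VV"
proof -
  have "VV = (\<Inter>p. {u. proj p u \<in> VP p f})" by (auto simp: VV_def)
  thus ?thesis by (auto intro!: fv.subspace_Inter subspace_vimage clin_proj subspace_VP)
qed

lemma VP_VV: "u \<in> VP p f \<Longrightarrow> u \<in> VV"
  using proj_parf'[OF parf_VP[OF pf, of u p]] fv.subspace_0[OF subspace_VP] by (auto simp: VV_def)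

lemma VV_SL: "u \<in> VV \<Longrightarrow> SL l u \<in> VV"
  using VP_SL[of "proj (\<not> p) u" "\<not> p" f l for p] by (auto simp: VV_def proj_SL)

lemma VV_rel:
  assumes "u \<in> VV"
  shows "SX (SY u) = SY (SX u) - (t0 *f proj True u + t1 *f proj False u) + ev u *f f"
proof -
  have r: "SX (SY (proj p u)) - SY (SX (proj p u)) + tsel t0 t1 p *f proj p u = ev (proj p u) *f f" for p
    using assms by (intro cmf_rel[OF cm]) (simp add: VV_def)
  have u: "u = proj True u + proj False u" by (simp add: proj_add)
  have "SX (SY u) - SY (SX u) = (SX (SY (proj True u)) - SY (SX (proj True u)))
      + (SX (SY (proj False u)) - SY (SX (proj False u)))"
    by (subst (1 2) u) (simp add: clinD[OF clin_SL])
  also have "\<dots> = (ev (proj True u) *f f - t0 *f proj True u) + (ev (proj False u) *f f - t1 *f proj False u)"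
  proof -
    have "SX (SY (proj True u)) - SY (SX (proj True u)) = ev (proj True u) *f f - t0 *f proj True u"
      using r[of True] unfolding tsel_def eq_diff_eq by simp
    moreover have "SX (SY (proj False u)) - SY (SX (proj False u)) = ev (proj False u) *f f - t1 *f proj False u"
      using r[of False] unfolding tsel_def eq_diff_eq by simp
    ultimately show ?thesis by (simp only:)
  qed
  also have "\<dots> = ev u *f f - (t0 *f proj True u + t1 *f proj False u)"
    by (subst (3) u) (simp add: clfD[OF clf_ev] fv.scale_left_distrib)
  finally show ?thesis by (simp add: algebra_simps diff_eq_eq)
qed

lemma Uc_VV: "u \<in> Uc f k \<Longrightarrow> u \<in> VV"
proof (induction k arbitrary: u)
  case 0
  have "fv.span (range (Xp f)) \<subseteq> VV"
    by (rule fv.span_minimal[OF _ subspace_VV]) (use VP_VV[OF VP_pow[OF VP_self]] in auto)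
  thus ?case using 0 by auto
next
  case (Suc k)
  then obtain a b where "u = a + SY b" "a \<in> Uc f k" "b \<in> Uc f k" by auto
  thus ?case using Suc.IH VV_SL fv.subspace_add[OF subspace_VV] by simp
qed

lemma Uc_proj: "u \<in> Uc f k \<Longrightarrow> proj p u \<in> Uc f k"
proof (induction k arbitrary: u p)
  case 0
  show ?case
  proof (rule clin_span_mem[where A = "proj p" and u = u, OF clin_proj subspace_Uc])
    show "u \<in> fv.span (range (Xp f))" using 0 by simp
    fix s assume "s \<in> range (Xp f)"
    then obtain i where "s = Xp f i" by auto
    thus "proj p s \<in> Uc f 0"
      using Xp_mem[where f = f and i = i] fv.subspace_0[OF subspace_Uc, of f 0] by (simp only: proj_Xp[OF pf] split: if_split) simp
  qed
next
  case (Suc k)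
  then obtain a b where ab: "u = a + SY b" "a \<in> Uc f k" "b \<in> Uc f k" by auto
  have "proj p u = proj p a + SY (proj (\<not> p) b)"
    by (simp add: ab clinD[OF clin_proj] proj_SL)
  thus ?case using Suc.IH ab by auto
qed

text \<open>Moving X past Y costs only parity components of a vector of lower degree and a multiple
  of f.\<close>

lemma Uc_X: "u \<in> Uc f k \<Longrightarrow> SX u \<in> Uc f k"
proof (induction k arbitrary: u)
  case 0
  show ?case
  proof (rule clin_span_mem[where A = SX and u = u, OF clin_SL subspace_Uc])
    show "u \<in> fv.span (range (Xp f))" using 0 by simp
    fix s assume "s \<in> range (Xp f)"
    then obtain i where "s = Xp f i" by auto
    hence "SX s = Xp f (Suc i)" by simp
    thus "SX s \<in> Uc f 0" using Xp_mem[where f = f and i = "Suc i"] by (simp only:)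
  qed
next
  case (Suc k)
  then obtain a b where ab: "u = a + SY b" "a \<in> Uc f k" "b \<in> Uc f k" by auto
  note sub = subspace_Uc[of f "Suc k"]
  have "SX u = SX a + (SY (SX b) - (t0 *f proj True b + t1 *f proj False b) + ev b *f f)"
    using VV_rel[OF Uc_VV[OF ab(3)]] by (simp add: ab clinD[OF clin_SL])
  moreover have "SX a \<in> Uc f (Suc k)" by (rule Uc_Suc[OF Suc.IH[OF ab(2)]])
  moreover have "SY (SX b) \<in> Uc f (Suc k)" by (rule Uc_Y[OF Suc.IH[OF ab(3)]])
  moreover have "proj p b \<in> Uc f (Suc k)" for p by (rule Uc_Suc[OF Uc_proj[OF ab(3)]])
  moreover have "f \<in> Uc f (Suc k)" by (rule Uc_mono[OF _ Uc_start]) simp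
  ultimately show ?case
    by (simp only: fv.subspace_add[OF sub] fv.subspace_diff[OF sub] fv.subspace_scale[OF sub])
qed

lemma VP_Uc:
  assumes "u \<in> VP p f" shows "\<exists>k. u \<in> Uc f k"
proof -
  have sub: "fv.subspace {u. \<exists>k. u \<in> Uc f k}"
  proof (rule fv.subspaceI)
    show "0 \<in> {u. \<exists>k. u \<in> Uc f k}" using fv.subspace_0[OF subspace_Uc] by blast
    fix x y assume "x \<in> {u. \<exists>k. u \<in> Uc f k}" "y \<in> {u. \<exists>k. u \<in> Uc f k}"
    then obtain k l where "x \<in> Uc f k" "y \<in> Uc f l" by auto
    hence "x \<in> Uc f (max k l)" "y \<in> Uc f (max k l)"
      using Uc_mono[of k "max k l"] Uc_mono[of l "max k l"] by auto
    thus "x + y \<in> {u. \<exists>k. u \<in> Uc f k}" using fv.subspace_add[OF subspace_Uc] by blast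
  next
    fix c x assume "x \<in> {u. \<exists>k. u \<in> Uc f k}"
    thus "c *f x \<in> {u. \<exists>k. u \<in> Uc f k}" using fv.subspace_scale[OF subspace_Uc] by blast
  qed
  have "opw SX SY W f \<in> Uc f (length W)" for W
  proof (induction W)
    case (Cons l W)
    thus ?case using Uc_X[OF Uc_Suc[OF Cons]] Uc_Y[OF Cons] by (cases l) (simp_all del: Uc.simps)
  qed (use Uc_start in simp)
  hence "{opw SX SY W f | W. even (length W) = p} \<subseteq> {u. \<exists>k. u \<in> Uc f k}" by blast
  hence "VP p f \<subseteq> {u. \<exists>k. u \<in> Uc f k}" unfolding VP_def by (rule fv.span_minimal[OF _ sub])
  thus ?thesis using assms by blast
qed

text \<open>The relation expresses Y X^(i+1) f by X Y X^i f and elements of the span, so the span is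
  stable under Y as soon as it contains Y f.\<close>

lemma Uc_stable: assumes "SY f \<in> Uc f 0" shows "u \<in> Uc f k \<Longrightarrow> u \<in> Uc f 0"
proof -
  note sub = subspace_Uc[of f 0]
  have b: "SY (Xp f i) \<in> Uc f 0" for i
  proof (induction i)
    case 0 thus ?case using assms by simp
  next
    case (Suc i)
    have x: "Xp f i \<in> Uc f 0" by (rule Xp_mem)
    have "SY (SX (Xp f i)) = SX (SY (Xp f i)) + (t0 *f proj True (Xp f i) + t1 *f proj False (Xp f i))
        - ev (Xp f i) *f f"
      using VV_rel[OF Uc_VV[OF x]] by (simp add: algebra_simps)
    moreover have "SX (SY (Xp f i)) \<in> Uc f 0" by (rule Uc_X[OF Suc])
    ultimately have "SY (SX (Xp f i)) \<in> Uc f 0"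
      using Uc_proj[OF x] Uc_start[of f]
      by (simp only: fv.subspace_add[OF sub] fv.subspace_diff[OF sub] fv.subspace_scale[OF sub])
    thus ?case by simp
  qed
  have Y: "SY v \<in> Uc f 0" if "v \<in> Uc f 0" for v
  proof (rule clin_span_mem[where A = SY and u = v, OF clin_SL subspace_Uc])
    show "v \<in> fv.span (range (Xp f))" using that by simp
  qed (use b in auto)
  show "u \<in> Uc f k \<Longrightarrow> u \<in> Uc f 0"
  proof (induction k arbitrary: u)
    case (Suc k)
    then obtain a b where "u = a + SY b" "a \<in> Uc f k" "b \<in> Uc f k" by auto
    thus ?case using Suc.IH Y fv.subspace_add[OF sub] by blast
  qed
qed

end

context variation
begin

text \<open>Since g is monic of degree d, the coefficient of X^(d-1) f in A u is psi u: only the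
  term with k = d and i = 0 reaches that power.\<close>

lemma A_zero_imp: assumes "cindep d (Xp f)" "d > 0" "A u = 0" shows "\<psi> u = 0"
proof -
  obtain l where l: "\<And>j. clf (l j)" "\<And>i j. i < d \<Longrightarrow> l j (Xp f i) = (if i = j then 1 else 0)"
    using cindep_dual[OF assms(1)] by blast
  have "0 = l (d - 1) (A u)" unfolding assms(3) by (simp add: clfD[OF l(1)])
  also have "\<dots> = (\<Sum>k\<le>d. g k * (\<Sum>i<k. \<psi> (Xp u i) * l (d - 1) (Xp f (k - 1 - i))))"
    unfolding A_def by (simp only: clfD[OF l(1)])
  also have "\<dots> = (\<Sum>k\<le>d. if k = d then \<psi> u else 0)"
  proof (rule sum.cong[OF HOL.refl])
    fix k assume "k \<in> {..d}"
    hence "(\<Sum>i<k. \<psi> (Xp u i) * l (d - 1) (Xp f (k - 1 - i)))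
      = (\<Sum>i<k. if i = 0 then (if k = d then \<psi> u else 0) else 0)"
      using l(2) by (intro sum.cong) auto
    also have "\<dots> = (if k = d then \<psi> u else 0)" using assms(2) by auto
    finally show "g k * (\<Sum>i<k. \<psi> (Xp u i) * l (d - 1) (Xp f (k - 1 - i))) = (if k = d then \<psi> u else 0)"
      using g(2) by simp
  qed
  finally show ?thesis by simp
qed

lemma A_zero: assumes "\<And>u. u \<in> Uc f m \<Longrightarrow> \<psi> u = 0" "u \<in> Uc f m" shows "A u = 0"
proof -
  have "Xp u i \<in> Uc f m" for i
    by (induction i) (use assms(2) Uc_X[OF cm] in auto)
  hence "\<psi> (Xp u i) = 0" for i using assms(1) by blast
  thus ?thesis by (simp add: A_def)
qed

text \<open>A vanishes on degree at most m by \<open>A_zero\<close>, so applying Y once more still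
  creates no correction.\<close>

lemma tangent_Uc:
  assumes "\<And>u. u \<in> Uc f m \<Longrightarrow> \<psi> u = 0"
  shows "k \<le> Suc m \<Longrightarrow> u \<in> Uc f k \<Longrightarrow> tangent u 0"
proof (induction k arbitrary: u)
  case 0
  have sub: "fv.subspace {u. tangent u 0}"
  proof (rule fv.subspaceI)
    show "0 \<in> {u. tangent u 0}" using tangent_scl[OF tangent_start, of 0] by simp
    show "x + y \<in> {u. tangent u 0}" if "x \<in> {u. tangent u 0}" "y \<in> {u. tangent u 0}" for x y
      using tangent_add[of x 0 y 0] that by simp
    show "c *f x \<in> {u. tangent u 0}" if "x \<in> {u. tangent u 0}" for c x
      using tangent_scl[of x 0 c] that by simp
  qed
  have "tangent (Xp f i) 0" for i
  proof (induction i)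
    case (Suc i) thus ?case using tangent_X[OF Suc] by (simp add: clinD[OF clin_SL])
  qed (simp add: tangent_start)
  hence "Uc f 0 \<subseteq> {u. tangent u 0}" unfolding Uc.simps by (intro fv.span_minimal sub) auto
  thus ?case using 0 by blast
next
  case (Suc k)
  then obtain a b where ab: "u = a + SY b" "a \<in> Uc f k" "b \<in> Uc f k" by auto
  have "A b = 0" by (rule A_zero[OF assms Uc_mono[OF _ ab(3)]]) (use Suc.prems in auto)
  moreover have "tangent b 0" "tangent a 0" using Suc ab by auto
  ultimately show ?case
    using tangent_add[OF \<open>tangent a 0\<close> tangent_Y[OF \<open>tangent b 0\<close>]] by (simp add: ab clinD[OF clin_SL])
qed

text \<open>The vector Y u has the correction A u, because u has the correction 0. It also has the
  correction 0 itself, because of its low degree. Uniqueness gives A u = 0.\<close>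

lemma filtration_step:
  assumes "cindep d (Xp f)" "d > 0" "\<And>u. u \<in> Uc f m \<Longrightarrow> \<psi> u = 0"
    "u \<in> Uc f (Suc m)" "SY u \<in> Uc f (Suc m)"
  shows "\<psi> u = 0"
proof (rule A_zero_imp[OF assms(1,2)])
  have "tangent u 0" by (rule tangent_Uc[OF assms(3) le_refl assms(4)])
  hence "tangent (SY u) (SY 0 + A u)" by (rule tangent_Y)
  moreover have "tangent (SY u) 0" by (rule tangent_Uc[OF assms(3) le_refl assms(5)])
  ultimately have "SY 0 + A u = 0" by (rule tangent_unique)
  thus "A u = 0" by (simp add: clinD[OF clin_SL])
qed

end

lemma cindep_subset_dim:
  assumes "cindep d u" "I \<subseteq> {..<d}"
  shows "has_dim (fv.span (u ` I)) (card I)"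
proof -
  note c = cindep_independent[OF assms(1)]
  have "inj_on u I" by (rule inj_on_subset[OF conjunct1[OF c] assms(2)])
  moreover have "fv.independent (u ` I)"
    by (rule fv.independent_mono[OF conjunct2[OF c] image_mono[OF assms(2)]])
  moreover have "finite I" by (rule finite_subset[OF assms(2)]) simp
  ultimately show ?thesis unfolding has_dim_def
    by (intro exI[of _ "u ` I"] conjI HOL.refl) (simp_all add: card_image)
qed

lemma card_parity: "card {i. i < d \<and> even i} = d - d div 2" "card {i. i < d \<and> odd i} = d div 2"
proof -
  have "card {i. i < d \<and> even i} = d - d div 2 \<and> card {i. i < d \<and> odd i} = d div 2"
  proof (induction d)
    case (Suc d)
    have e: "{i. i < Suc d \<and> even i} = (if even d then insert d {i. i < d \<and> even i} else {i. i < d \<and> even i})"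
      "{i. i < Suc d \<and> odd i} = (if odd d then insert d {i. i < d \<and> odd i} else {i. i < d \<and> odd i})"
      by (auto simp: less_Suc_eq)
    have a: "odd d \<Longrightarrow> Suc d - Suc d div 2 = d - d div 2" "odd d \<Longrightarrow> Suc d div 2 = Suc (d div 2)"
      "even d \<Longrightarrow> Suc d - Suc d div 2 = Suc (d - d div 2)" "even d \<Longrightarrow> Suc d div 2 = d div 2"
      by presburger+
    have c: "card (insert d {i. i < d \<and> P i}) = Suc (card {i. i < d \<and> P i})" for P by simp
    show ?case
    proof (cases "even d")
      case True
      thus ?thesis unfolding e a(3,4)[OF True] using Suc by (simp only: if_True if_False c simp_thms)
    next
      case False
      thus ?thesis unfolding e a(1,2)[OF False] using Suc by (simp only: if_True if_False c simp_thms)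
    qed
  qed simp
  thus "card {i. i < d \<and> even i} = d - d div 2" "card {i. i < d \<and> odd i} = d div 2" by auto
qed

lemma card_parity': "card {i. i < d \<and> even i = even d} = d div 2"
  "card {i. i < d \<and> even i \<noteq> even d} = d - d div 2"
proof -
  show "card {i. i < d \<and> even i = even d} = d div 2"
  proof (cases "even d")
    case True
    hence "d - d div 2 = d div 2" by presburger
    thus ?thesis using card_parity(1)[of d] True by simp
  qed (use card_parity(2)[of d] in simp)
  show "card {i. i < d \<and> even i \<noteq> even d} = d - d div 2"
  proof (cases "even d")
    case True
    hence "d - d div 2 = d div 2" by presburger
    thus ?thesis using card_parity(2)[of d] True by simp
  qed (use card_parity(1)[of d] in simp)
qed

lemma span_Xp:
  assumes "Xp f d \<in> fv.span (Xp f ` {..<d})"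
  shows "fv.span (range (Xp f)) = fv.span (Xp f ` {..<d})"
proof
  have st: "SX u \<in> fv.span (Xp f ` {..<d})" if "u \<in> fv.span (Xp f ` {..<d})" for u
  proof (rule clin_span_mem[where A = SX and u = u, OF clin_SL fv.subspace_span _ that])
    fix s assume "s \<in> Xp f ` {..<d}"
    then obtain i where i: "s = Xp f i" "i < d" by auto
    have "SX s = Xp f (Suc i)" using i by simp
    show "SX s \<in> fv.span (Xp f ` {..<d})"
    proof (cases "Suc i = d")
      case True thus ?thesis using assms \<open>SX s = Xp f (Suc i)\<close> by simp
    next
      case False
      hence "Suc i \<in> {..<d}" using i by simp
      thus ?thesis unfolding \<open>SX s = Xp f (Suc i)\<close> by (intro fv.span_base imageI)
    qed
  qed
  have f: "f \<in> fv.span (Xp f ` {..<d})"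
  proof (cases "d = 0")
    case True thus ?thesis using assms by simp
  next
    case False
    hence "Xp f 0 \<in> Xp f ` {..<d}" by blast
    from fv.span_base[OF this] show ?thesis by simp
  qed
  have "Xp f i \<in> fv.span (Xp f ` {..<d})" for i
    by (induction i) (use f st in auto)
  thus "fv.span (range (Xp f)) \<subseteq> fv.span (Xp f ` {..<d})" by (intro fv.span_minimal) auto
  show "fv.span (Xp f ` {..<d}) \<subseteq> fv.span (range (Xp f))" by (rule fv.span_mono) auto
qed

text \<open>Let S be the span, with parts Se of the parity of d and So of the other parity, of
  dimensions d div 2 and d - d div 2. By \<open>step\<close>, Y maps only vectors of Se from the
  vertex space of parity d into R, so dim R \<le> d div 2, the two vertex spaces having the same
  dimension N. As R contains So, d is even and R = So. Now Y f lies in R, hence in S, and S is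
  stable under both operators.\<close>

lemma maximal_is_cyclic:
  assumes dim: "cmdim t0 t1 N N f"
    and ind: "cindep d (Xp f)"
    and maxi: "\<And>h. mequiv f h \<Longrightarrow> \<not> cindep (Suc d) (Xp h)"
  shows "cindep (2 * N) (Xp f) \<and> Xp f (2 * N) \<in> fv.span (Xp f ` {..<2 * N}) \<and> SY f \<in> fv.span (Xp f ` {..<2 * N})"
proof -
  have cm: "cmf t0 t1 f" using dim by (simp add: cmdim_def)
  have dims: "has_dim (VP p f) N" for p using dim by (cases p) (simp_all add: cmdim_def)
  note pf = pf[OF cm]
  have "\<not> cindep (Suc d) (Xp f)" by (rule maxi[OF mequiv.base])
  hence sp: "Xp f d \<in> fv.span (Xp f ` {..<d})" using ind by (simp add: cindep_Suc_iff)
  note U0 = span_Xp[OF sp]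
  from sp obtain c where c: "Xp f d = (\<Sum>i<d. c i *f Xp f i)" by (auto simp: span_image_sum)
  \<comment> \<open>Coefficients of the wrong parity are dropped, so that g only involves exponents
    of the parity of d, as the locale demands.\<close>
  define c' where "c' i = (if even i = even d then c i else 0)" for i
  have c': "Xp f d = (\<Sum>i<d. c' i *f Xp f i)"
  proof -
    have "Xp f d = proj (even d) (Xp f d)" by (simp add: proj_Xp[OF pf])
    also have "\<dots> = (\<Sum>i<d. c i *f (if even d = even i then Xp f i else 0))"
      unfolding c by (simp add: clinD[OF clin_proj] proj_Xp[OF pf])
    also have "\<dots> = (\<Sum>i<d. c' i *f Xp f i)" by (rule sum.cong) (auto simp: c'_def)
    finally show ?thesis .
  qed
  define g where "g k = (if k = d then 1 else - c' k)" for k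
  have g0: "(\<Sum>k\<le>d. g k *f Xp f k) = 0"
  proof -
    have "(\<Sum>k\<le>d. g k *f Xp f k) = (\<Sum>k<d. g k *f Xp f k) + Xp f d"
      by (simp add: lessThan_Suc_atMost[symmetric] g_def)
    also have "(\<Sum>k<d. g k *f Xp f k) = - (\<Sum>i<d. c' i *f Xp f i)"
      unfolding sum_negf[symmetric] by (rule sum.cong) (auto simp: g_def)
    finally show ?thesis using c' by simp
  qed
  have step: "u \<in> Uc f m" if u: "parf (even d) u" "u \<in> Uc f (Suc m)" "SY u \<in> Uc f (Suc m)" and d0: "d > 0" for u m
  proof (rule ccontr)
    assume "u \<notin> Uc f m"
    hence "u \<notin> fv.span (Uc f m)" unfolding fv.span_eq_iff[THEN iffD2, OF subspace_Uc] .
    from separating_functional[OF this] obtain ps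
      where ps0: "clf ps" "\<forall>s\<in>fv.span (Uc f m). ps s = 0" "ps u = 1" by blast
    have ps: "clf ps" "\<And>s. s \<in> Uc f m \<Longrightarrow> ps s = 0" "ps u = 1"
      using ps0 fv.span_superset[of "Uc f m"] by auto
    \<comment> \<open>Projecting first makes psi vanish on the parity other than that of d; its
      value at u is unchanged, because u has the parity of d.\<close>
    define psi where "psi v = ps (proj (even d) v)" for v
    have cps: "clf psi" unfolding psi_def by (rule clf_comp[OF ps(1) clin_proj])
    have psU: "psi v = 0" if "v \<in> Uc f m" for v unfolding psi_def by (rule ps(2)[OF Uc_proj[OF cm that]])
    have XU: "Xp f i \<in> Uc f m" for i by (rule Uc_mono[OF _ Xp_mem]) simp
    interpret variation t0 t1 f d g psi
    proof
      show "cmf t0 t1 f" by (rule cm)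
      show "(\<Sum>k\<le>d. g k *f Xp f k) = 0" by (rule g0)
      show "g d = 1" by (simp add: g_def)
      show "g k = 0" if "even k \<noteq> even d" for k using that by (auto simp: g_def c'_def)
      show "clf psi" by (rule cps)
      show "psi (Xp f i) = 0" for i by (rule psU[OF XU])
      show "psi v = 0" if "parf (odd d) v" for v
        unfolding psi_def using proj_parf(2)[of "even d" v] that by (simp add: clfD[OF ps(1)])
      fix \<alpha> j
      have "(\<Sum>k\<le>d. g k *f (\<Sum>a<k. Xp ((zop \<alpha> ^^ (2 * j + 1)) (Xp f (k - 1 - a))) a)) \<in> fv.span (Xp f ` {..<d})"
        by (rule maximal_condition[OF ind maxi g0]) (simp_all add: g_def)
      hence "(\<Sum>k\<le>d. g k *f (\<Sum>a<k. Xp ((zop \<alpha> ^^ (2 * j + 1)) (Xp f (k - 1 - a))) a)) \<in> Uc f m"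
        using U0 Uc_mono[of 0 m] by auto
      from psU[OF this] show "(\<Sum>k\<le>d. g k * (\<Sum>i<k. psi (Xp ((zop \<alpha> ^^ (2 * j + 1)) (Xp f (k - 1 - i))) i))) = 0"
        by (simp only: clfD[OF cps])
    qed
    have "psi u = 0" by (rule filtration_step[OF ind d0 psU u(2,3)])
    thus False using ps(3) u(1) by (simp add: psi_def proj_parf)
  qed
  define Se So where "Se = fv.span (Xp f ` {i. i < d \<and> even i = even d})"
    and "So = fv.span (Xp f ` {i. i < d \<and> even i \<noteq> even d})"
  have Se: "has_dim Se (d div 2)" unfolding Se_def card_parity'(1)[symmetric]
    by (rule cindep_subset_dim[OF ind]) auto
  have So: "has_dim So (d - d div 2)" unfolding So_def card_parity'(2)[symmetric]
    by (rule cindep_subset_dim[OF ind]) auto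
  have XVP: "Xp f i \<in> VP (even i) f" for i using VP_pow[OF VP_self, where k = i and l = LetterX and f = f] by simp
  have SeV: "Se \<subseteq> VP (even d) f" unfolding Se_def
  proof (rule fv.span_minimal[OF _ subspace_VP], rule image_subsetI)
    fix i assume "i \<in> {i. i < d \<and> even i = even d}"
    thus "Xp f i \<in> VP (even d) f" using XVP[of i] by simp
  qed
  have SoV: "So \<subseteq> VP (odd d) f" unfolding So_def
  proof (rule fv.span_minimal[OF _ subspace_VP], rule image_subsetI)
    fix i assume "i \<in> {i. i < d \<and> even i \<noteq> even d}"
    hence "even i = odd d" by auto
    thus "Xp f i \<in> VP (odd d) f" using XVP[of i] by (simp only:)
  qed
  have So0: "So \<subseteq> Uc f 0" unfolding So_def Uc.simps by (rule fv.span_mono) auto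
  have inSe: "u \<in> Se" if "u \<in> VP (even d) f" "u \<in> Uc f 0" for u
  proof -
    from that(2) U0 obtain b where b: "u = (\<Sum>i<d. b i *f Xp f i)" by (auto simp: span_image_sum)
    have "u = proj (even d) u" using proj_parf(1)[OF parf_VP[OF pf that(1)]] by simp
    also have "\<dots> = (\<Sum>i<d. b i *f (if even d = even i then Xp f i else 0))"
      unfolding b by (simp add: clinD[OF clin_proj] proj_Xp[OF pf])
    also have "\<dots> \<in> Se" unfolding Se_def
      by (intro fv.span_sum fv.span_scale) (auto intro!: fv.span_base fv.span_zero)
    finally show ?thesis .
  qed
  \<comment> \<open>Degree 1 is chosen because Y f lies there.\<close>
  define R where "R = Uc f 1 \<inter> VP (odd d) f"
  have subR: "fv.subspace R" unfolding R_def by (rule fv.subspace_inter[OF subspace_Uc subspace_VP])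
  obtain B where B: "finite B" "fv.span B = VP (odd d) f" using dims[of "odd d"] unfolding has_dim_def by blast
  obtain r where r: "has_dim R r"
    by (rule has_dim_finite_span[OF B(1) _ subR]) (use B in \<open>auto simp: R_def\<close>)
  have SoR: "So \<subseteq> R" unfolding R_def using SoV So0 Uc_mono[of 0 1] by auto
  have le: "N + r \<le> N + d div 2" if d0: "d > 0"
  proof (rule dim_quotient_le[OF clin_SL[of LetterY] dims[of "even d"] Se dims[of "odd d"] r SeV])
    show "R \<subseteq> VP (odd d) f" by (auto simp: R_def)
    fix u assume u: "u \<in> VP (even d) f"
    show "SY u \<in> VP (odd d) f" using VP_SL[OF u] by simp
    assume SYu: "SY u \<in> R"
    have par: "parf (even d) u" by (rule parf_VP[OF pf u])
    obtain k where "u \<in> Uc f k" using VP_Uc[OF cm u] by blast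
    hence "u \<in> Uc f 0"
    \<comment> \<open>Y u has degree at most 1, so \<open>step\<close> lowers the degree of u one by
      one down to 0.\<close>
    proof (induction k)
      case (Suc k)
      have "SY u \<in> Uc f (Suc k)" by (rule Uc_mono[of 1]) (use SYu in \<open>auto simp: R_def\<close>)
      from step[OF par Suc.prems this d0] show ?case by (rule Suc.IH)
    qed
    thus "u \<in> Se" by (rule inSe[OF u])
  qed
  \<comment> \<open>For d = 0 the empty span contains f, hence f = 0.\<close>
  have SY0: "SY f \<in> Uc f 0 \<and> even d"
  proof (cases "d = 0")
    case True
    hence "f = 0" using sp by simp
    thus ?thesis using True fv.subspace_0[OF subspace_Uc, of f 0] by (simp add: clinD[OF clin_SL])
  next
    case False
    have "d - d div 2 \<le> r" by (rule has_dim_le[OF So r SoR])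
    moreover have "r \<le> d div 2" using le False by simp
    ultimately have ev: "even d" and rr: "r = d - d div 2" by presburger+
    have "SY f \<in> VP False f" using VP_SL[OF VP_self, where l = LetterY and f = f] by simp
    moreover have "SY f \<in> Uc f 1" using Uc_Y[OF Uc_start] by simp
    ultimately have "SY f \<in> R" using ev by (simp add: R_def)
    hence "SY f \<in> So" using has_dim_eq[OF So r[unfolded rr] SoR] by simp
    thus ?thesis using So0 ev by blast
  qed
  have "VP (even d) f \<subseteq> Se"
  proof
    fix u assume u: "u \<in> VP (even d) f"
    then obtain k where "u \<in> Uc f k" using VP_Uc[OF cm u] by blast
    with Uc_stable[OF cm] SY0 have "u \<in> Uc f 0" by blast
    thus "u \<in> Se" by (rule inSe[OF u])
  qed
  hence "Se = VP (even d) f" using SeV by auto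
  hence "N = d div 2" using has_dim_unique[OF Se] dims[of "even d"] by auto
  hence "d = 2 * N" using SY0 by auto
  thus ?thesis using ind sp SY0 U0 by simp
qed

text \<open>The powers X^i h lie in the sum of two N-dimensional spaces, so the number of
  independent ones among all equivalent points is bounded and attains a maximum.\<close>

theorem equivalent_to_cyclic:
  assumes dim: "cmdim t0 t1 N N f"
  shows "\<exists>h. mequiv f h \<and> cindep (2 * N) (Xp h) \<and> Xp h (2 * N) \<in> fv.span (Xp h ` {..<2 * N})
     \<and> SY h \<in> fv.span (Xp h ` {..<2 * N})"
proof -
  define P where "P d \<longleftrightarrow> (\<exists>h. mequiv f h \<and> cindep d (Xp h))" for d
  have bound: "d \<le> 2 * N" if Pd: "P d" for d
  proof -
    obtain h where h: "mequiv f h" "cindep d (Xp h)" using Pd unfolding P_def by blast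
    have dh: "cmdim t0 t1 N N h" by (rule cmdim_mequiv[OF h(1) dim])
    obtain B C where B: "finite B" "card B = N" "fv.span B = VP True h"
      and C: "finite C" "card C = N" "fv.span C = VP False h"
      using dh unfolding cmdim_def has_dim_def by blast
    have "Xp h i \<in> fv.span (B \<union> C)" for i
    proof -
      have "Xp h i \<in> VP (even i) h" using VP_pow[OF VP_self, where k = i and l = LetterX and f = h] by simp
      hence "Xp h i \<in> fv.span B \<or> Xp h i \<in> fv.span C" using B(3) C(3) by (cases "even i") auto
      thus ?thesis using fv.span_mono[of B "B \<union> C"] fv.span_mono[of C "B \<union> C"] by blast
    qed
    hence "Xp h ` {..<d} \<subseteq> fv.span (B \<union> C)" by blast
    from fv.independent_span_bound[OF _ _ this] cindep_independent[OF h(2)] B C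
    have "card (Xp h ` {..<d}) \<le> card (B \<union> C)" by blast
    also have "\<dots> \<le> 2 * N" using card_Un_le[of B C] B C by simp
    also have "card (Xp h ` {..<d}) = d" using cindep_independent[OF h(2)] card_image by fastforce
    finally show ?thesis .
  qed
  have "P 0" unfolding P_def cindep_def using mequiv.base by auto
  obtain d where d: "P d" "\<And>e. P e \<Longrightarrow> e \<le> d"
    using Greatest_le_nat[of P _ "2 * N"] GreatestI_nat[of P 0 "2 * N"] bound \<open>P 0\<close> by blast
  obtain h where h: "mequiv f h" "cindep d (Xp h)" using d(1) unfolding P_def by blast
  have "\<not> cindep (Suc d) (Xp h')" if "mequiv h h'" for h'
  proof
    assume "cindep (Suc d) (Xp h')"
    hence "P (Suc d)" unfolding P_def using mequiv_trans[OF that h(1)] by blast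
    thus False using d(2) by fastforce
  qed
  from maximal_is_cyclic[OF cmdim_mequiv[OF h(1) dim] h(2) this] show ?thesis using h(1) by blast
qed

section \<open>Points that are cyclic for X\<close>

text \<open>The scalar that \<tau> contributes when X^k is commuted with Y on v: k consecutive
  parities, beginning with the framed one.\<close>

definition sig :: "complex \<Rightarrow> complex \<Rightarrow> nat \<Rightarrow> complex" where
  "sig t0 t1 k = (\<Sum>l<k. tsel t0 t1 (even l))"

lemma sig_Suc: "sig t0 t1 (Suc k) = sig t0 t1 k + tsel t0 t1 (even k)"
  by (simp add: sig_def)

lemma sig_double: "sig t0 t1 (2 * m) = of_nat m * (t0 + t1)"
  by (induction m) (simp_all add: sig_def tsel_def algebra_simps)

lemma sig_rev: "(\<Sum>i<k. tsel t0 t1 (even (k - 1 - i))) = sig t0 t1 k"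
  unfolding sig_def by (rule sum.reindex_bij_witness[of _ "\<lambda>i. k - 1 - i" "\<lambda>i. k - 1 - i"]) auto

text \<open>The differences are nonzero multiples of t0 + t1 for even j, and for odd j they are
  linear forms that define root hyperplanes.\<close>

lemma sig_regular:
  assumes "tau_regular t0 t1" "j < 2 * N" "j > 0"
  shows "sig t0 t1 j \<noteq> sig t0 t1 (2 * N)"
proof (cases "even j")
  case True
  then obtain m where m: "j = 2 * m" by auto
  hence "of_nat m \<noteq> (of_nat N :: complex)" using assms by simp
  thus ?thesis using assms(1) by (simp add: m sig_double tau_regular_def)
next
  case False
  then obtain m where m: "j = Suc (2 * m)" by (auto elim!: oddE)
  \<comment> \<open>Chosen because sig (2N) - sig (2m+1) = (N - m - 1) t0 + (N - m) t1.\<close>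
  define n where "n = int N - int m - 1"
  have "of_int n * t0 + of_int (n + 1) * t1 \<noteq> 0" using assms(1) unfolding tau_regular_def by blast
  hence "(of_nat N - of_nat m - 1) * t0 + (of_nat N - of_nat m) * t1 \<noteq> 0" by (simp add: n_def)
  moreover have "sig t0 t1 j = of_nat m * (t0 + t1) + t0" by (simp only: m sig_Suc sig_double) (simp add: tsel_def)
  ultimately show ?thesis unfolding sig_double by (auto simp: algebra_simps)
qed

text \<open>Newton's identities: with \<open>f(X) v = 0\<close>, compare the coefficients of \<open>X\<^sup>i v\<close> in \<open>f(X) Y v = Y f(X) v\<close>.\<close>

lemma newton_identities:
  fixes X Y :: "('i \<Rightarrow> complex) \<Rightarrow> 'i \<Rightarrow> complex"
  assumes lin: "clin X" "clin Y" "clf w"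
    and rel: "\<And>l. l < D \<Longrightarrow> X (Y ((X ^^ l) v)) - Y (X ((X ^^ l) v)) + tsel t0 t1 (even l) *f (X ^^ l) v = w ((X ^^ l) v) *f v"
    and ind: "cindep D (\<lambda>i. (X ^^ i) v)"
    and g: "(\<Sum>k\<le>D. g k *f (X ^^ k) v) = 0"
    and Yv: "Y v = (\<Sum>i<D. r i *f (X ^^ i) v)"
    and j: "0 < j" "j \<le> D"
  shows "(\<Sum>k=j..D. g k * w ((X ^^ (k - j)) v)) = g j * sig t0 t1 j"
proof -
  note cX = clin_pow[OF lin(1)]
  have com: "(X ^^ k) (Y v) - Y ((X ^^ k) v)
      = (\<Sum>i<k. w ((X ^^ (k - 1 - i)) v) *f (X ^^ i) v) - sig t0 t1 k *f (X ^^ (k - 1)) v" if k: "k \<le> D" for k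
  proof -
    have "(X ^^ k) (Y v) - Y ((X ^^ k) v)
       = (\<Sum>i<k. (X ^^ i) (X (Y ((X ^^ (k - 1 - i)) v)) - Y (X ((X ^^ (k - 1 - i)) v))))"
      by (rule commutator_pow[OF lin(1,2)])
    also have "\<dots> = (\<Sum>i<k. w ((X ^^ (k - 1 - i)) v) *f (X ^^ i) v - tsel t0 t1 (even (k - 1 - i)) *f (X ^^ (k - 1)) v)"
    proof (rule sum.cong[OF HOL.refl])
      fix i assume i: "i \<in> {..<k}"
      have "X (Y ((X ^^ (k - 1 - i)) v)) - Y (X ((X ^^ (k - 1 - i)) v))
        = w ((X ^^ (k - 1 - i)) v) *f v - tsel t0 t1 (even (k - 1 - i)) *f (X ^^ (k - 1 - i)) v"
        using rel[of "k - 1 - i"] i k by (simp add: eq_diff_eq)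
      moreover have "(X ^^ i) ((X ^^ (k - 1 - i)) v) = (X ^^ (k - 1)) v"
        using i by (simp flip: funpow_add comp_apply[of "X ^^ i"])
      ultimately show "(X ^^ i) (X (Y ((X ^^ (k - 1 - i)) v)) - Y (X ((X ^^ (k - 1 - i)) v)))
        = w ((X ^^ (k - 1 - i)) v) *f (X ^^ i) v - tsel t0 t1 (even (k - 1 - i)) *f (X ^^ (k - 1)) v"
        by (simp only: clinD[OF cX])
    qed
    finally show ?thesis
      by (simp only: sum_subtractf sig_rev fv.scale_sum_left[symmetric])
  qed
  have "(\<Sum>k\<le>D. g k *f (X ^^ k) (Y v)) = (\<Sum>k\<le>D. \<Sum>i<D. r i *f (X ^^ i) (g k *f (X ^^ k) v))"
    unfolding Yv clinD[OF cX] fv.scale_sum_right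
    by (intro sum.cong HOL.refl) (simp add: mult.commute funpow_add[symmetric, unfolded comp_def, THEN fun_cong] add.commute)
  also have "\<dots> = (\<Sum>i<D. r i *f (X ^^ i) (\<Sum>k\<le>D. g k *f (X ^^ k) v))"
    unfolding clinD(6)[OF cX] fv.scale_sum_right by (rule sum.swap)
  also have "\<dots> = 0" unfolding g by (simp add: clinD[OF cX])
  finally have 1: "(\<Sum>k\<le>D. g k *f (X ^^ k) (Y v)) = 0" .
  have 2: "(\<Sum>k\<le>D. g k *f Y ((X ^^ k) v)) = 0"
    using arg_cong[OF g, of Y] by (simp add: clinD[OF lin(2)])
  have 3: "(\<Sum>k\<le>D. g k *f (\<Sum>i<k. w ((X ^^ (k - 1 - i)) v) *f (X ^^ i) v))
      = (\<Sum>i<D. (\<Sum>k=Suc i..D. g k * w ((X ^^ (k - Suc i)) v)) *f (X ^^ i) v)"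
  proof -
    have "(\<Sum>k\<le>D. g k *f (\<Sum>i<k. w ((X ^^ (k - 1 - i)) v) *f (X ^^ i) v))
      = (\<Sum>k\<le>D. \<Sum>i<D. (if i < k then g k * w ((X ^^ (k - Suc i)) v) else 0) *f (X ^^ i) v)"
    proof (rule sum.cong[OF HOL.refl])
      fix k assume "k \<in> {..D}"
      hence "(\<Sum>i<D. (if i < k then g k * w ((X ^^ (k - Suc i)) v) else 0) *f (X ^^ i) v)
        = (\<Sum>i<k. (if i < k then g k * w ((X ^^ (k - Suc i)) v) else 0) *f (X ^^ i) v)"
        by (intro sum.mono_neutral_right) auto
      also have "\<dots> = g k *f (\<Sum>i<k. w ((X ^^ (k - 1 - i)) v) *f (X ^^ i) v)"
        unfolding fv.scale_sum_right by (intro sum.cong) auto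
      finally show "g k *f (\<Sum>i<k. w ((X ^^ (k - 1 - i)) v) *f (X ^^ i) v)
        = (\<Sum>i<D. (if i < k then g k * w ((X ^^ (k - Suc i)) v) else 0) *f (X ^^ i) v)" ..
    qed
    also have "\<dots> = (\<Sum>i<D. \<Sum>k\<le>D. (if i < k then g k * w ((X ^^ (k - Suc i)) v) else 0) *f (X ^^ i) v)"
      by (rule sum.swap)
    also have "\<dots> = (\<Sum>i<D. (\<Sum>k=Suc i..D. g k * w ((X ^^ (k - Suc i)) v)) *f (X ^^ i) v)"
    proof (rule sum.cong[OF HOL.refl])
      fix i
      have "(\<Sum>k\<le>D. (if i < k then g k * w ((X ^^ (k - Suc i)) v) else 0)) = (\<Sum>k=Suc i..D. g k * w ((X ^^ (k - Suc i)) v))"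
        by (rule sum.mono_neutral_cong_right) auto
      thus "(\<Sum>k\<le>D. (if i < k then g k * w ((X ^^ (k - Suc i)) v) else 0) *f (X ^^ i) v)
        = (\<Sum>k=Suc i..D. g k * w ((X ^^ (k - Suc i)) v)) *f (X ^^ i) v"
        by (simp only: fv.scale_sum_left[symmetric])
    qed
    finally show ?thesis .
  qed
  have 4: "(\<Sum>k\<le>D. g k *f (sig t0 t1 k *f (X ^^ (k - 1)) v)) = (\<Sum>i<D. (g (Suc i) * sig t0 t1 (Suc i)) *f (X ^^ i) v)"
    unfolding lessThan_Suc_atMost[symmetric] sum.lessThan_Suc_shift by (simp add: sig_def[of _ _ 0])
  have "(\<Sum>i<D. ((\<Sum>k=Suc i..D. g k * w ((X ^^ (k - Suc i)) v)) - g (Suc i) * sig t0 t1 (Suc i)) *f (X ^^ i) v)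
     = (\<Sum>k\<le>D. g k *f ((X ^^ k) (Y v) - Y ((X ^^ k) v)))"
  proof -
    have "(\<Sum>k\<le>D. g k *f ((X ^^ k) (Y v) - Y ((X ^^ k) v)))
       = (\<Sum>k\<le>D. g k *f ((\<Sum>i<k. w ((X ^^ (k - 1 - i)) v) *f (X ^^ i) v) - sig t0 t1 k *f (X ^^ (k - 1)) v))"
      by (intro sum.cong HOL.refl arg_cong2[of _ _ _ _ scl] com) simp
    thus ?thesis
      by (simp only: fv.scale_right_diff_distrib sum_subtractf 3 4 fv.scale_left_diff_distrib)
  qed
  also have "\<dots> = 0" by (simp only: fv.scale_right_diff_distrib sum_subtractf 1 2 diff_self)
  finally have z: "(\<Sum>i<D. ((\<Sum>k=Suc i..D. g k * w ((X ^^ (k - Suc i)) v)) - g (Suc i) * sig t0 t1 (Suc i)) *f (X ^^ i) v) = 0" .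
  define c where "c i = (\<Sum>k=Suc i..D. g k * w ((X ^^ (k - Suc i)) v)) - g (Suc i) * sig t0 t1 (Suc i)" for i
  have "(\<Sum>i<D. c i *f (X ^^ i) v) = 0" using z unfolding c_def .
  hence "c i = 0" if "i < D" for i using ind that unfolding cindep_def by metis
  from this[of "j - 1"] show ?thesis using j by (simp add: c_def)
qed

text \<open>The identity for j = D gives s 0 = \<sigma> D. For j < D the unknown g j then has the
  coefficient \<sigma> j - \<sigma> D, which is nonzero, so the identities determine g from the top
  downwards. The recurrence \<open>n2\<close> yields g 0 and afterwards all higher moments.\<close>

lemma newton_unique:
  fixes g g' s s' \<sigma> :: "nat \<Rightarrow> complex"
  assumes n1: "\<And>j. 0 < j \<Longrightarrow> j \<le> D \<Longrightarrow> (\<Sum>k=j..D. g k * s (k - j)) = g j * \<sigma> j"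
    "\<And>j. 0 < j \<Longrightarrow> j \<le> D \<Longrightarrow> (\<Sum>k=j..D. g' k * s' (k - j)) = g' j * \<sigma> j"
    and n2: "\<And>i. (\<Sum>k\<le>D. g k * s (k + i)) = 0" "\<And>i. (\<Sum>k\<le>D. g' k * s' (k + i)) = 0"
    and top: "g D = 1" "g' D = 1"
    and reg: "\<And>j. 0 < j \<Longrightarrow> j < D \<Longrightarrow> \<sigma> j \<noteq> \<sigma> D" "\<sigma> D \<noteq> 0" "D > 0"
    and eq: "\<And>i. 0 < i \<Longrightarrow> i \<le> D \<Longrightarrow> s i = s' i"
  shows "s i = s' i"
proof -
  have s0: "s 0 = \<sigma> D" "s' 0 = \<sigma> D" using n1[of D] top reg(3) by auto
  have gj: "0 < j \<Longrightarrow> j \<le> D \<Longrightarrow> g j = g' j" for j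
  proof (induction "D - j" arbitrary: j rule: less_induct)
    case less
    show ?case
    proof (cases "j = D")
      case True thus ?thesis using top by simp
    next
      case False
      hence jD: "j < D" using less.prems by simp
      have e: "{j..D} = insert j {Suc j..D}" using jD by auto
      have "(\<Sum>k=Suc j..D. g k * s (k - j)) = (\<Sum>k=Suc j..D. g' k * s' (k - j))"
        by (rule sum.cong) (use less eq jD in auto)
      moreover have "g j * (\<sigma> j - \<sigma> D) = (\<Sum>k=Suc j..D. g k * s (k - j))"
        using n1(1)[OF less.prems] unfolding e by (simp add: s0 algebra_simps)
      moreover have "g' j * (\<sigma> j - \<sigma> D) = (\<Sum>k=Suc j..D. g' k * s' (k - j))"
        using n1(2)[OF less.prems] unfolding e by (simp add: s0 algebra_simps)
      ultimately have "g j * (\<sigma> j - \<sigma> D) = g' j * (\<sigma> j - \<sigma> D)" by simp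
      thus ?thesis using reg(1)[OF less.prems(1) jD] by simp
    qed
  qed
  have e: "{..D} = insert 0 {1..D}" by auto
  have "(\<Sum>k=1..D. g k * s k) = (\<Sum>k=1..D. g' k * s' k)"
    by (rule sum.cong) (use gj eq in auto)
  hence "g 0 * \<sigma> D = g' 0 * \<sigma> D" using n2(1)[of 0] n2(2)[of 0] unfolding e by (auto simp: s0 add_eq_0_iff)
  hence g0: "g 0 = g' 0" using reg(2) by simp
  have G: "g k = g' k" if "k \<le> D" for k using that g0 gj by (cases "k = 0") auto
  show ?thesis
  proof (induction i rule: less_induct)
    case (less i)
    show ?case
    proof (cases "i \<le> D")
      case True thus ?thesis using eq[of i] s0 by (cases "i = 0") auto
    next
      case False
      define m where "m = i - D"
      have i: "i = D + m" using False by (simp add: m_def)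
      have f: "{..D} = insert D {..<D}" by auto
      have "(\<Sum>k<D. g k * s (k + m)) = (\<Sum>k<D. g' k * s' (k + m))"
        by (rule sum.cong) (use G less i in auto)
      thus ?thesis using n2(1)[of m] n2(2)[of m] unfolding f i by (simp add: top add_eq_0_iff2)
    qed
  qed
qed

lemma mequiv_polyX:
  assumes "clin A" "clin B" "clf w"
  shows "mequiv (fnl A B w v) (fnl (\<lambda>u. A u + (\<Sum>j<n. c j *f (B ^^ (2 * j + 1)) u)) B w v)"
proof (induction n)
  case (Suc n)
  have "clin (\<lambda>u. A u + (\<Sum>j<n. c j *f (B ^^ (2 * j + 1)) u))"
    by (intro clin_plus clin_sum clin_scl clin_pow assms)
  from moveX_fnl[OF this assms(2,3), of "c n" n v]
  have "moveX (c n) n (fnl (\<lambda>u. A u + (\<Sum>j<n. c j *f (B ^^ (2 * j + 1)) u)) B w v)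
     = fnl (\<lambda>u. A u + (\<Sum>j<Suc n. c j *f (B ^^ (2 * j + 1)) u)) B w v"
    by (simp add: add.assoc)
  with mequiv.stepX[OF Suc, of "c n" n] show ?case by simp
qed (simp add: mequiv.base)

lemma mequiv_polyY:
  assumes "clin A" "clin B" "clf w"
  shows "mequiv (fnl A B w v) (fnl A (\<lambda>u. B u + (\<Sum>j<n. c j *f (A ^^ (2 * j + 1)) u)) w v)"
proof (induction n)
  case (Suc n)
  have "clin (\<lambda>u. B u + (\<Sum>j<n. c j *f (A ^^ (2 * j + 1)) u))"
    by (intro clin_plus clin_sum clin_scl clin_pow assms)
  from moveY_fnl[OF assms(1) this assms(3), of "c n" n v]
  have "moveY (c n) n (fnl A (\<lambda>u. B u + (\<Sum>j<n. c j *f (A ^^ (2 * j + 1)) u)) w v)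
     = fnl A (\<lambda>u. B u + (\<Sum>j<Suc n. c j *f (A ^^ (2 * j + 1)) u)) w v"
    by (simp add: add.assoc)
  with mequiv.stepY[OF Suc, of "c n" n] show ?case by simp
qed (simp add: mequiv.base)

text \<open>The linear relation generated by matching X^i v with X'^i v'. A relation is used because
  the powers may be dependent on either side, so a linear map need not be well defined in
  advance.\<close>

inductive_set corr :: "(('i \<Rightarrow> complex) \<Rightarrow> 'i \<Rightarrow> complex) \<Rightarrow> ('i \<Rightarrow> complex) \<Rightarrow>
    (('j \<Rightarrow> complex) \<Rightarrow> 'j \<Rightarrow> complex) \<Rightarrow> ('j \<Rightarrow> complex) \<Rightarrow> (('i \<Rightarrow> complex) \<times> ('j \<Rightarrow> complex)) set"
  for X v X' v' where
  pow: "((X ^^ i) v, (X' ^^ i) v') \<in> corr X v X' v'"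
| plus: "(u, u') \<in> corr X v X' v' \<Longrightarrow> (z, z') \<in> corr X v X' v' \<Longrightarrow> (u + z, u' + z') \<in> corr X v X' v'"
| scale: "(u, u') \<in> corr X v X' v' \<Longrightarrow> (c *f u, c *f u') \<in> corr X v X' v'"

lemma corr_X: "(u, u') \<in> corr X v X' v' \<Longrightarrow> clin X \<Longrightarrow> clin X' \<Longrightarrow> (X u, X' u') \<in> corr X v X' v'"
proof (induction rule: corr.induct)
  case (pow i) thus ?case using corr.pow[where i = "Suc i" and X = X and v = v and X' = X' and v' = v'] by simp
next
  case (plus u u' z z') thus ?case by (simp add: clinD(1)[of X] clinD(1)[of X'] corr.plus)
next
  case (scale u u' c) thus ?case by (simp add: clinD(2)[of X] clinD(2)[of X'] corr.scale)
qed

lemma corr_diff: "(u, u') \<in> corr X v X' v' \<Longrightarrow> (z, z') \<in> corr X v X' v' \<Longrightarrow> (u - z, u' - z') \<in> corr X v X' v'"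
  using corr.plus[OF _ corr.scale[of z z' X v X' v' "-1"], of u u'] by simp

lemma corr_zero: "(0, 0) \<in> corr X v X' v'"
  using corr.scale[OF corr.pow[where i = 0 and X = X and v = v and X' = X' and v' = v'], of 0] by simp

lemma corr_sum: "finite S \<Longrightarrow> (\<And>s. s \<in> S \<Longrightarrow> (f s, f' s) \<in> corr X v X' v') \<Longrightarrow> (\<Sum>s\<in>S. f s, \<Sum>s\<in>S. f' s) \<in> corr X v X' v'"
  by (induction S rule: finite_induct) (auto intro: corr_zero corr.plus)

text \<open>A realisation that is cyclic for \<open>X\<close> is determined by the moments \<open>w X\<^sup>i v\<close>, up to \<open>Y \<mapsto> Y + p(X)\<close>.\<close>

lemma fnl_determined:
  fixes X Y :: "('i \<Rightarrow> complex) \<Rightarrow> 'i \<Rightarrow> complex" and X' Y' :: "('j \<Rightarrow> complex) \<Rightarrow> 'j \<Rightarrow> complex"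
  assumes lin: "clin X" "clin Y" "clf w" "clin X'" "clin Y'" "clf w'"
    and rel: "\<And>l. X (Y ((X ^^ l) v)) - Y (X ((X ^^ l) v)) + \<tau> l *f (X ^^ l) v = w ((X ^^ l) v) *f v"
    and rel': "\<And>l. X' (Y' ((X' ^^ l) v')) - Y' (X' ((X' ^^ l) v')) + \<tau> l *f (X' ^^ l) v' = w' ((X' ^^ l) v') *f v'"
    and Yv: "Y v = (\<Sum>j<n. r j *f (X ^^ (2 * j + 1)) v)" and Yv': "Y' v' = 0"
    and mom: "\<And>i. w ((X ^^ i) v) = w' ((X' ^^ i) v')"
  shows "fnl X Y w v = fnl X' (\<lambda>u. Y' u + (\<Sum>j<n. r j *f (X' ^^ (2 * j + 1)) u)) w' v'"
proof -
  define Z where "Z u = Y' u + (\<Sum>j<n. r j *f (X' ^^ (2 * j + 1)) u)" for u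
  let ?E = "corr X v X' v'"
  have cZ: "clin Z" unfolding Z_def by (intro clin_plus clin_sum clin_scl clin_pow lin)
  have ev: "w u = w' u'" if "(u, u') \<in> ?E" for u u'
    using that by (induction rule: corr.induct) (simp_all add: mom clfD[OF lin(3)] clfD[OF lin(6)])
  have XZ: "X' (Z u) - Z (X' u) = X' (Y' u) - Y' (X' u)" for u
    unfolding Z_def by (simp add: clinD[OF lin(4)] funpow_swap1)
  have base: "(Y ((X ^^ i) v), Z ((X' ^^ i) v')) \<in> ?E" for i
  proof (induction i)
    case 0
    have "(\<Sum>j<n. r j *f (X ^^ (2 * j + 1)) v, \<Sum>j<n. r j *f (X' ^^ (2 * j + 1)) v') \<in> ?E"
      by (rule corr_sum) (auto simp del: funpow.simps intro: corr.scale corr.pow)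
    thus ?case by (simp add: Yv Z_def Yv' del: funpow.simps)
  next
    case (Suc i)
    have e: "Y (X ((X ^^ i) v)) = X (Y ((X ^^ i) v)) + \<tau> i *f (X ^^ i) v - w ((X ^^ i) v) *f (X ^^ 0) v"
      using rel[of i] by (simp add: algebra_simps)
    have e': "Z (X' ((X' ^^ i) v')) = X' (Z ((X' ^^ i) v')) + \<tau> i *f (X' ^^ i) v' - w ((X ^^ i) v) *f (X' ^^ 0) v'"
    proof -
      let ?q = "(X' ^^ i) v'"
      have "X' (Y' ?q) - Y' (X' ?q) = w' ?q *f v' - \<tau> i *f ?q" using rel'[of i] by (simp only: eq_diff_eq)
      hence "X' (Z ?q) - Z (X' ?q) = w' ?q *f v' - \<tau> i *f ?q" by (simp only: XZ)
      moreover have "Z (X' ?q) = X' (Z ?q) - (X' (Z ?q) - Z (X' ?q))" by simp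
      ultimately have "Z (X' ?q) = X' (Z ?q) - (w' ?q *f v' - \<tau> i *f ?q)" by (simp only:)
      thus ?thesis by (simp add: mom algebra_simps)
    qed
    have "(Y (X ((X ^^ i) v)), Z (X' ((X' ^^ i) v'))) \<in> ?E"
      unfolding e e' by (intro corr_diff corr.plus corr.scale corr.pow corr_X[OF Suc lin(1,4)])
    thus ?case by simp
  qed
  have Ystep: "(Y u, Z u') \<in> ?E" if "(u, u') \<in> ?E" for u u'
    using that
  proof (induction rule: corr.induct)
    case (pow i) show ?case by (rule base)
  next
    case (plus u u' z z') thus ?case by (simp add: clinD[OF lin(2)] clinD[OF cZ] corr.plus)
  next
    case (scale u u' c) thus ?case by (simp add: clinD[OF lin(2)] clinD[OF cZ] corr.scale)
  qed
  have "(opw X Y W v, opw X' Z W v') \<in> ?E" for W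
  proof (induction W)
    case Nil show ?case using corr.pow[where i = 0 and X = X and v = v and X' = X' and v' = v'] by simp
  next
    case (Cons l W)
    thus ?case using corr_X[OF Cons lin(1,4)] Ystep[OF Cons] by (cases l) simp_all
  qed
  hence "fnl X Y w v = fnl X' Z w' v'" unfolding fnl_def using ev by (intro ext) blast
  thus ?thesis by (simp add: Z_def[abs_def])
qed

text \<open>\<open>Y\<close> is the backward shift on sequences and \<open>X\<close> a weighted forward shift plus an odd polynomial in \<open>Y\<close>. The
  weight \<open>cc (2 * N - 1)\<close> vanishes, so the first \<open>2 * N\<close> coordinates form an invariant subspace.\<close>

locale model =
  fixes t0 t1 :: complex and N :: nat
  assumes reg: "tau_regular t0 t1" and N: "N > 0"
begin

text \<open>The relation forces the weights to grow by \<tau> of the parity at each step. The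
  constant is fixed by cc (2N-1) = 0, which makes the first 2N coordinates invariant; the relation
  at coordinate 0 then gives the factor in \<open>mw\<close>.\<close>

definition cc :: "nat \<Rightarrow> complex" where "cc i = sig t0 t1 (Suc i) - sig t0 t1 (2 * N)"

definition mY :: "(nat \<Rightarrow> complex) \<Rightarrow> nat \<Rightarrow> complex" where "mY u = (\<lambda>i. u (Suc i))"

definition mX0 :: "(nat \<Rightarrow> complex) \<Rightarrow> nat \<Rightarrow> complex" where
  "mX0 u = (\<lambda>i. case i of 0 \<Rightarrow> 0 | Suc j \<Rightarrow> cc j * u j)"

definition mX :: "(nat \<Rightarrow> complex) \<Rightarrow> (nat \<Rightarrow> complex) \<Rightarrow> nat \<Rightarrow> complex" where
  "mX a u = mX0 u + (\<Sum>j<N. a j *f (mY ^^ (2 * j + 1)) u)"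

definition me :: "nat \<Rightarrow> nat \<Rightarrow> complex" where "me k = (\<lambda>i. if i = k then 1 else 0)"

definition mw :: "(nat \<Rightarrow> complex) \<Rightarrow> complex" where "mw u = sig t0 t1 (2 * N) * u 0"

lemma clin_mY: "clin mY" by (auto simp: clin_def mY_def fun_pointwise)

lemma clin_mX0: "clin mX0"
  by (auto simp: clin_def mX0_def fun_pointwise algebra_simps split: nat.split)

lemma clin_mX: "clin (mX a)"
  unfolding mX_def by (intro clin_plus clin_sum clin_scl clin_pow clin_mX0 clin_mY)

lemma clf_mw: "clf mw"
  by (auto simp: clf_def mw_def fun_pointwise algebra_simps)

lemma mY_pow: "(mY ^^ k) u = (\<lambda>i. u (i + k))"
  by (induction k arbitrary: u) (auto simp: mY_def)

lemma mX_apply: "mX a u i = (case i of 0 \<Rightarrow> 0 | Suc j \<Rightarrow> cc j * u j) + (\<Sum>j<N. a j * u (i + 2 * j + 1))"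
  unfolding mX_def mX0_def mY_pow plus_fun_apply sum_fun_apply scl_apply by (simp add: add.assoc)

lemma mrel: "mX a (mY u) - mY (mX a u) + (\<lambda>i. tsel t0 t1 (even i) * u i) = mw u *f me 0"
proof
  fix i
  have "mX a (mY u) i - mY (mX a u) i + tsel t0 t1 (even i) * u i = mw u * me 0 i"
  proof (cases i)
    case 0
    thus ?thesis
      by (simp add: mX_apply mY_def cc_def sig_Suc sig_def[of _ _ 0] mw_def me_def algebra_simps)
  next
    case (Suc j)
    have "cc (Suc j) = cc j + tsel t0 t1 (even i)" by (simp add: cc_def sig_Suc Suc)
    thus ?thesis by (simp add: mX_apply mY_def Suc mw_def me_def algebra_simps)
  qed
  thus "(mX a (mY u) - mY (mX a u) + (\<lambda>i. tsel t0 t1 (even i) * u i)) i = (mw u *f me 0) i"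
    by (simp add: fun_pointwise)
qed

definition x :: "(nat \<Rightarrow> complex) \<Rightarrow> nat \<Rightarrow> nat \<Rightarrow> complex" where "x a l = (mX a ^^ l) (me 0)"

lemma x_0: "x a 0 = me 0" by (simp add: x_def)

lemma x_Suc: "x a (Suc l) k = (case k of 0 \<Rightarrow> 0 | Suc j \<Rightarrow> cc j * x a l j) + (\<Sum>j<N. a j * x a l (k + 2 * j + 1))"
  by (cases k) (simp_all add: x_def mX_apply)

lemma x_high: "l < k \<Longrightarrow> x a l k = 0"
proof (induction l arbitrary: k)
  case (Suc l)
  have "(\<Sum>j<N. a j * x a l (k + 2 * j + 1)) = 0" using Suc by (intro sum.neutral) auto
  thus ?case using Suc by (cases k) (simp_all add: x_Suc)
qed (simp add: x_0 me_def)

lemma x_diag: "x a l l = (\<Prod>i<l. cc i)"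
proof (induction l)
  case (Suc l)
  have "(\<Sum>j<N. a j * x a l (Suc l + 2 * j + 1)) = 0" by (intro sum.neutral) (auto simp: x_high)
  thus ?case using Suc by (simp add: x_Suc mult.commute)
qed (simp add: x_0 me_def)

lemma cc_nz: "Suc i < 2 * N \<Longrightarrow> cc i \<noteq> 0"
  using sig_regular[OF reg, of "Suc i" N] by (simp add: cc_def)

lemma x_diag_nz: "l < 2 * N \<Longrightarrow> x a l l \<noteq> 0"
  unfolding x_diag by (auto simp: cc_nz)

lemma x_parity: "odd (l + k) \<Longrightarrow> x a l k = 0"
proof (induction l arbitrary: k)
  case 0 thus ?case by (cases k) (auto simp: x_0 me_def)
next
  case (Suc l)
  have "(\<Sum>j<N. a j * x a l (k + 2 * j + 1)) = 0" using Suc by (intro sum.neutral) auto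
  thus ?case using Suc by (cases k) (simp_all add: x_Suc)
qed

lemma x_bound: "2 * N \<le> k \<Longrightarrow> x a l k = 0"
proof (induction l arbitrary: k)
  case 0 thus ?case using N by (simp add: x_0 me_def)
next
  case (Suc l)
  have "(\<Sum>j<N. a j * x a l (k + 2 * j + 1)) = 0" using Suc by (intro sum.neutral) auto
  moreover have "(case k of 0 \<Rightarrow> 0 | Suc j \<Rightarrow> cc j * x a l j) = 0"
  proof (cases k)
    fix j assume k: "k = Suc j"
    have "cc j * x a l j = 0"
    proof (cases "2 * N \<le> j")
      case False
      hence "Suc j = 2 * N" using k Suc.prems by simp
      thus ?thesis unfolding cc_def by simp
    qed (use Suc.IH in simp)
    thus ?thesis by (simp add: k)
  qed simp
  ultimately show ?case by (simp add: x_Suc)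
qed

text \<open>The coefficient a j acts through Y^(2j+1), which lowers the position by 2j+1, and the
  other l - 1 steps raise it by at most l - 1. So a j with j \<ge> i reaches only positions up to l
  - 2i - 2.\<close>

lemma x_depends:
  assumes "\<And>j. j < i \<Longrightarrow> a j = b j"
  shows "l < k + 2 * i + 2 \<Longrightarrow> x a l k = x b l k"
proof (induction l arbitrary: k)
  case 0 show ?case by (simp add: x_0)
next
  case (Suc l)
  have *: "a j * x a l (k + 2 * j + 1) = b j * x b l (k + 2 * j + 1)" for j
  proof (cases "j < i")
    case True thus ?thesis using Suc.IH[of "k + 2 * j + 1"] Suc.prems assms by simp
  next
    case False
    hence "l < k + 2 * j + 1" using Suc.prems by simp
    thus ?thesis by (simp add: x_high)
  qed
  have "x a l j = x b l j" if "k = Suc j" for j using that Suc by simp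
  thus ?case unfolding x_Suc * by (cases k) simp_all
qed

lemma sig_N_nz: "sig t0 t1 (2 * N) \<noteq> 0"
  using reg N by (simp add: sig_double tau_regular_def)

text \<open>The moments are triangular in the coefficients \<open>a\<close>, so they can be prescribed.\<close>

lemma prescribe_moments:
  "i \<le> N \<Longrightarrow> \<exists>a. \<forall>j<i. mw (x a (2 * j + 2)) = \<mu> j"
proof (induction i)
  case (Suc i)
  then obtain a where a: "\<forall>j<i. mw (x a (2 * j + 2)) = \<mu> j" by auto
  have low: "x (a(i := c)) l k = x a l k" if "l < k + 2 * i + 2" for c l k
    by (rule x_depends[OF _ that]) simp
  have i: "i < N" using Suc.prems by simp
  \<comment> \<open>The new coefficient enters this moment linearly, multiplied by a diagonal entry,
    which is nonzero by regularity.\<close>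
  have val: "x (a(i := c)) (2 * i + 2) 0 = c * x a (2 * i + 1) (2 * i + 1) + (\<Sum>j<i. a j * x a (2 * i + 1) (2 * j + 1))" for c
  proof -
    have "x (a(i := c)) (2 * i + 2) 0 = (\<Sum>j<N. (a(i := c)) j * x (a(i := c)) (2 * i + 1) (2 * j + 1))"
      using x_Suc[of "a(i := c)" "2 * i + 1" 0] by simp
    also have "\<dots> = (\<Sum>j<Suc i. (a(i := c)) j * x (a(i := c)) (2 * i + 1) (2 * j + 1))"
      by (rule sum.mono_neutral_right) (use i in \<open>auto simp: x_high\<close>)
    also have "\<dots> = (\<Sum>j<Suc i. (a(i := c)) j * x a (2 * i + 1) (2 * j + 1))"
      by (rule sum.cong) (auto simp: low)
    also have "\<dots> = (\<Sum>j<i. (a(i := c)) j * x a (2 * i + 1) (2 * j + 1)) + c * x a (2 * i + 1) (2 * i + 1)"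
      by simp
    also have "(\<Sum>j<i. (a(i := c)) j * x a (2 * i + 1) (2 * j + 1)) = (\<Sum>j<i. a j * x a (2 * i + 1) (2 * j + 1))"
      by (rule sum.cong) auto
    finally show ?thesis by (simp only: add.commute)
  qed
  define c where "c = (\<mu> i / sig t0 t1 (2 * N) - (\<Sum>j<i. a j * x a (2 * i + 1) (2 * j + 1))) / x a (2 * i + 1) (2 * i + 1)"
  have "x a (2 * i + 1) (2 * i + 1) \<noteq> 0" by (rule x_diag_nz) (use i in simp)
  hence "c * x a (2 * i + 1) (2 * i + 1) = \<mu> i / sig t0 t1 (2 * N) - (\<Sum>j<i. a j * x a (2 * i + 1) (2 * j + 1))"
    unfolding c_def by (rule nonzero_eq_divide_eq[THEN iffD1, OF _ HOL.refl])
  hence "mw (x (a(i := c)) (2 * i + 2)) = \<mu> i"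
    unfolding mw_def val using sig_N_nz by (simp only: diff_add_cancel nonzero_mult_div_cancel_left times_divide_eq_right not_False_eq_True)
  moreover have "mw (x (a(i := c)) (2 * j + 2)) = \<mu> j" if "j < i" for j
    using a that by (simp add: mw_def low)
  ultimately have "\<forall>j<Suc i. mw (x (a(i := c)) (2 * j + 2)) = \<mu> j" by (auto simp: less_Suc_eq)
  thus ?case by blast
qed simp

lemma x_cindep: "d \<le> 2 * N \<Longrightarrow> cindep d (x a)"
proof (induction d)
  case 0 thus ?case by (simp add: cindep_def)
next
  case (Suc d)
  have "x a d \<notin> fv.span (x a ` {..<d})"
  proof
    assume "x a d \<in> fv.span (x a ` {..<d})"
    hence "x a d d = 0"
      by (rule clf_zero_on_span[where w = "\<lambda>u. u d", OF clf_eval, rotated]) (auto simp: x_high)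
    thus False using x_diag_nz[of d a] Suc.prems by simp
  qed
  thus ?case using Suc by (simp add: cindep_Suc_iff)
qed

lemma me_cindep: "cindep d me"
  unfolding cindep_def
proof (intro allI impI)
  fix c i assume c: "(\<Sum>i<d. c i *f me i) = 0" and i: "i < d"
  have "(\<Sum>j<d. c j *f me j) i = (\<Sum>j<d. if j = i then c j else 0)"
    unfolding sum_fun_apply scl_apply me_def by (rule sum.cong) auto
  thus "c i = 0" using c i by (simp add: zero_fun_apply)
qed

text \<open>All X^l e_0 lie in the first 2N coordinates, and the first 2N of them are
  independent.\<close>

lemma x_span: "x a l \<in> fv.span (x a ` {..<2 * N})"
proof -
  have mem: "x a l \<in> fv.span (me ` {..<2 * N})" for l
  proof -
    have "x a l = (\<Sum>i<2 * N. x a l i *f me i)"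
    proof
      fix k
      have "(\<Sum>i<2 * N. x a l i *f me i) k = (\<Sum>i<2 * N. if i = k then x a l i else 0)"
        unfolding sum_fun_apply scl_apply me_def by (rule sum.cong) auto
      thus "x a l k = (\<Sum>i<2 * N. x a l i *f me i) k" by (auto simp: x_bound)
    qed
    thus ?thesis unfolding span_image_sum by blast
  qed
  have "fv.span (x a ` {..<2 * N}) \<subseteq> fv.span (me ` {..<2 * N})"
    by (rule fv.span_minimal) (use mem in auto)
  from has_dim_eq[OF cindep_has_dim[OF x_cindep[OF order_refl]] cindep_has_dim[OF me_cindep] this] mem
  show ?thesis by blast
qed

text \<open>Choose a so that the model has the even moments of f up to 2N; the odd ones vanish by
  parity. Newton's identities extend the agreement to all moments, so f is the model with an odd
  polynomial in X added to Y. Moves remove this polynomial, and further moves remove the odd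
  polynomial in Y with the coefficients a.\<close>

lemma cyclic_equiv_model:
  assumes cm: "cmf t0 t1 f" and ind: "cindep (2 * N) (Xp f)"
    and Xf: "Xp f (2 * N) \<in> fv.span (Xp f ` {..<2 * N})" and Yf: "SY f \<in> fv.span (Xp f ` {..<2 * N})"
  shows "mequiv f (fnl mX0 mY mw (me 0))"
proof -
  note pf = pf[OF cm]
  have XVP: "Xp f i \<in> VP (even i) f" for i using VP_pow[OF VP_self, where k = i and l = LetterX and f = f] by simp
  have rel: "SX (SY (Xp f l)) - SY (SX (Xp f l)) + tsel t0 t1 (even l) *f Xp f l = ev (Xp f l) *f f" for l
    by (rule cmf_rel[OF cm XVP])
  have evodd: "ev (Xp f i) = 0" if "odd i" for i
    using XVP[of i] that parf_VP[OF pf] ev_odd by auto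
  define \<mu> where "\<mu> j = ev (Xp f (2 * j + 2))" for j
  obtain a where a: "\<forall>j<N. mw (x a (2 * j + 2)) = \<mu> j" using prescribe_moments[of N \<mu>] by auto
  have mom: "ev (Xp f i) = mw (x a i)" if i: "0 < i" "i \<le> 2 * N" for i
  proof (cases "even i")
    case True
    then obtain m where m: "i = 2 * m" by auto
    obtain j where "m = Suc j" using i m by (cases m) auto
    thus ?thesis using a m i by (simp add: \<mu>_def del: funpow.simps)
  next
    case False
    thus ?thesis using evodd x_parity[of i 0 a] by (simp add: mw_def)
  qed
  obtain c where c: "Xp f (2 * N) = (\<Sum>i<2 * N. c i *f Xp f i)" using Xf by (auto simp: span_image_sum)
  obtain c' where c': "x a (2 * N) = (\<Sum>i<2 * N. c' i *f x a i)" using x_span by (auto simp: span_image_sum)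
  define g where "g k = (if k = 2 * N then 1 else - c k)" for k
  define g' where "g' k = (if k = 2 * N then 1 else - c' k)" for k
  have g: "(\<Sum>k\<le>2 * N. g k *f Xp f k) = 0"
  proof -
    have "(\<Sum>k<2 * N. g k *f Xp f k) = - (\<Sum>i<2 * N. c i *f Xp f i)"
      unfolding sum_negf[symmetric] by (rule sum.cong) (auto simp: g_def)
    thus ?thesis using c by (simp add: lessThan_Suc_atMost[symmetric] g_def)
  qed
  have g': "(\<Sum>k\<le>2 * N. g' k *f x a k) = 0"
  proof -
    have "(\<Sum>k<2 * N. g' k *f x a k) = - (\<Sum>i<2 * N. c' i *f x a i)"
      unfolding sum_negf[symmetric] by (rule sum.cong) (auto simp: g'_def)
    thus ?thesis using c' by (simp add: lessThan_Suc_atMost[symmetric] g'_def)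
  qed
  obtain r where r: "SY f = (\<Sum>i<2 * N. r i *f Xp f i)" using Yf by (auto simp: span_image_sum)
  have mrel': "mX a (mY (x a l)) - mY (mX a (x a l)) + tsel t0 t1 (even l) *f x a l = mw (x a l) *f me 0" for l
  proof -
    have "(\<lambda>i. tsel t0 t1 (even i) * x a l i) = tsel t0 t1 (even l) *f x a l"
    proof
      fix i show "tsel t0 t1 (even i) * x a l i = (tsel t0 t1 (even l) *f x a l) i"
        by (cases "even (l + i)") (auto simp: x_parity scl_apply)
    qed
    thus ?thesis using mrel[of a "x a l"] by simp
  qed
  have mY0: "mY (me 0) = 0" by (auto simp: mY_def me_def fun_pointwise)
  have mompos: "ev (Xp f i) = mw (x a i)" for i
  proof (rule newton_unique[where D = "2 * N" and g = g and g' = g' and \<sigma> = "sig t0 t1"])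
    show "(\<Sum>k=j..2 * N. g k * ev (Xp f (k - j))) = g j * sig t0 t1 j" if "0 < j" "j \<le> 2 * N" for j
      by (rule newton_identities[OF clin_SL clin_SL clf_ev rel ind g r that])
    show "(\<Sum>k=j..2 * N. g' k * mw (x a (k - j))) = g' j * sig t0 t1 j" if "0 < j" "j \<le> 2 * N" for j
      unfolding x_def
    proof (rule newton_identities[where r = "\<lambda>_. 0", OF clin_mX clin_mY clf_mw _ _ _ _ that])
      show "mX a (mY ((mX a ^^ l) (me 0))) - mY (mX a ((mX a ^^ l) (me 0)))
        + tsel t0 t1 (even l) *f (mX a ^^ l) (me 0) = mw ((mX a ^^ l) (me 0)) *f me 0" for l
        using mrel'[of l] by (simp add: x_def)
      show "cindep (2 * N) (\<lambda>i. (mX a ^^ i) (me 0))" using x_cindep[of "2 * N" a] by (simp add: x_def[abs_def])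
      show "(\<Sum>k\<le>2 * N. g' k *f (mX a ^^ k) (me 0)) = 0" using g' by (simp add: x_def)
      show "mY (me 0) = (\<Sum>i<2 * N. 0 *f (mX a ^^ i) (me 0))" by (simp add: mY0)
    qed
    show "(\<Sum>k\<le>2 * N. g k * ev (Xp f (k + i))) = 0" for i
    proof -
      have e: "Xp (\<Sum>k\<le>2 * N. g k *f Xp f k) i = (\<Sum>k\<le>2 * N. g k *f Xp f (k + i))"
        by (simp add: clinD[OF clin_pow[OF clin_SL]] funpow_add add.commute[of _ i])
      hence "ev (\<Sum>k\<le>2 * N. g k *f Xp f (k + i)) = 0"
        unfolding e[symmetric] g by (simp add: clinD[OF clin_pow[OF clin_SL]] clfD[OF clf_ev])
      thus ?thesis by (simp add: clfD[OF clf_ev])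
    qed
    show "(\<Sum>k\<le>2 * N. g' k * mw (x a (k + i))) = 0" for i
    proof -
      have e: "(mX a ^^ i) (\<Sum>k\<le>2 * N. g' k *f x a k) = (\<Sum>k\<le>2 * N. g' k *f x a (k + i))"
        by (simp add: x_def clinD[OF clin_pow[OF clin_mX]] funpow_add add.commute[of _ i])
      hence "mw (\<Sum>k\<le>2 * N. g' k *f x a (k + i)) = 0"
        unfolding e[symmetric] g' by (simp add: clinD[OF clin_pow[OF clin_mX]] clfD[OF clf_mw])
      thus ?thesis by (simp add: clfD[OF clf_mw])
    qed
    show "g (2 * N) = 1" "g' (2 * N) = 1" by (simp_all add: g_def g'_def)
    show "sig t0 t1 j \<noteq> sig t0 t1 (2 * N)" if "0 < j" "j < 2 * N" for j
      by (rule sig_regular[OF reg that(2,1)])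
    show "sig t0 t1 (2 * N) \<noteq> 0" by (rule sig_N_nz)
    show "2 * N > 0" using N by simp
    show "ev (Xp f i) = mw (x a i)" if "0 < i" "i \<le> 2 * N" for i by (rule mom[OF that])
  qed
  \<comment> \<open>Y f has odd parity, so only odd powers of X occur, and these can be realised by
    moves.\<close>
  have SYr: "SY f = (\<Sum>j<N. r (2 * j + 1) *f Xp f (2 * j + 1))"
  proof -
    have "SY f = proj False (SY f)"
      by (rule proj_parf(1)[symmetric]) (use parf_SL[OF pf, of LetterY] in simp)
    also have "\<dots> = (\<Sum>i<2 * N. r i *f (if odd i then Xp f i else 0))"
      unfolding r by (simp add: clinD[OF clin_proj] proj_Xp[OF pf] if_distrib cong: if_cong)
    also have "\<dots> = (\<Sum>j<N. r (2 * j + 1) *f Xp f (2 * j + 1))"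
    proof -
      have "(\<Sum>i<2 * n. r i *f (if odd i then Xp f i else 0)) = (\<Sum>j<n. r (2 * j + 1) *f Xp f (2 * j + 1))" for n
        by (induction n) (simp_all del: funpow.simps)
      thus ?thesis .
    qed
    finally show ?thesis .
  qed
  have "fnl SX SY ev f = fnl (mX a) (\<lambda>u. mY u + (\<Sum>j<N. r (2 * j + 1) *f (mX a ^^ (2 * j + 1)) u)) mw (me 0)"
  proof (rule fnl_determined[OF clin_SL clin_SL clf_ev clin_mX clin_mY clf_mw rel _ SYr mY0])
    show "mX a (mY ((mX a ^^ l) (me 0))) - mY (mX a ((mX a ^^ l) (me 0)))
        + tsel t0 t1 (even l) *f (mX a ^^ l) (me 0) = mw ((mX a ^^ l) (me 0)) *f me 0" for l
      using mrel'[of l] by (simp add: x_def)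
    show "ev (Xp f i) = mw ((mX a ^^ i) (me 0))" for i using mompos[of i] by (simp add: x_def)
  qed
  hence "mequiv (fnl (mX a) mY mw (me 0)) f"
    using mequiv_polyY[OF clin_mX clin_mY clf_mw, where v = "me 0" and n = N and c = "\<lambda>j. r (2 * j + 1)"] by (simp del: funpow.simps)
  moreover have "mequiv (fnl mX0 mY mw (me 0)) (fnl (mX a) mY mw (me 0))"
    using mequiv_polyX[OF clin_mX0 clin_mY clf_mw, where v = "me 0" and n = N and c = a] unfolding mX_def[abs_def] .
  ultimately show ?thesis using mequiv_trans mequiv_sym by blast
qed

end

theorem balanced_transitive:
  assumes "tau_regular t0 t1" "cmdim t0 t1 N N f" "cmdim t0 t1 N N h"
  shows "mequiv f h"
proof (cases "N = 0")
  case True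
  have "f' = 0" if "cmdim t0 t1 N N f'" for f'
  proof -
    have "has_dim (VP True f') 0" using that True by (simp add: cmdim_def)
    then obtain B where "finite B" "card B = 0" "fv.span B = VP True f'" unfolding has_dim_def by blast
    hence "VP True f' = {0}" using fv.span_empty by simp
    thus ?thesis using VP_self[of f'] by blast
  qed
  from this[OF assms(2)] this[OF assms(3)] show ?thesis by (simp add: mequiv.base)
next
  case False
  then interpret model t0 t1 N using assms by unfold_locales auto
  have "mequiv f' (fnl mX0 mY mw (me 0))" if dim: "cmdim t0 t1 N N f'" for f'
  proof -
    obtain h' where h': "mequiv f' h'" "cindep (2 * N) (Xp h')"
      "Xp h' (2 * N) \<in> fv.span (Xp h' ` {..<2 * N})" "SY h' \<in> fv.span (Xp h' ` {..<2 * N})"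
      using equivalent_to_cyclic[OF dim] by blast
    have "cmf t0 t1 h'" using cmdim_mequiv[OF h'(1) dim] by (simp add: cmdim_def)
    from mequiv_trans[OF cyclic_equiv_model[OF this h'(2-4)] h'(1)] show ?thesis .
  qed
  from mequiv_trans[OF mequiv_sym[OF this[OF assms(3)]] this[OF assms(2)]] show ?thesis .
qed

section \<open>Reflections\<close>

lemma representation_image:
  fixes C :: "('i \<Rightarrow> complex) \<Rightarrow> 'j \<Rightarrow> complex"
  assumes C: "clin C" and T: "finite T" "fv.independent T" and S: "fv.independent S"
    and CT: "\<And>t. t \<in> T \<Longrightarrow> C t \<in> fv.span S" and x: "x \<in> fv.span T"
  shows "fv.representation S (C x) s = (\<Sum>t\<in>T. fv.representation T x t * fv.representation S (C t) s)"
proof -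
  have "x = (\<Sum>t\<in>T. fv.representation T x t *f t)"
    using fv.sum_representation_eq[OF T(2) x T(1) order_refl] by simp
  from arg_cong[OF this, of C] have "C x = (\<Sum>t\<in>T. fv.representation T x t *f C t)"
    by (simp only: clinD(2,6)[OF C])
  moreover have "fv.representation S (\<Sum>t\<in>T. fv.representation T x t *f C t)
      = (\<lambda>b. \<Sum>t\<in>T. fv.representation S (fv.representation T x t *f C t) b)"
    by (rule fv.representation_sum[OF S]) (rule fv.span_scale[OF CT])
  ultimately show ?thesis by (simp add: fv.representation_scale[OF S CT])
qed

lemma trace_commutes:
  assumes A: "clin A" and B: "clin B"
    and S: "finite S" "fv.independent S" and T: "finite T" "fv.independent T"
    and AS: "\<And>s. s \<in> S \<Longrightarrow> A s \<in> fv.span T" and BT: "\<And>t. t \<in> T \<Longrightarrow> B t \<in> fv.span S"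
  shows "(\<Sum>s\<in>S. fv.representation S (B (A s)) s) = (\<Sum>t\<in>T. fv.representation T (A (B t)) t)"
proof -
  have "(\<Sum>s\<in>S. fv.representation S (B (A s)) s)
     = (\<Sum>s\<in>S. \<Sum>t\<in>T. fv.representation T (A s) t * fv.representation S (B t) s)"
    by (rule sum.cong[OF HOL.refl]) (rule representation_image[OF B T S(2) BT AS])
  also have "\<dots> = (\<Sum>t\<in>T. \<Sum>s\<in>S. fv.representation S (B t) s * fv.representation T (A s) t)"
    by (subst sum.swap) (simp add: mult.commute)
  also have "\<dots> = (\<Sum>t\<in>T. fv.representation T (A (B t)) t)"
    by (rule sum.cong[OF HOL.refl]) (rule representation_image[OF A S T(2) AS BT, symmetric])
  finally show ?thesis .
qed

text \<open>Take the trace of the relation over both vertex spaces. The commutators cancel, since AB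
  and BA have the same trace across the two vertices, and the rank-one operator has trace ev f. This
  later yields the dimensions of reflected points.\<close>

lemma trace_identity:
  assumes "cmdim t0 t1 n0 n1 f"
  shows "of_nat n0 * t0 + of_nat n1 * t1 = f []"
proof -
  have cm: "cmf t0 t1 f" using assms by (simp add: cmdim_def)
  obtain S where S: "finite S" "card S = n0" "fv.independent S" "fv.span S = VP True f"
    using assms unfolding cmdim_def has_dim_def by blast
  obtain T where T: "finite T" "card T = n1" "fv.independent T" "fv.span T = VP False f"
    using assms unfolding cmdim_def has_dim_def by blast
  have inS: "s \<in> VP True f" if "s \<in> S" for s using that fv.span_base[of s S] S(4) by simp
  have inT: "s \<in> VP False f" if "s \<in> T" for s using that fv.span_base[of s T] T(4) by simp
  have step: "SL l s \<in> fv.span T" if "s \<in> S" for l s using VP_SL[OF inS[OF that], of l] T(4) by simp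
  have step': "SL l s \<in> fv.span S" if "s \<in> T" for l s using VP_SL[OF inT[OF that], of l] S(4) by simp
  let ?r = "fv.representation S" and ?r' = "fv.representation T"
  have c1: "(\<Sum>s\<in>S. ?r (SX (SY s)) s) = (\<Sum>t\<in>T. ?r' (SY (SX t)) t)"
    by (rule trace_commutes[OF clin_SL clin_SL S(1,3) T(1,3)]) (rule step step', assumption)+
  have c2: "(\<Sum>s\<in>S. ?r (SY (SX s)) s) = (\<Sum>t\<in>T. ?r' (SX (SY t)) t)"
    by (rule trace_commutes[OF clin_SL clin_SL S(1,3) T(1,3)]) (rule step step', assumption)+
  have one: "?r (SX (SY s)) s - ?r (SY (SX s)) s + t0 = ev s * ?r f s" if s: "s \<in> S" for s
  proof -
    have m: "SX (SY s) \<in> fv.span S" "SY (SX s) \<in> fv.span S" "s \<in> fv.span S" "f \<in> fv.span S"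
      using VP_SL[OF VP_SL[OF inS[OF s]]] inS[OF s] VP_self[of f] S(4) by auto
    have "SX (SY s) = SY (SX s) + ev s *f f - t0 *f s"
      using cmf_rel[OF cm inS[OF s]] by (simp add: tsel_def algebra_simps)
    moreover have "?r (SY (SX s) + ev s *f f - t0 *f s) s = ?r (SY (SX s)) s + ev s * ?r f s - t0 * ?r s s"
      using m by (simp add: fv.representation_diff[OF S(3)] fv.representation_add[OF S(3)]
          fv.representation_scale[OF S(3)] fv.span_add fv.span_scale)
    ultimately show ?thesis using fv.representation_basis[OF S(3) s] by simp
  qed
  have two: "?r' (SX (SY s)) s - ?r' (SY (SX s)) s + t1 = 0" if s: "s \<in> T" for s
  proof -
    have m: "SX (SY s) \<in> fv.span T" "SY (SX s) \<in> fv.span T" "s \<in> fv.span T"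
      using VP_SL[OF VP_SL[OF inT[OF s]]] inT[OF s] T(4) by auto
    have "ev s = 0" using cm inT[OF s] parf_VP ev_odd unfolding cmf_def by blast
    hence "SX (SY s) = SY (SX s) - t1 *f s"
      using cmf_rel[OF cm inT[OF s]] by (simp add: tsel_def algebra_simps eq_diff_eq)
    moreover have "?r' (SY (SX s) - t1 *f s) s = ?r' (SY (SX s)) s - t1 * ?r' s s"
      using m by (simp add: fv.representation_diff[OF T(3)] fv.representation_scale[OF T(3)] fv.span_scale)
    ultimately show ?thesis using fv.representation_basis[OF T(3) s] by simp
  qed
  have "(\<Sum>s\<in>S. ?r (SX (SY s)) s - ?r (SY (SX s)) s + t0) = (\<Sum>s\<in>S. ev s * ?r f s)"
    by (rule sum.cong[OF HOL.refl one])
  moreover have "(\<Sum>s\<in>T. ?r' (SX (SY s)) s - ?r' (SY (SX s)) s + t1) = 0"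
    by (rule sum.neutral) (use two in blast)
  moreover have "(\<Sum>s\<in>S. ev s * ?r f s) = f []"
  proof -
    have "f \<in> fv.span S" using VP_self[of f] S(4) by simp
    hence "f = (\<Sum>s\<in>S. ?r f s *f s)" using fv.sum_representation_eq[OF S(3) _ S(1) order_refl] by metis
    hence "ev f = (\<Sum>s\<in>S. ev (?r f s *f s))" by (metis (no_types, lifting) clf_ev clfD(6) sum.cong)
    thus ?thesis by (simp add: clfD[OF clf_ev] mult.commute) (simp add: ev_def)
  qed
  moreover define P Q where "P = (\<Sum>t\<in>T. ?r' (SY (SX t)) t)" and "Q = (\<Sum>t\<in>T. ?r' (SX (SY t)) t)"
  ultimately have "P - Q + of_nat n0 * t0 = f []" "Q - P + of_nat n1 * t1 = 0"
    unfolding sum.distrib sum_subtractf c1 c2 using S(2) T(2) by simp_all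
  hence "(P - Q + of_nat n0 * t0) + (Q - P + of_nat n1 * t1) = f []" by simp
  thus ?thesis by (simp add: algebra_simps)
qed

section \<open>Words read in pairs of letters, and shifted pairs\<close>

text \<open>A pair of letters is a path from a vertex through the other one and back. A single
  leftover letter gets the default value 0; the laws below are stated for even lengths.\<close>

fun opp :: "('a::zero \<Rightarrow> 'a) \<Rightarrow> ('a \<Rightarrow> 'a) \<Rightarrow> ('a \<Rightarrow> 'a) \<Rightarrow> ('a \<Rightarrow> 'a) \<Rightarrow> letter list \<Rightarrow> 'a \<Rightarrow> 'a" where
  "opp a b c d [] u = u"
| "opp a b c d [l] u = 0"
| "opp a b c d (LetterX # LetterX # W) u = a (opp a b c d W u)"
| "opp a b c d (LetterX # LetterY # W) u = b (opp a b c d W u)"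
| "opp a b c d (LetterY # LetterX # W) u = c (opp a b c d W u)"
| "opp a b c d (LetterY # LetterY # W) u = d (opp a b c d W u)"

definition pairop :: "('a \<Rightarrow> 'a) \<Rightarrow> ('a \<Rightarrow> 'a) \<Rightarrow> ('a \<Rightarrow> 'a) \<Rightarrow> ('a \<Rightarrow> 'a) \<Rightarrow> letter \<Rightarrow> letter \<Rightarrow> 'a \<Rightarrow> 'a" where
  "pairop a b c d l m = (case l of LetterX \<Rightarrow> (case m of LetterX \<Rightarrow> a | LetterY \<Rightarrow> b)
     | LetterY \<Rightarrow> (case m of LetterX \<Rightarrow> c | LetterY \<Rightarrow> d))"

lemma opp_Cons2: "opp a b c d (l # m # W) u = pairop a b c d l m (opp a b c d W u)"
  by (cases l; cases m) (auto simp: pairop_def)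

lemma pair_induct [consumes 1, case_names nil pair]:
  assumes "even (length W)" "P []" "\<And>l m W. even (length W) \<Longrightarrow> P W \<Longrightarrow> P (l # m # W)"
  shows "P W"
  using assms(1)
proof (induction W rule: length_induct)
  case (1 W)
  show ?case
  proof (cases W)
    case Nil thus ?thesis using assms(2) by simp
  next
    case (Cons l V)
    then obtain m U where "V = m # U" using 1(2) by (cases V) auto
    thus ?thesis using 1 Cons assms(3)[of U l m] by auto
  qed
qed

lemma opp_append: "even (length V) \<Longrightarrow> opp a b c d (V @ W) u = opp a b c d V (opp a b c d W u)"
  by (induction V rule: pair_induct) (simp_all add: opp_Cons2)

lemma opp_opw: "even (length W) \<Longrightarrow> opp (\<lambda>u. A (A u)) (\<lambda>u. A (B u)) (\<lambda>u. B (A u)) (\<lambda>u. B (B u)) W u = opw A B W u"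
  for A B :: "'a::zero \<Rightarrow> 'a"
proof (induction W rule: pair_induct)
  case (pair l m W) thus ?case by (cases l; cases m) auto
qed simp

lemma opp_intertwine:
  fixes J :: "'a::zero \<Rightarrow> 'b::zero"
  assumes "\<And>u. J (a u) = a' (J u)" "\<And>u. J (b u) = b' (J u)" "\<And>u. J (c u) = c' (J u)" "\<And>u. J (d u) = d' (J u)"
    "even (length W)"
  shows "J (opp a b c d W u) = opp a' b' c' d' W (J u)"
  using assms(5)
proof (induction W rule: pair_induct)
  case (pair l m W) thus ?case by (cases l; cases m) (simp_all add: assms(1-4))
qed simp

text \<open>\<open>P\<^sub>\<kappa>\<close> is the action of the pairs of letters shifted by \<open>xy \<mapsto> xy + \<kappa>\<close>, \<open>yx \<mapsto> yx - \<kappa>\<close>; for the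
  appropriate \<open>\<kappa>\<close> this realises a reflection functor at the vertex that the pairs pass through.\<close>

definition shp :: "complex \<Rightarrow> (('i \<Rightarrow> complex) \<Rightarrow> 'i \<Rightarrow> complex) \<Rightarrow> (('i \<Rightarrow> complex) \<Rightarrow> 'i \<Rightarrow> complex) \<Rightarrow> letter list \<Rightarrow> ('i \<Rightarrow> complex) \<Rightarrow> 'i \<Rightarrow> complex" where
  "shp \<kappa> A B = opp (\<lambda>u. A (A u)) (\<lambda>u. A (B u) + \<kappa> *f u) (\<lambda>u. B (A u) - \<kappa> *f u) (\<lambda>u. B (B u))"

definition shq :: "complex \<Rightarrow> (('i \<Rightarrow> complex) \<Rightarrow> 'i \<Rightarrow> complex) \<Rightarrow> (('i \<Rightarrow> complex) \<Rightarrow> 'i \<Rightarrow> complex) \<Rightarrow> letter \<Rightarrow> letter \<Rightarrow> ('i \<Rightarrow> complex) \<Rightarrow> 'i \<Rightarrow> complex" where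
  "shq \<kappa> A B = pairop (\<lambda>u. A (A u)) (\<lambda>u. A (B u) + \<kappa> *f u) (\<lambda>u. B (A u) - \<kappa> *f u) (\<lambda>u. B (B u))"

lemma shp_Cons2: "shp \<kappa> A B (l # m # W) u = shq \<kappa> A B l m (shp \<kappa> A B W u)"
  by (simp add: shp_def shq_def opp_Cons2)

lemma shp_Nil [simp]: "shp \<kappa> A B [] u = u" by (simp add: shp_def)

lemma shp_pair: "shp \<kappa> A B [l, m] u = shq \<kappa> A B l m u"
  by (simp add: shp_Cons2)

lemma shp_append: "even (length V) \<Longrightarrow> shp \<kappa> A B (V @ W) u = shp \<kappa> A B V (shp \<kappa> A B W u)"
  by (simp add: shp_def opp_append)

lemma shq_simps:
  "shq \<kappa> A B LetterX LetterX u = A (A u)" "shq \<kappa> A B LetterX LetterY u = A (B u) + \<kappa> *f u"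
  "shq \<kappa> A B LetterY LetterX u = B (A u) - \<kappa> *f u" "shq \<kappa> A B LetterY LetterY u = B (B u)"
  by (simp_all add: shq_def pairop_def)

lemma clin_shq: assumes "clin A" "clin B" shows "clin (shq \<kappa> A B l m)"
proof -
  have c: "clin (\<lambda>u. A (A u))" "clin (\<lambda>u. A (B u))" "clin (\<lambda>u. B (A u))" "clin (\<lambda>u. B (B u))"
    by (rule clin_comp[OF assms(1) assms(1)] clin_comp[OF assms(1) assms(2)]
        clin_comp[OF assms(2) assms(1)] clin_comp[OF assms(2) assms(2)])+
  show ?thesis unfolding shq_def pairop_def
    by (cases l; cases m) (simp_all add: c clin_plus clin_minus clin_scl clin_id)
qed

lemma clin_shp: assumes "clin A" "clin B" "even (length W)" shows "clin (shp \<kappa> A B W)"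
  using assms(3)
proof (induction W rule: pair_induct)
  case nil
  have "shp \<kappa> A B [] = (\<lambda>u. u)" by (rule ext) simp
  thus ?case by (simp add: clin_id)
next
  case (pair l m W)
  have "shp \<kappa> A B (l # m # W) = (\<lambda>u. shq \<kappa> A B l m (shp \<kappa> A B W u))" by (rule ext) (rule shp_Cons2)
  thus ?case using clin_comp[OF clin_shq[OF assms(1,2), of \<kappa> l m] pair(2)] by simp
qed

lemma shp_0: "even (length W) \<Longrightarrow> shp 0 A B W u = opw A B W u"
  by (simp add: shp_def opp_opw)

lemma shp_intertwine:
  assumes "clin J" "\<And>u. J (A u) = A' (J u)" "\<And>u. J (B u) = B' (J u)" "even (length W)"
  shows "J (shp \<kappa> A B W u) = shp \<kappa> A' B' W (J u)"
  unfolding shp_def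
  by (rule opp_intertwine[where J = J]) (simp_all add: clinD[OF assms(1)] assms)

text \<open>A further shift adds multiples of the identity to the pairs on both sides, and every
  linear J respects these.\<close>

lemma shp_intertwine_pairs:
  assumes J: "clin J" and q: "\<And>l m u. J (shq \<kappa> A B l m u) = shq \<nu> A' B' l m (J u)" and W: "even (length W)"
  shows "J (shp (\<kappa> + \<mu>) A B W u) = shp (\<nu> + \<mu>) A' B' W (J u)"
  unfolding shp_def
proof (rule opp_intertwine[where J = J, OF _ _ _ _ W])
  have q': "J (A (A u)) = A' (A' (J u))" "J (A (B u) + \<kappa> *f u) = A' (B' (J u)) + \<nu> *f J u"
    "J (B (A u) - \<kappa> *f u) = B' (A' (J u)) - \<nu> *f J u" "J (B (B u)) = B' (B' (J u))" for u
    using q[of LetterX LetterX u] q[of LetterX LetterY u] q[of LetterY LetterX u] q[of LetterY LetterY u]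
    by (simp_all add: shq_simps)
  fix u
  have s: "J (x + \<mu> *f u) = J x + \<mu> *f J u" "J (x - \<mu> *f u) = J x - \<mu> *f J u" for x
    by (simp_all add: clinD[OF J])
  show "J (A (A u)) = A' (A' (J u))" "J (B (B u)) = B' (B' (J u))" by (rule q')+
  have "A (B u) + (\<kappa> + \<mu>) *f u = (A (B u) + \<kappa> *f u) + \<mu> *f u"
    by (simp add: fv.scale_left_distrib add.assoc)
  thus "J (A (B u) + (\<kappa> + \<mu>) *f u) = A' (B' (J u)) + (\<nu> + \<mu>) *f J u"
    by (simp only: s q') (simp add: fv.scale_left_distrib add.assoc)
  have "B (A u) - (\<kappa> + \<mu>) *f u = (B (A u) - \<kappa> *f u) - \<mu> *f u"
    by (simp add: fv.scale_left_distrib diff_diff_eq)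
  thus "J (B (A u) - (\<kappa> + \<mu>) *f u) = B' (A' (J u)) - (\<nu> + \<mu>) *f J u"
    by (simp only: s q') (simp add: fv.scale_left_distrib diff_diff_eq)
qed

text \<open>Reflections commute with moves for this reason: in the square of A + c B^(2k+1) the
  cross terms A B^(2k+1) and B^(2k+1) A acquire the corrections -\<kappa> B^(2k) and +\<kappa>
  B^(2k), which cancel.\<close>

lemma pair_shift:
  fixes A B :: "('i \<Rightarrow> complex) \<Rightarrow> 'i \<Rightarrow> complex" and A' B' :: "('j \<Rightarrow> complex) \<Rightarrow> 'j \<Rightarrow> complex"
    and \<kappa> c :: complex and k :: nat
  assumes lin: "clin A" "clin B" "clin A'" "clin B'" "clin J"
    and e: "\<And>u. J (A (A u)) = A' (A' (J u))" "\<And>u. J (A (B u) + \<kappa> *f u) = A' (B' (J u))"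
      "\<And>u. J (B (A u) - \<kappa> *f u) = B' (A' (J u))" "\<And>u. J (B (B u)) = B' (B' (J u))"
  defines "X \<equiv> \<lambda>u. A u + c *f (B ^^ (2 * k + 1)) u" and "X' \<equiv> \<lambda>u. A' u + c *f (B' ^^ (2 * k + 1)) u"
  shows "J (X (X u)) = X' (X' (J u))" "J (X (B u) + \<kappa> *f u) = X' (B' (J u))"
    "J (B (X u) - \<kappa> *f u) = B' (X' (J u))"
proof -
  note lA = clinD[OF lin(1)] and lB = clinD[OF lin(2)] and lA' = clinD[OF lin(3)] and lB' = clinD[OF lin(4)]
    and lJ = clinD[OF lin(5)] and pB = clinD[OF clin_pow[OF lin(2)]] and pB' = clinD[OF clin_pow[OF lin(4)]]
  have J2: "J ((B ^^ (2 * n)) u) = (B' ^^ (2 * n)) (J u)" for n u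
    by (induction n) (simp_all add: e(4))
  have AB: "J (A (B u)) = A' (B' (J u)) - \<kappa> *f J u" for u
    using e(2)[of u] by (simp add: lJ eq_diff_eq)
  have BA: "J (B (A u)) = B' (A' (J u)) + \<kappa> *f J u" for u
    using e(3)[of u] by (simp add: lJ diff_eq_eq)
  have odd1: "(B ^^ (2 * k + 1)) v = B ((B ^^ (2 * k)) v)" "(B' ^^ (2 * k + 1)) v' = B' ((B' ^^ (2 * k)) v')"
    and odd2: "(B ^^ (2 * k + 1)) v = (B ^^ (2 * k)) (B v)" "(B' ^^ (2 * k + 1)) v' = (B' ^^ (2 * k)) (B' v')"
    for v v' by (simp_all add: funpow_swap1)
  have t1: "J (A ((B ^^ (2 * k + 1)) u)) = A' ((B' ^^ (2 * k + 1)) (J u)) - \<kappa> *f (B' ^^ (2 * k)) (J u)" for u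
    unfolding odd1 AB J2 ..
  have t2: "J ((B ^^ (2 * k + 1)) (A u)) = (B' ^^ (2 * k + 1)) (A' (J u)) + \<kappa> *f (B' ^^ (2 * k)) (J u)" for u
    unfolding odd2 J2 BA by (simp add: pB')
  have t3: "J ((B ^^ (2 * k + 1)) ((B ^^ (2 * k + 1)) u)) = (B' ^^ (2 * k + 1)) ((B' ^^ (2 * k + 1)) (J u))" for u
  proof -
    have "(B ^^ (2 * k + 1)) ((B ^^ (2 * k + 1)) u) = (B ^^ (2 * k)) (B (B ((B ^^ (2 * k)) u)))"
      by (subst odd2(1)[of "(B ^^ (2 * k + 1)) u"], subst odd1(1)[of u]) (rule HOL.refl)
    moreover have "(B' ^^ (2 * k + 1)) ((B' ^^ (2 * k + 1)) (J u)) = (B' ^^ (2 * k)) (B' (B' ((B' ^^ (2 * k)) (J u))))"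
      by (subst odd2(2)[of "(B' ^^ (2 * k + 1)) (J u)"], subst odd1(2)[of "J u"]) (rule HOL.refl)
    ultimately show ?thesis by (simp only: J2 e(4))
  qed
  have t4: "J ((B ^^ (2 * k + 1)) (B u)) = (B' ^^ (2 * k + 1)) (B' (J u))"
    "J (B ((B ^^ (2 * k + 1)) u)) = B' ((B' ^^ (2 * k + 1)) (J u))" for u
    unfolding odd2 odd1 J2 e(4) by (simp_all add: e(4) J2 funpow_swap1)
  show "J (X (X u)) = X' (X' (J u))"
    unfolding X_def X'_def lA lA' pB pB' lJ fv.scale_right_distrib e(1) t1 t2 t3
    by (simp add: fv.scale_right_distrib fv.scale_right_diff_distrib)
  show "J (X (B u) + \<kappa> *f u) = X' (B' (J u))"
    unfolding X_def X'_def lJ AB t4 by simp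
  show "J (B (X u) - \<kappa> *f u) = B' (X' (J u))"
    unfolding X_def X'_def lB lB' lJ BA t4 by simp
qed

lemma shq_cases:
  assumes "P LetterX LetterX" "P LetterX LetterY" "P LetterY LetterX" "P LetterY LetterY"
  shows "P l m"
  using assms by (cases l; cases m) auto

definition Lx :: "('a \<Rightarrow> 'a) \<Rightarrow> ('a \<Rightarrow> 'a) \<Rightarrow> letter \<Rightarrow> 'a \<Rightarrow> 'a" where
  "Lx A B l = opw A B [l]"

lemma Lx_simps [simp]: "Lx A B LetterX u = A u" "Lx A B LetterY u = B u"
  by (simp_all add: Lx_def)

lemma Lx_SL: "Lx SX SY l = SL l"
  by (cases l) (auto simp: fun_eq_iff)

text \<open>Between l and m stands AB - BA - \<kappa>, evaluated at the vertex in the middle of the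
  pairs. If -\<kappa> is the value of \<tau> there, the relation turns this into 0 or into the
  rank-one operator.\<close>

lemma shq_quadric:
  assumes "clin A" "clin B"
  shows "shq \<kappa> A B l LetterX (shq \<kappa> A B LetterY m u) - shq \<kappa> A B l LetterY (shq \<kappa> A B LetterX m u)
      + \<kappa> *f shq \<kappa> A B l m u
    = Lx A B l (A (B (Lx A B m u)) - B (A (Lx A B m u)) - \<kappa> *f Lx A B m u)"
  by (rule shq_cases[of _ l m])
    (simp_all add: shq_simps clinD[OF assms(1)] clinD[OF assms(2)] algebra_simps fv.scale_right_diff_distrib
      fv.scale_right_distrib)

lemma shq_left:
  assumes "clin A" "clin B"
  shows "shq \<kappa> A B m LetterX (B u) - shq \<kappa> A B m LetterY (A u)
    = Lx A B m (A (B u) - B (A u)) - \<kappa> *f Lx A B m u"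
  by (cases m) (simp_all add: shq_simps clinD[OF assms(1)] clinD[OF assms(2)] algebra_simps)

lemma shq_right:
  assumes "clin A" "clin B"
  shows "A (shq \<kappa> A B LetterY m u) - B (shq \<kappa> A B LetterX m u)
    = A (B (Lx A B m u)) - B (A (Lx A B m u)) - \<kappa> *f Lx A B m u"
  by (cases m) (simp_all add: shq_simps clinD[OF assms(1)] clinD[OF assms(2)] algebra_simps)

abbreviation "shS \<kappa> \<equiv> shp \<kappa> SX SY"
abbreviation "sqS \<kappa> \<equiv> shq \<kappa> SX SY"

lemma sqS_0: "sqS 0 l m g = (\<lambda>W. g (W @ [l, m]))"
  by (rule shq_cases[of _ l m]) (simp_all add: shq_simps SL_def)

lemma VP_sqS: assumes "u \<in> VP p f" shows "sqS \<kappa> l m u \<in> VP p f"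
proof -
  have t: "SL a (SL b u) \<in> VP p f" for a b using VP_SL[OF VP_SL[OF assms], of a b] by simp
  note su = fv.subspace_scale[OF subspace_VP assms]
  show ?thesis
    by (rule shq_cases[of _ l m])
      (simp_all only: shq_simps t fv.subspace_add[OF subspace_VP t su] fv.subspace_diff[OF subspace_VP t su])
qed

lemma VP_shS: "even (length W) \<Longrightarrow> u \<in> VP p f \<Longrightarrow> shS \<kappa> W u \<in> VP p f"
proof (induction W rule: pair_induct)
  case (pair l m W) thus ?case by (simp add: shp_Cons2 VP_sqS)
qed simp

lemma shS_0: "even (length W) \<Longrightarrow> shS 0 W u = opw SX SY W u"
  by (rule shp_0)

lemmas clin_shS = clin_shp[OF clin_SL[of LetterX] clin_SL[of LetterY]]

text \<open>\<open>J1\<close> and \<open>J0\<close> transport the functionals of vectors in the framed and in the other vertex space to the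
  representation that is reflected at the opposite vertex.\<close>

definition J1 :: "complex \<Rightarrow> wfun \<Rightarrow> wfun" where
  "J1 \<kappa> u = (\<lambda>W. if even (length W) then ev (shS \<kappa> W u) else 0)"

definition J0 :: "complex \<Rightarrow> wfun \<Rightarrow> wfun" where
  "J0 \<kappa> u = (\<lambda>W. if odd (length W) then ev (SL (hd W) (shS \<kappa> (tl W) u)) else 0)"

lemma clin_J1: "clin (J1 \<kappa>)"
  unfolding clin_def J1_def
  by (auto simp: fun_pointwise clinD[OF clin_shS] clfD[OF clf_ev])

lemma clin_J0: "clin (J0 \<kappa>)"
  unfolding clin_def J0_def
  by (auto simp: fun_pointwise clinD[OF clin_shS] clinD[OF clin_SL] clfD[OF clf_ev])

lemma J1_sq: "J1 \<kappa> (sqS \<kappa> l m u) = sqS 0 l m (J1 \<kappa> u)"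
  by (auto simp: sqS_0 J1_def shp_append shp_pair fun_eq_iff)

lemma J0_sq: "J0 \<kappa> (sqS \<kappa> l m u) = sqS 0 l m (J0 \<kappa> u)"
proof
  fix W show "J0 \<kappa> (sqS \<kappa> l m u) W = sqS 0 l m (J0 \<kappa> u) W"
    by (cases W) (auto simp: sqS_0 J0_def shp_append shp_pair)
qed

lemma J1_shift: "even (length W) \<Longrightarrow> J1 \<kappa> (shS (\<kappa> + \<mu>) W u) = shS \<mu> W (J1 \<kappa> u)"
  using shp_intertwine_pairs[OF clin_J1, of \<kappa> \<kappa> SX SY 0 SX SY W \<mu> u] J1_sq by simp

lemma J0_shift: "even (length W) \<Longrightarrow> J0 \<kappa> (shS (\<kappa> + \<mu>) W u) = shS \<mu> W (J0 \<kappa> u)"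
  using shp_intertwine_pairs[OF clin_J0, of \<kappa> \<kappa> SX SY 0 SX SY W \<mu> u] J0_sq by simp

lemma ev_J1: "ev (J1 \<kappa> u) = ev u" by (simp add: J1_def ev_def)

lemma ev_SL_J0: "ev (SL l (J0 \<kappa> u)) = ev (SL l u)" by (simp add: J0_def ev_def SL_def)

text \<open>Reflecting with \<kappa> and then with -\<kappa> shifts all pairs by 0 in total, by
  \<open>J1_shift\<close>.\<close>

lemma J1_inverse: assumes "parf True u" shows "J1 (- \<kappa>) (J1 \<kappa> u) = u"
proof
  fix W
  show "J1 (- \<kappa>) (J1 \<kappa> u) W = u W"
  proof (cases "even (length W)")
    case True
    have "shS (- \<kappa>) W (J1 \<kappa> u) = J1 \<kappa> (opw SX SY W u)"
      using J1_shift[OF True, of \<kappa> "- \<kappa>" u] by (simp add: shS_0[OF True])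
    hence "J1 (- \<kappa>) (J1 \<kappa> u) W = ev (opw SX SY W u)" using True by (simp add: J1_def[of "- \<kappa>"] ev_J1)
    thus ?thesis by (simp add: opw_SL ev_def)
  next
    case False
    thus ?thesis using assms by (simp add: J1_def[of "- \<kappa>"] parf_def)
  qed
qed

lemma J0_inverse: assumes "parf False u" shows "J0 (- \<kappa>) (J0 \<kappa> u) = u"
proof
  fix W
  show "J0 (- \<kappa>) (J0 \<kappa> u) W = u W"
  proof (cases "odd (length W)")
    case True
    then obtain l P where W: "W = l # P" and P: "even (length P)" by (cases W) auto
    have "shS (- \<kappa>) P (J0 \<kappa> u) = J0 \<kappa> (opw SX SY P u)"
      using J0_shift[OF P, of \<kappa> "- \<kappa>" u] by (simp add: shS_0[OF P])
    hence "J0 (- \<kappa>) (J0 \<kappa> u) W = ev (SL l (opw SX SY P u))"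
      using True W by (simp add: J0_def[of "- \<kappa>"] ev_SL_J0)
    thus ?thesis by (simp add: opw_SL ev_def SL_def W)
  next
    case False
    thus ?thesis using assms by (simp add: J0_def[of "- \<kappa>"] parf_def)
  qed
qed

text \<open>The reflection at the framed vertex: after splitting off the first and the last letter,
  the pairs run through that vertex. The relation for two empty words fixes the value at []: values
  on two letters are unchanged, and f[]^2 - 2 t f[] + t^2 = (f[] - t)^2.\<close>

definition r0 :: "complex \<Rightarrow> wfun \<Rightarrow> wfun" where
  "r0 t f = (\<lambda>W. if W = [] then f [] - t else if even (length W) then J0 (- t) (SL (last W) f) (butlast W) else 0)"

lemma r0_SL: "SL l (r0 t f) = J0 (- t) (SL l f)"
proof
  fix W show "SL l (r0 t f) W = J0 (- t) (SL l f) W"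
    unfolding SL_def[of l "r0 t f"] by (auto simp: r0_def J0_def)
qed

lemma r0_word: "even (length P) \<Longrightarrow> r0 t f (l # P @ [m]) = ev (SL l (shS (- t) P (SL m f)))"
  by (simp add: r0_def J0_def butlast_append)

lemma r0_Nil: "r0 t f [] = f [] - t" by (simp add: r0_def)

lemma parf_r0: "parf True (r0 t f)" by (auto simp: parf_def r0_def)

lemma r0_inverse: assumes "parf True f" shows "r0 (- t) (r0 t f) = f"
proof
  fix W show "r0 (- t) (r0 t f) W = f W"
  proof (cases W rule: rev_cases)
    case Nil thus ?thesis by (simp add: r0_Nil)
  next
    case (snoc P l)
    have "SL l (r0 (- t) (r0 t f)) = J0 t (J0 (- t) (SL l f))" using r0_SL[of l "- t"] r0_SL[of l t f] by simp
    also have "\<dots> = SL l f" using J0_inverse[of "SL l f" "- t"] parf_SL[OF assms, of l] by simp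
    finally have "SL l (r0 (- t) (r0 t f)) P = SL l f P" by simp
    thus ?thesis by (simp add: SL_def snoc)
  qed
qed

lemma cmfI:
  assumes pf: "parf True f"
    and ee: "\<And>V W. even (length V) \<Longrightarrow> even (length W) \<Longrightarrow>
      f (V @ [LetterX, LetterY] @ W) - f (V @ [LetterY, LetterX] @ W) + t0 * f (V @ W) = f V * f W"
    and oo: "\<And>V W. odd (length V) \<Longrightarrow> odd (length W) \<Longrightarrow>
      f (V @ [LetterX, LetterY] @ W) - f (V @ [LetterY, LetterX] @ W) + t1 * f (V @ W) = 0"
  shows "cmf t0 t1 f"
  unfolding cmf_def
proof (intro conjI allI pf)
  fix V W :: "letter list"
  have z: "f U = 0" if "odd (length U)" for U using pf that by (simp add: parf_def)
  consider "even (length V)" "even (length W)" | "odd (length V)" "odd (length W)"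
    | "odd (length V + length W)" by auto
  thus "f (V @ [LetterX, LetterY] @ W) - f (V @ [LetterY, LetterX] @ W)
     + tsel t0 t1 (even (length W)) * f (V @ W) = f V * f W"
  proof cases
    case 1 thus ?thesis using ee by (simp add: tsel_def)
  next
    case 2 thus ?thesis using oo z by (simp add: tsel_def)
  next
    case 3
    hence "f V * f W = 0" using z by (cases "even (length V)") auto
    moreover have "f (V @ [LetterX, LetterY] @ W) = 0" "f (V @ [LetterY, LetterX] @ W) = 0" "f (V @ W) = 0"
      by (rule z; use 3 in simp)+
    ultimately show ?thesis by simp
  qed
qed

lemma odd_last: "odd (length V) \<Longrightarrow> \<exists>U l. V = U @ [l] \<and> even (length U)"
  by (cases V rule: rev_cases) auto

lemma odd_hd: "odd (length V) \<Longrightarrow> \<exists>U l. V = l # U \<and> even (length U)"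
  by (cases V) auto

lemma even_split: "even (length V) \<Longrightarrow> V = [] \<or> (\<exists>l U m. V = l # U @ [m] \<and> even (length U))"
proof -
  assume e: "even (length V)"
  show ?thesis
  proof (cases V)
    case (Cons l U)
    hence "odd (length U)" using e by simp
    from odd_last[OF this] show ?thesis using Cons by auto
  qed simp
qed

text \<open>At the framed vertex the shifts change XY - YX by -2 t1, which the new parameter t0 + 2
  t1 compensates. At the other vertex \<open>shq_quadric\<close> with \<kappa> = -t1 reduces the
  claim to the old relation there, whose right-hand side is 0.\<close>

lemma cmf_J1:
  assumes cm: "cmf t0 t1 f" shows "cmf (t0 + 2 * t1) (- t1) (J1 (- t1) f)"
proof (rule cmfI)
  show "parf True (J1 (- t1) f)" by (auto simp: parf_def J1_def)
  let ?s = "shS (- t1)" and ?q = "sqS (- t1)"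
  fix V W :: "letter list"
  {
    assume V: "even (length V)" and W: "even (length W)"
    define u where "u = ?s W f"
    have u: "u \<in> VP True f" unfolding u_def by (rule VP_shS[OF W VP_self])
    have "?q LetterX LetterY u - ?q LetterY LetterX u + (t0 + 2 * t1) *f u
        = SX (SY u) - SY (SX u) + tsel t0 t1 True *f u"
      by (simp add: shq_simps tsel_def fun_pointwise algebra_simps)
    also have "\<dots> = ev u *f f" by (rule cmf_rel[OF cm u])
    finally have "ev (?s V (?q LetterX LetterY u - ?q LetterY LetterX u + (t0 + 2 * t1) *f u)) = ev (?s V (ev u *f f))"
      by simp
    thus "J1 (- t1) f (V @ [LetterX, LetterY] @ W) - J1 (- t1) f (V @ [LetterY, LetterX] @ W)
        + (t0 + 2 * t1) * J1 (- t1) f (V @ W) = J1 (- t1) f V * J1 (- t1) f W"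
      using V W unfolding clinD[OF clin_shS[OF V]] clfD[OF clf_ev]
      by (simp add: J1_def shp_append shp_Cons2 u_def)
  next
    assume "odd (length V)" "odd (length W)"
    then obtain V1 l W1 m where V: "V = V1 @ [l]" "even (length V1)" and W: "W = m # W1" "even (length W1)"
      using odd_last odd_hd by meson
    define u where "u = ?s W1 f"
    have u: "u \<in> VP True f" unfolding u_def by (rule VP_shS[OF W(2) VP_self])
    have z: "SL m u \<in> VP False f" using VP_SL[OF u, of m] by simp
    have "ev (SL m u) = 0" using cm z parf_VP ev_odd unfolding cmf_def by blast
    hence r: "SX (SY (SL m u)) - SY (SX (SL m u)) + t1 *f SL m u = 0"
      using cmf_rel[OF cm z] by (simp add: tsel_def)
    have "?q l LetterX (?q LetterY m u) - ?q l LetterY (?q LetterX m u) + (- t1) *f ?q l m u = SL l 0"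
      unfolding shq_quadric[OF clin_SL clin_SL] Lx_SL using r by simp
    hence "ev (?s V1 (?q l LetterX (?q LetterY m u) - ?q l LetterY (?q LetterX m u) + (- t1) *f ?q l m u)) = 0"
      by (simp add: clinD[OF clin_SL] clinD[OF clin_shS[OF V(2)]] clfD[OF clf_ev])
    thus "J1 (- t1) f (V @ [LetterX, LetterY] @ W) - J1 (- t1) f (V @ [LetterY, LetterX] @ W)
        + (- t1) * J1 (- t1) f (V @ W) = 0"
      using V W unfolding clinD[OF clin_shS[OF V(2)]] clfD[OF clf_ev]
      by (simp add: J1_def shp_append shp_Cons2 u_def)
  }
qed

text \<open>The roles of the vertices in \<open>cmf_J1\<close> are exchanged, but the operator in
  the middle of \<open>shq_quadric\<close> now has rank one and splits a word into two
  factors.\<close>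

lemma cmf_r0:
  assumes cm: "cmf t0 t1 f" shows "cmf (- t0) (t1 + 2 * t0) (r0 t0 f)"
proof (rule cmfI[OF parf_r0])
  let ?s = "shS (- t0)" and ?q = "sqS (- t0)"
  have fVP: "SL l f \<in> VP False f" for l using VP_SL[OF VP_self, of l] by simp
  have ff: "SX (SY f) - SY (SX f) = f [] *f f - t0 *f f"
    using cmf_rel[OF cm VP_self] by (simp add: tsel_def ev_def eq_diff_eq)
  fix V W :: "letter list"
  {
    assume "odd (length V)" "odd (length W)"
    then obtain V1 l P m where V: "V = l # V1" "even (length V1)" and W: "W = P @ [m]" "even (length P)"
      using odd_last odd_hd by meson
    define u where "u = ?s P (SL m f)"
    have u: "u \<in> VP False f" unfolding u_def by (rule VP_shS[OF W(2) fVP])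
    have "ev u = 0" using cm u parf_VP ev_odd unfolding cmf_def by blast
    have "?q LetterX LetterY u - ?q LetterY LetterX u + (t1 + 2 * t0) *f u
        = SX (SY u) - SY (SX u) + tsel t0 t1 False *f u"
      by (simp add: shq_simps tsel_def fun_pointwise algebra_simps)
    also have "\<dots> = 0" using cmf_rel[OF cm u] \<open>ev u = 0\<close> by simp
    finally have "ev (SL l (?s V1 (?q LetterX LetterY u - ?q LetterY LetterX u + (t1 + 2 * t0) *f u))) = 0"
      by (simp add: clinD[OF clin_SL] clinD[OF clin_shS[OF V(2)]] clfD[OF clf_ev])
    moreover have "r0 t0 f (V @ [a, b] @ W) = ev (SL l (?s V1 (?q a b u)))" for a b
      using r0_word[of "V1 @ [a, b] @ P" t0 f l m] V W by (simp add: shp_append shp_Cons2 u_def)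
    moreover have "r0 t0 f (V @ W) = ev (SL l (?s V1 u))"
      using r0_word[of "V1 @ P" t0 f l m] V W by (simp add: shp_append u_def)
    ultimately show "r0 t0 f (V @ [LetterX, LetterY] @ W) - r0 t0 f (V @ [LetterY, LetterX] @ W)
        + (t1 + 2 * t0) * r0 t0 f (V @ W) = 0"
      by (simp add: clinD[OF clin_SL] clinD[OF clin_shS[OF V(2)]] clfD[OF clf_ev])
  next
    assume V: "even (length V)" and W: "even (length W)"
    \<comment> \<open>An empty V or W leaves no pair on that side, so the boundary forms
      \<open>shq_left\<close> and \<open>shq_right\<close> of the quadratic relation take
      over.\<close>
    have "V = [] \<or> (\<exists>l U m. V = l # U @ [m] \<and> even (length U))" "W = [] \<or> (\<exists>l U m. W = l # U @ [m] \<and> even (length U))"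
      by (rule even_split[OF V], rule even_split[OF W])
    then consider (1) "V = []" "W = []" | (2) m P l where "V = []" "W = m # P @ [l]" "even (length P)"
      | (3) l V1 m where "V = l # V1 @ [m]" "even (length V1)" "W = []"
      | (4) k V1 l m P n where "V = k # V1 @ [l]" "even (length V1)" "W = m # P @ [n]" "even (length P)"
      by blast
    thus "r0 t0 f (V @ [LetterX, LetterY] @ W) - r0 t0 f (V @ [LetterY, LetterX] @ W)
        + (- t0) * r0 t0 f (V @ W) = r0 t0 f V * r0 t0 f W"
    proof cases
      case 1
      have w: "r0 t0 f [a, b] = ev (SL a (SL b f))" for a b using r0_word[of "[]" t0 f a b] by simp
      have "ev (SX (SY f)) - ev (SY (SX f)) = f [] * f [] - t0 * f []"
        using arg_cong[OF ff, of ev] by (simp add: clfD[OF clf_ev]) (simp add: ev_def)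
      thus ?thesis unfolding 1 by (simp add: w r0_Nil algebra_simps)
    next
      case 2
      define u where "u = ?s P (SL l f)"
      have u: "u \<in> VP False f" unfolding u_def by (rule VP_shS[OF 2(3) fVP])
      have z: "SL m u \<in> VP True f" using VP_SL[OF u, of m] by simp
      have w2: "r0 t0 f ([a, b] @ W) = ev (SL a (?q b m u))" for a b
        using r0_word[of "[b, m] @ P" t0 f a l] 2 by (simp add: shp_Cons2 u_def)
      have w1: "r0 t0 f W = ev (SL m u)" using r0_word[of P t0 f m l] 2 by (simp add: u_def)
      have "SX (?q LetterY m u) - SY (?q LetterX m u)
         = (SX (SY (SL m u)) - SY (SX (SL m u)) + tsel t0 t1 True *f SL m u)"
        unfolding shq_right[OF clin_SL clin_SL] Lx_SL by (simp add: tsel_def)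
      hence "ev (SX (?q LetterY m u)) - ev (SY (?q LetterX m u)) = ev (SL m u) * f []"
        unfolding cmf_rel[OF cm z] clfD(5)[OF clf_ev, symmetric] by (simp add: clfD[OF clf_ev]) (simp add: ev_def)
      thus ?thesis using w2 w1 by (simp add: 2(1) r0_Nil algebra_simps)
    next
      case 3
      have w2: "r0 t0 f (V @ [a, b]) = ev (SL l (?s V1 (?q m a (SL b f))))" for a b
        using r0_word[of "V1 @ [m, a]" t0 f l b] 3 by (simp add: shp_append shp_pair)
      have w1: "r0 t0 f V = ev (SL l (?s V1 (SL m f)))" using r0_word[of V1 t0 f l m] 3 by simp
      have "?q m LetterX (SY f) - ?q m LetterY (SX f) = f [] *f SL m f"
        unfolding shq_left[OF clin_SL clin_SL] Lx_SL ff by (simp add: clinD[OF clin_SL])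
      hence "ev (SL l (?s V1 (?q m LetterX (SY f) - ?q m LetterY (SX f)))) = f [] * ev (SL l (?s V1 (SL m f)))"
        by (simp add: clinD[OF clin_SL] clinD[OF clin_shS[OF 3(2)]] clfD[OF clf_ev])
      thus ?thesis using w2[of LetterX LetterY] w2[of LetterY LetterX] w1
        unfolding clinD[OF clin_SL] clinD[OF clin_shS[OF 3(2)]] clfD[OF clf_ev]
        by (simp add: 3(3) r0_Nil algebra_simps)
    next
      case 4
      define u where "u = ?s P (SL n f)"
      have u: "u \<in> VP False f" unfolding u_def by (rule VP_shS[OF 4(4) fVP])
      have z: "SL m u \<in> VP True f" using VP_SL[OF u, of m] by simp
      have w2: "r0 t0 f (V @ [a, b] @ W) = ev (SL k (?s V1 (?q l a (?q b m u))))" for a b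
        using r0_word[of "V1 @ [l, a, b, m] @ P" t0 f k n] 4 by (simp add: shp_append shp_Cons2 u_def)
      have w1: "r0 t0 f (V @ W) = ev (SL k (?s V1 (?q l m u)))"
        using r0_word[of "V1 @ [l, m] @ P" t0 f k n] 4 by (simp add: shp_append shp_Cons2 u_def)
      have wV: "r0 t0 f V = ev (SL k (?s V1 (SL l f)))" using r0_word[of V1 t0 f k l] 4 by simp
      have wW: "r0 t0 f W = ev (SL m u)" using r0_word[of P t0 f m n] 4 by (simp add: u_def)
      have "?q l LetterX (?q LetterY m u) - ?q l LetterY (?q LetterX m u) + (- t0) *f ?q l m u
          = SL l (SX (SY (SL m u)) - SY (SX (SL m u)) + tsel t0 t1 True *f SL m u)"
        unfolding shq_quadric[OF clin_SL clin_SL] Lx_SL by (simp add: tsel_def)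
      also have "\<dots> = ev (SL m u) *f SL l f" unfolding cmf_rel[OF cm z] by (simp add: clinD[OF clin_SL])
      finally have "ev (SL k (?s V1 (?q l LetterX (?q LetterY m u) - ?q l LetterY (?q LetterX m u) + (- t0) *f ?q l m u)))
          = ev (SL m u) * ev (SL k (?s V1 (SL l f)))"
        by (simp add: clinD[OF clin_SL] clinD[OF clin_shS[OF 4(2)]] clfD[OF clf_ev])
      thus ?thesis using w2[of LetterX LetterY] w2[of LetterY LetterX] w1 wV wW
        unfolding clinD[OF clin_SL] clinD[OF clin_shS[OF 4(2)]] clfD[OF clf_ev]
        by (simp add: mult.commute)
    qed
  }
qed

section \<open>Compatibility of the reflections with the moves\<close>

lemma stepX_pairs:
  assumes J: "clin J" and q: "\<And>l m u. J (sqS \<kappa> l m u) = sqS 0 l m (J u)"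
  shows "J (shq \<kappa> (\<lambda>u. SX u + c *f (SY ^^ (2 * k + 1)) u) SY l m u)
    = shq 0 (\<lambda>u. SX u + c *f (SY ^^ (2 * k + 1)) u) SY l m (J u)"
proof -
  have e: "J (SX (SX u)) = SX (SX (J u))" "J (SX (SY u) + \<kappa> *f u) = SX (SY (J u))"
    "J (SY (SX u) - \<kappa> *f u) = SY (SX (J u))" "J (SY (SY u)) = SY (SY (J u))" for u
    using q[of LetterX LetterX u] q[of LetterX LetterY u] q[of LetterY LetterX u] q[of LetterY LetterY u]
    by (simp_all add: shq_simps)
  note p = pair_shift[where A = SX and B = SY and A' = SX and B' = SY and J = J and \<kappa> = \<kappa>,
      OF clin_SL clin_SL clin_SL clin_SL J e]
  show ?thesis by (rule shq_cases[of _ l m]) (simp_all only: shq_simps p e fv.scale_zero_left add_0_right diff_0_right)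
qed

lemma stepY_pairs:
  assumes J: "clin J" and q: "\<And>l m u. J (sqS \<kappa> l m u) = sqS 0 l m (J u)"
  shows "J (shq \<kappa> SX (\<lambda>u. SY u + c *f (SX ^^ (2 * k + 1)) u) l m u)
    = shq 0 SX (\<lambda>u. SY u + c *f (SX ^^ (2 * k + 1)) u) l m (J u)"
proof -
  \<comment> \<open>Exchanging the letters exchanges the pairs XY and YX, so
    \<open>pair_shift\<close> is used with -\<kappa>.\<close>
  have e: "J (SY (SY u)) = SY (SY (J u))" "J (SY (SX u) + (- \<kappa>) *f u) = SY (SX (J u))"
    "J (SX (SY u) - (- \<kappa>) *f u) = SX (SY (J u))" "J (SX (SX u)) = SX (SX (J u))" for u
    using q[of LetterX LetterX u] q[of LetterX LetterY u] q[of LetterY LetterX u] q[of LetterY LetterY u]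
    by (simp_all add: shq_simps)
  have s: "x + (- \<kappa>) *f u = x - \<kappa> *f u" "x - (- \<kappa>) *f u = x + \<kappa> *f u" for x u :: wfun
    by simp_all
  note p = pair_shift[where A = SY and B = SX and A' = SY and B' = SX and J = J and \<kappa> = "- \<kappa>",
      OF clin_SL clin_SL clin_SL clin_SL J e, unfolded s]
  show ?thesis by (rule shq_cases[of _ l m]) (simp_all only: shq_simps p e[unfolded s] fv.scale_zero_left add_0_right diff_0_right)
qed

lemma fnl_reflect:
  assumes lin: "clin X" "clin Y" and J: "clin J"
    and q: "\<And>l m u. J (shq \<kappa> X Y l m u) = shq 0 X Y l m (J u)" and W: "even (length W)"
  shows "shS \<kappa> W (fnl X Y ev u) = fnl X Y ev (shp \<kappa> X Y W u)" "opw X Y W (J u) = J (shp \<kappa> X Y W u)"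
  using shp_intertwine[where J = "fnl X Y ev" and A = X and B = Y and A' = SX and B' = SY and \<kappa> = \<kappa> and u = u,
      OF clin_fnl[OF lin clf_ev] SX_fnl[symmetric] SY_fnl[symmetric] W]
    shp_intertwine_pairs[where J = J and A = X and B = Y and A' = X and B' = Y and \<kappa> = \<kappa> and \<nu> = 0 and \<mu> = 0 and u = u,
      OF J q W]
  by (simp_all add: shp_0[OF W])

text \<open>Both sides evaluate a word pair by pair: on the left by shifted pairs on f, on the right
  by plain pairs on \<open>J1 \<kappa> f\<close>. Hypothesis \<open>q\<close> identifies the
  two.\<close>

lemma J1_fnl:
  assumes lin: "clin X" "clin Y"
    and q: "\<And>l m u. J1 \<kappa> (shq \<kappa> X Y l m u) = shq 0 X Y l m (J1 \<kappa> u)"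
    and par: "parf True (fnl X Y ev (J1 \<kappa> f))"
  shows "J1 \<kappa> (fnl X Y ev f) = fnl X Y ev (J1 \<kappa> f)"
proof
  fix W
  show "J1 \<kappa> (fnl X Y ev f) W = fnl X Y ev (J1 \<kappa> f) W"
  proof (cases "even (length W)")
    case True
    note r = fnl_reflect[where X = X and Y = Y and J = "J1 \<kappa>" and \<kappa> = \<kappa> and u = f, OF lin clin_J1 q True]
    have "J1 \<kappa> (fnl X Y ev f) W = ev (shS \<kappa> W (fnl X Y ev f))" using True by (simp add: J1_def)
    also have "\<dots> = ev (opw X Y W (J1 \<kappa> f))" unfolding r by (simp add: ev_J1)
    finally show ?thesis by (simp add: fnl_def)
  next
    case False
    thus ?thesis using par by (simp add: J1_def parf_def)
  qed
qed

lemma SL_fnl': "SL l (fnl X Y w u) = fnl X Y w (Lx X Y l u)"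
  by (simp add: SL_fnl Lx_def)

text \<open>As for \<open>J1_fnl\<close>, with the last and the first letter of the word handled by
  \<open>right\<close> and \<open>left\<close>.\<close>

lemma r0_fnl:
  assumes lin: "clin X" "clin Y"
    and q: "\<And>l m u. J0 (- t) (shq (- t) X Y l m u) = shq 0 X Y l m (J0 (- t) u)"
    and left: "\<And>l u. ev (Lx X Y l (J0 (- t) u)) = ev (Lx X Y l u)"
    and right: "\<And>l. Lx X Y l (r0 t f) = J0 (- t) (Lx X Y l f)"
    and par: "parf True (fnl X Y ev (r0 t f))"
  shows "r0 t (fnl X Y ev f) = fnl X Y ev (r0 t f)"
proof
  fix W
  show "r0 t (fnl X Y ev f) W = fnl X Y ev (r0 t f) W"
  proof (cases "even (length W)")
    case True
    consider "W = []" | l U m where "W = l # U @ [m]" "even (length U)" using even_split[OF True] by blast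
    thus ?thesis
    proof cases
      case 1 thus ?thesis by (simp add: r0_Nil fnl_def ev_def)
    next
      case 2
      note r = fnl_reflect[where X = X and Y = Y and J = "J0 (- t)" and \<kappa> = "- t" and u = "Lx X Y m f", OF lin clin_J0 q 2(2)]
      have "r0 t (fnl X Y ev f) W = ev (SL l (shS (- t) U (SL m (fnl X Y ev f))))"
        using r0_word 2 by simp
      also have "\<dots> = ev (Lx X Y l (opw X Y U (Lx X Y m (r0 t f))))"
        unfolding SL_fnl' r right left by simp
      also have "\<dots> = fnl X Y ev (r0 t f) W"
        unfolding fnl_def 2(1) Lx_def by (simp add: opw_append[symmetric])
      finally show ?thesis .
    qed
  next
    case False
    thus ?thesis using par parf_r0[of t "fnl X Y ev f"] by (simp add: parf_def)
  qed
qed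

lemma J1_moveX: "cmf t0 t1 f \<Longrightarrow> J1 (- t1) (moveX c k f) = moveX c k (J1 (- t1) f)"
  unfolding moveX_def
  by (rule J1_fnl[where X = "\<lambda>u. SX u + c *f (SY ^^ (2 * k + 1)) u" and Y = SY and \<kappa> = "- t1", OF clin_step[OF clin_SL clin_SL] clin_SL stepX_pairs[where J = "J1 (- t1)" and \<kappa> = "- t1", OF clin_J1 J1_sq]])
    (use cmf_moveX[OF cmf_J1, of t0 t1 f c k] in \<open>simp add: cmf_def moveX_def\<close>)

lemma J1_moveY: "cmf t0 t1 f \<Longrightarrow> J1 (- t1) (moveY c k f) = moveY c k (J1 (- t1) f)"
  unfolding moveY_def
  by (rule J1_fnl[where X = SX and Y = "\<lambda>u. SY u + c *f (SX ^^ (2 * k + 1)) u" and \<kappa> = "- t1", OF clin_SL clin_step[OF clin_SL clin_SL] stepY_pairs[where J = "J1 (- t1)" and \<kappa> = "- t1", OF clin_J1 J1_sq]])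
    (use cmf_moveY[OF cmf_J1, of t0 t1 f c k] in \<open>simp add: cmf_def moveY_def\<close>)

lemma J0_even_pow: "(SL l ^^ (2 * k)) (J0 \<kappa> u) = J0 \<kappa> ((SL l ^^ (2 * k)) u)"
proof (induction k)
  case (Suc k)
  have "SL l (SL l (J0 \<kappa> v)) = J0 \<kappa> (SL l (SL l v))" for v
    using J0_sq[of \<kappa> l l v] by (cases l) (simp_all add: shq_simps)
  thus ?case using Suc by simp
qed simp

lemma J0_step_left:
  "ev (SL l (J0 \<kappa> u) + c *f (SL m ^^ (2 * k + 1)) (J0 \<kappa> u)) = ev (SL l u + c *f (SL m ^^ (2 * k + 1)) u)"
  by (simp add: clfD[OF clf_ev] ev_SL_J0 J0_even_pow)

lemma J0_step_right:
  "SL l (r0 t f) + c *f (SL m ^^ (2 * k + 1)) (r0 t f) = J0 (- t) (SL l f + c *f (SL m ^^ (2 * k + 1)) f)"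
proof -
  have o: "(SL m ^^ (2 * k + 1)) v = (SL m ^^ (2 * k)) (SL m v)" for v by (simp add: funpow_swap1)
  show ?thesis unfolding o r0_SL J0_even_pow clinD[OF clin_J0] ..
qed

lemma r0_moveX: "cmf t0 t1 f \<Longrightarrow> r0 t0 (moveX c k f) = moveX c k (r0 t0 f)"
  unfolding moveX_def
proof (rule r0_fnl[where X = "\<lambda>u. SX u + c *f (SY ^^ (2 * k + 1)) u" and Y = SY and t = t0, OF clin_step[OF clin_SL clin_SL] clin_SL stepX_pairs[where J = "J0 (- t0)" and \<kappa> = "- t0", OF clin_J0 J0_sq]])
  let ?X = "\<lambda>u. SX u + c *f (SY ^^ (2 * k + 1)) u"
  show "ev (Lx ?X SY l (J0 (- t0) u)) = ev (Lx ?X SY l u)" for l u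
    by (cases l) (simp_all only: Lx_simps J0_step_left ev_SL_J0)
  show "Lx ?X SY l (r0 t0 f) = J0 (- t0) (Lx ?X SY l f)" for l
    by (cases l) (simp_all only: Lx_simps J0_step_right, simp_all only: r0_SL)
  assume "cmf t0 t1 f"
  thus "parf True (fnl ?X SY ev (r0 t0 f))" using cmf_moveX[OF cmf_r0, of t0 t1 f c k] by (simp add: cmf_def moveX_def)
qed

lemma r0_moveY: "cmf t0 t1 f \<Longrightarrow> r0 t0 (moveY c k f) = moveY c k (r0 t0 f)"
  unfolding moveY_def
proof (rule r0_fnl[where X = SX and Y = "\<lambda>u. SY u + c *f (SX ^^ (2 * k + 1)) u" and t = t0, OF clin_SL clin_step[OF clin_SL clin_SL] stepY_pairs[where J = "J0 (- t0)" and \<kappa> = "- t0", OF clin_J0 J0_sq]])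
  let ?Y = "\<lambda>u. SY u + c *f (SX ^^ (2 * k + 1)) u"
  show "ev (Lx SX ?Y l (J0 (- t0) u)) = ev (Lx SX ?Y l u)" for l u
    by (cases l) (simp_all only: Lx_simps J0_step_left ev_SL_J0)
  show "Lx SX ?Y l (r0 t0 f) = J0 (- t0) (Lx SX ?Y l f)" for l
    by (cases l) (simp_all only: Lx_simps J0_step_right, simp_all only: r0_SL)
  assume "cmf t0 t1 f"
  thus "parf True (fnl SX ?Y ev (r0 t0 f))" using cmf_moveY[OF cmf_r0, of t0 t1 f c k] by (simp add: cmf_def moveY_def)
qed

lemma cmf_mequiv: "mequiv f g \<Longrightarrow> cmf t0 t1 f \<Longrightarrow> cmf t0 t1 g"
  by (induction rule: mequiv.induct) (simp_all add: cmf_moveX cmf_moveY)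

lemma mequiv_J1: "mequiv f g \<Longrightarrow> cmf t0 t1 f \<Longrightarrow> mequiv (J1 (- t1) f) (J1 (- t1) g)"
proof (induction rule: mequiv.induct)
  case (stepX g c k)
  show ?case using mequiv.stepX[OF stepX.IH[OF stepX.prems]]
    unfolding J1_moveX[OF cmf_mequiv[OF stepX.hyps stepX.prems]] .
next
  case (stepY g c k)
  show ?case using mequiv.stepY[OF stepY.IH[OF stepY.prems]]
    unfolding J1_moveY[OF cmf_mequiv[OF stepY.hyps stepY.prems]] .
qed (rule mequiv.base)

lemma mequiv_r0: "mequiv f g \<Longrightarrow> cmf t0 t1 f \<Longrightarrow> mequiv (r0 t0 f) (r0 t0 g)"
proof (induction rule: mequiv.induct)
  case (stepX g c k)
  show ?case using mequiv.stepX[OF stepX.IH[OF stepX.prems]]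
    unfolding r0_moveX[OF cmf_mequiv[OF stepX.hyps stepX.prems]] .
next
  case (stepY g c k)
  show ?case using mequiv.stepY[OF stepY.IH[OF stepY.prems]]
    unfolding r0_moveY[OF cmf_mequiv[OF stepY.hyps stepY.prems]] .
qed (rule mequiv.base)

section \<open>Dimensions after a reflection and the induction on them\<close>

lemma VP_False_le:
  assumes "has_dim (VP True f) n" shows "\<exists>m. has_dim (VP False f) m"
proof -
  obtain B where B: "finite B" "fv.span B = VP True f" using assms unfolding has_dim_def by blast
  have "VP False f \<subseteq> fv.span (SX ` B \<union> SY ` B)"
    unfolding VP_def
  proof (rule fv.span_minimal[OF _ fv.subspace_span], clarsimp)
    fix W :: "letter list" assume W: "odd (length W)"
    obtain l P where P: "W = l # P" "even (length P)" using odd_hd[OF W] by blast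
    have "opw SX SY P f \<in> fv.span B" using VP_base[of P True f] P(2) B(2) by simp
    hence "SL l (opw SX SY P f) \<in> fv.span (SL l ` B)" unfolding span_image_clin[OF clin_SL] by simp
    also have "\<dots> \<subseteq> fv.span (SX ` B \<union> SY ` B)" by (rule fv.span_mono, cases l) auto
    finally show "opw SX SY W f \<in> fv.span (SX ` B \<union> SY ` B)" unfolding P(1) by (cases l) simp_all
  qed
  moreover have "finite (SX ` B \<union> SY ` B)" using B(1) by simp
  ultimately obtain m where "has_dim (VP False f) m" using has_dim_finite_span[OF _ _ subspace_VP] by metis
  thus ?thesis ..
qed

lemma VP_True_le:
  assumes "has_dim (VP False f) n" shows "\<exists>m. has_dim (VP True f) m"
proof -
  obtain B where B: "finite B" "fv.span B = VP False f" using assms unfolding has_dim_def by blast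
  let ?T = "insert f (SX ` B \<union> SY ` B)"
  have "VP True f \<subseteq> fv.span ?T"
    unfolding VP_def
  proof (rule fv.span_minimal[OF _ fv.subspace_span], clarsimp)
    fix W :: "letter list" assume W: "even (length W)"
    show "opw SX SY W f \<in> fv.span ?T"
    proof (cases W)
      case Nil thus ?thesis by (simp add: fv.span_base)
    next
      case (Cons l P)
      have "opw SX SY P f \<in> fv.span B" using VP_base[of P False f] Cons W B(2) by simp
      hence "SL l (opw SX SY P f) \<in> fv.span (SL l ` B)" unfolding span_image_clin[OF clin_SL] by simp
      also have "\<dots> \<subseteq> fv.span ?T" by (rule fv.span_mono, cases l) auto
      finally show ?thesis unfolding Cons by (cases l) simp_all
    qed
  qed
  moreover have "finite ?T" using B(1) by simp
  ultimately obtain m where "has_dim (VP True f) m" using has_dim_finite_span[OF _ _ subspace_VP] by metis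
  thus ?thesis ..
qed

lemma VP_J1: "VP True (J1 \<kappa> f) = J1 \<kappa> ` VP True f"
proof
  show "VP True (J1 \<kappa> f) \<subseteq> J1 \<kappa> ` VP True f"
    unfolding VP_def[of True "J1 \<kappa> f"]
  proof (rule fv.span_minimal[OF _ subspace_image[OF clin_J1 subspace_VP]], clarsimp)
    fix W :: "letter list" assume W: "even (length W)"
    have "opw SX SY W (J1 \<kappa> f) = J1 \<kappa> (shS \<kappa> W f)" using J1_shift[OF W, of \<kappa> 0 f] shS_0[OF W] by simp
    thus "opw SX SY W (J1 \<kappa> f) \<in> J1 \<kappa> ` VP True f" using VP_shS[OF W VP_self] by simp
  qed
  show "J1 \<kappa> ` VP True f \<subseteq> VP True (J1 \<kappa> f)"
    unfolding VP_def[of True f] span_image_clin[OF clin_J1, symmetric]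
  proof (rule fv.span_minimal[OF _ subspace_VP], clarsimp)
    fix W :: "letter list" assume W: "even (length W)"
    have "J1 \<kappa> (opw SX SY W f) = shS (- \<kappa>) W (J1 \<kappa> f)" using J1_shift[OF W, of \<kappa> "- \<kappa>" f] shS_0[OF W] by simp
    thus "J1 \<kappa> (opw SX SY W f) \<in> VP True (J1 \<kappa> f)" using VP_shS[OF W VP_self] by simp
  qed
qed

lemma VP_r0: "VP False (r0 t f) = J0 (- t) ` VP False f"
proof
  have sf: "SL l g \<in> VP False g" for l g using VP_SL[OF VP_self] by simp
  show "VP False (r0 t f) \<subseteq> J0 (- t) ` VP False f"
    unfolding VP_def[of False "r0 t f"]
  proof (rule fv.span_minimal[OF _ subspace_image[OF clin_J0 subspace_VP]], clarsimp)
    fix W :: "letter list" assume W: "odd (length W)"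
    obtain P l where P: "W = P @ [l]" "even (length P)" using odd_last[OF W] by blast
    have "opw SX SY W (r0 t f) = opw SX SY P (SL l (r0 t f))" unfolding P(1) opw_append by (cases l) simp_all
    also have "\<dots> = J0 (- t) (shS (- t) P (SL l f))"
      unfolding r0_SL using J0_shift[OF P(2), of "- t" 0 "SL l f"] shS_0[OF P(2)] by simp
    finally show "opw SX SY W (r0 t f) \<in> J0 (- t) ` VP False f" using VP_shS[OF P(2) sf] by simp
  qed
  show "J0 (- t) ` VP False f \<subseteq> VP False (r0 t f)"
    unfolding VP_def[of False f] span_image_clin[OF clin_J0, symmetric]
  proof (rule fv.span_minimal[OF _ subspace_VP], clarsimp)
    fix W :: "letter list" assume W: "odd (length W)"
    obtain P l where P: "W = P @ [l]" "even (length P)" using odd_last[OF W] by blast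
    have "opw SX SY W f = opw SX SY P (SL l f)" unfolding P(1) opw_append by (cases l) simp_all
    hence "J0 (- t) (opw SX SY W f) = shS t P (SL l (r0 t f))"
      unfolding r0_SL using J0_shift[OF P(2), of "- t" t "SL l f"] shS_0[OF P(2)] by simp
    thus "J0 (- t) (opw SX SY W f) \<in> VP False (r0 t f)" using VP_shS[OF P(2) sf] by simp
  qed
qed

text \<open>The space at the framed vertex is transported injectively. The other dimension m follows
  from the trace identity: f [] is unchanged, so n0 (t0 + 2 t1) - m t1 = n0 t0 + n1 t1.\<close>

lemma cmdim_J1:
  assumes f: "cmdim t0 t1 n0 n1 f" and t1: "t1 \<noteq> 0"
  shows "\<exists>m. m + n1 = 2 * n0 \<and> cmdim (t0 + 2 * t1) (- t1) n0 m (J1 (- t1) f)"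
proof -
  have cm: "cmf t0 t1 f" and d: "has_dim (VP True f) n0" using f by (auto simp: cmdim_def)
  have "has_dim (VP True (J1 (- t1) f)) n0"
    unfolding VP_J1
  proof (rule has_dim_inj_image[OF clin_J1 d])
    fix u assume u: "u \<in> VP True f" "J1 (- t1) u = 0"
    have "parf True u" using cm u(1) parf_VP unfolding cmf_def by blast
    from J1_inverse[OF this, of "- t1"] show "u = 0" using u(2) clinD(3)[OF clin_J1] by simp
  qed
  moreover from VP_False_le[OF this] obtain m where "has_dim (VP False (J1 (- t1) f)) m" ..
  ultimately have g: "cmdim (t0 + 2 * t1) (- t1) n0 m (J1 (- t1) f)" using cmf_J1[OF cm] by (simp add: cmdim_def)
  have "J1 (- t1) f [] = f []" using ev_J1 by (simp add: ev_def)
  hence "of_nat n0 * (t0 + 2 * t1) + of_nat m * (- t1) = of_nat n0 * t0 + of_nat n1 * t1"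
    using trace_identity[OF g] trace_identity[OF f] by simp
  hence "(of_nat (m + n1) - of_nat (2 * n0)) * t1 = 0" by (simp add: algebra_simps)
  hence "(of_nat (m + n1) :: complex) = of_nat (2 * n0)" using t1 by (simp only: mult_eq_0_iff) simp
  hence "m + n1 = 2 * n0" by (simp only: of_nat_eq_iff)
  thus ?thesis using g by blast
qed

text \<open>As for \<open>cmdim_J1\<close>; the additional 1 comes from the change of f [] by -t0,
  the effect of the framing.\<close>

lemma cmdim_r0:
  assumes f: "cmdim t0 t1 n0 n1 f" and t0: "t0 \<noteq> 0"
  shows "\<exists>m. m + n0 = 2 * n1 + 1 \<and> cmdim (- t0) (t1 + 2 * t0) m n1 (r0 t0 f)"
proof -
  have cm: "cmf t0 t1 f" and d: "has_dim (VP False f) n1" using f by (auto simp: cmdim_def)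
  have "has_dim (VP False (r0 t0 f)) n1"
    unfolding VP_r0
  proof (rule has_dim_inj_image[OF clin_J0 d])
    fix u assume u: "u \<in> VP False f" "J0 (- t0) u = 0"
    have "parf False u" using cm u(1) parf_VP unfolding cmf_def by blast
    from J0_inverse[OF this, of "- t0"] show "u = 0" using u(2) clinD(3)[OF clin_J0] by simp
  qed
  moreover from VP_True_le[OF this] obtain m where "has_dim (VP True (r0 t0 f)) m" ..
  ultimately have g: "cmdim (- t0) (t1 + 2 * t0) m n1 (r0 t0 f)" using cmf_r0[OF cm] by (simp add: cmdim_def)
  have "of_nat m * (- t0) + of_nat n1 * (t1 + 2 * t0) = of_nat n0 * t0 + of_nat n1 * t1 - t0"
    using trace_identity[OF g] trace_identity[OF f] r0_Nil by simp
  hence "(of_nat (m + n0) - of_nat (2 * n1 + 1)) * t0 = 0" by (simp add: algebra_simps)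
  hence "(of_nat (m + n0) :: complex) = of_nat (2 * n1 + 1)" using t0 by (simp only: mult_eq_0_iff) simp
  hence "m + n0 = 2 * n1 + 1" by (simp only: of_nat_eq_iff)
  thus ?thesis using g by blast
qed

text \<open>Reflections permute the root hyperplanes: the index n goes to -n at the unframed vertex
  and to -n - 2 at the framed one.\<close>

lemma tau_regular_reflect:
  assumes "tau_regular t0 t1"
  shows "t0 \<noteq> 0" "t1 \<noteq> 0" "tau_regular (t0 + 2 * t1) (- t1)" "tau_regular (- t0) (t1 + 2 * t0)"
proof -
  have s: "t0 + t1 \<noteq> 0" and r: "of_int n * t0 + of_int (n + 1) * t1 \<noteq> 0" for n :: int
    using assms by (auto simp: tau_regular_def)
  show "t0 \<noteq> 0" "t1 \<noteq> 0" using r[of "-1"] r[of 0] by auto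
  have "of_int n * (t0 + 2 * t1) + of_int (n + 1) * (- t1) = - (of_int (- n) * t0 + of_int (- n + 1) * t1)" for n :: int
    by (simp add: algebra_simps)
  hence "of_int n * (t0 + 2 * t1) + of_int (n + 1) * (- t1) \<noteq> 0" for n :: int
    using r[of "- n"] by (metis neg_equal_0_iff_equal)
  thus "tau_regular (t0 + 2 * t1) (- t1)" unfolding tau_regular_def using s by (simp add: add.commute)
  have "of_int n * (- t0) + of_int (n + 1) * (t1 + 2 * t0) = - (of_int (- n - 2) * t0 + of_int (- n - 2 + 1) * t1)" for n :: int
    by (simp add: algebra_simps)
  hence "of_int n * (- t0) + of_int (n + 1) * (t1 + 2 * t0) \<noteq> 0" for n :: int
    using r[of "- n - 2"] by (metis neg_equal_0_iff_equal)
  moreover have "- t0 + (t1 + 2 * t0) \<noteq> 0" using s by (simp add: algebra_simps)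
  ultimately show "tau_regular (- t0) (t1 + 2 * t0)" unfolding tau_regular_def by blast
qed

theorem moves_transitive:
  "tau_regular t0 t1 \<Longrightarrow> cmdim t0 t1 n0 n1 f \<Longrightarrow> cmdim t0 t1 n0 n1 h \<Longrightarrow> mequiv f h"
\<comment> \<open>The reflection is taken at the larger vertex. A difference n1 - n0 = k turns into
  k in the opposite direction, and n0 - n1 = k into k - 1, so each reflection lowers this measure by
  exactly one.\<close>
proof (induction "if n0 > n1 then 2 * (n0 - n1) - 1 else 2 * (n1 - n0)" arbitrary: t0 t1 n0 n1 f h rule: less_induct)
  case less
  have cm: "cmf t0 t1 f" "cmf t0 t1 h" and par: "parf True f" "parf True h"
    using less(3,4) by (auto simp: cmdim_def cmf_def)
  note reg = tau_regular_reflect[OF less(2)]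
  consider "n0 = n1" | "n0 < n1" | "n0 > n1" by linarith
  thus ?case
  proof cases
    case 1 thus ?thesis using balanced_transitive less(2-4) by blast
  next
    case 2
    obtain m where m: "m + n1 = 2 * n0" "cmdim (t0 + 2 * t1) (- t1) n0 m (J1 (- t1) f)"
      using cmdim_J1[OF less(3) reg(2)] by blast
    obtain m' where m': "m' + n1 = 2 * n0" "cmdim (t0 + 2 * t1) (- t1) n0 m' (J1 (- t1) h)"
      using cmdim_J1[OF less(4) reg(2)] by blast
    have [simp]: "m' = m" using m(1) m'(1) by simp
    have "mequiv (J1 (- t1) f) (J1 (- t1) h)"
      by (rule less(1)[OF _ reg(3) m(2)]) (use m(1) m'(2) 2 in auto)
    from mequiv_J1[OF this, of "t0 + 2 * t1" "- t1"] show ?thesis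
      using m(2) J1_inverse[of f "- t1"] J1_inverse[of h "- t1"] par by (simp add: cmdim_def)
  next
    case 3
    obtain m where m: "m + n0 = 2 * n1 + 1" "cmdim (- t0) (t1 + 2 * t0) m n1 (r0 t0 f)"
      using cmdim_r0[OF less(3) reg(1)] by blast
    obtain m' where m': "m' + n0 = 2 * n1 + 1" "cmdim (- t0) (t1 + 2 * t0) m' n1 (r0 t0 h)"
      using cmdim_r0[OF less(4) reg(1)] by blast
    have [simp]: "m' = m" using m(1) m'(1) by simp
    have "mequiv (r0 t0 f) (r0 t0 h)"
      by (rule less(1)[OF _ reg(4) m(2)]) (use m(1) m'(2) 3 in auto)
    from mequiv_r0[OF this, of "- t0" "t1 + 2 * t0"] show ?thesis
      using m(2) r0_inverse[of f t0] r0_inverse[of h t0] par by (simp add: cmdim_def)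
  qed
qed

section \<open>Cyclicity and rigidity\<close>

definition pap :: "(('i \<Rightarrow> complex) \<Rightarrow> 'i \<Rightarrow> complex) \<Rightarrow> complex poly \<Rightarrow> ('i \<Rightarrow> complex) \<Rightarrow> 'i \<Rightarrow> complex" where
  "pap H p = fold_coeffs (\<lambda>a g u. a *f u + g (H u)) p (\<lambda>u. 0)"

lemma pap_0: "pap H 0 u = 0" by (simp add: pap_def)

lemma pap_pCons: "pap H (pCons a p) u = a *f u + pap H p (H u)"
  unfolding pap_def by (cases "a = 0"; cases "p = 0") simp_all

lemma clin_pap: assumes "clin H" shows "clin (pap H p)"
proof (induction p)
  case 0
  have "pap H 0 = (\<lambda>u. 0)" by (rule ext) (rule pap_0)
  thus ?case by (simp add: clin_zero)
next
  case (pCons a p)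
  have "pap H (pCons a p) = (\<lambda>u. a *f u + pap H p (H u))" by (rule ext) (rule pap_pCons)
  thus ?case using clin_plus[OF clin_scl[OF clin_id] clin_comp[OF pCons(2) assms], of a] by simp
qed

lemma pap_linear_factor:
  assumes "clin H" shows "pap H ([:- l, 1:] * q) u = pap H q (H u - l *f u)"
proof -
  have s: "pap H (smult c q) u = c *f pap H q u" for c u
    by (induction q arbitrary: u) (simp_all add: pap_0 pap_pCons fv.scale_right_distrib)
  have a: "pap H (q + r) u = pap H q u + pap H r u" for q r u
    by (induction q r arbitrary: u rule: poly_induct2)
      (simp_all add: pap_0 pap_pCons fv.scale_left_distrib algebra_simps)
  have "[:- l, 1:] * q = smult (- l) q + pCons 0 q" by simp
  thus ?thesis by (simp only: a s pap_pCons clinD[OF clin_pap[OF assms]]) simp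
qed

lemma pap_Poly: "pap H (Poly cs) u = (\<Sum>i<length cs. cs ! i *f (H ^^ i) u)"
proof (induction cs arbitrary: u)
  case (Cons z cs)
  show ?case by (simp only: Poly.simps pap_pCons Cons length_Cons sum.lessThan_Suc_shift)
      (simp add: funpow_swap1)
qed (simp add: pap_0)

text \<open>Some nonzero polynomial p satisfies p(H) u = 0. Split off a root l: either u is an
  eigenvector for l, or H u - l u is a nonzero vector killed by the quotient of smaller
  degree.\<close>

lemma eigenvector_exists:
  assumes H: "clin H" and S: "has_dim S n" and inv: "\<And>x. x \<in> S \<Longrightarrow> H x \<in> S"
    and u: "u \<in> S" "u \<noteq> 0"
  shows "\<exists>l x. x \<in> S \<and> x \<noteq> 0 \<and> H x = l *f x"
proof -
  note sub = has_dim_subspace[OF S]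
  have pw: "(H ^^ i) u \<in> S" for i by (induction i) (simp_all add: u inv)
  have "\<not> cindep (Suc n) (\<lambda>i. (H ^^ i) u)"
  proof
    assume "cindep (Suc n) (\<lambda>i. (H ^^ i) u)"
    from has_dim_le[OF cindep_has_dim[OF this] S] show False
      using fv.span_minimal[OF _ sub] pw by (metis image_subsetI not_less_eq_eq order_refl)
  qed
  then obtain c i where c: "(\<Sum>i<Suc n. c i *f (H ^^ i) u) = 0" "i < Suc n" "c i \<noteq> 0"
    unfolding cindep_def by blast
  let ?p = "Poly (map c [0..<Suc n])"
  have "pap H ?p u = 0" unfolding pap_Poly using c(1) by (simp del: upt_Suc)
  moreover have "coeff ?p i \<noteq> 0" using c by (simp add: nth_default_def del: upt_Suc)
  hence "?p \<noteq> 0" by (metis coeff_0)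
  ultimately obtain p where "pap H p u = 0" "p \<noteq> 0" by blast
  thus ?thesis using u
  proof (induction "degree p" arbitrary: p u)
    case 0
    then obtain a where "p = [:a:]" "a \<noteq> 0" by (metis degree_eq_zeroE pCons_0_0)
    thus ?case using 0 by (simp add: pap_pCons pap_0)
  next
    case (Suc d)
    have "\<not> constant (poly p)" using Suc(2) constant_degree[of p] by simp
    then obtain l where "poly p l = 0" using fundamental_theorem_of_algebra by blast
    then obtain q where q: "p = [:- l, 1:] * q" unfolding poly_eq_0_iff_dvd by (elim dvdE)
    have q0: "q \<noteq> 0" using q Suc(4) by auto
    have "degree ([:- l, 1:] * q) = Suc (degree q)" using q0 by (subst degree_mult_eq) auto
    hence d: "d = degree q" using Suc(2) q by simp
    let ?x = "H u - l *f u"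
    show ?case
    proof (cases "?x = 0")
      case True thus ?thesis using Suc(5,6) by auto
    next
      case False
      show ?thesis
        by (rule Suc(1)[OF d _ q0 _ False])
          (use Suc(3) q pap_linear_factor[OF H] inv[OF Suc(5)] Suc(5)
            in \<open>auto intro: fv.subspace_diff[OF sub] fv.subspace_scale[OF sub]\<close>)
    qed
  qed
qed

text \<open>Nonzero eigenvectors with distinct eigenvalues are independent, and S has no room for
  infinitely many.\<close>

lemma eigen_chain:
  assumes H: "clin H" and S: "has_dim S n" and x: "\<And>j. x j \<in> S"
    and e: "\<And>j. H (x j) = (a + of_nat j * d) *f x j" and d: "d \<noteq> 0"
  shows "\<exists>j. x j = 0"
proof (rule ccontr)
  assume nz: "\<nexists>j. x j = 0"
  have "cindep m x" for m
  proof (induction m)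
    case (Suc m)
    show ?case unfolding cindep_def
    proof (intro allI impI)
      fix c i assume z: "(\<Sum>i<Suc m. c i *f x i) = 0" and i: "i < Suc m"
      \<comment> \<open>Subtracting the last eigenvalue removes x m from the combination.\<close>
      have "H (\<Sum>i<Suc m. c i *f x i) - (a + of_nat m * d) *f (\<Sum>i<Suc m. c i *f x i)
          = (\<Sum>i<Suc m. (c i * (of_nat i - of_nat m) * d) *f x i)"
        unfolding clinD(6)[OF H] clinD(2)[OF H] e fv.scale_sum_right sum_subtractf[symmetric]
        by (rule sum.cong) (simp_all add: fun_pointwise algebra_simps)
      hence "(\<Sum>i<Suc m. (c i * (of_nat i - of_nat m) * d) *f x i) = 0"
        unfolding z clinD(3)[OF H] fv.scale_zero_right diff_0_right by (rule sym)
      hence "(\<Sum>i<m. (c i * (of_nat i - of_nat m) * d) *f x i) = 0" by simp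
      hence "\<forall>i<m. c i * (of_nat i - of_nat m) * d = 0"
        using Suc[unfolded cindep_def, rule_format, of "\<lambda>i. c i * (of_nat i - of_nat m) * d"] by simp
      hence c0: "\<forall>i<m. c i = 0" using d by auto
      hence "c m *f x m = 0" using z by simp
      hence "c m = 0" using nz by auto
      thus "c i = 0" using c0 i less_Suc_eq by blast
    qed
  qed (simp add: cindep_def)
  from has_dim_le[OF cindep_has_dim[OF this[of "Suc n"]] S]
  show False using fv.span_minimal[OF _ has_dim_subspace[OF S]] x
    by (metis image_subsetI not_less_eq_eq order_refl)
qed

text \<open>An eigenvector of \<open>BA\<close> in one parity yields a nonzero \<open>u\<close> with \<open>A u = 0\<close>, and then the \<open>B\<^sup>2\<^sup>j u\<close>
  are eigenvectors of \<open>BA\<close> with infinitely many eigenvalues: regularity keeps them from vanishing.\<close>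

lemma no_graded_module:
  fixes A B :: "('i \<Rightarrow> complex) \<Rightarrow> 'i \<Rightarrow> complex"
  assumes reg: "tau_regular t0 t1" and lin: "clin A" "clin B"
    and K: "\<And>p. has_dim (K p) (n p)"
    and AK: "\<And>p u. u \<in> K p \<Longrightarrow> A u \<in> K (\<not> p)" and BK: "\<And>p u. u \<in> K p \<Longrightarrow> B u \<in> K (\<not> p)"
    and rel: "\<And>p u. u \<in> K p \<Longrightarrow> A (B u) - B (A u) + tsel t0 t1 p *f u = 0"
    and u: "u \<in> K p"
  shows "u = 0"
proof (rule ccontr)
  assume u0: "u \<noteq> 0"
  have d: "t0 + t1 \<noteq> 0" using reg by (simp add: tau_regular_def)
  note lA = clinD[OF lin(1)] and lB = clinD[OF lin(2)]
  have BA: "clin (\<lambda>u. B (A u))" by (rule clin_comp[where A = B and B = A, OF lin(2) lin(1)])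
  have AB: "A (B x) = B (A x) - tsel t0 t1 q *f x" if "x \<in> K q" for q x
    using rel[OF that] by (simp add: algebra_simps eq_diff_eq)
  have ts: "tsel t0 t1 q + tsel t0 t1 (\<not> q) = t0 + t1" for q by (simp add: tsel_def)
  have "B (A y) \<in> K p" if "y \<in> K p" for y using BK[OF AK[OF that]] by simp
  from eigenvector_exists[where H = "\<lambda>u. B (A u)", OF BA K this u u0]
  obtain l x where x: "x \<in> K p" "x \<noteq> 0" "B (A x) = l *f x" by blast
  have Ax: "(A ^^ j) x \<in> K (p = even j)" for j
  proof (induction j)
    case (Suc j) thus ?case using AK[OF Suc] by (cases p; cases "even j") simp_all
  qed (simp add: x)
  have shift: "B (A (A y)) = (m + tsel t0 t1 (\<not> q)) *f A y" if "y \<in> K q" "B (A y) = m *f y" for q y m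
    using AB[OF AK[OF that(1)]] that(2) by (simp add: lA fv.scale_left_distrib algebra_simps eq_diff_eq)
  have ev: "B (A ((A ^^ (2 * j)) x)) = (l + of_nat j * (t0 + t1)) *f (A ^^ (2 * j)) x" for j
  proof (induction j)
    case (Suc j)
    have m: "(A ^^ (2 * j)) x \<in> K p" using Ax[of "2 * j"] by simp
    from shift[OF AK[OF m] shift[OF m Suc]]
    show ?case using ts[of p] by (simp add: algebra_simps)
  qed (simp add: x)
  have "(A ^^ (2 * j)) x \<in> K p" for j using Ax[of "2 * j"] by simp
  from eigen_chain[where H = "\<lambda>u. B (A u)" and x = "\<lambda>j. (A ^^ (2 * j)) x", OF BA K this ev d]
  obtain j where "(A ^^ (2 * j)) x = 0" by blast
  hence ex: "\<exists>j. (A ^^ j) x = 0" by blast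
  define m where "m = (LEAST j. (A ^^ j) x = 0)"
  have m: "(A ^^ m) x = 0" unfolding m_def by (rule LeastI_ex[OF ex])
  then obtain m' where m': "m = Suc m'" using x(2) by (cases m) auto
  \<comment> \<open>The last nonzero vector among the powers of A on x: A kills it.\<close>
  define y where "y = (A ^^ m') x"
  have y: "y \<noteq> 0" "A y = 0"
    using not_less_Least[of m' "\<lambda>j. (A ^^ j) x = 0"] m m' unfolding y_def m_def[symmetric] by auto
  obtain q where q: "y \<in> K q" using Ax unfolding y_def by blast
  \<comment> \<open>The sum of \<tau> over k alternating parities, beginning with that of y. Up to
    sign it is the factor by which A undoes B on the powers of B on y.\<close>
  define c where "c k = (if even k then of_nat (k div 2) * (t0 + t1) else of_nat (k div 2) * (t0 + t1) + tsel t0 t1 q)" for k :: nat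
  have cS: "c (Suc k) = c k + tsel t0 t1 (q = even k)" for k
    using ts[of q] by (cases "even k") (auto simp: c_def algebra_simps elim!: evenE oddE)
  have r: "of_int i * t0 + of_int (i + 1) * t1 \<noteq> 0" for i using reg by (simp add: tau_regular_def)
  have cn: "c (Suc k) \<noteq> 0" for k
  proof (cases "even k")
    case True
    then obtain i where i: "k = 2 * i" by (elim evenE)
    show ?thesis
    proof (cases q)
      case True
      \<comment> \<open>The sum (i + 1) t0 + i t1 is, up to sign, the regularity form with index -i
        - 1.\<close>
      have "c (Suc k) = - (of_int (- int i - 1) * t0 + of_int (- int i - 1 + 1) * t1)"
        unfolding c_def i tsel_def using True by (simp add: algebra_simps)
      thus ?thesis using r[of "- int i - 1"] by (metis neg_equal_0_iff_equal)
    next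
      case False
      have "c (Suc k) = of_int (int i) * t0 + of_int (int i + 1) * t1"
        unfolding c_def i tsel_def using False by (simp add: algebra_simps)
      thus ?thesis using r[of "int i"] by metis
    qed
  next
    case False
    then obtain i where i: "k = 2 * i + 1" by (elim oddE)
    have "c (Suc k) = of_nat (Suc i) * (t0 + t1)" unfolding c_def i by simp
    thus ?thesis using d by (simp only: mult_eq_0_iff of_nat_eq_0_iff) simp
  qed
  have By: "(B ^^ j) y \<in> K (q = even j)" for j
  proof (induction j)
    case (Suc j) thus ?case using BK[OF Suc] by (cases q; cases "even j") simp_all
  qed (simp add: q)
  have A1: "A ((B ^^ Suc k) y) = - (c (Suc k) *f (B ^^ k) y)" for k
  proof (induction k)
    case 0 show ?case using AB[OF q] y(2) cS[of 0] by (simp add: lB c_def)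
  next
    case (Suc k)
    have "A ((B ^^ Suc (Suc k)) y) = B (A ((B ^^ Suc k) y)) - tsel t0 t1 (q = even (Suc k)) *f (B ^^ Suc k) y"
      using AB[OF By[of "Suc k"]] by simp
    also have "\<dots> = - (c (Suc (Suc k)) *f (B ^^ Suc k) y)"
      unfolding Suc cS[of "Suc k"] by (simp add: lB fv.scale_left_distrib)
    finally show ?case .
  qed
  have nz: "(B ^^ k) y \<noteq> 0" for k
  proof (induction k)
    case (Suc k)
    show ?case
    proof
      assume "(B ^^ Suc k) y = 0"
      hence "c (Suc k) *f (B ^^ k) y = 0" using A1[of k] lA(3) by simp
      thus False using Suc cn by simp
    qed
  qed (simp add: y)
  have ev2: "B (A ((B ^^ (2 * j)) y)) = (0 + of_nat j * (- (t0 + t1))) *f (B ^^ (2 * j)) y" for j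
  proof (cases j)
    case 0 thus ?thesis using y lB(3) by simp
  next
    case (Suc i)
    have "c (Suc (2 * i + 1)) = of_nat j * (t0 + t1)" unfolding c_def Suc by simp
    hence "B (A ((B ^^ Suc (2 * i + 1)) y)) = - ((of_nat j * (t0 + t1)) *f B ((B ^^ (2 * i + 1)) y))"
      unfolding A1 by (simp only: lB)
    moreover have "B ((B ^^ (2 * i + 1)) y) = (B ^^ (2 * j)) y" "Suc (2 * i + 1) = 2 * j" unfolding Suc by simp_all
    ultimately show ?thesis by (simp only: add_0_left mult_minus_right fv.scale_minus_left)
  qed
  have "(B ^^ (2 * j)) y \<in> K q" for j using By[of "2 * j"] by simp
  moreover have "- (t0 + t1) \<noteq> 0" using d by (simp only: neg_equal_0_iff_equal not_False_eq_True)
  ultimately obtain j where "(B ^^ (2 * j)) y = 0"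
    using eigen_chain[where H = "\<lambda>u. B (A u)" and x = "\<lambda>j. (B ^^ (2 * j)) y" and a = 0 and d = "- (t0 + t1)",
      OF BA K[of q] _ ev2] by blast
  thus False using nz by simp
qed

section \<open>Representations by matrices, their cyclicity and rigidity\<close>

definition mop :: "nat \<Rightarrow> (nat \<Rightarrow> nat \<Rightarrow> complex) \<Rightarrow> (nat \<Rightarrow> complex) \<Rightarrow> nat \<Rightarrow> complex" where
  "mop N a u = (\<lambda>i. if i < N then \<Sum>j<N. a i j * u j else 0)"

definition dotp :: "nat \<Rightarrow> (nat \<Rightarrow> complex) \<Rightarrow> (nat \<Rightarrow> complex) \<Rightarrow> complex" where
  "dotp N w u = (\<Sum>i<N. w i * u i)"

definition unitf :: "nat \<Rightarrow> nat \<Rightarrow> complex" where "unitf j = (\<lambda>i. if i = j then 1 else 0)"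

lemma clin_mop: "clin (mop N a)"
  unfolding clin_def mop_def
  by (auto simp: fun_pointwise distrib_left sum.distrib sum_distrib_left mult.left_commute)

lemma clf_dotp: "clf (dotp N w)"
  unfolding clf_def dotp_def
  by (auto simp: fun_pointwise distrib_left sum.distrib sum_distrib_left mult.left_commute)

lemma mop_unitf: "j < N \<Longrightarrow> mop N a (unitf j) = (\<lambda>i. if i < N then a i j else 0)"
  unfolding mop_def unitf_def by (auto simp: fun_eq_iff if_distrib cong: if_cong)

lemma dotp_unitf: "j < N \<Longrightarrow> dotp N w (unitf j) = w j"
  unfolding dotp_def unitf_def by (simp add: if_distrib cong: if_cong)

lemma dotp_commute: "dotp N u v = dotp N v u" by (simp add: dotp_def mult.commute)

lemma mop_mop: "mop N a (mop N b u) = mop N (\<lambda>i j. \<Sum>k<N. a i k * b k j) u"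
proof
  fix i
  have "(\<Sum>k<N. a i k * (\<Sum>j<N. b k j * u j)) = (\<Sum>j<N. (\<Sum>k<N. a i k * b k j) * u j)"
    unfolding sum_distrib_left sum_distrib_right by (subst sum.swap) (simp add: mult.assoc)
  thus "mop N a (mop N b u) i = mop N (\<lambda>i j. \<Sum>k<N. a i k * b k j) u i" by (simp add: mop_def)
qed

lemma dotp_mop: "dotp N g (mop N a u) = dotp N (mop N (\<lambda>i j. a j i) g) u"
proof -
  have "(\<Sum>i<N. g i * (\<Sum>j<N. a i j * u j)) = (\<Sum>j<N. (\<Sum>i<N. a i j * g i) * u j)"
    unfolding sum_distrib_left sum_distrib_right by (subst sum.swap) (simp add: mult.assoc mult.left_commute)
  thus ?thesis by (simp add: dotp_def mop_def)
qed

text \<open>The quiver relation in matrix entries. P marks the coordinates that belong to the framed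
  vertex, and t0 is the value of \<tau> there.\<close>

locale graded_rep =
  fixes N :: nat and P :: "nat \<Rightarrow> bool" and a b :: "nat \<Rightarrow> nat \<Rightarrow> complex"
    and v w :: "nat \<Rightarrow> complex" and t0 t1 :: complex
  assumes reg: "tau_regular t0 t1"
    and a_par: "\<And>i j. i < N \<Longrightarrow> j < N \<Longrightarrow> P i = P j \<Longrightarrow> a i j = 0"
    and b_par: "\<And>i j. i < N \<Longrightarrow> j < N \<Longrightarrow> P i = P j \<Longrightarrow> b i j = 0"
    and v_par: "\<And>i. v i \<noteq> 0 \<Longrightarrow> i < N \<and> P i" and w_par: "\<And>i. w i \<noteq> 0 \<Longrightarrow> i < N \<and> P i"
    and rel: "\<And>i j. i < N \<Longrightarrow> j < N \<Longrightarrow> (\<Sum>k<N. a i k * b k j) - (\<Sum>k<N. b i k * a k j)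
      + (if i = j then tsel t0 t1 (P i) else 0) = v i * w j"
begin

definition E where "E p = {u :: nat \<Rightarrow> complex. \<forall>i. u i \<noteq> 0 \<longrightarrow> i < N \<and> P i = p}"

abbreviation "AA \<equiv> mop N a"
abbreviation "BB \<equiv> mop N b"
abbreviation "ww \<equiv> dotp N w"
definition J where "J = fnl AA BB ww"
definition \<phi> where "\<phi> = J v"

lemma subspace_E: "fv.subspace (E p)"
  by (rule fv.subspaceI) (auto simp: E_def fun_pointwise, (metis add.right_neutral)+)

lemma unitf_E: "j < N \<Longrightarrow> unitf j \<in> E (P j)" by (auto simp: E_def unitf_def split: if_splits)

lemma E_expand: "u \<in> E p \<Longrightarrow> u = (\<Sum>j\<in>{j. j < N \<and> P j = p}. u j *f unitf j)"
  by (rule ext) (auto simp: sum_fun_apply scl_apply unitf_def E_def if_distrib cong: if_cong)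

lemma E_span: "E p = fv.span (unitf ` {j. j < N \<and> P j = p})"
proof
  show "E p \<subseteq> fv.span (unitf ` {j. j < N \<and> P j = p})"
  proof
    fix u assume "u \<in> E p"
    from E_expand[OF this] show "u \<in> fv.span (unitf ` {j. j < N \<and> P j = p})"
      by (elim ssubst) (intro fv.span_sum fv.span_scale fv.span_base, auto)
  qed
  show "fv.span (unitf ` {j. j < N \<and> P j = p}) \<subseteq> E p"
    by (rule fv.span_minimal[OF _ subspace_E]) (use unitf_E in auto)
qed

lemma has_dim_E: "has_dim (E p) (card {j. j < N \<and> P j = p})"
proof -
  let ?I = "{j. j < N \<and> P j = p}"
  have i: "inj_on unitf ?I" by (rule inj_onI) (metis unitf_def zero_neq_one)
  have "fv.independent (unitf ` ?I)"
    unfolding fv.independent_explicit_finite_subsets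
  proof (intro allI impI ballI)
    fix S u x assume S: "S \<subseteq> unitf ` ?I" "finite S" "(\<Sum>s\<in>S. u s *f s) = 0" and x: "x \<in> S"
    then obtain j where j: "x = unitf j" "j < N" by blast
    have "0 = (\<Sum>s\<in>S. u s *f s) j" using S(3) by (simp add: fun_pointwise)
    also have "\<dots> = (\<Sum>s\<in>S. if s = x then u s else 0)"
      unfolding sum_fun_apply scl_apply
    proof (rule sum.cong[OF HOL.refl])
      fix s assume "s \<in> S"
      then obtain k where "s = unitf k" using S(1) by blast
      moreover have "unitf k = unitf j \<longleftrightarrow> k = j" by (metis unitf_def zero_neq_one)
      ultimately show "u s * s j = (if s = x then u s else 0)" by (auto simp: j(1)) (simp_all add: unitf_def)
    qed
    finally show "u x = 0" using S(2) x by simp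
  qed
  thus ?thesis unfolding has_dim_def E_span using card_image[OF i] by (intro exI[of _ "unitf ` ?I"]) simp
qed

lemma sub_has_dim: "fv.subspace K \<Longrightarrow> K \<subseteq> E p \<Longrightarrow> \<exists>n. has_dim K n"
proof -
  assume s: "fv.subspace K" "K \<subseteq> E p"
  have "finite (unitf ` {j. j < N \<and> P j = p})" by simp
  from has_dim_finite_span[OF this s(2)[unfolded E_span] s(1)] show ?thesis by blast
qed

lemma mop_E:
  assumes c: "\<And>i j. i < N \<Longrightarrow> j < N \<Longrightarrow> P i = P j \<Longrightarrow> c i j = 0" and u: "u \<in> E p"
  shows "mop N c u \<in> E (\<not> p)"
proof -
  have "mop N c u i = 0" if "i < N" "P i = p" for i
    unfolding mop_def using that u c[OF that(1)] by (auto simp: E_def intro!: sum.neutral)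
  thus ?thesis unfolding E_def by (auto simp: mop_def split: if_splits)
qed

lemma AA_E: "u \<in> E p \<Longrightarrow> AA u \<in> E (\<not> p)" by (rule mop_E) (simp_all add: a_par)

lemma BB_E: "u \<in> E p \<Longrightarrow> BB u \<in> E (\<not> p)" by (rule mop_E) (simp_all add: b_par)

lemma AT_E: "u \<in> E p \<Longrightarrow> mop N (\<lambda>i j. a j i) u \<in> E (\<not> p)"
  by (rule mop_E) (simp_all add: a_par)

lemma BT_E: "u \<in> E p \<Longrightarrow> mop N (\<lambda>i j. b j i) u \<in> E (\<not> p)"
  by (rule mop_E) (simp_all add: b_par)

lemma v_E: "v \<in> E True" and w_E: "w \<in> E True"
  using v_par w_par by (auto simp: E_def)

lemma mop_rel: assumes "u \<in> E p" shows "AA (BB u) - BB (AA u) + tsel t0 t1 p *f u = ww u *f v"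
proof
  fix i
  show "(AA (BB u) - BB (AA u) + tsel t0 t1 p *f u) i = (ww u *f v) i"
  proof (cases "i < N")
    case True
    have "(AA (BB u) - BB (AA u)) i = (\<Sum>j<N. ((\<Sum>k<N. a i k * b k j) - (\<Sum>k<N. b i k * a k j)) * u j)"
      unfolding mop_mop using True by (simp add: fun_pointwise mop_def sum_subtractf left_diff_distrib)
    also have "\<dots> = (\<Sum>j<N. (v i * w j - (if i = j then tsel t0 t1 (P i) else 0)) * u j)"
      by (rule sum.cong[OF HOL.refl]) (use rel[OF True] in \<open>simp add: eq_diff_eq\<close>)
    also have "\<dots> = v i * ww u - tsel t0 t1 (P i) * u i"
      using True unfolding left_diff_distrib sum_subtractf
      by (simp add: dotp_def sum_distrib_left mult.assoc if_distrib[of "\<lambda>x. x * _"] cong: if_cong)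
    finally have e: "(AA (BB u) - BB (AA u)) i = v i * ww u - tsel t0 t1 (P i) * u i" .
    have "P i = p \<or> u i = 0" using assms by (auto simp: E_def)
    thus ?thesis using e by (auto simp: fun_pointwise)
  next
    case False
    have "v i = 0" "u i = 0" using False v_par assms by (auto simp: E_def)
    thus ?thesis using False by (simp add: fun_pointwise mop_def)
  qed
qed

lemma ww_odd: "u \<in> E False \<Longrightarrow> ww u = 0"
  unfolding dotp_def using w_par by (intro sum.neutral) (force simp: E_def)

lemma clin_J: "clin J" unfolding J_def by (rule clin_fnl[OF clin_mop clin_mop clf_dotp])

lemma J_AA: "J (AA u) = SX (J u)" and J_BB: "J (BB u) = SY (J u)" and ev_J: "ev (J u) = ww u"
  by (simp_all add: J_def SX_fnl SY_fnl)

lemma J_opw: "J (opw AA BB W u) = opw SX SY W (J u)"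
  by (rule opw_intertwine[where J = J]) (rule J_AA J_BB)+

text \<open>The kernel of J is a graded submodule on which w vanishes, so the relation has no
  rank-one term there and \<open>no_graded_module\<close> applies. This is cocyclicity.\<close>

lemma J_inj: assumes "u \<in> E p" "J u = 0" shows "u = 0"
proof -
  let ?K = "\<lambda>p. {u \<in> E p. J u = 0}"
  have s: "fv.subspace (?K p)" for p
    by (rule fv.subspaceI) (auto simp: clinD[OF clin_J] intro: fv.subspace_0 fv.subspace_add fv.subspace_scale subspace_E)
  have "\<exists>n. has_dim (?K p) n" for p by (rule sub_has_dim[OF s]) auto
  hence "has_dim (?K p) (SOME n. has_dim (?K p) n)" for p by (rule someI_ex)
  note K = this
  show ?thesis
    by (rule no_graded_module[where A = AA and B = BB and K = ?K and u = u and p = p, OF reg clin_mop clin_mop K])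
      (use assms in \<open>auto simp: AA_E BB_E J_AA J_BB clinD[OF clin_SL] mop_rel ev_J[symmetric] clfD[OF clf_ev]\<close>)
qed

definition C where "C p = fv.span {opw AA BB W v | W. even (length W) = p}"

lemma opw_E: "opw AA BB W v \<in> E (even (length W))"
  by (rule opw_parity[where E = E, OF v_E AA_E BB_E])

lemma C_E: "C p \<subseteq> E p"
  unfolding C_def by (rule fv.span_minimal[OF _ subspace_E]) (use opw_E in auto)

lemma C_step: assumes "x \<in> C p" shows "AA x \<in> C (\<not> p)" "BB x \<in> C (\<not> p)"
proof -
  have "opw AA BB (l # W) v \<in> C (\<not> p)" if "even (length W) = p" for l W
    unfolding C_def by (rule fv.span_base) (use that in auto)
  from this[of _ LetterX] this[of _ LetterY]
  have "AA s \<in> C (\<not> p)" "BB s \<in> C (\<not> p)" if "s \<in> {opw AA BB W v | W. even (length W) = p}" for s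
    using that by auto
  thus "AA x \<in> C (\<not> p)" "BB x \<in> C (\<not> p)"
    using clin_span_mem[where A = AA and W = "C (\<not> p)", OF clin_mop] clin_span_mem[where A = BB and W = "C (\<not> p)", OF clin_mop]
      assms unfolding C_def by (blast intro: fv.subspace_span)+
qed

text \<open>The annihilator of the cyclic part is a module for the transposed matrices in exchanged order.\<close>

lemma C_eq: "C p = E p"
proof (rule antisym[OF C_E])
  let ?A = "mop N (\<lambda>i j. b j i)" and ?B = "mop N (\<lambda>i j. a j i)"
  define K where "K p = {g \<in> E p. \<forall>x\<in>C p. dotp N g x = 0}" for p
  have T: "dotp N (?A g) x = dotp N g (BB x)" "dotp N (?B g) x = dotp N g (AA x)" for g x
    by (rule dotp_mop[symmetric])+
  have lg: "clf (\<lambda>g. dotp N g x)" for x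
  proof -
    have "(\<lambda>g. dotp N g x) = dotp N x" by (rule ext) (rule dotp_commute)
    thus ?thesis using clf_dotp[of N x] by simp
  qed
  have s: "fv.subspace (K p)" for p
    unfolding K_def by (rule fv.subspaceI) (auto simp: clfD[OF lg] intro: fv.subspace_0 fv.subspace_add fv.subspace_scale subspace_E)
  have "\<exists>n. has_dim (K p) n" for p by (rule sub_has_dim[OF s]) (auto simp: K_def)
  hence n: "has_dim (K p) (SOME n. has_dim (K p) n)" for p by (rule someI_ex)
  have K0: "g = 0" if g: "g \<in> K p" for g p
  proof (rule no_graded_module[where A = ?A and B = ?B and K = K and n = "\<lambda>p. SOME n. has_dim (K p) n" and u = g and p = p,
        OF reg clin_mop clin_mop n])
    show "g \<in> K p" by (rule g)
  next
    fix q u assume u: "u \<in> K q"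
    have uE: "u \<in> E q" and uC: "\<And>x. x \<in> C q \<Longrightarrow> dotp N u x = 0" using u by (auto simp: K_def)
    show "?A u \<in> K (\<not> q)"
      unfolding K_def
    proof (intro CollectI conjI ballI BT_E[OF uE])
      fix x assume "x \<in> C (\<not> q)"
      hence "BB x \<in> C q" using C_step(2)[of x "\<not> q"] by simp
      thus "dotp N (?A u) x = 0" unfolding T by (rule uC)
    qed
    show "?B u \<in> K (\<not> q)"
      unfolding K_def
    proof (intro CollectI conjI ballI AT_E[OF uE])
      fix x assume "x \<in> C (\<not> q)"
      hence "AA x \<in> C q" using C_step(1)[of x "\<not> q"] by simp
      thus "dotp N (?B u) x = 0" unfolding T by (rule uC)
    qed
    show "?A (?B u) - ?B (?A u) + tsel t0 t1 q *f u = 0" (is "?z = 0")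
    proof
      fix j
      have zE: "?z \<in> E q" using uE BT_E[OF AT_E[OF uE]] AT_E[OF BT_E[OF uE]]
        by (auto intro!: fv.subspace_add[OF subspace_E] fv.subspace_diff[OF subspace_E] fv.subspace_scale[OF subspace_E])
      show "?z j = 0 j"
      proof (cases "j < N \<and> P j = q")
        case True
        have e: "unitf j \<in> E q" using unitf_E True by blast
        have "?z j = dotp N ?z (unitf j)" using dotp_unitf True by simp
        also have "\<dots> = dotp N u (AA (BB (unitf j)) - BB (AA (unitf j)) + tsel t0 t1 q *f unitf j)"
          by (simp add: clfD[OF lg] clfD[OF clf_dotp] T)
        also have "\<dots> = ww (unitf j) * dotp N u v" unfolding mop_rel[OF e] by (simp add: clfD[OF clf_dotp])
        also have "\<dots> = 0"
        proof (cases q)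
          case True
          have "v \<in> C True" unfolding C_def by (rule fv.span_base) (auto intro: exI[of _ "[]"])
          thus ?thesis using uC True by simp
        next
          case False thus ?thesis using ww_odd e by simp
        qed
        finally show ?thesis by (simp add: fun_pointwise)
      next
        case False thus ?thesis using zE by (auto simp: E_def fun_pointwise)
      qed
    qed
  qed
  show "E p \<subseteq> C p"
  proof (rule ccontr)
    assume "\<not> E p \<subseteq> C p"
    then obtain x where x: "x \<in> E p" "x \<notin> C p" by blast
    obtain h where h: "clf h" "\<And>s. s \<in> C p \<Longrightarrow> h s = 0" "h x = 1"
      using separating_functional[OF x(2)[unfolded C_def]] unfolding C_def by blast
    define g where "g = (\<lambda>j. if j < N \<and> P j = p then h (unitf j) else 0)"
    \<comment> \<open>The coordinates g represent h on the vertex space and are 0 elsewhere, so g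
      annihilates the cyclic part and lies in K.\<close>
    have gh: "dotp N g u = h u" if "u \<in> E p" for u
    proof -
      have "h u = (\<Sum>j\<in>{j. j < N \<and> P j = p}. h (u j *f unitf j))"
        using arg_cong[OF E_expand[OF that], of h] by (simp only: clfD(6)[OF h(1)])
      also have "\<dots> = (\<Sum>j\<in>{j. j < N \<and> P j = p}. g j * u j)"
        by (rule sum.cong) (simp_all add: g_def clfD[OF h(1)] mult.commute)
      also have "\<dots> = dotp N g u" unfolding dotp_def by (rule sum.mono_neutral_left) (auto simp: g_def)
      finally show ?thesis by simp
    qed
    have "g \<in> K p" using gh h(2) C_E[of p] by (auto simp: K_def E_def) (auto simp: g_def split: if_splits)
    hence "g = 0" by (rule K0)
    thus False using gh[OF x(1)] h(3) by (simp add: dotp_def fun_pointwise)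
  qed
qed

lemma VP_phi: "VP p \<phi> = J ` E p"
proof -
  have "{opw SX SY W \<phi> | W. even (length W) = p} = J ` {opw AA BB W v | W. even (length W) = p}"
    unfolding \<phi>_def J_opw[symmetric] by blast
  thus ?thesis unfolding VP_def by (simp only: span_image_clin[OF clin_J] C_def[symmetric] C_eq)
qed

lemma cmf_phi: "cmf t0 t1 \<phi>"
  unfolding \<phi>_def J_def
  by (rule cmf_fnl[where E = E, OF clin_mop clin_mop clf_dotp v_E AA_E BB_E ww_odd mop_rel])

lemma has_dim_phi: "has_dim (VP p \<phi>) (card {j. j < N \<and> P j = p})"
  unfolding VP_phi by (rule has_dim_inj_image[OF clin_J has_dim_E]) (rule J_inj)

lemma cmdim_phi: "cmdim t0 t1 (card {j. j < N \<and> P j}) (card {j. j < N \<and> \<not> P j}) \<phi>"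
  using cmf_phi has_dim_phi[of True] has_dim_phi[of False] by (simp add: cmdim_def)

end

text \<open>Two cyclic and cocyclic representations with the same functional are isomorphic, by an
  isomorphism that is given on a basis by its effect on functionals.\<close>

lemma graded_rep_iso:
  assumes r: "graded_rep N P a b v w t0 t1" and r': "graded_rep N P a' b' v' w' t0 t1"
    and eq: "graded_rep.\<phi> N a b v w = graded_rep.\<phi> N a' b' v' w'"
  shows "\<exists>th. (\<forall>j<N. \<forall>i. th i j \<noteq> 0 \<longrightarrow> i < N \<and> P i = P j) \<and>
    (\<forall>p. \<forall>u\<in>graded_rep.E N P p. mop N th u \<in> graded_rep.E N P p \<and>
      graded_rep.J N a' b' w' (mop N th u) = graded_rep.J N a b w u)"
proof -
  interpret r: graded_rep N P a b v w t0 t1 by (rule r)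
  interpret r': graded_rep N P a' b' v' w' t0 t1 by (rule r')
  have "r.J ` r.E p = r'.J ` r.E p" for p using r.VP_phi[of p] r'.VP_phi[of p] eq by simp
  hence "\<exists>y. y \<in> r.E (P j) \<and> r'.J y = r.J (unitf j)" if "j < N" for j
    using r.unitf_E[OF that] by (metis (no_types, lifting) imageE imageI)
  then obtain y where y: "\<And>j. j < N \<Longrightarrow> y j \<in> r.E (P j) \<and> r'.J (y j) = r.J (unitf j)" by metis
  define th where "th i j = y j i" for i j
  have m: "mop N th u = (\<Sum>j\<in>{j. j < N \<and> P j = p}. u j *f y j)" if u: "u \<in> r.E p" for p u
  proof
    fix i
    have "mop N th u i = (if i < N then \<Sum>j\<in>{j. j < N \<and> P j = p}. y j i * u j else 0)"
      unfolding mop_def th_def using u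
      by (auto simp: r.E_def intro!: sum.mono_neutral_right)
    also have "\<dots> = (\<Sum>j\<in>{j. j < N \<and> P j = p}. y j i * u j)"
    proof (cases "i < N")
      case False
      have "y j i = 0" if "j < N" for j using y[OF that] False by (auto simp: r.E_def)
      thus ?thesis using False by simp
    qed simp
    finally show "mop N th u i = (\<Sum>j\<in>{j. j < N \<and> P j = p}. u j *f y j) i"
      by (simp add: sum_fun_apply scl_apply mult.commute)
  qed
  have "mop N th u \<in> r.E p \<and> r'.J (mop N th u) = r.J u" if u: "u \<in> r.E p" for p u
  proof
    show "mop N th u \<in> r.E p" unfolding m[OF u]
      by (intro fv.subspace_sum[OF r.subspace_E] fv.subspace_scale[OF r.subspace_E]) (use y in auto)
    have "r'.J (mop N th u) = (\<Sum>j\<in>{j. j < N \<and> P j = p}. u j *f r.J (unitf j))"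
      unfolding m[OF u] clinD(6)[OF r'.clin_J] clinD(2)[OF r'.clin_J] by (rule sum.cong) (simp_all add: y)
    also have "\<dots> = r.J u"
      unfolding clinD(6)[OF r.clin_J, symmetric] clinD(2)[OF r.clin_J, symmetric] r.E_expand[OF u, symmetric] ..
    finally show "r'.J (mop N th u) = r.J u" .
  qed
  moreover have "\<forall>j<N. \<forall>i. th i j \<noteq> 0 \<longrightarrow> i < N \<and> P i = P j" using y by (auto simp: r.E_def th_def)
  ultimately show ?thesis by blast
qed

text \<open>All identities are tested on unit vectors after passing to functionals, where th and ka
  become the identity; \<open>J_inj\<close> brings the equalities back.\<close>

lemma graded_rep_rigid:
  assumes r: "graded_rep N P a b v w t0 t1" and r': "graded_rep N P a' b' v' w' t0 t1"
    and eq: "graded_rep.\<phi> N a b v w = graded_rep.\<phi> N a' b' v' w'"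
  obtains th ka where "\<And>i j. i < N \<Longrightarrow> j < N \<Longrightarrow> P i \<noteq> P j \<Longrightarrow> th i j = 0 \<and> ka i j = 0"
    "\<And>i j. i < N \<Longrightarrow> j < N \<Longrightarrow> (\<Sum>k<N. th i k * ka k j) = (if i = j then 1 else 0)"
    "\<And>i j. i < N \<Longrightarrow> j < N \<Longrightarrow> (\<Sum>k<N. ka i k * th k j) = (if i = j then 1 else 0)"
    "\<And>i j. i < N \<Longrightarrow> j < N \<Longrightarrow> (\<Sum>k<N. th i k * a k j) = (\<Sum>k<N. a' i k * th k j)"
    "\<And>i j. i < N \<Longrightarrow> j < N \<Longrightarrow> (\<Sum>k<N. th i k * b k j) = (\<Sum>k<N. b' i k * th k j)"
    "\<And>i. i < N \<Longrightarrow> (\<Sum>k<N. th i k * v k) = v' i"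
    "\<And>j. j < N \<Longrightarrow> (\<Sum>k<N. w' k * th k j) = w j"
proof -
  interpret r: graded_rep N P a b v w t0 t1 by (rule r)
  interpret r': graded_rep N P a' b' v' w' t0 t1 by (rule r')
  obtain th where th0: "\<And>j i. j < N \<Longrightarrow> th i j \<noteq> 0 \<Longrightarrow> i < N \<and> P i = P j"
    and th: "\<And>p u. u \<in> r.E p \<Longrightarrow> mop N th u \<in> r.E p \<and> r'.J (mop N th u) = r.J u"
    using graded_rep_iso[OF r r' eq] by blast
  obtain ka where ka0: "\<And>j i. j < N \<Longrightarrow> ka i j \<noteq> 0 \<Longrightarrow> i < N \<and> P i = P j"
    and ka: "\<And>p u. u \<in> r.E p \<Longrightarrow> mop N ka u \<in> r.E p \<and> r.J (mop N ka u) = r'.J u"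
    using graded_rep_iso[OF r' r eq[symmetric]] by blast
  have thE: "u \<in> r.E p \<Longrightarrow> mop N th u \<in> r.E p" and kaE: "u \<in> r.E p \<Longrightarrow> mop N ka u \<in> r.E p"
    and thJ: "u \<in> r.E p \<Longrightarrow> r'.J (mop N th u) = r.J u" and kaJ: "u \<in> r.E p \<Longrightarrow> r.J (mop N ka u) = r'.J u" for p u
    using th ka by blast+
  have inj: "x = y" if "x \<in> r.E p" "y \<in> r.E p" "r.J x = r.J y" for x y p
    using r.J_inj[of "x - y" p] that fv.subspace_diff[OF r.subspace_E] by (simp add: clinD[OF r.clin_J])
  have inj': "x = y" if "x \<in> r.E p" "y \<in> r.E p" "r'.J x = r'.J y" for x y p
    using r'.J_inj[of "x - y" p] that fv.subspace_diff[OF r.subspace_E] by (simp add: clinD[OF r'.clin_J])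
  have mm: "mop N c (mop N d (unitf j)) i = (\<Sum>k<N. c i k * d k j)" if "i < N" "j < N" for c d i j
    unfolding mop_mop using that by (simp add: mop_unitf)
  have ent: "(\<Sum>k<N. c i k * d k j) = (\<Sum>k<N. c' i k * d' k j)"
    if "mop N c (mop N d (unitf j)) = mop N c' (mop N d' (unitf j))" "i < N" "j < N" for c d c' d' i j
    using fun_cong[OF that(1), of i] unfolding mm[OF that(2,3)] .
  have id: "(\<Sum>k<N. c i k * d k j) = (if i = j then 1 else 0)"
    if "mop N c (mop N d (unitf j)) = unitf j" "i < N" "j < N" for c d i j
    using fun_cong[OF that(1), of i] unfolding mm[OF that(2,3)] by (simp add: unitf_def)
  show ?thesis
  proof (rule that[of th ka])
    fix i j assume ij: "i < N" "j < N"
    have e: "unitf j \<in> r.E (P j)" by (rule r.unitf_E[OF ij(2)])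
    show "th i j = 0 \<and> ka i j = 0" if "P i \<noteq> P j" using th0[OF ij(2)] ka0[OF ij(2)] that by blast
    show "(\<Sum>k<N. th i k * ka k j) = (if i = j then 1 else 0)"
      by (rule id[OF _ ij], rule inj'[of _ "P j"])
        (simp_all only: e kaE[OF e] thE[OF kaE[OF e]] thJ[OF kaE[OF e]] kaJ[OF e])
    show "(\<Sum>k<N. ka i k * th k j) = (if i = j then 1 else 0)"
      by (rule id[OF _ ij], rule inj[of _ "P j"])
        (simp_all only: e thE[OF e] kaE[OF thE[OF e]] kaJ[OF thE[OF e]] thJ[OF e])
    show "(\<Sum>k<N. th i k * a k j) = (\<Sum>k<N. a' i k * th k j)"
      by (rule ent[OF _ ij], rule inj'[of _ "\<not> P j"])
        (simp_all only: thE[OF r.AA_E[OF e]] r'.AA_E[OF thE[OF e]] thJ[OF r.AA_E[OF e]] thJ[OF e] r'.J_AA r.J_AA)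
    show "(\<Sum>k<N. th i k * b k j) = (\<Sum>k<N. b' i k * th k j)"
      by (rule ent[OF _ ij], rule inj'[of _ "\<not> P j"])
        (simp_all only: thE[OF r.BB_E[OF e]] r'.BB_E[OF thE[OF e]] thJ[OF r.BB_E[OF e]] thJ[OF e] r'.J_BB r.J_BB)
  next
    fix i assume i: "i < N"
    have "mop N th v = v'" by (rule inj'[of _ True]) (use thE[OF r.v_E] thJ[OF r.v_E] r'.v_E eq in \<open>simp_all add: r.\<phi>_def r'.\<phi>_def\<close>)
    from fun_cong[OF this, of i] show "(\<Sum>k<N. th i k * v k) = v' i" using i by (simp add: mop_def)
    have e: "unitf i \<in> r.E (P i)" by (rule r.unitf_E[OF i])
    have "r'.ww (mop N th (unitf i)) = r.ww (unitf i)" unfolding r.ev_J[symmetric] r'.ev_J[symmetric] thJ[OF e] ..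
    thus "(\<Sum>k<N. w' k * th k i) = w i" using i by (simp add: mop_unitf dotp_unitf) (simp add: dotp_def)
  qed
qed

section \<open>Orbits of quadruples\<close>

definition ent :: "complex mat \<Rightarrow> nat \<Rightarrow> nat \<Rightarrow> complex" where "ent M = (\<lambda>i j. M $$ (i, j))"
definition colf :: "nat \<Rightarrow> complex mat \<Rightarrow> nat \<Rightarrow> complex" where "colf N v = (\<lambda>i. if i < N then v $$ (i, 0) else 0)"
definition rowf :: "nat \<Rightarrow> complex mat \<Rightarrow> nat \<Rightarrow> complex" where "rowf N w = (\<lambda>j. if j < N then w $$ (0, j) else 0)"

fun qcar :: "nat \<Rightarrow> quadruple \<Rightarrow> bool" where
  "qcar N (X, Y, v, w) \<longleftrightarrow> X \<in> carrier_mat N N \<and> Y \<in> carrier_mat N N \<and> v \<in> carrier_mat N 1 \<and> w \<in> carrier_mat 1 N"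

fun qphi :: "nat \<Rightarrow> quadruple \<Rightarrow> wfun" where
  "qphi N (X, Y, v, w) = fnl (mop N (ent X)) (mop N (ent Y)) (dotp N (rowf N w)) (colf N v)"

lemma mop_cong: "(\<And>i j. i < N \<Longrightarrow> j < N \<Longrightarrow> a i j = b i j) \<Longrightarrow> mop N a u = mop N b u"
  unfolding mop_def by (rule ext) simp

lemma mult_ent:
  assumes "A \<in> carrier_mat n N" "B \<in> carrier_mat N m" "i < n" "j < m"
  shows "(A * B) $$ (i, j) = (\<Sum>k<N. A $$ (i, k) * B $$ (k, j))"
  using assms by (auto simp: scalar_prod_def lessThan_atLeast0 intro!: sum.cong)

lemma mop_mult:
  assumes "A \<in> carrier_mat N N" "B \<in> carrier_mat N N"
  shows "mop N (ent (A * B)) u = mop N (ent A) (mop N (ent B) u)"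
  unfolding mop_mop by (rule mop_cong) (simp add: ent_def mult_ent[OF assms])

lemma mop_restrict: "mop N a (\<lambda>i. if i < N then u i else 0) = mop N a u"
  unfolding mop_def by (rule ext) (auto intro: sum.cong)

lemma mop_one: "mop N (ent (1\<^sub>m N)) u = (\<lambda>i. if i < N then u i else 0)"
  unfolding mop_def ent_def by (rule ext) (simp add: if_distrib[of "\<lambda>x. x * _"] cong: if_cong)

lemma colf_mult:
  assumes "A \<in> carrier_mat N N" "v \<in> carrier_mat N 1"
  shows "colf N (A * v) = mop N (ent A) (colf N v)"
  unfolding colf_def mop_def ent_def by (rule ext) (simp add: mult_ent[OF assms] cong: if_cong)

lemma rowf_mult:
  assumes "w \<in> carrier_mat 1 N" "A \<in> carrier_mat N N"
  shows "dotp N (rowf N (w * A)) u = dotp N (rowf N w) (mop N (ent A) u)"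
proof -
  have "dotp N (rowf N (w * A)) u = dotp N (mop N (\<lambda>i j. ent A j i) (rowf N w)) u"
    unfolding dotp_def rowf_def mop_def ent_def
    by (rule sum.cong) (simp_all add: mult_ent[OF assms] mult.commute)
  thus ?thesis unfolding dotp_mop .
qed

definition GLp :: "nat \<Rightarrow> nat \<Rightarrow> complex mat \<Rightarrow> complex mat \<Rightarrow> bool" where
  "GLp n0 n1 P Q \<longleftrightarrow> (\<exists>(a0, b0) \<in> GL_pairs n0. \<exists>(a1, b1) \<in> GL_pairs n1.
       P = four_block_mat a0 (0\<^sub>m n0 n1) (0\<^sub>m n1 n0) a1 \<and>
       Q = four_block_mat b0 (0\<^sub>m n0 n1) (0\<^sub>m n1 n0) b1)"

lemma GL_orbit_iff:
  "(X', Y', v', w') \<in> GL_orbit n0 n1 (X, Y, v, w) \<longleftrightarrow>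
    (\<exists>P Q. GLp n0 n1 P Q \<and> X' = P * X * Q \<and> Y' = P * Y * Q \<and> v' = P * v \<and> w' = w * Q)"
proof -
  have "GL_orbit n0 n1 (X, Y, v, w) = {(P * X * Q, P * Y * Q, P * v, w * Q) | P Q. GLp n0 n1 P Q}"
    by (simp add: GL_orbit_def GLp_def)
  thus ?thesis by blast
qed

lemma mult_mat_regroup:
  fixes A B C D Z :: "complex mat"
  assumes "A \<in> carrier_mat n n" "B \<in> carrier_mat n n" "C \<in> carrier_mat n n" "D \<in> carrier_mat n n"
  shows "(A * B) * (C * D) = A * (B * C) * D"
    and "Z \<in> carrier_mat n n \<Longrightarrow> A * (B * Z * C) * D = (A * B) * Z * (C * D)"
proof -
  have r: "(A * E) * (C * D) = A * (E * C) * D" if "E \<in> carrier_mat n n" for E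
    using assms that assoc_mult_mat[of A n n E n "C * D" n] assoc_mult_mat[of E n n C n D n]
      assoc_mult_mat[of A n n "E * C" n D n] by simp
  show "(A * B) * (C * D) = A * (B * C) * D" by (rule r[OF assms(2)])
  assume Z: "Z \<in> carrier_mat n n"
  show "A * (B * Z * C) * D = (A * B) * Z * (C * D)"
    using r[of "B * Z"] assoc_mult_mat[OF assms(1,2) Z] assms Z by simp
qed

lemma four_block_one: "four_block_mat (1\<^sub>m n0) (0\<^sub>m n0 n1) (0\<^sub>m n1 n0) (1\<^sub>m n1) = 1\<^sub>m (n0 + n1)"
  by (rule eq_matI) auto

lemma four_block_diag_mult:
  fixes a0 :: "complex mat"
  assumes "a0 \<in> carrier_mat n0 n0" "b0 \<in> carrier_mat n0 n0" "a1 \<in> carrier_mat n1 n1" "b1 \<in> carrier_mat n1 n1"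
  shows "four_block_mat a0 (0\<^sub>m n0 n1) (0\<^sub>m n1 n0) a1 * four_block_mat b0 (0\<^sub>m n0 n1) (0\<^sub>m n1 n0) b1
    = four_block_mat (a0 * b0) (0\<^sub>m n0 n1) (0\<^sub>m n1 n0) (a1 * b1)"
  by (subst mult_four_block_mat[OF assms(1) zero_carrier_mat zero_carrier_mat assms(3)
        assms(2) zero_carrier_mat zero_carrier_mat assms(4)]) (use assms in simp)

lemma GL_pairsD:
  assumes "(a, b) \<in> GL_pairs n"
  shows "a \<in> carrier_mat n n" "b \<in> carrier_mat n n" "a * b = 1\<^sub>m n" "b * a = 1\<^sub>m n"
  using assms by (auto simp: GL_pairs_def inverts_mat_def)

lemma GL_pairsI: "a \<in> carrier_mat n n \<Longrightarrow> b \<in> carrier_mat n n \<Longrightarrow> a * b = 1\<^sub>m n \<Longrightarrow> b * a = 1\<^sub>m n \<Longrightarrow> (a, b) \<in> GL_pairs n"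
  by (auto simp: GL_pairs_def inverts_mat_def)

lemma GLpE:
  assumes "GLp n0 n1 P Q"
  obtains a0 b0 a1 b1 where "(a0, b0) \<in> GL_pairs n0" "(a1, b1) \<in> GL_pairs n1"
    "P = four_block_mat a0 (0\<^sub>m n0 n1) (0\<^sub>m n1 n0) a1" "Q = four_block_mat b0 (0\<^sub>m n0 n1) (0\<^sub>m n1 n0) b1"
  using assms unfolding GLp_def by blast

lemma GLpI:
  assumes "(a0, b0) \<in> GL_pairs n0" "(a1, b1) \<in> GL_pairs n1"
  shows "GLp n0 n1 (four_block_mat a0 (0\<^sub>m n0 n1) (0\<^sub>m n1 n0) a1) (four_block_mat b0 (0\<^sub>m n0 n1) (0\<^sub>m n1 n0) b1)"
  using assms unfolding GLp_def by blast

lemma GLpD: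
  assumes "GLp n0 n1 P Q"
  shows "P \<in> carrier_mat (n0 + n1) (n0 + n1)" "Q \<in> carrier_mat (n0 + n1) (n0 + n1)"
    "P * Q = 1\<^sub>m (n0 + n1)" "Q * P = 1\<^sub>m (n0 + n1)"
proof -
  obtain a0 b0 a1 b1 where g: "(a0, b0) \<in> GL_pairs n0" "(a1, b1) \<in> GL_pairs n1"
    "P = four_block_mat a0 (0\<^sub>m n0 n1) (0\<^sub>m n1 n0) a1" "Q = four_block_mat b0 (0\<^sub>m n0 n1) (0\<^sub>m n1 n0) b1"
    using GLpE[OF assms] by metis
  note d0 = GL_pairsD[OF g(1)] and d1 = GL_pairsD[OF g(2)]
  show "P \<in> carrier_mat (n0 + n1) (n0 + n1)" "Q \<in> carrier_mat (n0 + n1) (n0 + n1)" using d0 d1 g by auto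
  show "P * Q = 1\<^sub>m (n0 + n1)" "Q * P = 1\<^sub>m (n0 + n1)"
    unfolding g four_block_diag_mult[OF d0(1,2) d1(1,2)] four_block_diag_mult[OF d0(2,1) d1(2,1)] d0 d1 four_block_one
    by (rule HOL.refl)+
qed

lemma GLp_one: "GLp n0 n1 (1\<^sub>m (n0 + n1)) (1\<^sub>m (n0 + n1))"
  using GLpI[of "1\<^sub>m n0" "1\<^sub>m n0" n0 "1\<^sub>m n1" "1\<^sub>m n1" n1] by (simp add: GL_pairsI four_block_one)

lemma GLp_swap: "GLp n0 n1 P Q \<Longrightarrow> GLp n0 n1 Q P"
  by (elim GLpE) (auto simp: GL_pairs_def intro!: GLpI)

lemma GLp_mult: assumes "GLp n0 n1 P Q" "GLp n0 n1 P' Q'" shows "GLp n0 n1 (P' * P) (Q * Q')"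
proof -
  obtain a0 b0 a1 b1 where g: "(a0, b0) \<in> GL_pairs n0" "(a1, b1) \<in> GL_pairs n1"
    "P = four_block_mat a0 (0\<^sub>m n0 n1) (0\<^sub>m n1 n0) a1" "Q = four_block_mat b0 (0\<^sub>m n0 n1) (0\<^sub>m n1 n0) b1"
    using GLpE[OF assms(1)] by metis
  obtain c0 d0 c1 d1 where h: "(c0, d0) \<in> GL_pairs n0" "(c1, d1) \<in> GL_pairs n1"
    "P' = four_block_mat c0 (0\<^sub>m n0 n1) (0\<^sub>m n1 n0) c1" "Q' = four_block_mat d0 (0\<^sub>m n0 n1) (0\<^sub>m n1 n0) d1"
    using GLpE[OF assms(2)] by metis
  have m: "(c * a, b * d) \<in> GL_pairs n" if "(a, b) \<in> GL_pairs n" "(c, d) \<in> GL_pairs n" for a b c d n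
  proof (rule GL_pairsI)
    note p = GL_pairsD[OF that(1)] and q = GL_pairsD[OF that(2)]
    show "c * a \<in> carrier_mat n n" "b * d \<in> carrier_mat n n" using p q by auto
    have "(c * a) * (b * d) = c * (a * b) * d" by (rule mult_mat_regroup(1)[OF q(1) p(1,2) q(2)])
    thus "(c * a) * (b * d) = 1\<^sub>m n" using p q by simp
    have "(b * d) * (c * a) = b * (d * c) * a" by (rule mult_mat_regroup(1)[OF p(2) q(2,1) p(1)])
    thus "(b * d) * (c * a) = 1\<^sub>m n" using p q by simp
  qed
  note g0 = GL_pairsD[OF g(1)] and g1 = GL_pairsD[OF g(2)] and h0 = GL_pairsD[OF h(1)] and h1 = GL_pairsD[OF h(2)]
  show ?thesis
    unfolding g(3,4) h(3,4) four_block_diag_mult[OF h0(1) g0(1) h1(1) g1(1)] four_block_diag_mult[OF g0(2) h0(2) g1(2) h1(2)]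
    by (rule GLpI) (rule m[OF g(1) h(1)], rule m[OF g(2) h(2)])
qed

lemma GL_orbit_self: assumes "qcar (n0 + n1) p" shows "p \<in> GL_orbit n0 n1 p"
proof -
  obtain X Y v w where p: "p = (X, Y, v, w)" by (cases p)
  show ?thesis unfolding p GL_orbit_iff
    by (rule exI[of _ "1\<^sub>m (n0 + n1)"], rule exI[of _ "1\<^sub>m (n0 + n1)"]) (use assms GLp_one in \<open>auto simp: p\<close>)
qed

lemma GL_orbit_trans:
  assumes "qcar (n0 + n1) p" "q \<in> GL_orbit n0 n1 p" "r \<in> GL_orbit n0 n1 q" shows "r \<in> GL_orbit n0 n1 p"
proof -
  obtain X Y v w where p: "p = (X, Y, v, w)" by (cases p)
  obtain X' Y' v' w' where q: "q = (X', Y', v', w')" by (cases q)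
  obtain X2 Y2 v2 w2 where r: "r = (X2, Y2, v2, w2)" by (cases r)
  obtain P Q where g: "GLp n0 n1 P Q" "X' = P * X * Q" "Y' = P * Y * Q" "v' = P * v" "w' = w * Q"
    using assms(2) unfolding p q GL_orbit_iff by blast
  obtain P' Q' where h: "GLp n0 n1 P' Q'" "X2 = P' * X' * Q'" "Y2 = P' * Y' * Q'" "v2 = P' * v'" "w2 = w' * Q'"
    using assms(3) unfolding q r GL_orbit_iff by blast
  note c = GLpD(1,2)[OF g(1)] GLpD(1,2)[OF h(1)]
  have m: "P' * (P * Z * Q) * Q' = (P' * P) * Z * (Q * Q')" if "Z \<in> carrier_mat (n0 + n1) (n0 + n1)" for Z
    by (rule mult_mat_regroup(2)[OF c(3,1,2,4) that])
  show ?thesis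
    unfolding p r GL_orbit_iff
    by (rule exI[of _ "P' * P"], rule exI[of _ "Q * Q'"])
      (use GLp_mult[OF g(1) h(1)] g h assms(1) c in \<open>auto simp: p m\<close>)
qed

lemma GL_orbit_sym:
  assumes "qcar (n0 + n1) p" "q \<in> GL_orbit n0 n1 p" shows "p \<in> GL_orbit n0 n1 q" "qcar (n0 + n1) q"
proof -
  obtain X Y v w where p: "p = (X, Y, v, w)" by (cases p)
  obtain X' Y' v' w' where q: "q = (X', Y', v', w')" by (cases q)
  obtain P Q where g: "GLp n0 n1 P Q" "X' = P * X * Q" "Y' = P * Y * Q" "v' = P * v" "w' = w * Q"
    using assms(2) unfolding p q GL_orbit_iff by blast
  note c = GLpD[OF g(1)]
  have car: "X \<in> carrier_mat (n0 + n1) (n0 + n1)" "Y \<in> carrier_mat (n0 + n1) (n0 + n1)"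
    "v \<in> carrier_mat (n0 + n1) 1" "w \<in> carrier_mat 1 (n0 + n1)" using assms(1) p by auto
  show "qcar (n0 + n1) q" using car c g q by auto
  have m: "Q * (P * Z * Q) * P = (Q * P) * Z * (Q * P)" if "Z \<in> carrier_mat (n0 + n1) (n0 + n1)" for Z
    by (rule mult_mat_regroup(2)[OF c(2,1,2,1) that])
  have m': "Q * (P * Z * Q) * P = Z" if "Z \<in> carrier_mat (n0 + n1) (n0 + n1)" for Z
    unfolding m[OF that] c using that by simp
  have "Q * (P * v) = v" using c car assoc_mult_mat[OF c(2) c(1) car(3)] by simp
  moreover have "w * Q * P = w" using c car assoc_mult_mat[OF car(4) c(2) c(1)] by simp
  ultimately show "p \<in> GL_orbit n0 n1 q"
    unfolding p q GL_orbit_iff using GLp_swap[OF g(1)] g m'[OF car(1)] m'[OF car(2)] by metis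
qed

lemma GL_orbit_eq:
  assumes "qcar (n0 + n1) p" "q \<in> GL_orbit n0 n1 p" shows "GL_orbit n0 n1 q = GL_orbit n0 n1 p"
  using GL_orbit_trans[OF assms] GL_orbit_sym[OF assms] GL_orbit_trans[of n0 n1 q p] by blast

lemma qphi_orbit:
  assumes "qcar (n0 + n1) p" "q \<in> GL_orbit n0 n1 p" shows "qphi (n0 + n1) q = qphi (n0 + n1) p"
proof -
  let ?N = "n0 + n1"
  obtain X Y v w where p: "p = (X, Y, v, w)" by (cases p)
  obtain X' Y' v' w' where q: "q = (X', Y', v', w')" by (cases q)
  obtain P Q where g: "GLp n0 n1 P Q" "X' = P * X * Q" "Y' = P * Y * Q" "v' = P * v" "w' = w * Q"
    using assms(2) unfolding p q GL_orbit_iff by blast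
  note c = GLpD[OF g(1)]
  have car: "X \<in> carrier_mat ?N ?N" "Y \<in> carrier_mat ?N ?N" "v \<in> carrier_mat ?N 1" "w \<in> carrier_mat 1 ?N"
    using assms(1) p by auto
  have QP: "mop ?N (ent Q) (mop ?N (ent P) u) = (\<lambda>i. if i < ?N then u i else 0)" for u
    using mop_mult[OF c(2,1), of u] unfolding c(4) mop_one by simp
  have i: "mop ?N (ent P) (mop ?N (ent Z) u) = mop ?N (ent (P * Z * Q)) (mop ?N (ent P) u)"
    if "Z \<in> carrier_mat ?N ?N" for Z u
    using that c(1,2)
    by (simp add: mop_mult[where A = "P * Z"] mop_mult[where A = P and B = Z] QP mop_restrict del: assoc_mult_mat)
  have d: "dotp ?N (rowf ?N (w * Q)) (mop ?N (ent P) u) = dotp ?N (rowf ?N w) u" for u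
    unfolding rowf_mult[OF car(4) c(2)] QP by (simp add: dotp_def)
  show ?thesis
    unfolding p q g(2-5) qphi.simps colf_mult[OF c(1) car(3)]
    by (rule fnl_intertwine[where J = "mop ?N (ent P)"]) (rule i[OF car(1)], rule i[OF car(2)], rule d)
qed

text \<open>Holds exactly for the coordinates of the framed vertex: the first n0 of them if
  \<epsilon> = 0, the remaining ones otherwise.\<close>

definition bpar :: "nat \<Rightarrow> nat \<Rightarrow> nat \<Rightarrow> bool" where "bpar n0 \<epsilon> i \<longleftrightarrow> (i < n0) = (\<epsilon> = 0)"

text \<open>The support condition makes both matrices block diagonal; since they are inverse to each
  other, so are their blocks, as \<open>GL_pairs\<close> asks.\<close>

lemma orbit_from_intertwiner:
  fixes th ka :: "nat \<Rightarrow> nat \<Rightarrow> complex" and n0 n1 :: nat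
  defines "N \<equiv> n0 + n1"
  assumes car: "qcar N (X, Y, v, w)" "qcar N (X', Y', v', w')"
    and blk: "\<And>i j. i < N \<Longrightarrow> j < N \<Longrightarrow> bpar n0 \<epsilon> i \<noteq> bpar n0 \<epsilon> j \<Longrightarrow> th i j = 0 \<and> ka i j = 0"
    and inv: "\<And>i j. i < N \<Longrightarrow> j < N \<Longrightarrow> (\<Sum>k<N. th i k * ka k j) = (if i = j then 1 else 0)"
      "\<And>i j. i < N \<Longrightarrow> j < N \<Longrightarrow> (\<Sum>k<N. ka i k * th k j) = (if i = j then 1 else 0)"
    and X: "\<And>i j. i < N \<Longrightarrow> j < N \<Longrightarrow> (\<Sum>k<N. th i k * ent X k j) = (\<Sum>k<N. ent X' i k * th k j)"
    and Y: "\<And>i j. i < N \<Longrightarrow> j < N \<Longrightarrow> (\<Sum>k<N. th i k * ent Y k j) = (\<Sum>k<N. ent Y' i k * th k j)"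
    and v: "\<And>i. i < N \<Longrightarrow> (\<Sum>k<N. th i k * colf N v k) = colf N v' i"
    and w: "\<And>j. j < N \<Longrightarrow> (\<Sum>k<N. rowf N w' k * th k j) = rowf N w j"
  shows "(X', Y', v', w') \<in> GL_orbit n0 n1 (X, Y, v, w)"
proof -
  define blk0 where "blk0 f = mat n0 n0 (\<lambda>(i, j). f i j)" for f :: "nat \<Rightarrow> nat \<Rightarrow> complex"
  define blk1 where "blk1 f = mat n1 n1 (\<lambda>(i, j). f (i + n0) (j + n0))" for f :: "nat \<Rightarrow> nat \<Rightarrow> complex"
  define P where "P = mat N N (\<lambda>(i, j). th i j)"
  define Q where "Q = mat N N (\<lambda>(i, j). ka i j)"
  have cP: "P \<in> carrier_mat N N" "Q \<in> carrier_mat N N" by (simp_all add: P_def Q_def)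
  have cb: "blk0 f \<in> carrier_mat n0 n0" "blk1 f \<in> carrier_mat n1 n1" for f by (simp_all add: blk0_def blk1_def)
  have fb: "mat N N (\<lambda>(i, j). f i j) = four_block_mat (blk0 f) (0\<^sub>m n0 n1) (0\<^sub>m n1 n0) (blk1 f)"
    if "\<And>i j. i < N \<Longrightarrow> j < N \<Longrightarrow> bpar n0 \<epsilon> i \<noteq> bpar n0 \<epsilon> j \<Longrightarrow> f i j = 0" for f
    by (rule eq_matI) (use that in \<open>auto simp: blk0_def blk1_def N_def bpar_def\<close>)
  have P: "P = four_block_mat (blk0 th) (0\<^sub>m n0 n1) (0\<^sub>m n1 n0) (blk1 th)"
    and Q: "Q = four_block_mat (blk0 ka) (0\<^sub>m n0 n1) (0\<^sub>m n1 n0) (blk1 ka)"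
    unfolding P_def Q_def by (rule fb, use blk in blast)+
  have PQ: "P * Q = 1\<^sub>m N" "Q * P = 1\<^sub>m N"
    by (rule eq_matI; use inv in \<open>auto simp: P_def Q_def scalar_prod_def lessThan_atLeast0\<close>)+
  have split: "a0 = 1\<^sub>m n0 \<and> a1 = 1\<^sub>m n1"
    if e: "four_block_mat a0 (0\<^sub>m n0 n1) (0\<^sub>m n1 n0) a1 = 1\<^sub>m N" and c: "a0 \<in> carrier_mat n0 n0" "a1 \<in> carrier_mat n1 n1"
    for a0 a1 :: "complex mat"
  proof
    show "a0 = 1\<^sub>m n0"
    proof (rule eq_matI)
      fix i j assume "i < dim_row (1\<^sub>m n0 :: complex mat)" "j < dim_col (1\<^sub>m n0 :: complex mat)"
      thus "a0 $$ (i, j) = 1\<^sub>m n0 $$ (i, j)" using arg_cong[OF e, of "\<lambda>M. M $$ (i, j)"] c by (simp add: N_def)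
    qed (use c in auto)
    show "a1 = 1\<^sub>m n1"
    proof (rule eq_matI)
      fix i j assume "i < dim_row (1\<^sub>m n1 :: complex mat)" "j < dim_col (1\<^sub>m n1 :: complex mat)"
      thus "a1 $$ (i, j) = 1\<^sub>m n1 $$ (i, j)" using arg_cong[OF e, of "\<lambda>M. M $$ (i + n0, j + n0)"] c by (simp add: N_def)
    qed (use c in auto)
  qed
  note mc = mult_carrier_mat[OF cb(1) cb(1)] mult_carrier_mat[OF cb(2) cb(2)]
  have g: "(blk0 th, blk0 ka) \<in> GL_pairs n0" "(blk1 th, blk1 ka) \<in> GL_pairs n1"
    using split[OF PQ(1)[unfolded P Q four_block_diag_mult[OF cb(1) cb(1) cb(2) cb(2)]] mc]
      split[OF PQ(2)[unfolded P Q four_block_diag_mult[OF cb(1) cb(1) cb(2) cb(2)]] mc] cb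
    by (auto intro!: GL_pairsI)
  have G: "GLp n0 n1 P Q" unfolding P Q by (rule GLpI[OF g])
  have c: "X \<in> carrier_mat N N" "Y \<in> carrier_mat N N" "v \<in> carrier_mat N 1" "w \<in> carrier_mat 1 N"
    "X' \<in> carrier_mat N N" "Y' \<in> carrier_mat N N" "v' \<in> carrier_mat N 1" "w' \<in> carrier_mat 1 N" using car by auto
  have conj: "Z' = P * Z * Q" if Z: "Z \<in> carrier_mat N N" "Z' \<in> carrier_mat N N"
    and e: "\<And>i j. i < N \<Longrightarrow> j < N \<Longrightarrow> (\<Sum>k<N. th i k * ent Z k j) = (\<Sum>k<N. ent Z' i k * th k j)" for Z Z'
  proof -
    have "P * Z = Z' * P"
    proof (rule eq_matI)
      fix i j assume "i < dim_row (Z' * P)" "j < dim_col (Z' * P)"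
      hence ij: "i < N" "j < N" using Z cP by auto
      show "(P * Z) $$ (i, j) = (Z' * P) $$ (i, j)"
        unfolding mult_ent[OF cP(1) Z(1) ij] mult_ent[OF Z(2) cP(1) ij]
        using e[OF ij] ij by (simp add: P_def ent_def)
    qed (use Z cP in auto)
    thus ?thesis using assoc_mult_mat[OF Z(2) cP] PQ Z by simp
  qed
  have "v' = P * v"
  proof (rule eq_matI)
    fix i j assume "i < dim_row (P * v)" "j < dim_col (P * v)"
    hence ij: "i < N" "j < 1" using c cP by auto
    show "v' $$ (i, j) = (P * v) $$ (i, j)"
      unfolding mult_ent[OF cP(1) c(3) ij] using v[OF ij(1)] ij by (simp add: P_def colf_def)
  qed (use c cP in auto)
  moreover have "w = w' * P"
  proof (rule eq_matI)
    fix i j assume "i < dim_row (w' * P)" "j < dim_col (w' * P)"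
    hence ij: "i < 1" "j < N" using c cP by auto
    show "w $$ (i, j) = (w' * P) $$ (i, j)"
      unfolding mult_ent[OF c(8) cP(1) ij] using w[OF ij(2)] ij by (simp add: P_def rowf_def)
  qed (use c cP in auto)
  hence "w' = w * Q" using assoc_mult_mat[OF c(8) cP] PQ c by simp
  ultimately show ?thesis
    unfolding GL_orbit_iff using G conj[OF c(1,5) X] conj[OF c(2,6) Y] by blast
qed

text \<open>The exchange maps the hyperplane with index n to the one with index -n - 1. It is used
  for \<epsilon> = 1.\<close>

lemma tau_regular_swap: assumes "tau_regular t0 t1" shows "tau_regular t1 t0"
proof -
  have "of_int n * t1 + of_int (n + 1) * t0 = - (of_int (- n - 1) * t0 + of_int (- n - 1 + 1) * t1)" for n :: int
    by (simp add: algebra_simps)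
  moreover have "of_int n * t0 + of_int (n + 1) * t1 \<noteq> 0" for n :: int using assms by (simp add: tau_regular_def)
  ultimately have "of_int n * t1 + of_int (n + 1) * t0 \<noteq> 0" for n :: int by (metis neg_equal_0_iff_equal)
  moreover have "t1 + t0 \<noteq> 0" using assms by (simp add: tau_regular_def add.commute)
  ultimately show ?thesis unfolding tau_regular_def by blast
qed

fun qrep :: "complex \<Rightarrow> complex \<Rightarrow> nat \<Rightarrow> nat \<Rightarrow> nat \<Rightarrow> quadruple \<Rightarrow> bool" where
  "qrep \<tau>0 \<tau>1 N n0 \<epsilon> (X, Y, v, w) \<longleftrightarrow> graded_rep N (bpar n0 \<epsilon>) (ent X) (ent Y) (colf N v) (rowf N w)
     (if \<epsilon> = 0 then \<tau>0 else \<tau>1) (if \<epsilon> = 0 then \<tau>1 else \<tau>0)"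

lemma quiver_reps_graded:
  assumes reg: "tau_regular \<tau>0 \<tau>1" and p: "p \<in> quiver_reps \<tau>0 \<tau>1 n0 n1 \<epsilon>"
  shows "qcar (n0 + n1) p" "qrep \<tau>0 \<tau>1 (n0 + n1) n0 \<epsilon> p"
proof -
  let ?n = "if \<epsilon> = 0 then n0 else n1" and ?N = "n0 + n1"
  obtain X0 X1 Y0 Y1 v w where p: "p = block_quadruple n0 n1 \<epsilon> X0 X1 Y0 Y1 v w"
    and c: "X0 \<in> carrier_mat n0 n1" "Y1 \<in> carrier_mat n0 n1" "X1 \<in> carrier_mat n1 n0" "Y0 \<in> carrier_mat n1 n0"
      "v \<in> carrier_mat ?n 1" "w \<in> carrier_mat 1 ?n"
    and e0: "X0 * Y0 - Y1 * X1 + \<tau>0 \<cdot>\<^sub>m 1\<^sub>m n0 = (if \<epsilon> = 0 then v * w else 0\<^sub>m n0 n0)"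
    and e1: "X1 * Y1 - Y0 * X0 + \<tau>1 \<cdot>\<^sub>m 1\<^sub>m n1 = (if \<epsilon> = 0 then 0\<^sub>m n1 n1 else v * w)"
    using p unfolding quiver_reps_def mem_Collect_eq by blast
  obtain X Y v' w' where q: "p = (X, Y, v', w')" by (cases p)
  have X: "X = four_block_mat (0\<^sub>m n0 n0) X0 X1 (0\<^sub>m n1 n1)" and Y: "Y = four_block_mat (0\<^sub>m n0 n0) Y1 Y0 (0\<^sub>m n1 n1)"
    and v': "v' = (if \<epsilon> = 0 then v @\<^sub>r 0\<^sub>m n1 1 else 0\<^sub>m n0 1 @\<^sub>r v)"
    and w': "w' = (if \<epsilon> = 0 then four_block_mat w (0\<^sub>m 1 n1) (0\<^sub>m 0 n0) (0\<^sub>m 0 n1)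
      else four_block_mat (0\<^sub>m 1 n0) w (0\<^sub>m 0 n0) (0\<^sub>m 0 n1))"
    using p q unfolding block_quadruple_def by simp_all
  have cX: "X \<in> carrier_mat ?N ?N" and cY: "Y \<in> carrier_mat ?N ?N" unfolding X Y using c by auto
  have cv: "v' \<in> carrier_mat ?N 1" unfolding v' append_rows_def using c by auto
  have cw: "w' \<in> carrier_mat 1 ?N"
    using c four_block_carrier_mat[of w 1 n0 "0\<^sub>m 0 n1" 0 n1] four_block_carrier_mat[of "0\<^sub>m 1 n0" 1 n0 "0\<^sub>m 0 n1" 0 n1]
    unfolding w' by (cases "\<epsilon> = 0") simp_all
  show "qcar ?N p" using q cX cY cv cw by simp
  have vi: "v' $$ (i, 0) = (if bpar n0 \<epsilon> i then v $$ (if \<epsilon> = 0 then i else i - n0, 0) else 0)" if "i < ?N" for i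
    using that c unfolding v' append_rows_def by (auto simp: bpar_def split: if_splits)
  have wi: "w' $$ (0, i) = (if bpar n0 \<epsilon> i then w $$ (0, if \<epsilon> = 0 then i else i - n0) else 0)" if "i < ?N" for i
    using that c unfolding w' by (auto simp: bpar_def split: if_splits)
  have XY: "X * Y = four_block_mat (X0 * Y0) (0\<^sub>m n0 n1) (0\<^sub>m n1 n0) (X1 * Y1)"
    unfolding X Y by (subst mult_four_block_mat[OF zero_carrier_mat c(1,3) zero_carrier_mat zero_carrier_mat c(2,4) zero_carrier_mat])
      (use c in simp)
  have YX: "Y * X = four_block_mat (Y1 * X1) (0\<^sub>m n0 n1) (0\<^sub>m n1 n0) (Y0 * X0)"
    unfolding X Y by (subst mult_four_block_mat[OF zero_carrier_mat c(2,4) zero_carrier_mat zero_carrier_mat c(1,3) zero_carrier_mat])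
      (use c in simp)
  have vw: "(v * w) $$ (i, j) = v $$ (i, 0) * w $$ (0, j)" if "i < ?n" "j < ?n" for i j
    using mult_ent[OF c(5,6) that] by simp
  have rel: "(X * Y) $$ (i, j) - (Y * X) $$ (i, j) + (if i = j then if i < n0 then \<tau>0 else \<tau>1 else 0)
      = v' $$ (i, 0) * w' $$ (0, j)" if ij: "i < ?N" "j < ?N" for i j
  proof -
    consider "i < n0" "j < n0" | "\<not> i < n0" "\<not> j < n0" | "(i < n0) \<noteq> (j < n0)" by blast
    thus ?thesis
    proof cases
      case 1
      have "(X0 * Y0 - Y1 * X1 + \<tau>0 \<cdot>\<^sub>m 1\<^sub>m n0) $$ (i, j) = (if \<epsilon> = 0 then v * w else 0\<^sub>m n0 n0) $$ (i, j)"
        unfolding e0 ..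
      hence "(X0 * Y0) $$ (i, j) - (Y1 * X1) $$ (i, j) + (if i = j then \<tau>0 else 0)
          = (if \<epsilon> = 0 then v $$ (i, 0) * w $$ (0, j) else 0)"
        using 1 c vw[of i j] by (auto split: if_splits)
      thus ?thesis unfolding XY YX vi[OF ij(1)] wi[OF ij(2)] using 1 ij c by (auto simp: bpar_def)
    next
      case 2
      have "(X1 * Y1 - Y0 * X0 + \<tau>1 \<cdot>\<^sub>m 1\<^sub>m n1) $$ (i - n0, j - n0)
          = (if \<epsilon> = 0 then 0\<^sub>m n1 n1 else v * w) $$ (i - n0, j - n0)"
        unfolding e1 ..
      moreover have "i - n0 < n1" "j - n0 < n1" "i - n0 = j - n0 \<longleftrightarrow> i = j" using 2 ij by auto
      ultimately have "(X1 * Y1) $$ (i - n0, j - n0) - (Y0 * X0) $$ (i - n0, j - n0) + (if i = j then \<tau>1 else 0)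
          = (if \<epsilon> = 0 then 0 else v $$ (i - n0, 0) * w $$ (0, j - n0))"
        using c vw[of "i - n0" "j - n0"] by (auto split: if_splits)
      thus ?thesis unfolding XY YX vi[OF ij(1)] wi[OF ij(2)] using 2 ij c by (auto simp: bpar_def)
    next
      case 3
      thus ?thesis unfolding XY YX vi[OF ij(1)] wi[OF ij(2)] using ij c by (auto simp: bpar_def)
    qed
  qed
  have "graded_rep ?N (bpar n0 \<epsilon>) (ent X) (ent Y) (colf ?N v') (rowf ?N w')
     (if \<epsilon> = 0 then \<tau>0 else \<tau>1) (if \<epsilon> = 0 then \<tau>1 else \<tau>0)"
  proof
    show "tau_regular (if \<epsilon> = 0 then \<tau>0 else \<tau>1) (if \<epsilon> = 0 then \<tau>1 else \<tau>0)"
      using reg tau_regular_swap by simp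
    fix i j
    show "colf ?N v' i \<noteq> 0 \<Longrightarrow> i < ?N \<and> bpar n0 \<epsilon> i" "rowf ?N w' i \<noteq> 0 \<Longrightarrow> i < ?N \<and> bpar n0 \<epsilon> i"
      using vi wi by (auto simp: colf_def rowf_def split: if_splits)
    assume ij: "i < ?N" "j < ?N"
    show "ent X i j = 0" if "bpar n0 \<epsilon> i = bpar n0 \<epsilon> j"
      using that ij c unfolding ent_def X by (auto simp: bpar_def)
    show "ent Y i j = 0" if "bpar n0 \<epsilon> i = bpar n0 \<epsilon> j"
      using that ij c unfolding ent_def Y by (auto simp: bpar_def)
    show "(\<Sum>k<?N. ent X i k * ent Y k j) - (\<Sum>k<?N. ent Y i k * ent X k j)
      + (if i = j then tsel (if \<epsilon> = 0 then \<tau>0 else \<tau>1) (if \<epsilon> = 0 then \<tau>1 else \<tau>0) (bpar n0 \<epsilon> i) else 0)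
      = colf ?N v' i * rowf ?N w' j"
      using rel[OF ij] ij unfolding mult_ent[OF cX cY ij] mult_ent[OF cY cX ij]
      by (auto simp: ent_def colf_def rowf_def tsel_def bpar_def split: if_splits)
  qed
  thus "qrep \<tau>0 \<tau>1 ?N n0 \<epsilon> p" unfolding q by simp
qed

lemma qphi_eq_orbit:
  assumes "tau_regular \<tau>0 \<tau>1" "p \<in> quiver_reps \<tau>0 \<tau>1 n0 n1 \<epsilon>" "q \<in> quiver_reps \<tau>0 \<tau>1 n0 n1 \<epsilon>"
    and eq: "qphi (n0 + n1) p = qphi (n0 + n1) q"
  shows "GL_orbit n0 n1 p = GL_orbit n0 n1 q"
proof -
  let ?N = "n0 + n1"
  obtain X Y v w where p: "p = (X, Y, v, w)" by (cases p)
  obtain X' Y' v' w' where q: "q = (X', Y', v', w')" by (cases q)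
  note P = quiver_reps_graded[OF assms(1,2)] and Q = quiver_reps_graded[OF assms(1,3)]
  have r: "graded_rep ?N (bpar n0 \<epsilon>) (ent X) (ent Y) (colf ?N v) (rowf ?N w)
     (if \<epsilon> = 0 then \<tau>0 else \<tau>1) (if \<epsilon> = 0 then \<tau>1 else \<tau>0)"
    and r': "graded_rep ?N (bpar n0 \<epsilon>) (ent X') (ent Y') (colf ?N v') (rowf ?N w')
     (if \<epsilon> = 0 then \<tau>0 else \<tau>1) (if \<epsilon> = 0 then \<tau>1 else \<tau>0)"
    using P(2) Q(2) p q by simp_all
  have "graded_rep.\<phi> ?N (ent X) (ent Y) (colf ?N v) (rowf ?N w) = graded_rep.\<phi> ?N (ent X') (ent Y') (colf ?N v') (rowf ?N w')"
    using eq unfolding graded_rep.\<phi>_def[OF r] graded_rep.\<phi>_def[OF r'] graded_rep.J_def[OF r] graded_rep.J_def[OF r'] p q by simp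
  from graded_rep_rigid[OF r r' this] obtain th ka where
    "\<And>i j. i < ?N \<Longrightarrow> j < ?N \<Longrightarrow> bpar n0 \<epsilon> i \<noteq> bpar n0 \<epsilon> j \<Longrightarrow> th i j = 0 \<and> ka i j = 0"
    "\<And>i j. i < ?N \<Longrightarrow> j < ?N \<Longrightarrow> (\<Sum>k<?N. th i k * ka k j) = (if i = j then 1 else 0)"
    "\<And>i j. i < ?N \<Longrightarrow> j < ?N \<Longrightarrow> (\<Sum>k<?N. ka i k * th k j) = (if i = j then 1 else 0)"
    "\<And>i j. i < ?N \<Longrightarrow> j < ?N \<Longrightarrow> (\<Sum>k<?N. th i k * ent X k j) = (\<Sum>k<?N. ent X' i k * th k j)"
    "\<And>i j. i < ?N \<Longrightarrow> j < ?N \<Longrightarrow> (\<Sum>k<?N. th i k * ent Y k j) = (\<Sum>k<?N. ent Y' i k * th k j)"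
    "\<And>i. i < ?N \<Longrightarrow> (\<Sum>k<?N. th i k * colf ?N v k) = colf ?N v' i"
    "\<And>j. j < ?N \<Longrightarrow> (\<Sum>k<?N. rowf ?N w' k * th k j) = rowf ?N w j"
    by blast
  from orbit_from_intertwiner[OF P(1)[unfolded p] Q(1)[unfolded q] this]
  have "q \<in> GL_orbit n0 n1 p" unfolding p q .
  from GL_orbit_eq[OF P(1) this] show ?thesis by simp
qed

lemma qphi_mequiv:
  assumes "tau_regular \<tau>0 \<tau>1" "p \<in> quiver_reps \<tau>0 \<tau>1 n0 n1 \<epsilon>" "q \<in> quiver_reps \<tau>0 \<tau>1 n0 n1 \<epsilon>"
  shows "mequiv (qphi (n0 + n1) p) (qphi (n0 + n1) q)"
proof -
  let ?N = "n0 + n1"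
  have "cmdim (if \<epsilon> = 0 then \<tau>0 else \<tau>1) (if \<epsilon> = 0 then \<tau>1 else \<tau>0)
      (card {j. j < ?N \<and> bpar n0 \<epsilon> j}) (card {j. j < ?N \<and> \<not> bpar n0 \<epsilon> j}) (qphi ?N r)"
    if r: "r \<in> quiver_reps \<tau>0 \<tau>1 n0 n1 \<epsilon>" for r
  proof -
    obtain X Y v w where e: "r = (X, Y, v, w)" by (cases r)
    have g: "graded_rep ?N (bpar n0 \<epsilon>) (ent X) (ent Y) (colf ?N v) (rowf ?N w)
       (if \<epsilon> = 0 then \<tau>0 else \<tau>1) (if \<epsilon> = 0 then \<tau>1 else \<tau>0)"
      using quiver_reps_graded(2)[OF assms(1) r] e by simp
    show ?thesis using graded_rep.cmdim_phi[OF g] unfolding graded_rep.\<phi>_def[OF g] graded_rep.J_def[OF g] e by simp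
  qed
  moreover have "tau_regular (if \<epsilon> = 0 then \<tau>0 else \<tau>1) (if \<epsilon> = 0 then \<tau>1 else \<tau>0)"
    using assms(1) tau_regular_swap by simp
  ultimately show ?thesis using moves_transitive assms(2,3) by blast
qed

section \<open>The generating automorphisms\<close>

lemma free_hom_minus: "free_hom p q (- f) = - free_hom p q f"
  using free_hom_add[of p q f "- f"] by (simp add: eq_neg_iff_add_eq_0 add.commute)

lemma free_hom_diff: "free_hom p q (f - h) = free_hom p q f - free_hom p q h"
  using free_hom_add[of p q f "- h"] by (simp add: free_hom_minus)

lemma free_hom_power: "free_hom p q (f ^ n) = free_hom p q f ^ n"
  by (induction n) (simp_all add: free_hom_mult)

lemma free_hom_const [simp]: "free_hom p q (free_const c) = free_const c"
  by (simp add: free_hom_single zero_xy_word_def)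

lemma free_hom_generator [simp]: "free_hom p q free_x = p" "free_hom p q free_y = q"
  by (simp_all add: free_x_def free_y_def free_hom_single)

lemma free_alg_induct [case_names single add]:
  assumes "\<And>u c. P (Poly_Mapping.single u c)" "\<And>f h. P f \<Longrightarrow> P h \<Longrightarrow> P (f + h)"
  shows "P (f :: free_alg)"
proof (induct f rule: update_induct)
  case const
  show ?case using assms(1)[of 0 0] by simp
next
  case (update f a b)
  have "Poly_Mapping.update a b f = Poly_Mapping.single a b + f"
    using update by (intro poly_mapping_eqI)
      (auto simp: lookup_update lookup_add lookup_single in_keys_iff when_def)
  thus ?case using assms update by simp
qed

lemma free_hom_comp:
  "free_hom p q (free_hom p' q' f) = free_hom (free_hom p q p') (free_hom p q q') f"
proof (induction f rule: free_alg_induct)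
  case (single u c)
  have "free_hom p q (prod_list (map (letter_value p' q') ls))
      = prod_list (map (letter_value (free_hom p q p') (free_hom p q q')) ls)" for ls
  proof (induction ls)
    case (Cons l ls) thus ?case by (cases l) (simp_all add: free_hom_mult)
  qed simp
  thus ?case
    by (simp only: free_hom_single[of p' q'] free_hom_single[of "free_hom p q p'"] free_hom_mult free_hom_const)
qed (simp add: free_hom_add)

lemma free_hom_id: "free_hom free_x free_y f = f"
proof (induction f rule: free_alg_induct)
  case (single u c)
  have "prod_list (map (letter_value free_x free_y) ls) = Poly_Mapping.single (Word ls) 1" for ls
  proof (induction ls)
    case Nil show ?case by (simp flip: zero_xy_word_def)
  next
    case (Cons l ls) thus ?case by (cases l) (simp_all add: free_x_def free_y_def mult_single plus_xy_word_def)
  qed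
  thus ?case by (simp add: free_hom_single mult_single)
qed (simp add: free_hom_add)

fun opposite_generator :: "generator \<Rightarrow> generator" where
  "opposite_generator (Theta l) = Theta (inverse l)"
| "opposite_generator (Psi k l) = Psi k (- l)"
| "opposite_generator (Phi k l) = Phi k (- l)"

text \<open>The generators that act on functionals by moves.\<close>

definition elementary :: "generator \<Rightarrow> bool" where
  "elementary s \<longleftrightarrow> (\<exists>k l. k \<ge> 1 \<and> (s = Psi k l \<or> s = Phi k l))"

lemma opposite_generator_simps:
  "elementary s \<Longrightarrow> elementary (opposite_generator s)"
  "elementary s \<Longrightarrow> opposite_generator (opposite_generator s) = s"
  by (auto simp: elementary_def)

lemma gen_free_opposite: "elementary s \<Longrightarrow> gen_free \<tau>0 \<tau>1 s (gen_free \<tau>0 \<tau>1 (opposite_generator s) f) = f"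
  unfolding elementary_def gen_free_def
  by (elim exE conjE disjE)
    (simp_all add: free_hom_comp free_hom_diff free_hom_add free_hom_mult free_hom_power free_hom_id
      single_uminus)

lemma free_const_mult: "free_const a * free_const b = free_const (a * b)" by (simp add: mult_single)

lemma gen_free_ring:
  "gen_free \<tau>0 \<tau>1 s (f + h) = gen_free \<tau>0 \<tau>1 s f + gen_free \<tau>0 \<tau>1 s h"
  "gen_free \<tau>0 \<tau>1 s (f - h) = gen_free \<tau>0 \<tau>1 s f - gen_free \<tau>0 \<tau>1 s h"
  "gen_free \<tau>0 \<tau>1 s (f * h) = gen_free \<tau>0 \<tau>1 s f * gen_free \<tau>0 \<tau>1 s h"
  "gen_free \<tau>0 \<tau>1 s (free_const c) = free_const c" "gen_free \<tau>0 \<tau>1 s 0 = 0" "gen_free \<tau>0 \<tau>1 s 1 = 1"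
  by (simp_all add: gen_free_def free_hom_add free_hom_diff free_hom_mult)

text \<open>The exponents 2k - 1 are odd, so the generators commute with the change of sign of x and
  y.\<close>

lemma gen_free_gamma: assumes "elementary s" shows "gen_free \<tau>0 \<tau>1 s (gamma f) = gamma (gen_free \<tau>0 \<tau>1 s f)"
proof -
  have o: "(- z) ^ (2 * k - 1) = - (z ^ (2 * k - 1))" if "k \<ge> 1" for k and z :: free_alg
    using that by (intro power_minus_odd) auto
  have "free_hom (image_x \<tau>0 \<tau>1 s) (image_y \<tau>0 \<tau>1 s) (- free_x) = gamma (image_x \<tau>0 \<tau>1 s)"
    "free_hom (image_x \<tau>0 \<tau>1 s) (image_y \<tau>0 \<tau>1 s) (- free_y) = gamma (image_y \<tau>0 \<tau>1 s)"
    using assms unfolding elementary_def gamma_def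
    by (auto simp: free_hom_minus free_hom_diff free_hom_add free_hom_mult free_hom_power o)
  thus ?thesis unfolding gen_free_def gamma_def free_hom_comp by simp
qed

text \<open>The term added to one variable is a polynomial in the other variable and commutes with
  it.\<close>

lemma gen_free_commutator:
  assumes "elementary s"
  shows "gen_free \<tau>0 \<tau>1 s (free_x * free_y - free_y * free_x) = free_x * free_y - free_y * free_x"
proof -
  have p: "z * (free_const c * z ^ m) = free_const c * z ^ m * z" for z c m
    by (metis free_const_commute mult.assoc power_commutes)
  show ?thesis
    using assms unfolding elementary_def gen_free_def
    by (elim exE conjE disjE)
      (simp_all add: free_hom_diff free_hom_mult left_diff_distrib right_diff_distrib distrib_left distrib_right p)
qed

section \<open>Descent of the generators to the algebras S_\<tau> and O_\<tau>\<close>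

lemma gen_R_opposite:
  "elementary s \<Longrightarrow> gen_R \<tau>0 \<tau>1 s (gen_R \<tau>0 \<tau>1 (opposite_generator s) r) = r"
  by (simp add: gen_R_def gen_free_opposite)

lemma gen_R_ring:
  assumes "elementary s"
  shows "gen_R \<tau>0 \<tau>1 s (r + t) = gen_R \<tau>0 \<tau>1 s r + gen_R \<tau>0 \<tau>1 s t"
    "gen_R \<tau>0 \<tau>1 s (r - t) = gen_R \<tau>0 \<tau>1 s r - gen_R \<tau>0 \<tau>1 s t"
    "gen_R \<tau>0 \<tau>1 s (r * t) = gen_R \<tau>0 \<tau>1 s r * gen_R \<tau>0 \<tau>1 s t"
    "gen_R \<tau>0 \<tau>1 s (of_scalar c) = of_scalar c" "gen_R \<tau>0 \<tau>1 s group_g = group_g" "gen_R \<tau>0 \<tau>1 s 1 = 1"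
  by (simp_all add: gen_R_def plus_crossed_def minus_crossed_def times_crossed_def one_crossed_def
      of_scalar_def of_free_def group_g_def gen_free_ring gen_free_gamma[OF assms])

lemma gen_R_idem:
  assumes "elementary s"
  shows "gen_R \<tau>0 \<tau>1 s idem_0 = idem_0" "gen_R \<tau>0 \<tau>1 s (tau_elem \<tau>0 \<tau>1) = tau_elem \<tau>0 \<tau>1"
  by (simp_all add: idem_0_def idem_1_def tau_elem_def gen_R_ring[OF assms])

lemma idem_0_mult: "idem_0 * idem_0 = idem_0"
  by (rule crossed.expand)
    (simp add: idem_0_def of_scalar_def of_free_def group_g_def times_crossed_def plus_crossed_def one_crossed_def
      gamma_def free_const_mult single_add[symmetric])

lemma of_scalar_central: "of_scalar c * r = r * of_scalar c"
  by (simp add: of_scalar_def of_free_def times_crossed_def gamma_def free_const_commute)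

interpretation R: ring R_alg by (rule ring_R_alg)

lemma R_alg_simps [simp]: "carrier R_alg = UNIV" "x \<otimes>\<^bsub>R_alg\<^esub> y = x * y" "x \<oplus>\<^bsub>R_alg\<^esub> y = x + y" "\<one>\<^bsub>R_alg\<^esub> = 1" "\<zero>\<^bsub>R_alg\<^esub> = 0"
  by (simp_all add: R_alg_def)

lemma ideal_S: "ideal (S_ideal \<tau>0 \<tau>1) R_alg"
  unfolding S_ideal_def by (rule R.genideal_ideal) simp

lemma S_ideal_closed:
  "0 \<in> S_ideal \<tau>0 \<tau>1" "a \<in> S_ideal \<tau>0 \<tau>1 \<Longrightarrow> b \<in> S_ideal \<tau>0 \<tau>1 \<Longrightarrow> a + b \<in> S_ideal \<tau>0 \<tau>1"
  "a \<in> S_ideal \<tau>0 \<tau>1 \<Longrightarrow> r * a \<in> S_ideal \<tau>0 \<tau>1"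
  using additive_subgroup.zero_closed[OF ideal.axioms(1)[OF ideal_S]]
    additive_subgroup.a_closed[OF ideal.axioms(1)[OF ideal_S], of a \<tau>0 \<tau>1 b]
    ideal.I_l_closed[OF ideal_S, of a \<tau>0 \<tau>1 r] by simp_all

text \<open>The generator of the ideal is fixed, and the preimage of the ideal is an ideal that
  contains it.\<close>

lemma gen_R_S_ideal:
  assumes s: "elementary s" and a: "a \<in> S_ideal \<tau>0 \<tau>1"
  shows "gen_R \<tau>0 \<tau>1 s a \<in> S_ideal \<tau>0 \<tau>1"
proof -
  have "gen_R \<tau>0 \<tau>1 s \<in> Ring.ring_hom R_alg R_alg"
    by (rule ring_hom_memI) (simp_all add: gen_R_ring[OF s])
  then interpret h: ring_hom_ring R_alg R_alg "gen_R \<tau>0 \<tau>1 s"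
    by (rule ring_hom_ringI2[OF ring_R_alg ring_R_alg])
  let ?D = "of_free free_x * of_free free_y - of_free free_y * of_free free_x"
  have D: "?D = of_free (free_x * free_y - free_y * free_x)"
    by (simp add: of_free_def times_crossed_def minus_crossed_def gamma_def)
  have "gen_R \<tau>0 \<tau>1 s ?D = ?D"
    unfolding D using gen_free_commutator[OF s] by (simp add: gen_R_def of_free_def gen_free_ring(5))
  hence "gen_R \<tau>0 \<tau>1 s (?D - tau_elem \<tau>0 \<tau>1) = ?D - tau_elem \<tau>0 \<tau>1"
    by (simp only: gen_R_ring[OF s] gen_R_idem[OF s])
  hence "{?D - tau_elem \<tau>0 \<tau>1} \<subseteq> {r \<in> carrier R_alg. gen_R \<tau>0 \<tau>1 s r \<in> S_ideal \<tau>0 \<tau>1}"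
    using R.genideal_self'[of "?D - tau_elem \<tau>0 \<tau>1"] by (simp add: S_ideal_def)
  from R.genideal_minimal[OF h.ideal_vimage[OF ideal_S] this] a
  show ?thesis unfolding S_ideal_def by auto
qed

lemma S_class_altdef: "S_class \<tau>0 \<tau>1 r = {a + r | a. a \<in> S_ideal \<tau>0 \<tau>1}"
  unfolding S_class_def a_r_coset_def' by auto

lemma S_class_self: "r \<in> S_class \<tau>0 \<tau>1 r"
  unfolding S_class_altdef using S_ideal_closed(1) by force

lemma S_class_shift: assumes "a \<in> S_ideal \<tau>0 \<tau>1" shows "S_class \<tau>0 \<tau>1 (a + r) = S_class \<tau>0 \<tau>1 r"
proof -
  have m: "- a \<in> S_ideal \<tau>0 \<tau>1" using S_ideal_closed(3)[OF assms, of "- 1"] by simp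
  have "\<exists>c. b + r = c + (a + r) \<and> c \<in> S_ideal \<tau>0 \<tau>1" if "b \<in> S_ideal \<tau>0 \<tau>1" for b
    using S_ideal_closed(2)[OF that m] by (intro exI[of _ "b + - a"]) simp
  moreover have "\<exists>c. b + (a + r) = c + r \<and> c \<in> S_ideal \<tau>0 \<tau>1" if "b \<in> S_ideal \<tau>0 \<tau>1" for b
    using S_ideal_closed(2)[OF that assms] by (intro exI[of _ "b + a"]) (simp add: add.assoc)
  ultimately show ?thesis unfolding S_class_altdef by blast
qed

lemma S_alg_simps:
  "carrier (S_alg \<tau>0 \<tau>1) = range (S_class \<tau>0 \<tau>1)"
  "S_class \<tau>0 \<tau>1 a \<otimes>\<^bsub>S_alg \<tau>0 \<tau>1\<^esub> S_class \<tau>0 \<tau>1 b = S_class \<tau>0 \<tau>1 (a * b)"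
  "S_class \<tau>0 \<tau>1 a \<oplus>\<^bsub>S_alg \<tau>0 \<tau>1\<^esub> S_class \<tau>0 \<tau>1 b = S_class \<tau>0 \<tau>1 (a + b)"
proof -
  have "abelian_subgroup (S_ideal \<tau>0 \<tau>1) R_alg"
    by (rule abelian_subgroupI3[OF ideal.axioms(1)[OF ideal_S] R.abelian_group_axioms])
  note sub = this
  show "carrier (S_alg \<tau>0 \<tau>1) = range (S_class \<tau>0 \<tau>1)"
    unfolding S_alg_def FactRing_def A_RCOSETS_def' S_class_def by auto
  show "S_class \<tau>0 \<tau>1 a \<otimes>\<^bsub>S_alg \<tau>0 \<tau>1\<^esub> S_class \<tau>0 \<tau>1 b = S_class \<tau>0 \<tau>1 (a * b)"
    using ideal.rcoset_mult_add[OF ideal_S, of a b] by (simp add: S_alg_def FactRing_def S_class_def)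
  show "S_class \<tau>0 \<tau>1 a \<oplus>\<^bsub>S_alg \<tau>0 \<tau>1\<^esub> S_class \<tau>0 \<tau>1 b = S_class \<tau>0 \<tau>1 (a + b)"
    using abelian_subgroup.a_rcos_sum[OF sub, of a b] by (simp add: S_alg_def FactRing_def S_class_def)
qed

lemma gen_S_class:
  assumes s: "elementary s"
  shows "gen_S \<tau>0 \<tau>1 s (S_class \<tau>0 \<tau>1 r) = S_class \<tau>0 \<tau>1 (gen_R \<tau>0 \<tau>1 s r)"
proof -
  have "(\<lambda>r. S_class \<tau>0 \<tau>1 (gen_R \<tau>0 \<tau>1 s r)) ` S_class \<tau>0 \<tau>1 r = {S_class \<tau>0 \<tau>1 (gen_R \<tau>0 \<tau>1 s r)}"
  proof -
    have "S_class \<tau>0 \<tau>1 (gen_R \<tau>0 \<tau>1 s t) = S_class \<tau>0 \<tau>1 (gen_R \<tau>0 \<tau>1 s r)" if "t \<in> S_class \<tau>0 \<tau>1 r" for t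
      using that S_class_shift[OF gen_R_S_ideal[OF s]] by (auto simp: S_class_altdef[of _ _ r] gen_R_ring[OF s])
    thus ?thesis using S_class_self[of r \<tau>0 \<tau>1] by blast
  qed
  thus ?thesis unfolding gen_S_def by simp
qed

lemma O_alg_simps:
  "carrier (O_alg \<tau>0 \<tau>1) = {S_class \<tau>0 \<tau>1 (idem_0 * r * idem_0) | r. True}"
  "x \<otimes>\<^bsub>O_alg \<tau>0 \<tau>1\<^esub> y = x \<otimes>\<^bsub>S_alg \<tau>0 \<tau>1\<^esub> y" "x \<oplus>\<^bsub>O_alg \<tau>0 \<tau>1\<^esub> y = x \<oplus>\<^bsub>S_alg \<tau>0 \<tau>1\<^esub> y"
  "\<one>\<^bsub>O_alg \<tau>0 \<tau>1\<^esub> = S_class \<tau>0 \<tau>1 idem_0"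
proof -
  have "carrier (O_alg \<tau>0 \<tau>1) = (\<lambda>s. S_class \<tau>0 \<tau>1 idem_0 \<otimes>\<^bsub>S_alg \<tau>0 \<tau>1\<^esub> s \<otimes>\<^bsub>S_alg \<tau>0 \<tau>1\<^esub> S_class \<tau>0 \<tau>1 idem_0) ` range (S_class \<tau>0 \<tau>1)"
    by (simp add: O_alg_def Let_def S_alg_simps(1))
  thus "carrier (O_alg \<tau>0 \<tau>1) = {S_class \<tau>0 \<tau>1 (idem_0 * r * idem_0) | r. True}"
    by (auto simp: S_alg_simps image_image)
qed (simp_all add: O_alg_def Let_def)

lemma gen_O_class:
  assumes s: "elementary s"
  shows "gen_O \<tau>0 \<tau>1 s (S_class \<tau>0 \<tau>1 (idem_0 * r * idem_0)) = S_class \<tau>0 \<tau>1 (idem_0 * gen_R \<tau>0 \<tau>1 s r * idem_0)"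
proof -
  have "S_class \<tau>0 \<tau>1 (idem_0 * r * idem_0) \<in> carrier (O_alg \<tau>0 \<tau>1)" unfolding O_alg_simps by blast
  thus ?thesis unfolding gen_O_def by (simp add: gen_S_class[OF s] gen_R_ring[OF s] gen_R_idem[OF s])
qed

lemma O_carrierE:
  assumes "x \<in> carrier (O_alg \<tau>0 \<tau>1)" obtains r where "x = S_class \<tau>0 \<tau>1 (idem_0 * r * idem_0)"
  using assms unfolding O_alg_simps by blast

lemma O_carrierI: "S_class \<tau>0 \<tau>1 (idem_0 * r * idem_0) \<in> carrier (O_alg \<tau>0 \<tau>1)"
  unfolding O_alg_simps by blast

lemma O_closed:
  "(idem_0 * r * idem_0) * (idem_0 * t * idem_0) = idem_0 * (r * idem_0 * t) * idem_0"
  "(idem_0 * r * idem_0) + (idem_0 * t * idem_0) = idem_0 * (r + t) * idem_0"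
  "of_scalar c * (idem_0 * r * idem_0) = idem_0 * (of_scalar c * r) * idem_0"
proof -
  have "(idem_0 * r * idem_0) * (idem_0 * t * idem_0) = idem_0 * r * (idem_0 * idem_0) * t * idem_0"
    by (simp only: mult.assoc)
  thus "(idem_0 * r * idem_0) * (idem_0 * t * idem_0) = idem_0 * (r * idem_0 * t) * idem_0"
    by (simp only: idem_0_mult mult.assoc)
  show "(idem_0 * r * idem_0) + (idem_0 * t * idem_0) = idem_0 * (r + t) * idem_0"
    by (simp add: distrib_left distrib_right)
  show "of_scalar c * (idem_0 * r * idem_0) = idem_0 * (of_scalar c * r) * idem_0"
    using of_scalar_central[of c idem_0] by (metis mult.assoc)
qed

text \<open>The action axioms speak only of elements of the group, so each map has to be shown to be
  an automorphism before it can move points. The opposite generator provides the inverse.\<close>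

lemma gen_O_in_G_Gamma:
  assumes s: "elementary s" shows "gen_O \<tau>0 \<tau>1 s \<in> carrier (G_Gamma \<tau>0 \<tau>1)"
proof -
  let ?A = "O_alg \<tau>0 \<tau>1" and ?h = "gen_O \<tau>0 \<tau>1 s" and ?h' = "gen_O \<tau>0 \<tau>1 (opposite_generator s)"
  note s' = opposite_generator_simps(1)[OF s]
  note gc = gen_O_class[OF s] and gc' = gen_O_class[OF s']
  have inv: "?h (?h' x) = x" "?h' (?h x) = x" if "x \<in> carrier ?A" for x
    using that gen_R_opposite[OF s] gen_R_opposite[OF s'] opposite_generator_simps(2)[OF s]
    by (auto elim!: O_carrierE simp: gc gc')
  have cl: "?h x \<in> carrier ?A" "?h' x \<in> carrier ?A" if "x \<in> carrier ?A" for x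
    using that by (auto elim!: O_carrierE simp: gc gc' O_carrierI)
  have "bij_betw ?h (carrier ?A) (carrier ?A)"
    by (rule bij_betw_byWitness[of _ ?h']) (use inv cl in auto)
  hence "?h \<in> Bij (carrier ?A)" by (simp add: Bij_def gen_O_def)
  moreover have "?h \<in> Ring.ring_hom ?A ?A"
  proof (rule ring_hom_memI)
    fix x y assume "x \<in> carrier ?A" "y \<in> carrier ?A"
    then obtain r t where x: "x = S_class \<tau>0 \<tau>1 (idem_0 * r * idem_0)" "y = S_class \<tau>0 \<tau>1 (idem_0 * t * idem_0)"
      by (auto elim!: O_carrierE)
    show "?h (x \<otimes>\<^bsub>?A\<^esub> y) = ?h x \<otimes>\<^bsub>?A\<^esub> ?h y" "?h (x \<oplus>\<^bsub>?A\<^esub> y) = ?h x \<oplus>\<^bsub>?A\<^esub> ?h y"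
      unfolding x O_alg_simps(2,3) S_alg_simps(2,3) O_closed gc gen_R_ring[OF s] gen_R_idem[OF s] by (rule HOL.refl)+
  next
    show "?h \<one>\<^bsub>?A\<^esub> = \<one>\<^bsub>?A\<^esub>"
      using gc[of \<tau>0 \<tau>1 1] by (simp add: O_alg_simps(4) idem_0_mult gen_R_ring[OF s])
  qed (rule cl)
  moreover have "\<forall>c. \<forall>x\<in>carrier ?A. ?h (S_scale \<tau>0 \<tau>1 c x) = S_scale \<tau>0 \<tau>1 c (?h x)"
  proof (intro allI ballI)
    fix c x assume "x \<in> carrier ?A"
    then obtain r where x: "x = S_class \<tau>0 \<tau>1 (idem_0 * r * idem_0)" by (auto elim!: O_carrierE)
    show "?h (S_scale \<tau>0 \<tau>1 c x) = S_scale \<tau>0 \<tau>1 c (?h x)"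
      unfolding x S_scale_def gc S_alg_simps(2) O_closed(3) gen_R_ring[OF s] by (rule HOL.refl)
  qed
  ultimately show ?thesis by (simp add: G_Gamma_def Let_def)
qed

section \<open>The generators on quadruples and on their functionals\<close>

lemma inv_gen_free:
  assumes "elementary s"
  shows "inv_into UNIV (gen_free \<tau>0 \<tau>1 s) free_x = image_x \<tau>0 \<tau>1 (opposite_generator s)"
    "inv_into UNIV (gen_free \<tau>0 \<tau>1 s) free_y = image_y \<tau>0 \<tau>1 (opposite_generator s)"
proof -
  have "inj (gen_free \<tau>0 \<tau>1 s)"
    by (rule inj_on_inverseI[where g = "gen_free \<tau>0 \<tau>1 (opposite_generator s)"])
      (metis gen_free_opposite opposite_generator_simps assms)
  moreover have "gen_free \<tau>0 \<tau>1 s (image_x \<tau>0 \<tau>1 (opposite_generator s)) = free_x"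
    "gen_free \<tau>0 \<tau>1 s (image_y \<tau>0 \<tau>1 (opposite_generator s)) = free_y"
    using gen_free_opposite[OF assms, of \<tau>0 \<tau>1 free_x] gen_free_opposite[OF assms, of \<tau>0 \<tau>1 free_y]
    by (simp_all add: gen_free_def)
  ultimately show "inv_into UNIV (gen_free \<tau>0 \<tau>1 s) free_x = image_x \<tau>0 \<tau>1 (opposite_generator s)"
    "inv_into UNIV (gen_free \<tau>0 \<tau>1 s) free_y = image_y \<tau>0 \<tau>1 (opposite_generator s)"
    by (auto intro: inv_into_f_eq)
qed

lemma mat_eval_add:
  assumes "i < N" "j < N"
  shows "mat_eval N X Y (f + h) $$ (i, j) = mat_eval N X Y f $$ (i, j) + mat_eval N X Y h $$ (i, j)"
proof -
  let ?A = "Poly_Mapping.keys f \<union> Poly_Mapping.keys h"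
  have e: "mat_eval N X Y g $$ (i, j) = (\<Sum>u\<in>?A. Poly_Mapping.lookup g u * mat_word N X Y u $$ (i, j))"
    if "Poly_Mapping.keys g \<subseteq> ?A" for g
    unfolding mat_eval_def using assms that
    by (simp, intro sum.mono_neutral_left) (auto simp: in_keys_iff)
  have "Poly_Mapping.keys (f + h) \<subseteq> ?A" by (rule Poly_Mapping.keys_add)
  from e[OF this] e[of f] e[of h] show ?thesis by (simp add: lookup_add distrib_right sum.distrib)
qed

lemma mat_eval_single:
  assumes "i < N" "j < N"
  shows "mat_eval N X Y (Poly_Mapping.single u c) $$ (i, j) = c * mat_word N X Y u $$ (i, j)"
  using assms by (cases "c = 0") (simp_all add: mat_eval_def)

text \<open>Stated for nonempty words: the identity matrix cuts off the coordinates beyond N,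
  whereas \<open>opw\<close> on the empty word does not.\<close>

lemma mop_mat_word:
  assumes "X \<in> carrier_mat N N" "Y \<in> carrier_mat N N"
  shows "mop N (ent (mat_word N X Y (Word (l # W)))) u = opw (mop N (ent X)) (mop N (ent Y)) (l # W) u"
proof -
  have c: "mat_word N X Y (Word V) \<in> carrier_mat N N" for V
  proof (induction V)
    case (Cons m V) thus ?case using assms by (cases m) (auto simp: mat_word_def)
  qed (simp add: mat_word_def)
  have s: "mop N (ent (mat_word N X Y (Word (m # V)))) u
      = mop N (ent (letter_value X Y m)) (mop N (ent (mat_word N X Y (Word V))) u)" for m V u
  proof -
    have "mat_word N X Y (Word (m # V)) = letter_value X Y m * mat_word N X Y (Word V)"
      by (simp add: mat_word_def)
    moreover have "letter_value X Y m \<in> carrier_mat N N" using assms by (cases m) auto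
    ultimately show ?thesis using mop_mult c by metis
  qed
  show ?thesis
  proof (induction W arbitrary: l)
    case Nil
    have "mop N (ent (mat_word N X Y (Word []))) u = (\<lambda>i. if i < N then u i else 0)"
      by (simp add: mat_word_def mop_one)
    thus ?case unfolding s by (cases l) (simp_all add: mop_restrict)
  next
    case (Cons m W)
    show ?case unfolding s[of l] Cons by (cases l) simp_all
  qed
qed

lemma opw_replicate: "opw A B (replicate m LetterX) u = (A ^^ m) u" "opw A B (replicate m LetterY) u = (B ^^ m) u"
  by (induction m) simp_all

lemma free_power_word:
  "free_const c * free_x ^ m = Poly_Mapping.single (Word (replicate m LetterX)) c"
  "free_const c * free_y ^ m = Poly_Mapping.single (Word (replicate m LetterY)) c"
proof -
  have "free_x ^ m = Poly_Mapping.single (Word (replicate m LetterX)) 1"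
    "free_y ^ m = Poly_Mapping.single (Word (replicate m LetterY)) 1"
    by (induction m) (simp_all add: free_x_def free_y_def mult_single plus_xy_word_def flip: zero_xy_word_def)
  thus "free_const c * free_x ^ m = Poly_Mapping.single (Word (replicate m LetterX)) c"
    "free_const c * free_y ^ m = Poly_Mapping.single (Word (replicate m LetterY)) c"
    by (simp_all add: mult_single)
qed

lemma mop_mat_eval:
  assumes "X \<in> carrier_mat N N" "Y \<in> carrier_mat N N"
  shows "mop N (ent (mat_eval N X Y free_x)) u = mop N (ent X) u"
    "mop N (ent (mat_eval N X Y free_y)) u = mop N (ent Y) u"
    "mop N (ent (mat_eval N X Y (free_x + free_const c * free_y ^ Suc m))) u
      = mop N (ent X) u + c *f (mop N (ent Y) ^^ Suc m) u"
    "mop N (ent (mat_eval N X Y (free_y + free_const c * free_x ^ Suc m))) u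
      = mop N (ent Y) u + c *f (mop N (ent X) ^^ Suc m) u"
proof -
  have one: "mop N (ent (mat_eval N X Y (Poly_Mapping.single (Word (l # W)) c))) u
      = c *f opw (mop N (ent X)) (mop N (ent Y)) (l # W) u" for l W c
    unfolding mop_mat_word[OF assms, symmetric]
    by (rule ext) (simp add: mop_def ent_def mat_eval_single scl_apply sum_distrib_left mult.assoc)
  have add: "mop N (ent (mat_eval N X Y (f + h))) u = mop N (ent (mat_eval N X Y f)) u + mop N (ent (mat_eval N X Y h)) u" for f h
    by (rule ext) (simp add: mop_def ent_def mat_eval_add fun_pointwise distrib_right sum.distrib)
  show x: "mop N (ent (mat_eval N X Y free_x)) u = mop N (ent X) u" and y: "mop N (ent (mat_eval N X Y free_y)) u = mop N (ent Y) u"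
    unfolding free_x_def free_y_def one by simp_all
  show "mop N (ent (mat_eval N X Y (free_x + free_const c * free_y ^ Suc m))) u
      = mop N (ent X) u + c *f (mop N (ent Y) ^^ Suc m) u"
    unfolding add x free_power_word replicate_Suc one unfolding replicate_Suc[symmetric] opw_replicate ..
  show "mop N (ent (mat_eval N X Y (free_y + free_const c * free_x ^ Suc m))) u
      = mop N (ent Y) u + c *f (mop N (ent X) ^^ Suc m) u"
    unfolding add y free_power_word replicate_Suc one unfolding replicate_Suc[symmetric] opw_replicate ..
qed

lemma qcar_gen: "qcar N p \<Longrightarrow> qcar N (gen_on_quadruple \<tau>0 \<tau>1 N s p)"
  by (cases p) (simp add: gen_on_quadruple_def mat_eval_def)

lemma elementary_simps [simp]: "elementary (Psi (Suc k) l)" "elementary (Phi (Suc k) l)"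
  by (auto simp: elementary_def)

text \<open>Quadruples are transformed by the inverse substitution, which gives the plus sign for
  \<open>Psi\<close> and the minus sign for \<open>Phi\<close>. The index is \<open>Suc k\<close>
  because 2 (k + 1) - 1 = 2k + 1.\<close>

lemma qphi_gen:
  assumes "qcar N p"
  shows "qphi N (gen_on_quadruple \<tau>0 \<tau>1 N (Psi (Suc k) l) p) = moveX (of_nat (Suc k) * l * (\<tau>0 + \<tau>1)) k (qphi N p)"
    "qphi N (gen_on_quadruple \<tau>0 \<tau>1 N (Phi (Suc k) l) p) = moveY (- (of_nat (Suc k) * l * (\<tau>0 + \<tau>1))) k (qphi N p)"
proof -
  obtain X Y v w where p: "p = (X, Y, v, w)" by (cases p)
  have c: "X \<in> carrier_mat N N" "Y \<in> carrier_mat N N" using assms p by auto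
  let ?c = "of_nat (Suc k) * l * (\<tau>0 + \<tau>1)"
  have m: "2 * Suc k - 1 = Suc (2 * k)" "2 * k + 1 = Suc (2 * k)" by simp_all
  have x: "image_x \<tau>0 \<tau>1 (opposite_generator (Psi (Suc k) l)) = free_x + free_const ?c * free_y ^ Suc (2 * k)"
    "image_y \<tau>0 \<tau>1 (opposite_generator (Psi (Suc k) l)) = free_y"
    unfolding opposite_generator.simps image_x.simps image_y.simps m
    by (simp_all only: mult_minus_left mult_minus_right single_uminus minus_mult_left[symmetric] diff_minus_eq_add)
  have y: "image_y \<tau>0 \<tau>1 (opposite_generator (Phi (Suc k) l)) = free_y + free_const (- ?c) * free_x ^ Suc (2 * k)"
    "image_x \<tau>0 \<tau>1 (opposite_generator (Phi (Suc k) l)) = free_x"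
    unfolding opposite_generator.simps image_x.simps image_y.simps m
    by (simp_all only: mult_minus_left mult_minus_right)
  show "qphi N (gen_on_quadruple \<tau>0 \<tau>1 N (Psi (Suc k) l) p) = moveX ?c k (qphi N p)"
    unfolding p gen_on_quadruple_def prod.case qphi.simps moveX_fnl[OF clin_mop clin_mop clf_dotp] m
      inv_gen_free[OF elementary_simps(1)] x
    using mop_mat_eval(3)[OF c, of ?c "2 * k"] mop_mat_eval(2)[OF c] by presburger
  show "qphi N (gen_on_quadruple \<tau>0 \<tau>1 N (Phi (Suc k) l) p) = moveY (- ?c) k (qphi N p)"
    unfolding p gen_on_quadruple_def prod.case qphi.simps moveY_fnl[OF clin_mop clin_mop clf_dotp] m
      inv_gen_free[OF elementary_simps(2)] y
    using mop_mat_eval(4)[OF c, of "- ?c" "2 * k"] mop_mat_eval(1)[OF c] by presburger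
qed

theorem theorem1p1:
  fixes \<tau>0 \<tau>1 :: complex and \<epsilon> m n :: nat
    and \<alpha> :: "(crossed set \<Rightarrow> crossed set) \<Rightarrow> quadruple set \<Rightarrow> quadruple set"
  assumes "tau_regular \<tau>0 \<tau>1"
    and "\<epsilon> \<in> {0, 1}"
    and "(m, n) \<in> L_set \<epsilon>"
    and "is_G_Gamma_action \<tau>0 \<tau>1 m n \<epsilon> \<alpha>"
  shows "transitive_action (G_Gamma \<tau>0 \<tau>1) (quiver_variety \<tau>0 \<tau>1 m n \<epsilon>) \<alpha>"
proof -
  let ?G = "G_Gamma \<tau>0 \<tau>1" and ?E = "quiver_variety \<tau>0 \<tau>1 m n \<epsilon>" and ?N = "m + n"
    and ?R = "quiver_reps \<tau>0 \<tau>1 m n \<epsilon>"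
  have ga: "group_action ?G ?E \<alpha>"
    and gen: "\<And>s p. s \<in> generators \<Longrightarrow> p \<in> ?R \<Longrightarrow>
      \<alpha> (gen_O \<tau>0 \<tau>1 s) (GL_orbit m n p) = GL_orbit m n (gen_on_quadruple \<tau>0 \<tau>1 ?N s p)"
    using assms(4) unfolding is_G_Gamma_action_def by auto
  interpret group_action ?G ?E \<alpha> by (rule ga)
  interpret G: group ?G using group_hom by (rule group_hom.axioms(1))
  have d: "\<tau>0 + \<tau>1 \<noteq> 0" using assms(1) by (simp add: tau_regular_def)
  have E: "GL_orbit m n p \<in> ?E" if "p \<in> ?R" for p using that unfolding quiver_variety_def by blast
  \<comment> \<open>The action maps the variety to itself, so the orbit of the transformed quadruple
    is also the orbit of some r in \<open>quiver_reps\<close>, and r has the same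
    functional.\<close>
  have step: "\<exists>g\<in>carrier ?G. \<exists>r\<in>?R. \<alpha> g (GL_orbit m n p) = GL_orbit m n r \<and>
      qphi ?N r = qphi ?N (gen_on_quadruple \<tau>0 \<tau>1 ?N s p)"
    if s: "elementary s" and p: "p \<in> ?R" for s p
  proof -
    let ?q = "gen_on_quadruple \<tau>0 \<tau>1 ?N s p"
    have sg: "s \<in> generators" using s by (auto simp: elementary_def generators_def)
    note g = gen_O_in_G_Gamma[OF s, of \<tau>0 \<tau>1]
    have "\<alpha> (gen_O \<tau>0 \<tau>1 s) (GL_orbit m n p) \<in> ?E" by (rule element_image[OF g E[OF p] HOL.refl])
    then obtain r where r: "r \<in> ?R" "GL_orbit m n ?q = GL_orbit m n r"
      unfolding gen[OF sg p] quiver_variety_def by blast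
    note q = qcar_gen[OF quiver_reps_graded(1)[OF assms(1) p], of \<tau>0 \<tau>1 s]
    have "r \<in> GL_orbit m n ?q" unfolding r(2) by (rule GL_orbit_self[OF quiver_reps_graded(1)[OF assms(1) r(1)]])
    from qphi_orbit[OF q this] have "qphi ?N r = qphi ?N ?q" .
    thus ?thesis using g r gen[OF sg p] by (intro bexI[of _ "gen_O \<tau>0 \<tau>1 s"] bexI[of _ r]) simp_all
  qed
  have reach: "\<exists>g\<in>carrier ?G. \<exists>r\<in>?R. \<alpha> g (GL_orbit m n p) = GL_orbit m n r \<and> qphi ?N r = h"
    if p: "p \<in> ?R" and "mequiv (qphi ?N p) h" for p h
    using that(2)
  proof (induction rule: mequiv.induct)
    case base
    have "\<alpha> \<one>\<^bsub>?G\<^esub> (GL_orbit m n p) = GL_orbit m n p"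
      using fun_cong[OF id_eq_one, of "GL_orbit m n p"] E[OF p] by simp
    thus ?case using p by (intro bexI[of _ "\<one>\<^bsub>?G\<^esub>"] bexI[of _ p]) simp_all
  next
    case (stepX h c k)
    then obtain g r where g: "g \<in> carrier ?G" "r \<in> ?R" "\<alpha> g (GL_orbit m n p) = GL_orbit m n r" "qphi ?N r = h" by blast
    \<comment> \<open>The parameter solves (k + 1) l (\<tau>0 + \<tau>1) = c, with \<tau>0 + \<tau>1
      nonzero by regularity.\<close>
    let ?s = "Psi (Suc k) (c / (of_nat (Suc k) * (\<tau>0 + \<tau>1)))"
    have "of_nat (Suc k) * (c / (of_nat (Suc k) * (\<tau>0 + \<tau>1))) * (\<tau>0 + \<tau>1) = c"
      using d of_nat_neq_0[where 'a = complex] by (simp del: of_nat_Suc)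
    hence "qphi ?N (gen_on_quadruple \<tau>0 \<tau>1 ?N ?s r) = moveX c k h"
      using qphi_gen(1)[OF quiver_reps_graded(1)[OF assms(1) g(2)]] g(4) by metis
    moreover obtain g' r' where g': "g' \<in> carrier ?G" "r' \<in> ?R" "\<alpha> g' (GL_orbit m n r) = GL_orbit m n r'"
      "qphi ?N r' = qphi ?N (gen_on_quadruple \<tau>0 \<tau>1 ?N ?s r)" using step[OF elementary_simps(1) g(2)] by blast
    ultimately show ?case
      using composition_rule[OF E[OF p] g'(1) g(1)] g g'
      by (intro bexI[of _ "g' \<otimes>\<^bsub>?G\<^esub> g"] bexI[of _ r']) simp_all
  next
    case (stepY h c k)
    then obtain g r where g: "g \<in> carrier ?G" "r \<in> ?R" "\<alpha> g (GL_orbit m n p) = GL_orbit m n r" "qphi ?N r = h" by blast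
    let ?s = "Phi (Suc k) (- c / (of_nat (Suc k) * (\<tau>0 + \<tau>1)))"
    have "- (of_nat (Suc k) * (- c / (of_nat (Suc k) * (\<tau>0 + \<tau>1))) * (\<tau>0 + \<tau>1)) = c"
      using d of_nat_neq_0[where 'a = complex] by (simp del: of_nat_Suc)
    hence "qphi ?N (gen_on_quadruple \<tau>0 \<tau>1 ?N ?s r) = moveY c k h"
      using qphi_gen(2)[OF quiver_reps_graded(1)[OF assms(1) g(2)]] g(4) by metis
    moreover obtain g' r' where g': "g' \<in> carrier ?G" "r' \<in> ?R" "\<alpha> g' (GL_orbit m n r) = GL_orbit m n r'"
      "qphi ?N r' = qphi ?N (gen_on_quadruple \<tau>0 \<tau>1 ?N ?s r)" using step[OF elementary_simps(2) g(2)] by blast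
    ultimately show ?case
      using composition_rule[OF E[OF p] g'(1) g(1)] g g'
      by (intro bexI[of _ "g' \<otimes>\<^bsub>?G\<^esub> g"] bexI[of _ r']) simp_all
  qed
  show ?thesis
  \<comment> \<open>The moves lead from p to a point with the functional of q, and equal functionals
    mean equal orbits.\<close>
  proof (rule transitive_action.intro[OF ga], rule transitive_action_axioms.intro)
    fix x y assume "x \<in> ?E" "y \<in> ?E"
    then obtain p q where p: "p \<in> ?R" "x = GL_orbit m n p" and q: "q \<in> ?R" "y = GL_orbit m n q"
      unfolding quiver_variety_def by blast
    from reach[OF p(1) qphi_mequiv[OF assms(1) p(1) q(1)]] obtain g r where
      g: "g \<in> carrier ?G" "r \<in> ?R" "\<alpha> g (GL_orbit m n p) = GL_orbit m n r" "qphi ?N r = qphi ?N q" by blast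
    from qphi_eq_orbit[OF assms(1) g(2) q(1) g(4)] show "\<exists>g\<in>carrier ?G. \<alpha> g x = y" using g p q by auto
  qed
qed

end
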